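(* Let $H$ satisfy the hypothesis that $H^D_{(a,c)}$ has purely discrete spectrum for one (hence all) $c\in(a,b)$, and let $\Phi(z,x),\Theta(z,x)$ be real entire solutions of $\tau u=zu$ such that $\Phi(z,\cdot)$ is non-trivial and lies in the domain of $H$ near $a$ for each $z\in\mathbb{C}$ and $W(\Theta(z),\Phi(z))=1$. Let $M(z)$ be the corresponding singular Weyl function and $\Psi(z,x)=\Theta(z,x)+M(z)\Phi(z,x)$. Let $\lambda\in\mathbb{R}$ and $\gamma\in[-\|\Phi(\lambda)\|^{-2},\infty)$; if $\Phi(\lambda)\in L^2(I,\mathbb{C}^2)$, assume moreover that $\lambda$ is an eigenvalue of $H$. Let $H_\gamma$ be the operator constructed from $u_-(\lambda,x)=\Phi(\lambda,x)$ by the double commutation method and set $\widetilde\Phi_\gamma(\lambda,x)=\Phi(\lambda,x)/c_\gamma(\lambda,x)$, where $c_\gamma(\lambda,x)=\frac1\gamma+\int_a^x\Phi(\lambda,y)^\top\Phi(\lambda,y)\,dy$. Then $H_\gamma$ has a system of real entire solutions $$\Phi_\gamma(z,x)=\Phi(z,x)-\widetilde\Phi_\gamma(\lambda,x)\int_a^x\Phi(\lambda,y)^\top\Phi(z,y)\,dy=\Phi(z,x)+\frac{1}{z-\lambda}\widetilde\Phi_\gamma(\lambda,x)W_x(\Phi(\lambda),\Phi(z)),$$ $$\Theta_\gamma(z,x)=\Theta(z,x)+\frac{1}{z-\lambda}\Big(\widetilde\Phi_\gamma(\lambda,x)W_x(\Phi(\lambda),\Theta(z))+\gamma\,\Phi_\gamma(z,x)\Big),$$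 with $W(\Theta_\gamma(z),\Phi_\gamma(z))=1$. For $z=\lambda$ one has $$\Phi_\gamma(\lambda,x)=\gamma^{-1}\widetilde\Phi_\gamma(\lambda,x),\qquad \Theta_\gamma(\lambda,x)=\Theta(\lambda,x)+\widetilde\Phi_\gamma(\lambda,x)W_x(\Phi(\lambda),\dot\Theta(\lambda))+\gamma\,\dot\Phi_\gamma(\lambda,x),$$ where the dot denotes the derivative with respect to $z$. In particular, $H_\gamma$ again satisfies the hypothesis that its Dirichlet restriction to $(a,c)$ has purely discrete spectrum for one (hence all) $c\in(a,b)$. The Weyl solutions of $H_\gamma$ (that is, the solutions lying in the domain of $H_\gamma$ near $a$, respectively near $b$) are given by $\Phi_\gamma(z,x)$ and $$\Psi_\gamma(z,x)=\Psi(z,x)+\frac{1}{z-\lambda}\widetilde\Phi_\gamma(\lambda,x)W_x(\Phi(\lambda),\Psi(z))=\Theta_\gamma(z,x)+M_\gamma(z)\Phi_\gamma(z,x),$$ where $$M_\gamma(z)=M(z)-\frac{\gamma}{z-\lambda}$$ is the singular Weyl function of $H_\gamma$ (with respect to $\Phi_\gamma,\Theta_\gamma$).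
   Context: Let $I=(a,b)\subseteq\mathbb{R}$, $-\infty\le a<b\le\infty$, and consider $L^2(I,\mathbb{C}^2)$ with $\langle f,g\rangle=\int_a^b f(y)^*g(y)\,dy$ and norm $\|\cdot\|$. Let $\tau=\frac{1}{\mathrm{i}}\sigma_2\frac{d}{dx}+Q(x)$ with $Q=q_{\rm el}\mathbb{1}+q_{\rm am}\sigma_1+(m+q_{\rm sc})\sigma_3$, where $m\in[0,\infty)$, $q_{\rm el},q_{\rm am},q_{\rm sc}\in L^1_{\rm loc}(I)$ are real-valued and $\sigma_1=\begin{pmatrix}0&1\\1&0\end{pmatrix}$, $\sigma_2=\begin{pmatrix}0&-\mathrm{i}\\ \mathrm{i}&0\end{pmatrix}$, $\sigma_3=\begin{pmatrix}1&0\\0&-1\end{pmatrix}$. The Wronskian is $W_x(f,g)=f_1(x)g_2(x)-f_2(x)g_1(x)$; $W_a,W_b$ denote its limits as $x\to a,b$; for two solutions of $\tau u=zu$ with the same $z$ it is independent of $x$ and written $W(f,g)$. $H$ is the self-adjoint operator $Hf=\tau f$ with domain $\{f\in L^2(I,\mathbb{C}^2): f\in AC_{\rm loc}(I,\mathbb{C}^2),\ \tau f\in L^2(I,\mathbb{C}^2),\ W_a(u_-,f)=W_b(u_+,f)=0\}$, where $u_-$ (resp. $u_+$) is a fixed non-trivial real solution of $\tau u=0$ if $\tau$ is limit circle at $a$ (resp. $b$), and zero otherwise. A function lies in the domain of $H$ near an endpoint if it is square integrable near that endpoint and satisfies the boundary condition of $H$ there (if any). $H^D_{(a,c)}$ is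 the restriction of $H$ to $(a,c)$ with the boundary condition $f_1(c)=0$ at $c$. A real entire solution is a solution of $\tau u=zu$ that is entire in $z$ for every fixed $x$ and real-valued for real $z$. Under the discreteness hypothesis, pairs $\Phi,\Theta$ as in the claim exist. The singular Weyl function is $M(z)=-\frac{W(\Theta(z),u_+(z))}{W(\Phi(z),u_+(z))}$, where $u_+(z)$ is the (unique up to multiples) non-trivial solution of $\tau u=zu$ lying in the domain of $H$ near $b$; thus $\Psi(z)=\Theta(z)+M(z)\Phi(z)$ lies in the domain of $H$ near $b$ ($z\in\mathbb{C}\setminus\sigma(H)$). The same terminology is used for $H_\gamma$. Double commutation from $u_-(\lambda,x)$ (a real solution of $\tau u=\lambda u$ in the domain of $H$ near $a$): put $c_\gamma(\lambda,x)=\frac1\gamma+\int_a^xu_-(\lambda,y)^\top u_-(\lambda,y)\,dy$, $u_\gamma(\lambda,x)=u_-(\lambda,x)/c_\gamma(\lambda,x)$, $$Q_\gamma(x)=\frac{u_{-,1}(\lambda,x)^2-u_{-,2}(\lambda,x)^2}{c_\gamma(\lambda,x)}\sigma_1-2\frac{u_{-,1}(\lambda,x)u_{-,2}(\lambda,x)}{c_\gamma(\lambda,x)}\sigma_3,$$ $\tau_\gamma=\tau+Q_\gamma$, and let $H_\gamma f=\tau_\gamma f$ on $\{f\in L^2(I,\mathbb{C}^2): f\in AC_{\rm loc}(I,\mathbb{C}^2),\ \tau_\gamma f\in L^2(I,\mathbb{C}^2),\ W_a(u_\gamma(\lambda),f)=W_b(u_\gamma(\lambda),f)=0\}$, where the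 boundary condition at an endpoint is imposed only if $\tau_\gamma$ is limit circle there. Conventions: $\infty^{-1}=0$ (so $\|\Phi(\lambda)\|^{-2}=0$ if $\Phi(\lambda)\notin L^2$); the case $\gamma=0$ is to be read as $H_0=H$ (trivial case: $\widetilde\Phi_0=0$ and $\gamma^{-1}\widetilde\Phi_\gamma(\lambda,x)$ is read as $\Phi(\lambda,x)$). *)

theory Defs
  imports "HOL-Analysis.Analysis"
begin

section \<open>Square integrable functions and operators in \<open>L\<^sup>2(S, \<complex>\<^sup>2)\<close>\<close>

text \<open>
  Elements of \<open>L\<^sup>2(S, \<complex>\<^sup>2)\<close> are represented by functions on the reals whose values outside \<open>S\<close>
  are irrelevant; equality in \<open>L\<^sup>2\<close> is equality almost everywhere on \<open>S\<close>.
\<close>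

definition square_integrable :: "real set \<Rightarrow> (real \<Rightarrow> complex^2) \<Rightarrow> bool" where
  "square_integrable S f \<longleftrightarrow>
     f \<in> borel_measurable (lebesgue_on S) \<and> integrable (lebesgue_on S) (\<lambda>x. (norm (f x))\<^sup>2)"

definition L2norm :: "real set \<Rightarrow> (real \<Rightarrow> complex^2) \<Rightarrow> real" where
  "L2norm S f = sqrt (LINT x|lebesgue_on S. (norm (f x))\<^sup>2)"

definition locally_integrable :: "real set \<Rightarrow> (real \<Rightarrow> real) \<Rightarrow> bool" where
  "locally_integrable S q \<longleftrightarrow> (\<forall>c d. {c..d} \<subseteq> S \<longrightarrow> q absolutely_integrable_on {c..d})"

text \<open>An operator in \<open>L\<^sup>2(S, \<complex>\<^sup>2)\<close> is given by its graph, the set of pairs \<open>(f, A f)\<close>.\<close>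

type_synonym operator = "((real \<Rightarrow> complex^2) \<times> (real \<Rightarrow> complex^2)) set"

text \<open>
  The resolvent set: \<open>A - z\<close> is a bijection from the domain onto \<open>L\<^sup>2\<close> with bounded inverse.
  Injectivity is contained in the norm bound.
\<close>

definition resolvent_set :: "real set \<Rightarrow> operator \<Rightarrow> complex set" where
  "resolvent_set S A = {z.
     (\<exists>C. \<forall>(f, h) \<in> A. L2norm S f \<le> C * L2norm S (\<lambda>x. h x - z *s f x)) \<and>
     (\<forall>g. square_integrable S g \<longrightarrow>
        (\<exists>(f, h) \<in> A. AE x in lebesgue_on S. h x - z *s f x = g x))}"

definition spectrum :: "real set \<Rightarrow> operator \<Rightarrow> complex set" where
  "spectrum S A = - resolvent_set S A"

definition eigenspace :: "operator \<Rightarrow> complex \<Rightarrow> (real \<Rightarrow> complex^2) set" where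
  "eigenspace A z = {f. (f, \<lambda>x. z *s f x) \<in> A}"

definition eigenvalue :: "real set \<Rightarrow> operator \<Rightarrow> complex \<Rightarrow> bool" where
  "eigenvalue S A z \<longleftrightarrow> (\<exists>f \<in> eigenspace A z. \<not> (AE x in lebesgue_on S. f x = 0))"

definition finite_multiplicity :: "real set \<Rightarrow> operator \<Rightarrow> complex \<Rightarrow> bool" where
  "finite_multiplicity S A z \<longleftrightarrow>
     (\<exists>B. finite B \<and> B \<subseteq> eigenspace A z \<and>
        (\<forall>f \<in> eigenspace A z. \<exists>k. AE x in lebesgue_on S. f x = (\<Sum>g\<in>B. k g *s g x)))"

definition purely_discrete_spectrum :: "real set \<Rightarrow> operator \<Rightarrow> bool" where
  "purely_discrete_spectrum S A \<longleftrightarrow>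
     (\<forall>z \<in> spectrum S A. \<not> z islimpt spectrum S A \<and> eigenvalue S A z \<and> finite_multiplicity S A z)"


section \<open>The Dirac differential expression\<close>

definition sigma1 :: "complex^2^2" where
  "sigma1 = vector [vector [0, 1], vector [1, 0]]"

definition sigma2 :: "complex^2^2" where
  "sigma2 = vector [vector [0, - \<i>], vector [\<i>, 0]]"

definition sigma3 :: "complex^2^2" where
  "sigma3 = vector [vector [1, 0], vector [0, - 1]]"

definition dirac_potential ::
  "real \<Rightarrow> (real \<Rightarrow> real) \<Rightarrow> (real \<Rightarrow> real) \<Rightarrow> (real \<Rightarrow> real) \<Rightarrow> real \<Rightarrow> complex^2^2" where
  "dirac_potential m q_el q_am q_sc x =
     q_el x *\<^sub>R mat 1 + q_am x *\<^sub>R sigma1 + (m + q_sc x) *\<^sub>R sigma3"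

text \<open>
  \<open>AC_loc_deriv S f f'\<close>: \<open>f\<close> belongs to \<open>AC\<^sub>l\<^sub>o\<^sub>c(S, \<complex>\<^sup>2)\<close>, that is, \<open>f\<close> is locally on \<open>S\<close> the
  indefinite integral of an integrable function, and \<open>f'\<close> is its derivative, which is
  determined up to null sets.
\<close>

definition AC_loc_deriv :: "real set \<Rightarrow> (real \<Rightarrow> complex^2) \<Rightarrow> (real \<Rightarrow> complex^2) \<Rightarrow> bool" where
  "AC_loc_deriv S f f' \<longleftrightarrow>
     (\<forall>c d. c \<le> d \<and> {c..d} \<subseteq> S \<longrightarrow>
        f' absolutely_integrable_on {c..d} \<and> f d = f c + (LINT x|lebesgue_on {c..d}. f' x))"

text \<open>
  \<open>tau_eq Q S f h\<close>: \<open>f \<in> AC\<^sub>l\<^sub>o\<^sub>c(S, \<complex>\<^sup>2)\<close> and \<open>\<tau> f = h\<close> almost everywhere on \<open>S\<close>, where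
  \<open>\<tau> f = (1/\<i>) \<sigma>\<^sub>2 f' + Q f\<close>.
\<close>

definition tau_eq ::
  "(real \<Rightarrow> complex^2^2) \<Rightarrow> real set \<Rightarrow> (real \<Rightarrow> complex^2) \<Rightarrow> (real \<Rightarrow> complex^2) \<Rightarrow> bool" where
  "tau_eq Q S f h \<longleftrightarrow>
     (\<exists>f'. AC_loc_deriv S f f' \<and>
        (AE x in lebesgue_on S. (1 / \<i>) *s (sigma2 *v f' x) + Q x *v f x = h x))"

definition solution ::
  "(real \<Rightarrow> complex^2^2) \<Rightarrow> real set \<Rightarrow> complex \<Rightarrow> (real \<Rightarrow> complex^2) \<Rightarrow> bool" where
  "solution Q S z u \<longleftrightarrow> tau_eq Q S u (\<lambda>x. z *s u x)"

definition wronskian :: "(real \<Rightarrow> complex^2) \<Rightarrow> (real \<Rightarrow> complex^2) \<Rightarrow> real \<Rightarrow> complex" where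
  "wronskian f g x = f x $ 1 * g x $ 2 - f x $ 2 * g x $ 1"

text \<open>The bilinear product \<open>u\<^sup>T v\<close>, without complex conjugation.\<close>

definition dotT :: "complex^2 \<Rightarrow> complex^2 \<Rightarrow> complex" where
  "dotT u v = (\<Sum>i\<in>UNIV. u $ i * v $ i)"

text \<open>
  The filters on the reals for \<open>x \<rightarrow> a\<close> and \<open>x \<rightarrow> b\<close> along \<open>(a, b)\<close>, for endpoints that may be
  infinite.
\<close>

definition to_left_end :: "ereal \<Rightarrow> real filter" where
  "to_left_end a = filtercomap ereal (at_right a)"

definition to_right_end :: "ereal \<Rightarrow> real filter" where
  "to_right_end b = filtercomap ereal (at_left b)"


section \<open>Dirac operators with separated boundary conditions\<close>

text \<open>
  The boundary conditions are \<open>W\<^sub>a(bc_left, f) = 0\<close> and \<open>W\<^sub>b(bc_right, f) = 0\<close>; each one is imposed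
  only if the expression is limit circle at that endpoint, and the component is irrelevant
  otherwise.
\<close>

record dirac =
  end_left :: ereal
  end_right :: ereal
  pot :: "real \<Rightarrow> complex^2^2"
  bc_left :: "real \<Rightarrow> complex^2"
  bc_right :: "real \<Rightarrow> complex^2"

definition ival :: "dirac \<Rightarrow> real set" where
  "ival H = einterval (end_left H) (end_right H)"

definition square_integrable_left :: "dirac \<Rightarrow> (real \<Rightarrow> complex^2) \<Rightarrow> bool" where
  "square_integrable_left H f \<longleftrightarrow>
     (\<exists>c \<in> ival H. square_integrable (einterval (end_left H) (ereal c)) f)"

definition square_integrable_right :: "dirac \<Rightarrow> (real \<Rightarrow> complex^2) \<Rightarrow> bool" where
  "square_integrable_right H f \<longleftrightarrow>
     (\<exists>c \<in> ival H. square_integrable (einterval (ereal c) (end_right H)) f)"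

text \<open>By the Weyl alternative it does not matter whether all \<open>z\<close> or a single \<open>z\<close> is considered.\<close>

definition limit_circle_left :: "dirac \<Rightarrow> bool" where
  "limit_circle_left H \<longleftrightarrow>
     (\<forall>z u. solution (pot H) (ival H) z u \<longrightarrow> square_integrable_left H u)"

definition limit_circle_right :: "dirac \<Rightarrow> bool" where
  "limit_circle_right H \<longleftrightarrow>
     (\<forall>z u. solution (pot H) (ival H) z u \<longrightarrow> square_integrable_right H u)"

definition boundary_left :: "dirac \<Rightarrow> (real \<Rightarrow> complex^2) \<Rightarrow> bool" where
  "boundary_left H f \<longleftrightarrow>
     (limit_circle_left H \<longrightarrow> (wronskian (bc_left H) f \<longlongrightarrow> 0) (to_left_end (end_left H)))"

definition boundary_right :: "dirac \<Rightarrow> (real \<Rightarrow> complex^2) \<Rightarrow> bool" where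
  "boundary_right H f \<longleftrightarrow>
     (limit_circle_right H \<longrightarrow> (wronskian (bc_right H) f \<longlongrightarrow> 0) (to_right_end (end_right H)))"

definition dirac_op :: "dirac \<Rightarrow> operator" where
  "dirac_op H = {(f, h).
     square_integrable (ival H) f \<and> tau_eq (pot H) (ival H) f h \<and> square_integrable (ival H) h \<and>
     boundary_left H f \<and> boundary_right H f}"

text \<open>
  The restriction to \<open>(a, c)\<close> with \<open>f\<^sub>1(c) = 0\<close>. The endpoint \<open>c\<close> is regular, so functions in the
  domain are absolutely continuous up to \<open>c\<close>.
\<close>

definition dirichlet_op :: "dirac \<Rightarrow> real \<Rightarrow> operator" where
  "dirichlet_op H c = {(f, h).
     square_integrable (einterval (end_left H) (ereal c)) f \<and>
     tau_eq (pot H) {x. end_left H < ereal x \<and> x \<le> c} f h \<and>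
     square_integrable (einterval (end_left H) (ereal c)) h \<and>
     boundary_left H f \<and> f c $ 1 = 0}"

abbreviation dirichlet_discrete :: "dirac \<Rightarrow> real \<Rightarrow> bool" where
  "dirichlet_discrete H c \<equiv>
     purely_discrete_spectrum (einterval (end_left H) (ereal c)) (dirichlet_op H c)"

definition in_domain_near_left :: "dirac \<Rightarrow> (real \<Rightarrow> complex^2) \<Rightarrow> bool" where
  "in_domain_near_left H f \<longleftrightarrow> square_integrable_left H f \<and> boundary_left H f"

definition in_domain_near_right :: "dirac \<Rightarrow> (real \<Rightarrow> complex^2) \<Rightarrow> bool" where
  "in_domain_near_right H f \<longleftrightarrow> square_integrable_right H f \<and> boundary_right H f"

definition nontrivial :: "dirac \<Rightarrow> (real \<Rightarrow> complex^2) \<Rightarrow> bool" where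
  "nontrivial H u \<longleftrightarrow> (\<exists>x \<in> ival H. u x \<noteq> 0)"

definition real_valued :: "dirac \<Rightarrow> (real \<Rightarrow> complex^2) \<Rightarrow> bool" where
  "real_valued H u \<longleftrightarrow> (\<forall>x \<in> ival H. \<forall>i. u x $ i \<in> \<real>)"

definition real_entire_solution :: "dirac \<Rightarrow> (complex \<Rightarrow> real \<Rightarrow> complex^2) \<Rightarrow> bool" where
  "real_entire_solution H U \<longleftrightarrow>
     (\<forall>z. solution (pot H) (ival H) z (U z)) \<and>
     (\<forall>x \<in> ival H. \<forall>i. (\<lambda>z. U z x $ i) holomorphic_on UNIV) \<and>
     (\<forall>z \<in> \<real>. real_valued H (U z))"

definition weyl_solution_left :: "dirac \<Rightarrow> complex \<Rightarrow> (real \<Rightarrow> complex^2) \<Rightarrow> bool" where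
  "weyl_solution_left H z u \<longleftrightarrow>
     solution (pot H) (ival H) z u \<and> nontrivial H u \<and> in_domain_near_left H u"

definition weyl_solution_right :: "dirac \<Rightarrow> complex \<Rightarrow> (real \<Rightarrow> complex^2) \<Rightarrow> bool" where
  "weyl_solution_right H z u \<longleftrightarrow>
     solution (pot H) (ival H) z u \<and> nontrivial H u \<and> in_domain_near_right H u"

text \<open>The constant value of the Wronskian of two solutions for the same spectral parameter.\<close>

definition const_wronskian :: "dirac \<Rightarrow> (real \<Rightarrow> complex^2) \<Rightarrow> (real \<Rightarrow> complex^2) \<Rightarrow> complex" where
  "const_wronskian H f g = (THE w. \<forall>x \<in> ival H. wronskian f g x = w)"

text \<open>
  The quotient does not depend on the choice of \<open>u\<^sub>+(z)\<close>, which is unique up to multiples for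
  \<open>z\<close> outside the spectrum.
\<close>

definition singular_weyl_function ::
  "dirac \<Rightarrow> (complex \<Rightarrow> real \<Rightarrow> complex^2) \<Rightarrow> (complex \<Rightarrow> real \<Rightarrow> complex^2) \<Rightarrow> complex \<Rightarrow> complex" where
  "singular_weyl_function H \<Phi> \<Theta> z =
     (let u = (SOME u. weyl_solution_right H z u)
      in - (const_wronskian H (\<Theta> z) u / const_wronskian H (\<Phi> z) u))"

definition z_deriv :: "(complex \<Rightarrow> real \<Rightarrow> complex^2) \<Rightarrow> complex \<Rightarrow> real \<Rightarrow> complex^2" where
  "z_deriv U z x = (\<chi> i. deriv (\<lambda>w. U w x $ i) z)"


section \<open>The double commutation method\<close>

text \<open>
  Here \<open>u\<close> stands for \<open>u\<^sub>-(\<lambda>, \<sqdot>)\<close>. The function \<open>c\<^sub>\<gamma>\<close> is used for \<open>\<gamma> \<noteq> 0\<close> only; \<open>\<gamma> = 0\<close> means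
  \<open>1/\<gamma> = \<infinity>\<close>, so that \<open>u\<^sub>\<gamma> = 0\<close>, \<open>Q\<^sub>\<gamma> = 0\<close> and \<open>H\<^sub>\<gamma> = H\<close>.
\<close>

definition c_gamma :: "dirac \<Rightarrow> real \<Rightarrow> (real \<Rightarrow> complex^2) \<Rightarrow> real \<Rightarrow> complex" where
  "c_gamma H \<gamma> u x = 1 / of_real \<gamma> +
     (LINT y|lebesgue_on (einterval (end_left H) (ereal x)). dotT (u y) (u y))"

definition u_gamma :: "dirac \<Rightarrow> real \<Rightarrow> (real \<Rightarrow> complex^2) \<Rightarrow> real \<Rightarrow> complex^2" where
  "u_gamma H \<gamma> u x = (if \<gamma> = 0 then 0 else (1 / c_gamma H \<gamma> u x) *s u x)"

text \<open>\<open>mat k ** A\<close> is the product of the matrix \<open>A\<close> with the complex scalar \<open>k\<close>.\<close>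

definition Q_gamma :: "dirac \<Rightarrow> real \<Rightarrow> (real \<Rightarrow> complex^2) \<Rightarrow> real \<Rightarrow> complex^2^2" where
  "Q_gamma H \<gamma> u x = (if \<gamma> = 0 then 0 else
     mat (((u x $ 1)\<^sup>2 - (u x $ 2)\<^sup>2) / c_gamma H \<gamma> u x) ** sigma1
     - mat (2 * (u x $ 1 * u x $ 2 / c_gamma H \<gamma> u x)) ** sigma3)"

definition double_commutation :: "dirac \<Rightarrow> real \<Rightarrow> (real \<Rightarrow> complex^2) \<Rightarrow> dirac" where
  "double_commutation H \<gamma> u = (if \<gamma> = 0 then H else
     H\<lparr>pot := (\<lambda>x. pot H x + Q_gamma H \<gamma> u x),
       bc_left := u_gamma H \<gamma> u, bc_right := u_gamma H \<gamma> u\<rparr>)"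

end

theory Submission
  imports Defs "HOL-Complex_Analysis.Conformal_Mappings"
begin

text \<open>
  Write \<open>u = \<Phi>(\<lambda>)\<close>. The map \<open>f \<mapsto> f - (u / c\<^sub>\<gamma>) J\<close> with \<open>J' = u\<^sup>T f\<close> takes solutions of
  \<open>\<tau> f = z f\<close> with \<open>W(u, f) = (\<lambda> - z) J\<close> to solutions of \<open>\<tau>\<^sub>\<gamma> f = z f\<close>, which gives
  \<open>\<Phi>\<^sub>\<gamma>\<close>, \<open>\<Theta>\<^sub>\<gamma>\<close> and \<open>\<Psi>\<^sub>\<gamma>\<close>. Boundary terms are controlled by Weyl's alternative in the form:
  if the Wronskian of two functions of the maximal domain does not tend to \<open>0\<close> at an end, then the
  expression is limit circle there. Discreteness of the Dirichlet restriction follows from the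
  existence of an entire \<open>\<Phi>\<close> in the domain near \<open>a\<close>: the resolvent, given by Green's function, is
  analytic off the zeros of \<open>\<Phi>\<^sub>1(z, c)\<close>, and its bound \<open>1 / \<bar>Im z\<bar>\<close> off the real axis extends to real
  points by the maximum principle.
\<close>

section \<open>Scalar absolutely continuous functions\<close>

text \<open>Everything about H and about the commuted operator is proved once, in
  \<open>dirac_pair\<close>, where the solutions are supplied by an entire pair with Wronskian 1.
  Such a pair is a fundamental system: every solution is a combination of the two, with constant
  Wronskians as coefficients, and no initial value problem has to be solved. So the task is to show
  that \<Phi>_\<gamma> and \<Theta>_\<gamma> form such a pair and that the transform respects the
  conditions at both ends.

  The delicate places are z = \<lambda> and the end b. Since W(\<Phi>(\<lambda>),
  \<Theta>(\<lambda>)) = -1, the transform of \<Theta> has a pole at \<lambda> with residue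
  -u_\<gamma>, where u_\<gamma> = u / c_\<gamma>. As \<Phi>_\<gamma>(\<lambda>) = u_\<gamma> /
  \<gamma>, adding \<gamma> \<Phi>_\<gamma> / (z - \<lambda>) removes it; this correction is the
  origin of the pole in M_\<gamma>. At b, c_\<gamma> may tend to 0 if \<gamma> < 0. There the
  eigenvalue assumption makes Wronskians with u vanish at b, so J is minus a tail integral and
  Cauchy-Schwarz bounds |J|^2 by a multiple of |c_\<gamma>|.\<close>

definition ac_deriv :: "real set \<Rightarrow> (real \<Rightarrow> complex) \<Rightarrow> (real \<Rightarrow> complex) \<Rightarrow> bool" where
  "ac_deriv S f f' \<longleftrightarrow>
     (\<forall>c d. c \<le> d \<and> {c..d} \<subseteq> S \<longrightarrow>
        f' absolutely_integrable_on {c..d} \<and> f d = f c + integral {c..d} f')"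

lemma ac_derivD:
  assumes "ac_deriv S f f'" "c \<le> d" "{c..d} \<subseteq> S"
  shows "f' absolutely_integrable_on {c..d}" "f d = f c + integral {c..d} f'"
  using assms unfolding ac_deriv_def by blast+

lemma ac_deriv_subset: "ac_deriv S f f' \<Longrightarrow> T \<subseteq> S \<Longrightarrow> ac_deriv T f f'"
  unfolding ac_deriv_def by (meson order_trans)

lemma ac_deriv_cong:
  assumes "ac_deriv S f f'" "\<And>x. x \<in> S \<Longrightarrow> f x = g x" "\<And>x. x \<in> S \<Longrightarrow> f' x = g' x"
  shows "ac_deriv S g g'"
  unfolding ac_deriv_def
proof (intro allI impI)
  fix c d :: real assume *: "c \<le> d \<and> {c..d} \<subseteq> S"
  have "g' absolutely_integrable_on {c..d} \<longleftrightarrow> f' absolutely_integrable_on {c..d}"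
    by (rule set_integrable_cong) (use assms(3) * in auto)
  moreover have "integral {c..d} g' = integral {c..d} f'"
    by (rule integral_cong) (use assms(3) * in auto)
  moreover have "c \<in> S" "d \<in> S" using * by auto
  ultimately show "g' absolutely_integrable_on {c..d} \<and> g d = g c + integral {c..d} g'"
    using ac_derivD[OF assms(1), of c d] * assms(2) by auto
qed

lemma ac_deriv_continuous_Icc:
  assumes "ac_deriv S f f'" "{c..d} \<subseteq> S"
  shows "continuous_on {c..d} f"
proof (cases "c \<le> d")
  case True
  have "f' integrable_on {c..d}"
    using ac_derivD(1)[OF assms(1) True assms(2)] by (simp add: absolutely_integrable_on_def)
  then have "continuous_on {c..d} (\<lambda>x. f c + integral {c..x} f')"
    by (intro continuous_intros indefinite_integral_continuous_1)
  moreover have "f c + integral {c..x} f' = f x" if "x \<in> {c..d}" for x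
    using ac_derivD(2)[OF assms(1), of c x] that subset_trans[OF _ assms(2), of "{c..x}"] by auto
  ultimately show ?thesis by (rule continuous_on_eq)
qed auto

text \<open>A convergent sequence together with its limit is compact, so it lies in one
  \<open>{c..d}\<close> inside \<open>S\<close>. Testing along sequences therefore reduces
  continuity to compact subintervals, whether or not \<open>S\<close> contains its
  endpoints.\<close>

lemma continuous_on_interval_local:
  fixes f :: "real \<Rightarrow> 'a::topological_space"
  assumes S: "is_interval S" and f: "\<And>c d. {c..d} \<subseteq> S \<Longrightarrow> continuous_on {c..d} f"
  shows "continuous_on S f"
  unfolding continuous_on_sequentially
proof (intro allI ballI impI)
  fix x l assume l: "l \<in> S" and x: "(\<forall>n. x n \<in> S) \<and> x \<longlonglongrightarrow> l"
  have cpt: "compact (insert l (range x))" using x by (intro compact_sequence_with_limit) auto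
  obtain c where c: "c \<in> insert l (range x)" "\<forall>t\<in>insert l (range x). c \<le> t"
    using compact_attains_inf[OF cpt] by auto
  obtain d where d: "d \<in> insert l (range x)" "\<forall>t\<in>insert l (range x). t \<le> d"
    using compact_attains_sup[OF cpt] by auto
  have "c \<in> S" "d \<in> S" using c(1) d(1) l x by auto
  then have "{c..d} \<subseteq> S" using S by (meson atLeastAtMost_iff is_interval_1 subsetI)
  then have "continuous_on {c..d} f" by (rule f)
  moreover have "\<forall>n. x n \<in> {c..d}" "l \<in> {c..d}" using c(2) d(2) by auto
  ultimately show "(f \<circ> x) \<longlonglongrightarrow> f l"
    using x by (simp add: continuous_on_sequentially)
qed

lemma ac_deriv_continuous:
  "ac_deriv S f f' \<Longrightarrow> is_interval S \<Longrightarrow> continuous_on S f"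
  by (rule continuous_on_interval_local) (auto intro: ac_deriv_continuous_Icc)

lemma ac_deriv_const [simp]: "ac_deriv S (\<lambda>x. k) (\<lambda>x. 0)"
  unfolding ac_deriv_def by auto

lemma ac_deriv_add:
  assumes "ac_deriv S f f'" "ac_deriv S g g'"
  shows "ac_deriv S (\<lambda>x. f x + g x) (\<lambda>x. f' x + g' x)"
  unfolding ac_deriv_def
proof (intro allI impI)
  fix c d :: real assume *: "c \<le> d \<and> {c..d} \<subseteq> S"
  note F = ac_derivD[OF assms(1), of c d] and G = ac_derivD[OF assms(2), of c d]
  have "integral {c..d} (\<lambda>x. f' x + g' x) = integral {c..d} f' + integral {c..d} g'"
    using F(1) G(1) * by (intro integral_add) (auto simp: absolutely_integrable_on_def)
  then show "(\<lambda>x. f' x + g' x) absolutely_integrable_on {c..d} \<and>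
      f d + g d = f c + g c + integral {c..d} (\<lambda>x. f' x + g' x)"
    using F G * by (auto intro: set_integral_add)
qed

lemma absolutely_integrable_mult_continuous:
  fixes f g :: "real \<Rightarrow> complex"
  assumes "continuous_on {c..d} f" "g absolutely_integrable_on {c..d}"
  shows "(\<lambda>x. f x * g x) absolutely_integrable_on {c..d}"
proof (rule absolutely_integrable_bounded_measurable_product[OF bilinear_times])
  show "f \<in> borel_measurable (lebesgue_on {c..d})"
    by (rule continuous_imp_measurable_on_sets_lebesgue[OF assms(1)]) simp
  show "bounded (f ` {c..d})"
    by (intro compact_imp_bounded compact_continuous_image assms(1)) simp
qed (use assms(2) in auto)

text \<open>Integration by parts without pointwise derivatives: f'(s) g'(t) is integrated over the
  triangle s <= t in both orders. Each inner integral is an increment of f or of g, and equating the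
  two outer ones gives the product rule.\<close>

lemma ac_deriv_mult:
  assumes "ac_deriv S f f'" "ac_deriv S g g'"
  shows "ac_deriv S (\<lambda>x. f x * g x) (\<lambda>x. f' x * g x + f x * g' x)"
  unfolding ac_deriv_def
proof (intro allI impI)
  fix c d :: real assume *: "c \<le> d \<and> {c..d} \<subseteq> S"
  note F = ac_derivD[OF assms(1)] and G = ac_derivD[OF assms(2)]
  have cf: "continuous_on {c..d} f" and cg: "continuous_on {c..d} g"
    using * assms by (auto intro: ac_deriv_continuous_Icc)
  have f': "f' absolutely_integrable_on {c..d}" and g': "g' absolutely_integrable_on {c..d}"
    using F(1) G(1) * by auto
  have i1: "(\<lambda>x. f x * g' x) absolutely_integrable_on {c..d}"
    by (rule absolutely_integrable_mult_continuous[OF cf g'])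
  have i2: "(\<lambda>x. f' x * g x) absolutely_integrable_on {c..d}"
    using absolutely_integrable_mult_continuous[OF cg f'] by (simp add: mult.commute)
  define M where "M = lebesgue_on {c..d}"
  interpret M: finite_measure M
    unfolding M_def by (rule finite_measure_lebesgue_on) simp
  interpret pair_sigma_finite M M ..
  have sp: "space M = {c..d}" by (simp add: M_def)
  have mf: "integrable M f'" and mg: "integrable M g'"
    using f' g' by (auto simp: M_def integrable_restrict_space set_integrable_def)
  have [measurable]: "f' \<in> borel_measurable M" "g' \<in> borel_measurable M"
    using mf mg by auto
  have idm [measurable]: "(\<lambda>x::real. x) \<in> borel_measurable M"
    unfolding M_def by (rule continuous_imp_measurable_on_sets_lebesgue) auto
  define T where "T = (\<lambda>(s, t). f' s * g' t * of_bool (s \<le> t))"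
  have Tm [measurable]: "T \<in> borel_measurable (M \<Otimes>\<^sub>M M)"
    unfolding T_def by measurable
  have "integrable (M \<Otimes>\<^sub>M M) (\<lambda>(s, t). f' s * g' t)"
  proof (rule Fubini_integrable)
    show "integrable M (\<lambda>x. \<integral>y. norm (case (x, y) of (s, t) \<Rightarrow> f' s * g' t) \<partial>M)"
      using mf by (simp add: norm_mult)
    show "AE x in M. integrable M (\<lambda>y. case (x, y) of (s, t) \<Rightarrow> f' s * g' t)"
      using mg by simp
  qed measurable
  then have Ti: "integrable (M \<Otimes>\<^sub>M M) T"
    by (rule Bochner_Integration.integrable_bound) (auto simp: T_def)
  have conv: "(\<integral>x. k x \<partial>M) = integral {c..d} k" if "k absolutely_integrable_on {c..d}" for k :: "real \<Rightarrow> complex"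
    unfolding M_def using that by (intro lebesgue_integral_eq_integral) (auto simp: integrable_restrict_space set_integrable_def)
  have in1: "(\<integral>s. T (s, t) \<partial>M) = g' t * (f t - f c)" if "t \<in> {c..d}" for t
  proof -
    have ab: "(\<lambda>s. if s \<in> {c..t} then f' s else 0) absolutely_integrable_on {c..d}"
      proof (rule set_integrable_subset)
      show "(\<lambda>s. if s \<in> {c..t} then f' s else 0) absolutely_integrable_on UNIV"
        using F(1)[of c t] that * subset_trans[of "{c..t}" "{c..d}" S]
        by (subst absolutely_integrable_restrict_UNIV) auto
    qed auto
    have "(\<integral>s. T (s, t) \<partial>M) = (\<integral>s. g' t * (if s \<in> {c..t} then f' s else 0) \<partial>M)"
      by (rule Bochner_Integration.integral_cong) (auto simp: T_def sp)
    also have "\<dots> = g' t * integral {c..d} (\<lambda>s. if s \<in> {c..t} then f' s else 0)"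
      by (simp only: integral_mult_right_zero conv[OF ab])
    also have "integral {c..d} (\<lambda>s. if s \<in> {c..t} then f' s else 0) = integral {c..t} f'"
      unfolding integral_restrict_Int by (rule arg_cong[where f="\<lambda>A. integral A _"]) (use that in auto)
    also have "\<dots> = f t - f c" using F(2)[of c t] that * subset_trans[of "{c..t}" "{c..d}" S] by auto
    finally show ?thesis .
  qed
  have in2: "(\<integral>t. T (s, t) \<partial>M) = f' s * (g d - g s)" if "s \<in> {c..d}" for s
  proof -
    have ab: "(\<lambda>t. if t \<in> {s..d} then g' t else 0) absolutely_integrable_on {c..d}"
      proof (rule set_integrable_subset)
      show "(\<lambda>t. if t \<in> {s..d} then g' t else 0) absolutely_integrable_on UNIV"
        using G(1)[of s d] that * subset_trans[of "{s..d}" "{c..d}" S]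
        by (subst absolutely_integrable_restrict_UNIV) auto
    qed auto
    have "(\<integral>t. T (s, t) \<partial>M) = (\<integral>t. f' s * (if t \<in> {s..d} then g' t else 0) \<partial>M)"
      by (rule Bochner_Integration.integral_cong) (auto simp: T_def sp)
    also have "\<dots> = f' s * integral {c..d} (\<lambda>t. if t \<in> {s..d} then g' t else 0)"
      by (simp only: integral_mult_right_zero conv[OF ab])
    also have "integral {c..d} (\<lambda>t. if t \<in> {s..d} then g' t else 0) = integral {s..d} g'"
      unfolding integral_restrict_Int by (rule arg_cong[where f="\<lambda>A. integral A _"]) (use that in auto)
    also have "\<dots> = g d - g s" using G(2)[of s d] that * subset_trans[of "{s..d}" "{c..d}" S] by auto
    finally show ?thesis .
  qed
  have "(\<integral>t. (\<integral>s. T (s, t) \<partial>M) \<partial>M) = (\<integral>s. (\<integral>t. T (s, t) \<partial>M) \<partial>M)"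
    by (rule Fubini_integral) (use Ti in \<open>simp add: case_prod_beta\<close>)
  moreover have "(\<integral>t. (\<integral>s. T (s, t) \<partial>M) \<partial>M) = (\<integral>t. g' t * (f t - f c) \<partial>M)"
    by (rule Bochner_Integration.integral_cong) (use in1 sp in auto)
  moreover have "(\<integral>s. (\<integral>t. T (s, t) \<partial>M) \<partial>M) = (\<integral>s. f' s * (g d - g s) \<partial>M)"
    by (rule Bochner_Integration.integral_cong) (use in2 sp in auto)
  ultimately have e1: "(\<integral>t. g' t * (f t - f c) \<partial>M) = (\<integral>s. f' s * (g d - g s) \<partial>M)"
    by simp
  have e2: "(\<integral>t. g' t * (f t - f c) \<partial>M) = integral {c..d} (\<lambda>t. f t * g' t) - f c * integral {c..d} g'"
  proof -
    have "integral\<^sup>L M (\<lambda>t. g' t * (f t - f c)) = integral\<^sup>L M (\<lambda>t. f t * g' t - f c * g' t)"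
      by (simp add: algebra_simps)
    also have "\<dots> = integral {c..d} (\<lambda>t. f t * g' t - f c * g' t)"
      by (rule conv) (intro set_integral_diff i1 set_integrable_mult_right g')
    finally show ?thesis
      using i1 g' by (simp add: absolutely_integrable_on_def integral_diff integrable_on_mult_right)
  qed
  have e3: "(\<integral>s. f' s * (g d - g s) \<partial>M) = g d * integral {c..d} f' - integral {c..d} (\<lambda>s. f' s * g s)"
  proof -
    have "integral\<^sup>L M (\<lambda>s. f' s * (g d - g s)) = integral\<^sup>L M (\<lambda>s. g d * f' s - f' s * g s)"
      by (simp add: algebra_simps)
    also have "\<dots> = integral {c..d} (\<lambda>s. g d * f' s - f' s * g s)"
      by (rule conv) (intro set_integral_diff i2 set_integrable_mult_right f')
    finally show ?thesis
      using i2 f' by (simp add: absolutely_integrable_on_def integral_diff integrable_on_mult_right)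
  qed
  have e4: "integral {c..d} (\<lambda>x. f' x * g x + f x * g' x)
      = integral {c..d} (\<lambda>s. f' s * g s) + integral {c..d} (\<lambda>t. f t * g' t)"
    using i1 i2 by (intro integral_add) (auto simp: absolutely_integrable_on_def)
  have "f c * integral {c..d} g' + g d * integral {c..d} f' =
      integral {c..d} (\<lambda>t. f t * g' t) + integral {c..d} (\<lambda>s. f' s * g s)"
    using e1 unfolding e2 e3 by (simp add: algebra_simps)
  moreover have "f d = f c + integral {c..d} f'" "g d = g c + integral {c..d} g'"
    using F(2) G(2) * by auto
  ultimately have "f d * g d = f c * g c + integral {c..d} (\<lambda>x. f' x * g x + f x * g' x)"
    unfolding e4 by (simp add: algebra_simps)
  then show "(\<lambda>x. f' x * g x + f x * g' x) absolutely_integrable_on {c..d} \<and>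
      f d * g d = f c * g c + integral {c..d} (\<lambda>x. f' x * g x + f x * g' x)"
    using i1 i2 by (auto intro: set_integral_add)
qed

section \<open>The first-order system in components\<close>

lemma dotT_eq: "dotT u v = u $ 1 * v $ 1 + u $ 2 * v $ 2"
  by (simp add: dotT_def sum_2)

lemma norm_vec2: "(norm (u :: complex^2))\<^sup>2 = (cmod (u $ 1))\<^sup>2 + (cmod (u $ 2))\<^sup>2"
  by (simp add: norm_vec_def L2_set_def sum_2)

lemma norm_dotT_le: "norm (dotT u v) \<le> norm u * norm v"
proof -
  have "norm (dotT u v) \<le> (\<Sum>i\<in>UNIV. \<bar>norm (u $ i)\<bar> * \<bar>norm (v $ i)\<bar>)"
    unfolding dotT_def by (rule order_trans[OF norm_sum]) (simp add: norm_mult)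
  also have "\<dots> \<le> norm u * norm v"
    unfolding norm_vec_def by (rule L2_set_mult_ineq)
  finally show ?thesis .
qed

lemma norm_wronskian_le: "norm (wronskian f g x) \<le> norm (f x) * norm (g x)"
proof -
  have "wronskian f g x = dotT (f x) (vector [g x $ 2, - g x $ 1])"
    by (simp add: wronskian_def dotT_eq)
  moreover have "norm (vector [g x $ 2, - g x $ 1] :: complex^2) = norm (g x)"
    by (simp add: norm_vec_def L2_set_def sum_2 add.commute)
  ultimately show ?thesis using norm_dotT_le by metis
qed

lemma vec2_eq_iff: "(u :: complex^2) = v \<longleftrightarrow> u $ 1 = v $ 1 \<and> u $ 2 = v $ 2"
  by (simp add: vec_eq_iff forall_2)

lemma dirac_derivative_part:
  "((1 / \<i>) *s (sigma2 *v v)) $ 1 = - v $ 2" "((1 / \<i>) *s (sigma2 *v v)) $ 2 = v $ 1"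
  by (simp_all add: sigma2_def matrix_vector_mult_def sum_2)

lemma matrix_vector_mult_2:
  "((A :: complex^2^2) *v v) $ i = A $ i $ 1 * v $ 1 + A $ i $ 2 * v $ 2"
  by (simp add: matrix_vector_mult_def sum_2)

lemma bounded_linear_axis: "bounded_linear (\<lambda>z. axis i (z :: complex) :: complex^2)"
proof (rule bounded_linear_intro[where K=1])
  show "norm (axis i z :: complex^2) \<le> norm z * 1" for z :: complex
    using exhaust_2[of i] by (auto simp: norm_vec_def L2_set_def sum_2 axis_def)
qed (auto simp: axis_def vec_eq_iff)

lemma LINT_eq_integral:
  fixes f :: "real \<Rightarrow> 'a::euclidean_space"
  assumes "f absolutely_integrable_on S" "S \<in> sets lebesgue"
  shows "integral\<^sup>L (lebesgue_on S) f = integral S f"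
  by (rule lebesgue_integral_eq_integral)
    (use assms in \<open>auto simp: integrable_restrict_space set_integrable_def\<close>)

lemma AE_lebesgue_on_negligible:
  assumes "AE x in lebesgue_on S. P x" "S \<in> sets lebesgue"
  obtains N where "negligible N" "\<And>x. x \<in> S - N \<Longrightarrow> P x"
proof -
  have "AE x in lebesgue. x \<in> S \<longrightarrow> P x"
    using assms by (subst (asm) AE_restrict_space_iff) auto
  then obtain N where "N \<in> null_sets lebesgue" "{x \<in> space lebesgue. \<not> (x \<in> S \<longrightarrow> P x)} \<subseteq> N"
    unfolding eventually_ae_filter by blast
  then show ?thesis
    by (intro that[of N]) (auto simp: negligible_iff_null_sets)
qed

text \<open>The matrix (1/i) \<sigma>_2 is the rotation (v1, v2) -> (-v2, v1), so the equation can
  be solved for f'. Taking the resulting expression as the derivative at every point absorbs the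
  null set in the definition of \<open>tau_eq\<close> and makes the calculus of
  \<open>ac_deriv\<close> applicable.\<close>

lemma tau_eq_iff:
  fixes Q :: "real \<Rightarrow> complex^2^2" and f h :: "real \<Rightarrow> complex^2"
  assumes S: "S \<in> sets lebesgue"
  shows "tau_eq Q S f h \<longleftrightarrow>
    ac_deriv S (\<lambda>x. f x $ 1) (\<lambda>x. h x $ 2 - Q x $ 2 $ 1 * f x $ 1 - Q x $ 2 $ 2 * f x $ 2) \<and>
    ac_deriv S (\<lambda>x. f x $ 2) (\<lambda>x. Q x $ 1 $ 1 * f x $ 1 + Q x $ 1 $ 2 * f x $ 2 - h x $ 1)"
    (is "_ \<longleftrightarrow> ac_deriv S _ ?F1 \<and> ac_deriv S _ ?F2")
proof
  assume "tau_eq Q S f h"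
  then obtain f' where f': "AC_loc_deriv S f f'"
    and ae: "AE x in lebesgue_on S. (1 / \<i>) *s (sigma2 *v f' x) + Q x *v f x = h x"
    unfolding tau_eq_def by blast
  obtain N where N: "negligible N"
    "\<And>x. x \<in> S - N \<Longrightarrow> (1 / \<i>) *s (sigma2 *v f' x) + Q x *v f x = h x"
    using AE_lebesgue_on_negligible[OF ae S] by blast
  have eq: "f' x $ 1 = ?F1 x" "f' x $ 2 = ?F2 x" if "x \<in> S - N" for x
    using N(2)[OF that] dirac_derivative_part[of "f' x"]
    by (auto simp: vec2_eq_iff matrix_vector_mult_2 algebra_simps)
  have comp: "(\<lambda>x. f' x $ i) absolutely_integrable_on {c..d} \<and>
      f d $ i = f c $ i + integral {c..d} (\<lambda>x. f' x $ i)"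
    if "c \<le> d" "{c..d} \<subseteq> S" for c d i
  proof -
    have ai: "f' absolutely_integrable_on {c..d}" and fd: "f d = f c + (LINT x|lebesgue_on {c..d}. f' x)"
      using f' that unfolding AC_loc_deriv_def by auto
    have "f d = f c + integral {c..d} f'"
      using fd LINT_eq_integral[OF ai] by simp
    moreover have "integral {c..d} (\<lambda>x. f' x $ i) = integral {c..d} f' $ i"
      using integral_linear[OF _ bounded_linear_vec_nth, of f' "{c..d}" i] ai
      by (auto simp: o_def absolutely_integrable_on_def)
    ultimately show ?thesis
      using absolutely_integrable_linear[OF ai bounded_linear_vec_nth, of i] by (simp add: o_def)
  qed
  have acF: "ac_deriv S (\<lambda>x. f x $ i) F"
    if "\<And>x. x \<in> S - N \<Longrightarrow> F x = f' x $ i" for i F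
    unfolding ac_deriv_def
  proof (intro allI impI)
    fix c d :: real assume *: "c \<le> d \<and> {c..d} \<subseteq> S"
    have "F absolutely_integrable_on {c..d}"
      by (rule absolutely_integrable_spike[where f="\<lambda>x. f' x $ i" and S=N]) (use comp * that N(1) in auto)
    moreover have "integral {c..d} F = integral {c..d} (\<lambda>x. f' x $ i)"
      by (rule integral_spike[OF N(1)]) (use * that in auto)
    ultimately show "F absolutely_integrable_on {c..d} \<and> f d $ i = f c $ i + integral {c..d} F"
      using comp * by auto
  qed
  show "ac_deriv S (\<lambda>x. f x $ 1) ?F1 \<and> ac_deriv S (\<lambda>x. f x $ 2) ?F2"
    by (intro conjI acF) (use eq in auto)
next
  assume R: "ac_deriv S (\<lambda>x. f x $ 1) ?F1 \<and> ac_deriv S (\<lambda>x. f x $ 2) ?F2"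
  define f' :: "real \<Rightarrow> complex^2" where "f' = (\<lambda>x. axis 1 (?F1 x) + axis 2 (?F2 x))"
  have c12: "f' x $ 1 = ?F1 x" "f' x $ 2 = ?F2 x" for x
    by (simp_all add: f'_def axis_def)
  have "AC_loc_deriv S f f'"
    unfolding AC_loc_deriv_def
  proof (intro allI impI)
    fix c d :: real assume *: "c \<le> d \<and> {c..d} \<subseteq> S"
    have a1: "?F1 absolutely_integrable_on {c..d}" and e1: "f d $ 1 = f c $ 1 + integral {c..d} ?F1"
      and a2: "?F2 absolutely_integrable_on {c..d}" and e2: "f d $ 2 = f c $ 2 + integral {c..d} ?F2"
      using R * ac_derivD by blast+
    have ai: "f' absolutely_integrable_on {c..d}"
      unfolding f'_def using absolutely_integrable_linear[OF a1 bounded_linear_axis, of 1]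
        absolutely_integrable_linear[OF a2 bounded_linear_axis, of 2]
      by (intro set_integral_add) (simp_all add: o_def)
    have "integral {c..d} f' $ i = integral {c..d} (\<lambda>x. f' x $ i)" for i
      using integral_linear[OF _ bounded_linear_vec_nth, of f' "{c..d}" i] ai
      by (auto simp: o_def absolutely_integrable_on_def)
    then have "f d = f c + integral {c..d} f'"
      using e1 e2 by (simp add: vec2_eq_iff c12)
    then show "f' absolutely_integrable_on {c..d} \<and> f d = f c + (LINT x|lebesgue_on {c..d}. f' x)"
      using ai LINT_eq_integral[OF ai] by simp
  qed
  moreover have "(1 / \<i>) *s (sigma2 *v f' x) + Q x *v f x = h x" for x
    unfolding vec2_eq_iff vector_add_component dirac_derivative_part c12 matrix_vector_mult_2 by simp
  ultimately show "tau_eq Q S f h"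
    unfolding tau_eq_def by blast
qed

lemmas tau_eq_deriv1 = conjunct1[OF iffD1[OF tau_eq_iff]]
  and tau_eq_deriv2 = conjunct2[OF iffD1[OF tau_eq_iff]]

lemma tau_eq_subset:
  assumes "tau_eq Q S f h" "T \<subseteq> S" "S \<in> sets lebesgue" "T \<in> sets lebesgue"
  shows "tau_eq Q T f h"
  using assms ac_deriv_subset by (simp add: tau_eq_iff) blast

lemma tau_eq_cong:
  assumes "tau_eq Q S f h" "S \<in> sets lebesgue" "\<And>x. x \<in> S \<Longrightarrow> f x = f' x" "\<And>x. x \<in> S \<Longrightarrow> h x = h' x"
  shows "tau_eq Q S f' h'"
  unfolding tau_eq_iff[OF assms(2)]
  by (intro conjI; rule ac_deriv_cong[OF tau_eq_deriv1[OF assms(2,1)]] ac_deriv_cong[OF tau_eq_deriv2[OF assms(2,1)]])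
    (auto simp: assms(3,4))

lemma ac_deriv_scale:
  assumes "ac_deriv S f f'"
  shows "ac_deriv S (\<lambda>x. k * f x) (\<lambda>x. k * f' x)"
  using ac_deriv_mult[OF ac_deriv_const[of S k] assms] by simp

lemma tau_eq_add:
  assumes "tau_eq Q S f h" "tau_eq Q S g k" "S \<in> sets lebesgue"
  shows "tau_eq Q S (\<lambda>x. f x + g x) (\<lambda>x. h x + k x)"
  unfolding tau_eq_iff[OF assms(3)]
  by (intro conjI; rule ac_deriv_cong[OF ac_deriv_add[OF tau_eq_deriv1[OF assms(3,1)] tau_eq_deriv1[OF assms(3,2)]]]
      ac_deriv_cong[OF ac_deriv_add[OF tau_eq_deriv2[OF assms(3,1)] tau_eq_deriv2[OF assms(3,2)]]])
    (auto simp: algebra_simps)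

lemma tau_eq_scale:
  assumes "tau_eq Q S f h" "S \<in> sets lebesgue"
  shows "tau_eq Q S (\<lambda>x. k *s f x) (\<lambda>x. k *s h x)"
  unfolding tau_eq_iff[OF assms(2)]
  by (intro conjI; rule ac_deriv_cong[OF ac_deriv_scale[OF tau_eq_deriv1[OF assms(2,1)], of k]]
      ac_deriv_cong[OF ac_deriv_scale[OF tau_eq_deriv2[OF assms(2,1)], of k]])
    (auto simp: algebra_simps)

text \<open>The vector (-f2, f1) is (1/i) \<sigma>_2 f, so the extra term comes from the derivative
  hitting the factor A. Variation of constants and the commutation transform both rest on
  this.\<close>

lemma tau_eq_scale_ac:
  assumes "tau_eq Q S f h" "ac_deriv S A A'" "S \<in> sets lebesgue"
  shows "tau_eq Q S (\<lambda>x. A x *s f x) (\<lambda>x. A x *s h x + A' x *s vector [- f x $ 2, f x $ 1])"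
  unfolding tau_eq_iff[OF assms(3)]
  by (intro conjI; rule ac_deriv_cong[OF ac_deriv_mult[OF assms(2) tau_eq_deriv1[OF assms(3,1)]]]
      ac_deriv_cong[OF ac_deriv_mult[OF assms(2) tau_eq_deriv2[OF assms(3,1)]]])
    (auto simp: algebra_simps)

lemma tau_eq_continuous_on:
  assumes "tau_eq Q S f h" "is_interval S" "S \<in> sets lebesgue"
  shows "continuous_on S f"
proof -
  have "continuous_on S (\<lambda>x. f x $ 1)" "continuous_on S (\<lambda>x. f x $ 2)"
    using ac_deriv_continuous[OF tau_eq_deriv1] ac_deriv_continuous[OF tau_eq_deriv2] assms by auto
  then have "continuous_on S (\<lambda>x. f x $ i)" for i
    using exhaust_2[of i] by auto
  then have "continuous_on S (\<lambda>x. \<chi> i. f x $ i)"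
    by (intro continuous_on_vec_lambda)
  then show ?thesis by simp
qed

lemma wronskian_self [simp]: "wronskian f f x = 0"
  by (simp add: wronskian_def)

lemma wronskian_commute: "wronskian f g x = - wronskian g f x"
  by (simp add: wronskian_def)

text \<open>Lagrange's identity in bilinear form: symmetry of the potential makes its contributions
  to the two products cancel, so only the right-hand sides h and k remain.\<close>

lemma ac_deriv_wronskian:
  fixes Q :: "real \<Rightarrow> complex^2^2"
  assumes f: "tau_eq Q S f h" and g: "tau_eq Q S g k" and S: "S \<in> sets lebesgue"
    and sym: "\<And>x. x \<in> S \<Longrightarrow> Q x $ 1 $ 2 = Q x $ 2 $ 1"
  shows "ac_deriv S (wronskian f g) (\<lambda>x. dotT (h x) (g x) - dotT (f x) (k x))"
proof -
  note F = f[unfolded tau_eq_iff[OF S]] and G = g[unfolded tau_eq_iff[OF S]]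
  note P1 = ac_deriv_mult[OF conjunct1[OF F] conjunct2[OF G]]
  note P2 = ac_deriv_scale[OF ac_deriv_mult[OF conjunct2[OF F] conjunct1[OF G]], of "-1"]
  show ?thesis
    by (rule ac_deriv_cong[OF ac_deriv_add[OF P1 P2]])
      (use sym in \<open>auto simp: wronskian_def dotT_eq algebra_simps\<close>)
qed

text \<open>Cramer's rule for writing u(x) in terms of f(x) and g(x), cleared of denominators so
  that it holds also where f and g are dependent.\<close>

lemma wronskian_expand:
  "wronskian f g x *s u x = wronskian u g x *s f x + wronskian f u x *s g x"
  by (simp add: vec2_eq_iff wronskian_def algebra_simps)

lemma wronskian_pluecker:
  "wronskian p q x * wronskian f g x
     = wronskian p f x * wronskian q g x - wronskian p g x * wronskian q f x"
  by (simp add: wronskian_def algebra_simps)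

section \<open>Square integrable functions\<close>

lemma integrable_lebesgue_on_iff:
  fixes f :: "real \<Rightarrow> 'a::euclidean_space"
  shows "S \<in> sets lebesgue \<Longrightarrow> integrable (lebesgue_on S) f \<longleftrightarrow> f absolutely_integrable_on S"
  by (simp add: integrable_restrict_space set_integrable_def)

lemma square_integrableD:
  assumes "square_integrable S f" "S \<in> sets lebesgue"
  shows "f \<in> borel_measurable (lebesgue_on S)" "(\<lambda>x. (norm (f x))\<^sup>2) absolutely_integrable_on S"
    "(\<lambda>x. (norm (f x))\<^sup>2) integrable_on S"
  using assms by (auto simp: square_integrable_def integrable_lebesgue_on_iff absolutely_integrable_on_def)

lemma square_integrableI:
  assumes "f \<in> borel_measurable (lebesgue_on S)" "(\<lambda>x. (norm (f x))\<^sup>2) absolutely_integrable_on S"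
    "S \<in> sets lebesgue"
  shows "square_integrable S f"
  using assms by (auto simp: square_integrable_def integrable_lebesgue_on_iff)

lemma L2norm_eq:
  assumes "square_integrable S f" "S \<in> sets lebesgue"
  shows "L2norm S f = sqrt (integral S (\<lambda>x. (norm (f x))\<^sup>2))"
  unfolding L2norm_def using LINT_eq_integral[OF square_integrableD(2)[OF assms] assms(2)] by simp

lemma borel_measurable_vec_nth_comp:
  fixes f :: "'b \<Rightarrow> complex^2"
  assumes "f \<in> borel_measurable M"
  shows "(\<lambda>x. f x $ i) \<in> borel_measurable M"
proof -
  have "(\<lambda>v :: complex^2. v $ i) \<in> borel_measurable borel"
    by (intro borel_measurable_continuous_onI continuous_intros)
  from measurable_compose[OF assms this] show ?thesis .
qed

lemma borel_measurable_dotT: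
  assumes "f \<in> borel_measurable M" "g \<in> borel_measurable M"
  shows "(\<lambda>x. dotT (f x) (g x)) \<in> borel_measurable M"
  unfolding dotT_eq by (intro borel_measurable_add borel_measurable_times borel_measurable_vec_nth_comp assms)

lemma square_integrable_subset:
  assumes "square_integrable S f" "T \<subseteq> S" "S \<in> sets lebesgue" "T \<in> sets lebesgue"
  shows "square_integrable T f"
proof (rule square_integrableI)
  show "f \<in> borel_measurable (lebesgue_on T)"
    by (rule measurable_restrict_mono[OF square_integrableD(1)[OF assms(1,3)] assms(2)])
  show "(\<lambda>x. (norm (f x))\<^sup>2) absolutely_integrable_on T"
    by (rule set_integrable_subset[OF square_integrableD(2)[OF assms(1,3)]]) (use assms in auto)
qed fact

lemma square_integrable_bound:
  assumes "g \<in> borel_measurable (lebesgue_on S)" "square_integrable S f" "S \<in> sets lebesgue"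
    "\<And>x. x \<in> S \<Longrightarrow> norm (g x) \<le> K * norm (f x)"
  shows "square_integrable S g"
proof (rule square_integrableI)
  show "(\<lambda>x. (norm (g x))\<^sup>2) absolutely_integrable_on S"
  proof (rule measurable_bounded_by_integrable_imp_absolutely_integrable)
    show "(\<lambda>x. (norm (g x))\<^sup>2) \<in> borel_measurable (lebesgue_on S)"
      using assms(1) by measurable
    show "(\<lambda>x. K\<^sup>2 * (norm (f x))\<^sup>2) integrable_on S"
      using square_integrableD(3)[OF assms(2,3)] by (rule integrable_on_mult_right)
    show "norm ((norm (g x))\<^sup>2) \<le> K\<^sup>2 * (norm (f x))\<^sup>2" if "x \<in> S" for x
      using power_mono[OF assms(4)[OF that], of 2] by (simp add: power_mult_distrib)
  qed fact
qed fact+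

lemma norm_vector_scalar_mult: "norm (k *s (v :: complex^2)) = norm k * norm v"
  by (simp add: norm_vec_def norm_mult L2_set_right_distrib)

lemma square_integrable_scale:
  assumes "square_integrable S f" "S \<in> sets lebesgue"
  shows "square_integrable S (\<lambda>x. k *s f x)"
proof (rule square_integrable_bound[OF _ assms])
  have "continuous_on UNIV (\<lambda>v :: complex^2. k *s v)"
  proof -
    have "bounded_linear (\<lambda>v :: complex^2. k *s v)"
      by (rule bounded_linear_intro[where K="norm k"])
        (simp_all add: vec_eq_iff algebra_simps norm_vector_scalar_mult)
    then show ?thesis by (rule linear_continuous_on)
  qed
  then have "(\<lambda>v :: complex^2. k *s v) \<in> borel_measurable borel"
    by (rule borel_measurable_continuous_onI)
  from measurable_compose[OF square_integrableD(1)[OF assms] this]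
  show "(\<lambda>x. k *s f x) \<in> borel_measurable (lebesgue_on S)" .
  show "norm (k *s f x) \<le> norm k * norm (f x)" for x
    by (simp add: norm_vector_scalar_mult)
qed

lemma square_integrable_add:
  assumes "square_integrable S f" "square_integrable S g" "S \<in> sets lebesgue"
  shows "square_integrable S (\<lambda>x. f x + g x)"
proof (rule square_integrableI)
  note F = square_integrableD[OF assms(1,3)] and G = square_integrableD[OF assms(2,3)]
  show m: "(\<lambda>x. f x + g x) \<in> borel_measurable (lebesgue_on S)"
    using F(1) G(1) by measurable
  show "(\<lambda>x. (norm (f x + g x))\<^sup>2) absolutely_integrable_on S"
  proof (rule measurable_bounded_by_integrable_imp_absolutely_integrable)
    show "(\<lambda>x. (norm (f x + g x))\<^sup>2) \<in> borel_measurable (lebesgue_on S)"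
      using m by measurable
    show "(\<lambda>x. 2 * (norm (f x))\<^sup>2 + 2 * (norm (g x))\<^sup>2) integrable_on S"
      using F(3) G(3) by (intro integrable_add integrable_on_mult_right)
    show "norm ((norm (f x + g x))\<^sup>2) \<le> 2 * (norm (f x))\<^sup>2 + 2 * (norm (g x))\<^sup>2" for x
    proof -
      have "(norm (f x + g x))\<^sup>2 \<le> (norm (f x) + norm (g x))\<^sup>2"
        by (intro power_mono norm_triangle_ineq) simp
      also have "\<dots> \<le> 2 * (norm (f x))\<^sup>2 + 2 * (norm (g x))\<^sup>2"
        using sum_squares_bound[of "norm (f x)" "norm (g x)"] by (simp add: power2_sum)
      finally show ?thesis by simp
    qed
  qed fact
qed fact

lemma square_integrable_bound_add:
  assumes "g \<in> borel_measurable (lebesgue_on S)" "square_integrable S f1" "square_integrable S f2"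
    "S \<in> sets lebesgue" "\<And>x. x \<in> S \<Longrightarrow> norm (g x) \<le> K * (norm (f1 x) + norm (f2 x))"
  shows "square_integrable S g"
proof (rule square_integrableI)
  show "(\<lambda>x. (norm (g x))\<^sup>2) absolutely_integrable_on S"
  proof (rule measurable_bounded_by_integrable_imp_absolutely_integrable)
    show "(\<lambda>x. (norm (g x))\<^sup>2) \<in> borel_measurable (lebesgue_on S)"
      using assms(1) by measurable
    show "(\<lambda>x. K\<^sup>2 * (2 * (norm (f1 x))\<^sup>2 + 2 * (norm (f2 x))\<^sup>2)) integrable_on S"
      using square_integrableD(3)[OF assms(2,4)] square_integrableD(3)[OF assms(3,4)]
      by (intro integrable_add integrable_on_mult_right)
    show "norm ((norm (g x))\<^sup>2) \<le> K\<^sup>2 * (2 * (norm (f1 x))\<^sup>2 + 2 * (norm (f2 x))\<^sup>2)" if "x \<in> S" for x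
    proof -
      have "(norm (g x))\<^sup>2 \<le> K\<^sup>2 * (norm (f1 x) + norm (f2 x))\<^sup>2"
        using power_mono[OF assms(5)[OF that], of 2] by (simp add: power_mult_distrib)
      also have "\<dots> \<le> K\<^sup>2 * (2 * (norm (f1 x))\<^sup>2 + 2 * (norm (f2 x))\<^sup>2)"
        using sum_squares_bound[of "norm (f1 x)" "norm (f2 x)"]
        by (intro mult_left_mono) (auto simp: power2_sum)
      finally show ?thesis by simp
    qed
  qed fact
qed fact+

lemma absolutely_integrable_norm_mult:
  assumes "square_integrable S f" "square_integrable S g" "S \<in> sets lebesgue"
  shows "(\<lambda>x. norm (f x) * norm (g x)) absolutely_integrable_on S"
proof (rule measurable_bounded_by_integrable_imp_absolutely_integrable)
  note F = square_integrableD[OF assms(1,3)] and G = square_integrableD[OF assms(2,3)]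
  show "(\<lambda>x. norm (f x) * norm (g x)) \<in> borel_measurable (lebesgue_on S)"
    using F(1) G(1) by measurable
  show "(\<lambda>x. (norm (f x))\<^sup>2 + (norm (g x))\<^sup>2) integrable_on S"
    using F(3) G(3) by (intro integrable_add)
  show "norm (norm (f x) * norm (g x)) \<le> (norm (f x))\<^sup>2 + (norm (g x))\<^sup>2" for x
  proof -
    have "2 * (norm (f x) * norm (g x)) \<le> (norm (f x))\<^sup>2 + (norm (g x))\<^sup>2"
      using sum_squares_bound[of "norm (f x)" "norm (g x)"] by (simp add: mult.assoc)
    moreover have "0 \<le> norm (f x) * norm (g x)" by simp
    ultimately have "norm (f x) * norm (g x) \<le> (norm (f x))\<^sup>2 + (norm (g x))\<^sup>2" by linarith
    then show ?thesis by (simp add: abs_mult)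
  qed
qed fact

lemma absolutely_integrable_dotT:
  assumes "square_integrable S f" "square_integrable S g" "S \<in> sets lebesgue"
  shows "(\<lambda>x. dotT (f x) (g x)) absolutely_integrable_on S"
proof (rule measurable_bounded_by_integrable_imp_absolutely_integrable)
  show "(\<lambda>x. dotT (f x) (g x)) \<in> borel_measurable (lebesgue_on S)"
    by (intro borel_measurable_dotT square_integrableD(1) assms)
  show "(\<lambda>x. norm (f x) * norm (g x)) integrable_on S"
    using absolutely_integrable_norm_mult[OF assms] by (simp add: absolutely_integrable_on_def)
qed (use assms norm_dotT_le in auto)

lemma integral_Cauchy_Schwarz:
  assumes "square_integrable S f" "square_integrable S g" "S \<in> sets lebesgue"
  shows "integral S (\<lambda>x. norm (f x) * norm (g x))
    \<le> sqrt (integral S (\<lambda>x. (norm (f x))\<^sup>2)) * sqrt (integral S (\<lambda>x. (norm (g x))\<^sup>2))"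
proof -
  note F = square_integrableD[OF assms(1,3)] and G = square_integrableD[OF assms(2,3)]
  define A where "A = integral S (\<lambda>x. (norm (f x))\<^sup>2)"
  define B where "B = integral S (\<lambda>x. (norm (g x))\<^sup>2)"
  define C where "C = integral S (\<lambda>x. norm (f x) * norm (g x))"
  have i: "(\<lambda>x. norm (f x) * norm (g x)) integrable_on S"
    using absolutely_integrable_norm_mult[OF assms] by (simp add: absolutely_integrable_on_def)
  have A: "A \<ge> 0" and B: "B \<ge> 0"
    unfolding A_def B_def using F(3) G(3) by (auto intro: integral_nonneg)
  have q: "0 \<le> A + t\<^sup>2 * B - 2 * t * C" for t
  proof -
    have "0 \<le> integral S (\<lambda>x. (norm (f x))\<^sup>2 + t\<^sup>2 * (norm (g x))\<^sup>2 - 2 * t * (norm (f x) * norm (g x)))"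
    proof (rule integral_nonneg)
      show "(\<lambda>x. (norm (f x))\<^sup>2 + t\<^sup>2 * (norm (g x))\<^sup>2 - 2 * t * (norm (f x) * norm (g x))) integrable_on S"
        by (intro integrable_add integrable_diff integrable_on_mult_right F(3) G(3) i)
      show "0 \<le> (norm (f x))\<^sup>2 + t\<^sup>2 * (norm (g x))\<^sup>2 - 2 * t * (norm (f x) * norm (g x))" for x
        using zero_le_power2[of "norm (f x) - t * norm (g x)"]
        by (simp add: power2_eq_square algebra_simps)
    qed
    also have "\<dots> = A + t\<^sup>2 * B - 2 * t * C"
      unfolding A_def B_def C_def
      by (simp add: integral_diff integral_add integrable_add integrable_on_mult_right F(3) G(3) i)
    finally show ?thesis .
  qed
  have "C\<^sup>2 \<le> A * B"
  proof (cases "B = 0")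
    case True
    have "C \<le> 0"
    proof (rule ccontr)
      assume "\<not> C \<le> 0"
      then have "0 < C" by simp
      with q[of "(A + 1) / (2 * C)"] True show False by simp
    qed
    moreover have "C \<ge> 0" unfolding C_def by (intro integral_nonneg i) simp
    ultimately show ?thesis using True by simp
  next
    case False
    with B have "B > 0" by simp
    \<comment> \<open>C / B is the minimiser of the quadratic in t.\<close>
    have "0 \<le> B * (A + (C / B)\<^sup>2 * B - 2 * (C / B) * C)"
      using q[of "C / B"] B by simp
    also have "\<dots> = A * B - C\<^sup>2"
      using False by (simp add: field_simps power2_eq_square)
    finally show ?thesis by simp
  qed
  then have "C \<le> sqrt (A * B)"
    by (rule real_le_rsqrt)
  then show ?thesis by (simp add: A_def B_def C_def real_sqrt_mult)
qed

lemma integral_dotT_Cauchy_Schwarz: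
  assumes "square_integrable S f" "square_integrable S g" "S \<in> sets lebesgue"
  shows "norm (integral S (\<lambda>x. dotT (f x) (g x)))
    \<le> sqrt (integral S (\<lambda>x. (norm (f x))\<^sup>2)) * sqrt (integral S (\<lambda>x. (norm (g x))\<^sup>2))"
proof -
  have "norm (integral S (\<lambda>x. dotT (f x) (g x))) \<le> integral S (\<lambda>x. norm (f x) * norm (g x))"
    using absolutely_integrable_dotT[OF assms] absolutely_integrable_norm_mult[OF assms]
    by (intro integral_norm_bound_integral) (auto simp: absolutely_integrable_on_def norm_dotT_le)
  with integral_Cauchy_Schwarz[OF assms] show ?thesis by simp
qed

text \<open>Bridges the open intervals \<open>einterval\<close> of the definitions and the half-open
  ones on which the arguments run.\<close>

lemma square_integrable_insert:
  assumes "square_integrable S f" "S \<in> sets lebesgue"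
  shows "square_integrable (insert c S) f"
proof (rule square_integrableI)
  have S': "insert c S \<in> sets lebesgue" using sets.Un[of "{c}" lebesgue S] assms(2) by simp
  then show "insert c S \<in> sets lebesgue" .
  have "(\<lambda>x. if x \<in> S then f x else 0) \<in> borel_measurable lebesgue"
    by (rule borel_measurable_if_I[OF square_integrableD(1)[OF assms] assms(2)])
  then have "(\<lambda>x. if x = c then f c else if x \<in> S then f x else 0) \<in> borel_measurable lebesgue"
    by (rule measurable_If[rotated]) simp_all
  moreover have "(\<lambda>x. if x = c then f c else if x \<in> S then f x else 0)
      = (\<lambda>x. if x \<in> insert c S then f x else 0)" by (simp add: fun_eq_iff)
  ultimately have "(\<lambda>x. if x \<in> insert c S then f x else 0) \<in> borel_measurable lebesgue"
    by (simp only:)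
  then show "f \<in> borel_measurable (lebesgue_on (insert c S))"
    by (rule borel_measurable_if_D)
  show "(\<lambda>x. (norm (f x))\<^sup>2) absolutely_integrable_on insert c S"
  proof (rule absolutely_integrable_spike_set[OF square_integrableD(2)[OF assms]])
    show "negligible {x \<in> S - insert c S. (norm (f x))\<^sup>2 \<noteq> 0}"
      by (rule negligible_subset[of "{c}"]) auto
    show "negligible {x \<in> insert c S - S. (norm (f x))\<^sup>2 \<noteq> 0}"
      by (rule negligible_subset[of "{c}"]) auto
  qed
qed

lemma integral_insert:
  fixes f :: "real \<Rightarrow> 'a::euclidean_space"
  shows "integral (insert c S) f = integral S f"
  by (rule integral_spike_set; rule negligible_subset[of "{c}"]) auto

lemma square_integrable_continuous_Icc:
  assumes "continuous_on {c..d} f"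
  shows "square_integrable {c..d} f"
proof (rule square_integrableI)
  show "f \<in> borel_measurable (lebesgue_on {c..d})"
    by (rule continuous_imp_measurable_on_sets_lebesgue[OF assms]) simp
  show "(\<lambda>x. (norm (f x))\<^sup>2) absolutely_integrable_on {c..d}"
    by (intro absolutely_integrable_continuous_real continuous_intros assms)
qed simp

section \<open>Half-open intervals abutting on an endpoint\<close>

text \<open>
  \<open>E\<close> is \<open>(a, e]\<close> or \<open>[e, b)\<close> and \<open>F\<close> the filter of convergence to the open end, so that both
  endpoints are treated at once.
\<close>

locale half_interval =
  fixes E :: "real set" and e :: real and F :: "real filter"
  assumes e_in: "e \<in> E" and interval: "is_interval E"
    and side: "(\<forall>x\<in>E. e \<le> x) \<or> (\<forall>x\<in>E. x \<le> e)"
    and eventually_beyond: "x0 \<in> E \<Longrightarrow> \<forall>\<^sub>F x in F. x \<in> E \<and> x0 \<in> closed_segment e x"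
    and eventually_near: "eventually P F \<Longrightarrow> \<exists>e'\<in>E. \<forall>x\<in>E. e' \<in> closed_segment e x \<longrightarrow> P x"
    and nontriv: "F \<noteq> bot"
    and exhaust: "\<exists>d :: nat \<Rightarrow> real. (\<forall>n. d n \<in> E) \<and>
      (\<forall>n. d n \<in> closed_segment e (d (Suc n))) \<and> (\<forall>x\<in>E. \<exists>n. x \<in> closed_segment e (d n))"
begin

lemma E_sets [simp]: "E \<in> sets lebesgue"
proof -
  have "E \<in> sets borel" using interval by (intro real_interval_borel_measurable)
  then show ?thesis by (simp add: sets_completionI_sets)
qed

lemma segment_subset: "x \<in> E \<Longrightarrow> closed_segment e x \<subseteq> E"
  using e_in interval by (simp add: closed_segment_subset is_interval_convex_1)

lemma segment_mono: "y \<in> closed_segment e x \<Longrightarrow> closed_segment e y \<subseteq> closed_segment e x"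
  by (intro closed_segment_subset) auto

lemma segment_sets [simp]: "closed_segment x (y :: real) \<in> sets lebesgue"
  by (simp add: closed_segment_eq_real_ivl)

lemma eventually_in: "\<forall>\<^sub>F x in F. x \<in> E"
  using eventually_beyond[OF e_in] by (rule eventually_mono) auto

text \<open>Segments are unoriented, so the sign that turns the integral over the segment from e to
  x into the increment p(x) - p(e) is fixed here once for all x. It is complex because
  \<open>ac_deriv\<close> concerns complex functions.\<close>

definition orient :: complex where
  "orient = (if \<forall>x\<in>E. e \<le> x then 1 else - 1)"

lemma norm_orient [simp]: "norm orient = 1"
  by (simp add: orient_def)

lemma ac_deriv_segment:
  assumes "ac_deriv E p p'" "x \<in> E"
  shows "p' absolutely_integrable_on closed_segment e x"
    "p x = p e + orient * integral (closed_segment e x) p'"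
proof -
  have sub: "closed_segment e x \<subseteq> E" by (rule segment_subset) fact
  consider "\<forall>x\<in>E. e \<le> x" | "\<not> (\<forall>x\<in>E. e \<le> x)" "\<forall>x\<in>E. x \<le> e" using side by auto
  then have "p' absolutely_integrable_on closed_segment e x \<and>
      p x = p e + orient * integral (closed_segment e x) p'"
  proof cases
    case 1
    then have "e \<le> x" using assms(2) by auto
    then show ?thesis
      using ac_derivD[OF assms(1), of e x] sub 1 by (auto simp: orient_def closed_segment_eq_real_ivl)
  next
    case 2
    then have "x \<le> e" using assms(2) by auto
    then have "closed_segment e x = {x..e}" by (auto simp: closed_segment_eq_real_ivl)
    then show ?thesis
      using ac_derivD[OF assms(1), of x e] sub 2 \<open>x \<le> e\<close> by (auto simp: orient_def)
  qed
  then show "p' absolutely_integrable_on closed_segment e x"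
    "p x = p e + orient * integral (closed_segment e x) p'" by auto
qed

lemma absolutely_integrable_segment:
  fixes k :: "real \<Rightarrow> 'a::euclidean_space"
  assumes "k absolutely_integrable_on E" "x \<in> E"
  shows "k absolutely_integrable_on closed_segment e x"
  by (rule set_integrable_subset[OF assms(1)]) (auto simp: segment_subset[OF assms(2)])

text \<open>Monotone convergence along the segments of \<open>exhaust\<close>, whose nesting makes
  the truncations increase. The third claim keeps a sequence of segments that realises the integral;
  \<open>integral_segment_tendsto\<close> upgrades it to convergence along F.\<close>

lemma integrable_on_exhaust:
  fixes k :: "real \<Rightarrow> real"
  assumes k: "\<And>x. x \<in> E \<Longrightarrow> k integrable_on closed_segment e x" and pos: "\<And>x. x \<in> E \<Longrightarrow> 0 \<le> k x"
    and B: "\<And>x. x \<in> E \<Longrightarrow> integral (closed_segment e x) k \<le> B"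
  shows "k integrable_on E" "integral E k \<le> B"
    "\<exists>d. (\<forall>n. d n \<in> E) \<and> (\<lambda>n. integral (closed_segment e (d n)) k) \<longlonglongrightarrow> integral E k"
proof -
  obtain d :: "nat \<Rightarrow> real" where d: "\<And>n. d n \<in> E" "\<And>n. d n \<in> closed_segment e (d (Suc n))"
    and ex: "\<And>x. x \<in> E \<Longrightarrow> \<exists>n. x \<in> closed_segment e (d n)"
    using exhaust by blast
  define f where "f n x = (if x \<in> closed_segment e (d n) then k x else 0)" for n x
  have sub: "closed_segment e (d n) \<subseteq> E" for n by (rule segment_subset) (rule d)
  have fi: "f n integrable_on E" for n
    unfolding f_def integrable_restrict_Int Int_absorb2[OF sub] by (rule k[OF d(1)])
  have fe: "integral E (f n) = integral (closed_segment e (d n)) k" for n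
    unfolding f_def Henstock_Kurzweil_Integration.integral_restrict_Int Int_absorb2[OF sub] ..
  have mono: "f n x \<le> f (Suc n) x" if "x \<in> E" for n x
    using segment_mono[OF d(2)[of n]] pos[OF that] by (auto simp: f_def)
  have lim: "(\<lambda>n. f n x) \<longlonglongrightarrow> k x" if "x \<in> E" for x
  proof -
    obtain m where m: "x \<in> closed_segment e (d m)" using ex \<open>x \<in> E\<close> by blast
    have "x \<in> closed_segment e (d n)" if "n \<ge> m" for n
      using that
    proof (induction rule: dec_induct)
      case (step n)
      then show ?case using segment_mono[OF d(2)[of n]] by blast
    qed (rule m)
    then have "\<forall>\<^sub>F n in sequentially. f n x = k x"
      unfolding eventually_sequentially f_def by auto
    then show ?thesis by (rule tendsto_eventually)
  qed
  have f0: "0 \<le> integral E (f n)" for n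
    using fi pos by (intro integral_nonneg) (auto simp: f_def)
  have "bounded (range (\<lambda>n. integral E (f n)))"
    unfolding bounded_iff using f0 B[OF d(1)] by (intro exI[of _ B]) (auto simp: fe)
  from monotone_convergence_increasing[OF fi mono lim this]
  have R: "k integrable_on E" "(\<lambda>n. integral E (f n)) \<longlonglongrightarrow> integral E k" by auto
  show "k integrable_on E" by fact
  show "integral E k \<le> B"
    by (rule LIMSEQ_le_const2[OF R(2)]) (use B[OF d(1)] in \<open>auto simp: fe\<close>)
  show "\<exists>d. (\<forall>n. d n \<in> E) \<and> (\<lambda>n. integral (closed_segment e (d n)) k) \<longlonglongrightarrow> integral E k"
    using R(2) d(1) by (auto simp: fe intro: exI[of _ d])
qed

text \<open>The remainder of k is dominated by the remainder of its norm, and the latter decreases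
  as the segment grows. Hence smallness at a single point \<open>d m\<close> of the sequence carries
  over to every x beyond \<open>d m\<close>.\<close>

lemma integral_segment_tendsto:
  fixes k :: "real \<Rightarrow> 'a::euclidean_space"
  assumes k: "k absolutely_integrable_on E"
  shows "((\<lambda>x. integral (closed_segment e x) k) \<longlongrightarrow> integral E k) F"
proof (rule tendstoI)
  fix \<epsilon> :: real assume \<epsilon>: "\<epsilon> > 0"
  let ?n = "\<lambda>x. norm (k x)"
  have nE: "?n integrable_on E" and kE: "k integrable_on E"
    using k by (auto simp: absolutely_integrable_on_def)
  have nS: "?n integrable_on closed_segment e x" if "x \<in> E" for x
    using absolutely_integrable_segment[OF k that] by (auto simp: absolutely_integrable_on_def)
  have "integral (closed_segment e x) ?n \<le> integral E ?n" if "x \<in> E" for x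
    by (rule integral_subset_le[OF segment_subset[OF that] nS[OF that] nE]) simp
  from integrable_on_exhaust(3)[OF nS _ this]
  obtain d :: "nat \<Rightarrow> real" where d: "\<And>n. d n \<in> E" "(\<lambda>n. integral (closed_segment e (d n)) ?n) \<longlonglongrightarrow> integral E ?n"
    by auto
  obtain m where m: "integral E ?n - integral (closed_segment e (d m)) ?n < \<epsilon>"
    using LIMSEQ_D[OF d(2) \<epsilon>] by (metis abs_less_iff minus_diff_eq order_refl real_norm_def)
  from eventually_beyond[OF d(1)[of m]]
  show "\<forall>\<^sub>F x in F. dist (integral (closed_segment e x) k) (integral E k) < \<epsilon>"
  proof (rule eventually_mono, elim conjE)
    fix x assume x: "x \<in> E" "d m \<in> closed_segment e x"
    let ?r = "\<lambda>h y. if y \<in> closed_segment e x then h y else 0"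
    have kS: "k integrable_on closed_segment e x"
      using absolutely_integrable_segment[OF k x(1)] by (auto simp: absolutely_integrable_on_def)
    have i1: "?r k integrable_on E"
      unfolding integrable_restrict_Int Int_absorb2[OF segment_subset[OF x(1)]] by (rule kS)
    have i2: "?r ?n integrable_on E"
      unfolding integrable_restrict_Int Int_absorb2[OF segment_subset[OF x(1)]] by (rule nS[OF x(1)])
    have r: "integral E (?r h) = integral (closed_segment e x) h" for h :: "real \<Rightarrow> 'b::euclidean_space"
      unfolding Henstock_Kurzweil_Integration.integral_restrict_Int
        Int_absorb2[OF segment_subset[OF x(1)]] ..
    have "integral E k - integral (closed_segment e x) k = integral E (\<lambda>y. k y - ?r k y)"
      by (simp only: integral_diff[OF kE i1] r)
    also have "norm \<dots> \<le> integral E (\<lambda>y. ?n y - ?r ?n y)"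
      by (rule integral_norm_bound_integral) (auto intro!: integrable_diff kE i1 nE i2)
    also have "\<dots> = integral E ?n - integral (closed_segment e x) ?n"
      by (simp only: integral_diff[OF nE i2] r)
    also have "\<dots> \<le> integral E ?n - integral (closed_segment e (d m)) ?n"
      using integral_subset_le[OF segment_mono[OF x(2)] nS[OF d(1)] nS[OF x(1)]] by simp
    also have "\<dots> < \<epsilon>" by (rule m)
    finally show "dist (integral (closed_segment e x) k) (integral E k) < \<epsilon>"
      by (simp add: dist_norm norm_minus_commute)
  qed
qed

text \<open>The tail beyond e' meets the segment from e to e' at most in e' itself, a null set. T is
  any measurable part of the tail, so that it can be a half interval with base point e'.\<close>

lemma integral_tail_le:
  fixes k :: "real \<Rightarrow> real"
  assumes k: "k absolutely_integrable_on E" "\<And>x. x \<in> E \<Longrightarrow> 0 \<le> k x"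
    and T: "T \<subseteq> {x \<in> E. e' \<in> closed_segment e x}" "T \<in> sets lebesgue" and e': "e' \<in> E"
  shows "integral T k \<le> integral E k - integral (closed_segment e e') k"
proof -
  let ?T = "T - {e'}"
  have T': "?T \<in> sets lebesgue" using T(2) by auto
  have TE: "?T \<subseteq> E" using T(1) by auto
  have "x = e'" if "x \<in> closed_segment e e'" "e' \<in> closed_segment e x" for x
    using that by (auto simp: closed_segment_eq_real_ivl split: if_splits)
  then have disj: "?T \<inter> closed_segment e e' = {}" using T(1) by auto
  have iT: "k integrable_on ?T"
    using set_integrable_subset[OF k(1) T' TE] by (simp add: absolutely_integrable_on_def)
  have iS: "k integrable_on closed_segment e e'"
    using absolutely_integrable_segment[OF k(1) e'] by (simp add: absolutely_integrable_on_def)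
  have "integral T k = integral ?T k"
    by (rule integral_spike_set; rule negligible_subset[of "{e'}"]) auto
  also have "\<dots> + integral (closed_segment e e') k = integral (?T \<union> closed_segment e e') k"
    by (subst integral_Un[OF iT iS]) (simp_all add: disj)
  also have "\<dots> \<le> integral E k"
  proof (rule integral_subset_le)
    show "?T \<union> closed_segment e e' \<subseteq> E" using TE segment_subset[OF e'] by auto
    show "k integrable_on ?T \<union> closed_segment e e'"
      by (rule integrable_Un[OF _ iT iS]) (simp add: disj)
  qed (use k in \<open>auto simp: absolutely_integrable_on_def\<close>)
  finally show ?thesis by simp
qed

lemma square_integrable_exhaust:
  assumes f: "continuous_on E f"
    and B: "\<And>x. x \<in> E \<Longrightarrow> integral (closed_segment e x) (\<lambda>y. (norm (f y))\<^sup>2) \<le> B"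
  shows "square_integrable E f" "integral E (\<lambda>y. (norm (f y))\<^sup>2) \<le> B"
proof -
  have i: "(\<lambda>y. (norm (f y))\<^sup>2) integrable_on closed_segment e x" if "x \<in> E" for x
  proof -
    have "continuous_on (closed_segment e x) (\<lambda>y. (norm (f y))\<^sup>2)"
      by (intro continuous_intros continuous_on_subset[OF f] segment_subset that)
    then show ?thesis
      unfolding closed_segment_eq_real_ivl by (auto intro: integrable_continuous_real split: if_splits)
  qed
  note R = integrable_on_exhaust[OF i _ B]
  show "square_integrable E f"
  proof (rule square_integrableI)
    show "f \<in> borel_measurable (lebesgue_on E)"
      by (rule continuous_imp_measurable_on_sets_lebesgue[OF f]) simp
    show "(\<lambda>x. (norm (f x))\<^sup>2) absolutely_integrable_on E"
      using R(1) by (intro nonnegative_absolutely_integrable_1) auto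
  qed simp
  show "integral E (\<lambda>y. (norm (f y))\<^sup>2) \<le> B"
    using R(2) by auto
qed

lemma ac_deriv_tendsto:
  assumes "ac_deriv E p p'" "p' absolutely_integrable_on E"
  shows "(p \<longlongrightarrow> p e + orient * integral E p') F"
proof -
  have "((\<lambda>x. p e + orient * integral (closed_segment e x) p') \<longlongrightarrow> p e + orient * integral E p') F"
    by (intro tendsto_intros integral_segment_tendsto assms)
  moreover have "\<forall>\<^sub>F x in F. p e + orient * integral (closed_segment e x) p' = p x"
    using eventually_in by (rule eventually_mono) (use ac_deriv_segment(2)[OF assms(1)] in auto)
  ultimately show ?thesis by (rule Lim_transform_eventually)
qed

end

subsection \<open>The two ends of an interval\<close>

lemma eventually_to_left_end:
  assumes "a < ereal c"
  shows "\<forall>\<^sub>F x in to_left_end a. a < ereal x \<and> x < c"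
proof -
  have "\<forall>\<^sub>F y in at_right a. a < y \<and> y < ereal c"
    using assms by (auto simp: eventually_at_right)
  then show ?thesis
    unfolding to_left_end_def by (rule eventually_filtercomapI[THEN eventually_mono]) auto
qed

lemma eventually_to_right_end:
  assumes "ereal c < b"
  shows "\<forall>\<^sub>F x in to_right_end b. ereal x < b \<and> c < x"
proof -
  have "\<forall>\<^sub>F y in at_left b. y < b \<and> ereal c < y"
    using assms by (auto simp: eventually_at_left)
  then show ?thesis
    unfolding to_right_end_def by (rule eventually_filtercomapI[THEN eventually_mono]) auto
qed

lemma to_left_end_neq_bot:
  assumes "a < ereal c"
  shows "to_left_end a \<noteq> bot"
  unfolding to_left_end_def
proof (rule filtercomap_neq_bot)
  fix P assume "eventually P (at_right a)"
  then obtain y where y: "y > a" "\<And>x. a < x \<Longrightarrow> x < y \<Longrightarrow> P x"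
    using assms by (auto simp: eventually_at_right)
  obtain r where "a < ereal r" "ereal r < y" using ereal_dense2[OF y(1)] by auto
  with y(2) show "\<exists>x. P (ereal x)" by blast
qed

lemma to_right_end_neq_bot:
  assumes "ereal c < b"
  shows "to_right_end b \<noteq> bot"
  unfolding to_right_end_def
proof (rule filtercomap_neq_bot)
  fix P assume "eventually P (at_left b)"
  then obtain y where y: "y < b" "\<And>x. y < x \<Longrightarrow> x < b \<Longrightarrow> P x"
    using assms by (auto simp: eventually_at_left)
  obtain r where "y < ereal r" "ereal r < b" using ereal_dense2[OF y(1)] by auto
  with y(2) show "\<exists>x. P (ereal x)" by blast
qed

definition left_half :: "ereal \<Rightarrow> real \<Rightarrow> real set" where
  "left_half a c = {x. a < ereal x \<and> x \<le> c}"

definition right_half :: "real \<Rightarrow> ereal \<Rightarrow> real set" where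
  "right_half c b = {x. c \<le> x \<and> ereal x < b}"

lemma left_half_insert: "a < ereal c \<Longrightarrow> left_half a c = insert c (einterval a (ereal c))"
  by (auto simp: left_half_def einterval_def)

lemma right_half_insert: "ereal c < b \<Longrightarrow> right_half c b = insert c (einterval (ereal c) b)"
  by (auto simp: right_half_def einterval_def)

lemma half_interval_left:
  assumes "a < ereal c"
  shows "half_interval (left_half a c) c (to_left_end a)"
proof
  show "c \<in> left_half a c" using assms by (simp add: left_half_def)
  show "is_interval (left_half a c)"
    unfolding is_interval_1
  proof (intro ballI allI impI)
    fix p q x assume "p \<in> left_half a c" "q \<in> left_half a c" "p \<le> x \<and> x \<le> q"
    then show "x \<in> left_half a c" using less_le_trans[of a "ereal p" "ereal x"] by (simp add: left_half_def)
  qed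
  show "(\<forall>x\<in>left_half a c. c \<le> x) \<or> (\<forall>x\<in>left_half a c. x \<le> c)" by (simp add: left_half_def)
  show "to_left_end a \<noteq> bot" by (rule to_left_end_neq_bot[OF assms])
  show "\<exists>e'\<in>left_half a c. \<forall>x\<in>left_half a c. e' \<in> closed_segment c x \<longrightarrow> P x"
    if P: "eventually P (to_left_end a)" for P
  proof -
    have "\<forall>\<^sub>F x in filtercomap ereal (at_right a). P x"
      using P by (simp add: to_left_end_def)
    then obtain R where R: "eventually R (at_right a)" "\<And>x. R (ereal x) \<Longrightarrow> P x"
      unfolding eventually_filtercomap by blast
    then obtain y where y: "y > a" "\<And>x. a < x \<Longrightarrow> x < y \<Longrightarrow> R x"
      using assms by (auto simp: eventually_at_right)
    have "a < min y (ereal c)" using y(1) assms by simp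
    then obtain r where r: "a < ereal r" "ereal r < min y (ereal c)" using ereal_dense2 by blast
    have "P x" if "x \<in> left_half a c" "r \<in> closed_segment c x" for x
    proof -
      have "x \<le> r" using that r(2) by (auto simp: closed_segment_eq_real_ivl left_half_def split: if_splits)
      then have "ereal x < y" using r(2) by (auto intro: le_less_trans[of _ "ereal r"])
      then show ?thesis using R(2) y(2) that(1) by (auto simp: left_half_def)
    qed
    then show ?thesis using r by (intro bexI[of _ r]) (auto simp: left_half_def)
  qed
  show "\<forall>\<^sub>F x in to_left_end a. x \<in> left_half a c \<and> x0 \<in> closed_segment c x" if "x0 \<in> left_half a c" for x0
  proof -
    have "\<forall>\<^sub>F x in to_left_end a. a < ereal x \<and> x < x0"
      by (rule eventually_to_left_end) (use that in \<open>auto simp: left_half_def\<close>)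
    then show ?thesis
      by (rule eventually_mono) (use that in \<open>auto simp: left_half_def closed_segment_eq_real_ivl\<close>)
  qed
  \<comment> \<open>Only the left ends l serve as exhausting sequence: they decrease, and the
    segments from c to \<open>l n\<close> cover everything up to c.\<close>
  obtain u l :: "nat \<Rightarrow> real" where ul: "einterval a (ereal c) = (\<Union>i. {l i..u i})" "incseq u"
    "decseq l" "\<And>i. l i < u i" "\<And>i. a < ereal (l i)" "\<And>i. ereal (u i) < ereal c"
    "(\<lambda>i. ereal (l i)) \<longlonglongrightarrow> a" "(\<lambda>i. ereal (u i)) \<longlonglongrightarrow> ereal c"
    by (rule einterval_Icc_approximation[OF assms]) (rule that)
  have lc: "l n < c" for n using ul(4)[of n] ul(6)[of n] by simp
  show "\<exists>d :: nat \<Rightarrow> real. (\<forall>n. d n \<in> left_half a c) \<and>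
      (\<forall>n. d n \<in> closed_segment c (d (Suc n))) \<and> (\<forall>x\<in>left_half a c. \<exists>n. x \<in> closed_segment c (d n))"
  proof (intro exI[of _ l] conjI allI ballI)
    fix n show "l n \<in> left_half a c" using ul(5)[of n] lc[of n] by (simp add: left_half_def)
    show "l n \<in> closed_segment c (l (Suc n))"
      using lc[of n] lc[of "Suc n"] decseq_SucD[OF ul(3), of n] by (simp add: closed_segment_eq_real_ivl)
  next
    fix x assume x: "x \<in> left_half a c"
    show "\<exists>n. x \<in> closed_segment c (l n)"
    proof (cases "x = c")
      case False
      then have "x \<in> einterval a (ereal c)" using x by (auto simp: left_half_def einterval_def)
      then obtain n where "x \<in> {l n..u n}" unfolding ul(1) by blast
      then show ?thesis using x lc[of n]
        by (intro exI[of _ n]) (auto simp: closed_segment_eq_real_ivl left_half_def)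
    qed auto
  qed
qed

lemma half_interval_right:
  assumes "ereal c < b"
  shows "half_interval (right_half c b) c (to_right_end b)"
proof
  show "c \<in> right_half c b" using assms by (simp add: right_half_def)
  show "is_interval (right_half c b)"
    unfolding is_interval_1
  proof (intro ballI allI impI)
    fix p q x assume "p \<in> right_half c b" "q \<in> right_half c b" "p \<le> x \<and> x \<le> q"
    then show "x \<in> right_half c b" using le_less_trans[of "ereal x" "ereal q" b] by (simp add: right_half_def)
  qed
  show "(\<forall>x\<in>right_half c b. c \<le> x) \<or> (\<forall>x\<in>right_half c b. x \<le> c)" by (simp add: right_half_def)
  show "to_right_end b \<noteq> bot" by (rule to_right_end_neq_bot[OF assms])
  show "\<exists>e'\<in>right_half c b. \<forall>x\<in>right_half c b. e' \<in> closed_segment c x \<longrightarrow> P x"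
    if P: "eventually P (to_right_end b)" for P
  proof -
    have "\<forall>\<^sub>F x in filtercomap ereal (at_left b). P x"
      using P by (simp add: to_right_end_def)
    then obtain R where R: "eventually R (at_left b)" "\<And>x. R (ereal x) \<Longrightarrow> P x"
      unfolding eventually_filtercomap by blast
    then obtain y where y: "y < b" "\<And>x. y < x \<Longrightarrow> x < b \<Longrightarrow> R x"
      using assms by (auto simp: eventually_at_left)
    have "max y (ereal c) < b" using y(1) assms by simp
    then obtain r where r: "max y (ereal c) < ereal r" "ereal r < b" using ereal_dense2 by blast
    have "P x" if "x \<in> right_half c b" "r \<in> closed_segment c x" for x
    proof -
      have "r \<le> x" using that r(1) by (auto simp: closed_segment_eq_real_ivl right_half_def split: if_splits)
      then have "y < ereal x" using r(1) by (auto intro: less_le_trans[of _ "ereal r"])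
      then show ?thesis using R(2) y(2) that(1) by (auto simp: right_half_def)
    qed
    then show ?thesis using r by (intro bexI[of _ r]) (auto simp: right_half_def)
  qed
  show "\<forall>\<^sub>F x in to_right_end b. x \<in> right_half c b \<and> x0 \<in> closed_segment c x" if "x0 \<in> right_half c b" for x0
  proof -
    have "\<forall>\<^sub>F x in to_right_end b. ereal x < b \<and> x0 < x"
      by (rule eventually_to_right_end) (use that in \<open>auto simp: right_half_def\<close>)
    then show ?thesis
      by (rule eventually_mono) (use that in \<open>auto simp: right_half_def closed_segment_eq_real_ivl\<close>)
  qed
  obtain u l :: "nat \<Rightarrow> real" where ul: "einterval (ereal c) b = (\<Union>i. {l i..u i})" "incseq u"
    "decseq l" "\<And>i. l i < u i" "\<And>i. ereal c < ereal (l i)" "\<And>i. ereal (u i) < b"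
    "(\<lambda>i. ereal (l i)) \<longlonglongrightarrow> ereal c" "(\<lambda>i. ereal (u i)) \<longlonglongrightarrow> b"
    by (rule einterval_Icc_approximation[OF assms]) (rule that)
  have uc: "c < u n" for n using ul(5)[of n] ul(4)[of n] by simp
  show "\<exists>d :: nat \<Rightarrow> real. (\<forall>n. d n \<in> right_half c b) \<and>
      (\<forall>n. d n \<in> closed_segment c (d (Suc n))) \<and> (\<forall>x\<in>right_half c b. \<exists>n. x \<in> closed_segment c (d n))"
  proof (intro exI[of _ u] conjI allI ballI)
    fix n show "u n \<in> right_half c b" using ul(6)[of n] uc[of n] by (simp add: right_half_def)
    show "u n \<in> closed_segment c (u (Suc n))"
      using uc[of n] uc[of "Suc n"] incseq_SucD[OF ul(2), of n] by (simp add: closed_segment_eq_real_ivl)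
  next
    fix x assume x: "x \<in> right_half c b"
    show "\<exists>n. x \<in> closed_segment c (u n)"
    proof (cases "x = c")
      case False
      then have "x \<in> einterval (ereal c) b" using x by (auto simp: right_half_def einterval_def)
      then obtain n where "x \<in> {l n..u n}" unfolding ul(1) by blast
      then show ?thesis using x uc[of n]
        by (intro exI[of _ n]) (auto simp: closed_segment_eq_real_ivl right_half_def)
    qed auto
  qed
qed

section \<open>Weyl's alternative\<close>

context half_interval
begin

lemma wronskian_tendsto:
  fixes Q :: "real \<Rightarrow> complex^2^2"
  assumes sym: "\<And>x. x \<in> E \<Longrightarrow> Q x $ 1 $ 2 = Q x $ 2 $ 1"
    and f: "tau_eq Q E f h" "square_integrable E f" "square_integrable E h"
    and g: "tau_eq Q E g k" "square_integrable E g" "square_integrable E k"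
  shows "\<exists>w. (wronskian f g \<longlongrightarrow> w) F"
proof -
  have "(\<lambda>x. dotT (h x) (g x) - dotT (f x) (k x)) absolutely_integrable_on E"
    by (intro set_integral_diff absolutely_integrable_dotT f g E_sets)
  from ac_deriv_tendsto[OF ac_deriv_wronskian[OF f(1) g(1) E_sets sym] this]
  show ?thesis by blast
qed

text \<open>
  The quantitative core of Weyl's alternative. Expanding a solution \<open>u\<close> in \<open>f\<close> and \<open>g\<close>, the
  monotone function \<open>v\<close> below bounds the coefficients and satisfies \<open>v \<le> A + v / 2\<close>.
\<close>

lemma solution_square_integrable:
  fixes Q :: "real \<Rightarrow> complex^2^2"
  assumes sym: "\<And>x. x \<in> E \<Longrightarrow> Q x $ 1 $ 2 = Q x $ 2 $ 1"
    and f: "tau_eq Q E f h" "square_integrable E f" "square_integrable E h"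
    and g: "tau_eq Q E g k" "square_integrable E g" "square_integrable E k"
    and u: "tau_eq Q E u (\<lambda>x. z *s u x)"
    and \<delta>: "\<delta> > 0" "\<And>x. x \<in> E \<Longrightarrow> \<delta> \<le> norm (wronskian f g x)"
    and small: "integral E (\<lambda>x. (norm (f x) + norm (g x)) *
        (norm z * (norm (f x) + norm (g x)) + norm (h x) + norm (k x))) \<le> \<delta> / 2"
  shows "square_integrable E u"
proof -
  let ?G = "\<lambda>x. norm (f x) + norm (g x)"
  \<comment> \<open>By Lagrange's identity the derivatives of both coefficients W(u, g) and W(f, u)
    are at most |u| K, so one majorant serves for the two.\<close>
  define K where "K x = norm z * ?G x + norm (h x) + norm (k x)" for x
  define A where "A = norm (wronskian u g e) + norm (wronskian f u e)"
  have cu: "continuous_on E u" by (rule tau_eq_continuous_on[OF u interval E_sets])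
  have cf: "continuous_on E f" by (rule tau_eq_continuous_on[OF f(1) interval E_sets])
  have cg: "continuous_on E g" by (rule tau_eq_continuous_on[OF g(1) interval E_sets])
  have Kpos: "0 \<le> K x" for x by (simp add: K_def)
  have GK: "(\<lambda>x. ?G x * K x) absolutely_integrable_on E"
  proof -
    note a = absolutely_integrable_norm_mult[OF _ _ E_sets]
    have "(\<lambda>x. norm z * (norm (f x) * norm (f x)) + 2 * norm z * (norm (f x) * norm (g x)) +
        norm z * (norm (g x) * norm (g x)) + norm (f x) * norm (h x) + norm (f x) * norm (k x) +
        norm (g x) * norm (h x) + norm (g x) * norm (k x)) absolutely_integrable_on E"
      by (intro set_integral_add set_integrable_mult_right a f g)
    then show ?thesis by (simp add: K_def algebra_simps)
  qed
  have uK: "(\<lambda>x. norm (u x) * K x) absolutely_integrable_on closed_segment e x" if x: "x \<in> E" for x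
  proof -
    have sub: "closed_segment e x \<subseteq> E" by (rule segment_subset[OF x])
    have us: "square_integrable (closed_segment e x) u"
      using square_integrable_continuous_Icc[OF continuous_on_subset[OF cu]] sub
      by (auto simp: closed_segment_eq_real_ivl split: if_splits)
    note a = absolutely_integrable_norm_mult[OF us square_integrable_subset[OF _ sub E_sets segment_sets] segment_sets]
    have "(\<lambda>x. norm z * (norm (u x) * norm (f x)) + norm z * (norm (u x) * norm (g x)) +
        norm (u x) * norm (h x) + norm (u x) * norm (k x)) absolutely_integrable_on closed_segment e x"
      by (intro set_integral_add set_integrable_mult_right a f g)
    then show ?thesis by (simp add: K_def algebra_simps)
  qed
  define v where "v x = A + integral (closed_segment e x) (\<lambda>y. norm (u y) * K y)" for x
  have uKi: "(\<lambda>y. norm (u y) * K y) integrable_on closed_segment e x" if "x \<in> E" for x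
    using uK[OF that] by (simp add: absolutely_integrable_on_def)
  have vmono: "v y \<le> v x" if "x \<in> E" "y \<in> closed_segment e x" for x y
    unfolding v_def using that segment_subset[OF that(1)]
    by (intro add_left_mono integral_subset_le segment_mono uKi) (auto simp: Kpos)
  have v0: "0 \<le> v x" if "x \<in> E" for x
    unfolding v_def using uKi[OF that] Kpos by (auto simp: A_def intro!: add_nonneg_nonneg integral_nonneg)
  have u_le: "norm (u x) \<le> ?G x * v x / \<delta>" if x: "x \<in> E" for x
  proof -
    have coeff: "norm (p x) \<le> norm (p e) + integral (closed_segment e x) (\<lambda>y. norm (u y) * K y)"
      if p: "ac_deriv E p p'" and le: "\<And>y. y \<in> E \<Longrightarrow> norm (p' y) \<le> norm (u y) * K y" for p p'
    proof -
      have "norm (p x) \<le> norm (p e) + norm (integral (closed_segment e x) p')"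
        using ac_deriv_segment(2)[OF p x] norm_triangle_ineq[of "p e" "orient * integral (closed_segment e x) p'"]
        by (simp add: norm_mult)
      also have "norm (integral (closed_segment e x) p') \<le> integral (closed_segment e x) (\<lambda>y. norm (u y) * K y)"
        using ac_deriv_segment(1)[OF p x] le segment_subset[OF x]
        by (intro integral_norm_bound_integral uKi[OF x]) (auto simp: absolutely_integrable_on_def)
      finally show ?thesis by simp
    qed
    have zuK: "norm (z * p) \<le> norm u' * (norm z * r)" if "norm p \<le> norm u' * r" for p :: complex and u' :: "complex^2" and r
      using mult_left_mono[OF that, of "norm z"] by (simp add: norm_mult algebra_simps)
    have b1: "norm (dotT (z *s u y) (g y) - dotT (u y) (k y)) \<le> norm (u y) * K y" for y
    proof -
      have "norm (dotT (z *s u y) (g y) - dotT (u y) (k y)) \<le> norm (dotT (z *s u y) (g y)) + norm (dotT (u y) (k y))"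
        by (rule norm_triangle_ineq4)
      also have "\<dots> \<le> norm (z *s u y) * norm (g y) + norm (u y) * norm (k y)"
        by (intro add_mono norm_dotT_le)
      also have "\<dots> \<le> norm (u y) * K y"
        by (simp add: K_def norm_vector_scalar_mult algebra_simps)
      finally show ?thesis .
    qed
    have b2: "norm (dotT (h y) (u y) - dotT (f y) (z *s u y)) \<le> norm (u y) * K y" for y
    proof -
      have "norm (dotT (h y) (u y) - dotT (f y) (z *s u y)) \<le> norm (dotT (h y) (u y)) + norm (dotT (f y) (z *s u y))"
        by (rule norm_triangle_ineq4)
      also have "\<dots> \<le> norm (h y) * norm (u y) + norm (f y) * norm (z *s u y)"
        by (intro add_mono norm_dotT_le)
      also have "\<dots> \<le> norm (u y) * K y"
        by (simp add: K_def norm_vector_scalar_mult algebra_simps)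
      finally show ?thesis .
    qed
    have w1: "norm (wronskian u g x) \<le> v x"
      using coeff[OF ac_deriv_wronskian[OF u g(1) E_sets sym] b1] norm_ge_zero[of "wronskian f u e"]
      unfolding v_def A_def by linarith
    have w2: "norm (wronskian f u x) \<le> v x"
      using coeff[OF ac_deriv_wronskian[OF f(1) u E_sets sym] b2] norm_ge_zero[of "wronskian u g e"]
      unfolding v_def A_def by linarith
    have "\<delta> * norm (u x) \<le> norm (wronskian f g x) * norm (u x)"
      by (intro mult_right_mono \<delta>(2)[OF x]) simp
    also have "\<dots> = norm (wronskian u g x *s f x + wronskian f u x *s g x)"
      unfolding wronskian_expand[symmetric] norm_vector_scalar_mult ..
    also have "\<dots> \<le> norm (wronskian u g x) * norm (f x) + norm (wronskian f u x) * norm (g x)"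
      by (rule order_trans[OF norm_triangle_ineq]) (simp add: norm_vector_scalar_mult)
    also have "\<dots> \<le> v x * norm (f x) + v x * norm (g x)"
      by (intro add_mono mult_right_mono w1 w2) auto
    finally show ?thesis using \<delta>(1) by (simp add: field_simps)
  qed
  have v_le: "v x \<le> 2 * A" if x: "x \<in> E" for x
  proof -
    have GKS: "(\<lambda>y. ?G y * K y) integrable_on closed_segment e x"
      using absolutely_integrable_segment[OF GK x] by (simp add: absolutely_integrable_on_def)
    have "integral (closed_segment e x) (\<lambda>y. norm (u y) * K y)
        \<le> integral (closed_segment e x) (\<lambda>y. v x / \<delta> * (?G y * K y))"
    proof (rule integral_le[OF uKi[OF x]])
      show "(\<lambda>y. v x / \<delta> * (?G y * K y)) integrable_on closed_segment e x"
        by (rule integrable_on_mult_right[OF GKS])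
      fix y assume y: "y \<in> closed_segment e x"
      then have yE: "y \<in> E" using segment_subset[OF x] by auto
      have "norm (u y) * K y \<le> ?G y * v y / \<delta> * K y"
        by (intro mult_right_mono u_le[OF yE] Kpos)
      also have "\<dots> \<le> ?G y * v x / \<delta> * K y"
        using vmono[OF x y] \<delta>(1) Kpos by (intro mult_right_mono divide_right_mono mult_left_mono) auto
      also have "\<dots> = v x / \<delta> * (?G y * K y)" by simp
      finally show "norm (u y) * K y \<le> v x / \<delta> * (?G y * K y)" .
    qed
    also have "\<dots> = v x / \<delta> * integral (closed_segment e x) (\<lambda>y. ?G y * K y)"
      by (rule integral_mult_right)
    also have "\<dots> \<le> v x / \<delta> * (\<delta> / 2)"
    proof (rule mult_left_mono)
      have "integral (closed_segment e x) (\<lambda>y. ?G y * K y) \<le> integral E (\<lambda>y. ?G y * K y)"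
        using GK Kpos by (intro integral_subset_le segment_subset[OF x] GKS) (auto simp: absolutely_integrable_on_def)
      also have "\<dots> \<le> \<delta> / 2" using small by (simp add: K_def)
      finally show "integral (closed_segment e x) (\<lambda>y. ?G y * K y) \<le> \<delta> / 2" .
    qed (use v0[OF x] \<delta>(1) in simp)
    also have "\<dots> = v x / 2" using \<delta>(1) by simp
    finally show ?thesis unfolding v_def[of x] by simp
  qed
  have "norm (u x) \<le> 2 * A / \<delta> * ?G x" if x: "x \<in> E" for x
  proof -
    have "norm (u x) \<le> ?G x * v x / \<delta>" by (rule u_le[OF x])
    also have "\<dots> \<le> ?G x * (2 * A) / \<delta>"
      using v_le[OF x] \<delta>(1) by (intro divide_right_mono mult_left_mono) auto
    finally show ?thesis by (simp add: algebra_simps)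
  qed
  then show ?thesis
    by (intro square_integrable_bound_add[OF _ f(2) g(2) E_sets, where K="2 * A / \<delta>"]
        continuous_imp_measurable_on_sets_lebesgue cu E_sets) auto
qed

text \<open>By the Pluecker identity, with a companion \<open>q\<close> of \<open>p\<close>.\<close>

lemma wronskian_tendsto_0:
  fixes Q :: "real \<Rightarrow> complex^2^2"
  assumes sym: "\<And>x. x \<in> E \<Longrightarrow> Q x $ 1 $ 2 = Q x $ 2 $ 1"
    and f: "tau_eq Q E f h" "square_integrable E f" "square_integrable E h"
    and g: "tau_eq Q E g k" "square_integrable E g" "square_integrable E k"
    and q: "tau_eq Q E q l" "square_integrable E q" "square_integrable E l"
    and pq: "\<And>x. x \<in> E \<Longrightarrow> wronskian p q x = w" "w \<noteq> 0"
    and bc: "(wronskian p f \<longlongrightarrow> 0) F" "(wronskian p g \<longlongrightarrow> 0) F"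
  shows "(wronskian f g \<longlongrightarrow> 0) F"
proof -
  obtain w1 where w1: "(wronskian q g \<longlongrightarrow> w1) F"
    using wronskian_tendsto[where Q=Q, OF sym q g] by blast
  obtain w2 where w2: "(wronskian q f \<longlongrightarrow> w2) F"
    using wronskian_tendsto[where Q=Q, OF sym q f] by blast
  have "((\<lambda>x. (wronskian p f x * wronskian q g x - wronskian p g x * wronskian q f x) / w) \<longlongrightarrow> (0 * w1 - 0 * w2) / w) F"
    by (intro tendsto_intros bc w1 w2 pq(2))
  moreover have "\<forall>\<^sub>F x in F. (wronskian p f x * wronskian q g x - wronskian p g x * wronskian q f x) / w = wronskian f g x"
    using eventually_in by (rule eventually_mono) (simp add: wronskian_pluecker[symmetric] pq)
  ultimately show ?thesis by (simp add: Lim_transform_eventually)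
qed

text \<open>\<open>solution_square_integrable\<close> asks for a lower bound on W(f, g) and a small
  integral. Both hold once the base point is moved far enough towards the open end: with \<delta>
  half the modulus of the limit, |W(f, g)| exceeds \<delta> and the tail of the integral is at most
  \<delta> / 2. The family E' supplies half intervals at the new base point, for either end.\<close>

lemma solutions_square_integrable_near:
  fixes Q :: "real \<Rightarrow> complex^2^2"
  assumes sym: "\<And>x. x \<in> E \<Longrightarrow> Q x $ 1 $ 2 = Q x $ 2 $ 1"
    and f: "tau_eq Q E f h" "square_integrable E f" "square_integrable E h"
    and g: "tau_eq Q E g k" "square_integrable E g" "square_integrable E k"
    and lim: "(wronskian f g \<longlongrightarrow> w) F" "w \<noteq> 0"
    and u: "tau_eq Q E u (\<lambda>x. z *s u x)"
    and sub: "\<And>e'. e' \<in> E \<Longrightarrow> half_interval (E' e') e' F"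
      "\<And>e'. e' \<in> E \<Longrightarrow> E' e' \<subseteq> {x \<in> E. e' \<in> closed_segment e x}"
  shows "\<exists>e'\<in>E. square_integrable (E' e') u"
proof -
  let ?k = "\<lambda>x. (norm (f x) + norm (g x)) * (norm z * (norm (f x) + norm (g x)) + norm (h x) + norm (k x))"
  define \<delta> where "\<delta> = norm w / 2"
  have \<delta>: "\<delta> > 0" using lim(2) by (simp add: \<delta>_def)
  have ai: "?k absolutely_integrable_on E"
  proof -
    note a = absolutely_integrable_norm_mult[OF _ _ E_sets]
    have "(\<lambda>x. norm z * (norm (f x) * norm (f x)) + 2 * norm z * (norm (f x) * norm (g x)) +
        norm z * (norm (g x) * norm (g x)) + norm (f x) * norm (h x) + norm (f x) * norm (k x) +
        norm (g x) * norm (h x) + norm (g x) * norm (k x)) absolutely_integrable_on E"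
      by (intro set_integral_add set_integrable_mult_right a f g)
    then show ?thesis by (simp add: algebra_simps)
  qed
  have "\<forall>\<^sub>F x in F. norm w / 2 < norm (wronskian f g x)"
    using tendsto_norm[OF lim(1)] by (rule order_tendstoD) (use lim(2) in simp)
  moreover have "\<forall>\<^sub>F x in F. dist (integral (closed_segment e x) ?k) (integral E ?k) < \<delta> / 2"
    using integral_segment_tendsto[OF ai] \<delta> by (intro tendstoD) auto
  ultimately have "\<forall>\<^sub>F x in F. norm w / 2 < norm (wronskian f g x) \<and>
      dist (integral (closed_segment e x) ?k) (integral E ?k) < \<delta> / 2"
    by (rule eventually_conj)
  from eventually_near[OF this] obtain e' where e': "e' \<in> E"
    and *: "\<And>x. x \<in> E \<Longrightarrow> e' \<in> closed_segment e x \<Longrightarrow> norm w / 2 < norm (wronskian f g x) \<and>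
      dist (integral (closed_segment e x) ?k) (integral E ?k) < \<delta> / 2"
    by blast
  let ?E = "E' e'"
  interpret E': half_interval ?E e' F by (rule sub(1)[OF e'])
  have E'E: "?E \<subseteq> E" using sub(2)[OF e'] by auto
  have "integral ?E ?k \<le> integral E ?k - integral (closed_segment e e') ?k"
    by (rule integral_tail_le[OF ai _ sub(2)[OF e'] E'.E_sets e']) simp
  also have "\<dots> \<le> \<delta> / 2"
    using conjunct2[OF *[OF e' ends_in_segment(2)]] unfolding dist_real_def abs_less_iff by linarith
  finally have small: "integral ?E ?k \<le> \<delta> / 2" .
  have "square_integrable ?E u"
  proof (rule E'.solution_square_integrable)
    show "Q x $ 1 $ 2 = Q x $ 2 $ 1" if "x \<in> ?E" for x using that E'E sym by auto
    show "\<delta> \<le> norm (wronskian f g x)" if "x \<in> ?E" for x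
      using *[of x] that sub(2)[OF e'] by (auto simp: \<delta>_def)
  qed (rule \<delta> small tau_eq_subset[OF _ E'E E_sets E'.E_sets] square_integrable_subset[OF _ E'E E_sets E'.E_sets] f g u)+
  with e' show ?thesis by blast
qed

end

section \<open>Families of solutions\<close>

lemma norm_vec2_le: "norm (v :: complex^2) \<le> norm (v $ 1) + norm (v $ 2)"
  using L2_set_le_sum[of UNIV "\<lambda>i. norm (v $ i)"] by (simp add: norm_vec_def sum_2)

text \<open>Turns bounds at single points, uniform in w, into one bound on the compact interval;
  later this gives the constants for dominated convergence. The system forces |U(x)| <= 2 |U(x0)| on
  a neighbourhood of x0 that depends only on the coefficients and R, and finitely many such
  neighbourhoods cover the interval.\<close>

lemma solution_family_bounded:
  fixes Q :: "real \<Rightarrow> complex^2^2" and U :: "'w \<Rightarrow> real \<Rightarrow> complex^2"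
  assumes Q: "\<And>i j. (\<lambda>x. Q x $ i $ j) absolutely_integrable_on {c..d}"
    and U: "\<And>w. w \<in> W \<Longrightarrow> tau_eq Q {c..d} (U w) (\<lambda>x. z w *s U w x)"
    and R: "\<And>w. w \<in> W \<Longrightarrow> norm (z w) \<le> R"
    and bd: "\<And>y. y \<in> {c..d} \<Longrightarrow> \<exists>B. \<forall>w\<in>W. norm (U w y) \<le> B"
  shows "\<exists>B. \<forall>w\<in>W. \<forall>y\<in>{c..d}. norm (U w y) \<le> B"
proof -
  \<comment> \<open>A majorant of the coefficients of the system for all w at once; increments of
    its primitive G control the increments of every U w.\<close>
  define q where "q x = R + (norm (Q x $ 1 $ 1) + norm (Q x $ 1 $ 2) + norm (Q x $ 2 $ 1) + norm (Q x $ 2 $ 2))" for x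
  have qi: "q integrable_on {c..d}"
    unfolding q_def using Q by (intro integrable_add) (auto simp: absolutely_integrable_on_def)
  define G where "G x = integral {c..x} q" for x
  have contG: "continuous_on {c..d} G"
    unfolding G_def by (rule indefinite_integral_continuous_1[OF qi])
  show ?thesis
  proof (cases "W = {}")
    case False
    then obtain w0 where "w0 \<in> W" by auto
    then have R0: "0 \<le> R" using R[of w0] norm_ge_zero[of "z w0"] by linarith
    then have q0: "0 \<le> q x" for x by (simp add: q_def)
    have qsub: "q integrable_on {x..y}" if "{x..y} \<subseteq> {c..d}" for x y
      using integrable_on_subinterval[OF qi that] .
    have Gdiff: "integral {x..y} q = G y - G x" if "x \<le> y" "x \<in> {c..d}" "y \<in> {c..d}" for x y
      using Henstock_Kurzweil_Integration.integral_combine[of c x y q] qsub[of c y] that by (auto simp: G_def)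
    have est: "norm (U w x - U w y) \<le> 2 * (M * \<bar>G x - G y\<bar>)"
      if w: "w \<in> W" and x: "x \<in> {c..d}" "y \<in> {c..d}"
        and M: "\<And>t. t \<in> closed_segment x y \<Longrightarrow> norm (U w t) \<le> M" for w x y M
    proof -
      have main: "norm (U w y - U w x) \<le> 2 * (M * (G y - G x))"
        if xy: "x \<le> y" "x \<in> {c..d}" "y \<in> {c..d}" and M: "\<And>t. t \<in> {x..y} \<Longrightarrow> norm (U w t) \<le> M" for x y
      proof -
        have sub: "{x..y} \<subseteq> {c..d}" using xy by auto
        have one: "norm (p y - p x) \<le> M * (G y - G x)"
          if p: "ac_deriv {c..d} p p'" and le: "\<And>t. t \<in> {x..y} \<Longrightarrow> norm (p' t) \<le> q t * norm (U w t)" for p p'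
        proof -
          have "norm (p y - p x) = norm (integral {x..y} p')"
            using ac_derivD(2)[OF p xy(1) sub] by simp
          also have "\<dots> \<le> integral {x..y} (\<lambda>t. M * q t)"
          proof (rule integral_norm_bound_integral)
            show "p' integrable_on {x..y}"
              using ac_derivD(1)[OF p xy(1) sub] by (simp add: absolutely_integrable_on_def)
            show "(\<lambda>t. M * q t) integrable_on {x..y}" by (intro integrable_on_mult_right qsub sub)
            fix t assume t: "t \<in> {x..y}"
            have "norm (p' t) \<le> q t * norm (U w t)" by (rule le[OF t])
            also have "\<dots> \<le> q t * M" by (intro mult_left_mono M t q0)
            finally show "norm (p' t) \<le> M * q t" by (simp add: mult.commute)
          qed
          also have "\<dots> = M * (G y - G x)" using Gdiff[OF xy] by simp
          finally show ?thesis .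
        qed
        have comp: "norm (U w t $ i) \<le> norm (U w t)" for t i by (rule Finite_Cartesian_Product.norm_nth_le)
        have zc: "norm (z w * U w t $ i) \<le> R * norm (U w t)" for t i
          unfolding norm_mult by (intro mult_mono R[OF w] comp R0) auto
        have Qc: "norm (Q t $ j $ k * U w t $ i) \<le> norm (Q t $ j $ k) * norm (U w t)" for t i j k
          unfolding norm_mult by (intro mult_left_mono comp) auto
        have b1: "norm ((z w *s U w t) $ 2 - Q t $ 2 $ 1 * U w t $ 1 - Q t $ 2 $ 2 * U w t $ 2) \<le> q t * norm (U w t)" for t
        proof -
          have "norm ((z w *s U w t) $ 2 - Q t $ 2 $ 1 * U w t $ 1 - Q t $ 2 $ 2 * U w t $ 2)
              \<le> norm (z w * U w t $ 2) + norm (Q t $ 2 $ 1 * U w t $ 1) + norm (Q t $ 2 $ 2 * U w t $ 2)"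
            unfolding vector_smult_component by (intro order_trans[OF norm_triangle_ineq4] add_right_mono norm_triangle_ineq4)
          also have "\<dots> \<le> R * norm (U w t) + norm (Q t $ 2 $ 1) * norm (U w t) + norm (Q t $ 2 $ 2) * norm (U w t)"
            by (intro add_mono zc Qc)
          also have "\<dots> \<le> q t * norm (U w t)"
            unfolding q_def distrib_right by (auto intro!: add_nonneg_nonneg)
          finally show ?thesis .
        qed
        have b2: "norm (Q t $ 1 $ 1 * U w t $ 1 + Q t $ 1 $ 2 * U w t $ 2 - (z w *s U w t) $ 1) \<le> q t * norm (U w t)" for t
        proof -
          have "norm (Q t $ 1 $ 1 * U w t $ 1 + Q t $ 1 $ 2 * U w t $ 2 - (z w *s U w t) $ 1)
              \<le> norm (Q t $ 1 $ 1 * U w t $ 1) + norm (Q t $ 1 $ 2 * U w t $ 2) + norm (z w * U w t $ 1)"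
            unfolding vector_smult_component by (intro order_trans[OF norm_triangle_ineq4] add_right_mono norm_triangle_ineq)
          also have "\<dots> \<le> norm (Q t $ 1 $ 1) * norm (U w t) + norm (Q t $ 1 $ 2) * norm (U w t) + R * norm (U w t)"
            by (intro add_mono zc Qc)
          also have "\<dots> \<le> q t * norm (U w t)"
            unfolding q_def distrib_right by (auto intro!: add_nonneg_nonneg)
          finally show ?thesis .
        qed
        have "norm (U w y - U w x) \<le> norm (U w y $ 1 - U w x $ 1) + norm (U w y $ 2 - U w x $ 2)"
          using norm_vec2_le[of "U w y - U w x"] by simp
        also have "\<dots> \<le> M * (G y - G x) + M * (G y - G x)"
          by (intro add_mono one[OF tau_eq_deriv1[OF _ U[OF w]]] one[OF tau_eq_deriv2[OF _ U[OF w]]] b1 b2) simp_all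
        finally show ?thesis by simp
      qed
      have Gmono: "G x \<le> G y" if "x \<le> y" "x \<in> {c..d}" "y \<in> {c..d}" for x y
      proof -
        have "0 \<le> integral {x..y} q" using that by (intro integral_nonneg qsub q0) auto
        then show ?thesis using Gdiff[OF that] by simp
      qed
      consider "x \<le> y" | "y \<le> x" by linarith
      then show ?thesis
      proof cases
        case 1
        have "norm (U w y - U w x) \<le> 2 * (M * (G y - G x))"
          using 1 by (intro main x M) (auto simp: closed_segment_eq_real_ivl)
        then show ?thesis using Gmono[OF 1 x] by (simp add: norm_minus_commute abs_minus_commute)
      next
        case 2
        have "norm (U w x - U w y) \<le> 2 * (M * (G x - G y))"
          using 2 by (intro main x M) (auto simp: closed_segment_eq_real_ivl)
        then show ?thesis using Gmono[OF 2 x(2,1)] by simp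
      qed
    qed
    have "\<exists>\<delta>>0. \<forall>w\<in>W. \<forall>x\<in>{c..d}. dist x x0 < \<delta> \<longrightarrow> norm (U w x) \<le> 2 * norm (U w x0)" if x0: "x0 \<in> {c..d}" for x0
    proof -
      \<comment> \<open>With increments of G below 1/4, \<open>est\<close> bounds |U(y) - U(x0)| by
        half of the maximum |U(y)| over the segment; absorbing this half gives the factor 2.\<close>
      obtain \<delta> where \<delta>: "\<delta> > 0" "\<And>x. x \<in> {c..d} \<Longrightarrow> dist x x0 < \<delta> \<Longrightarrow> dist (G x) (G x0) < 1 / 4"
        using contG[unfolded continuous_on_iff, rule_format, OF x0, of "1/4"] by auto
      show ?thesis
      proof (intro exI[of _ \<delta>] conjI ballI impI)
        fix w x assume w: "w \<in> W" and x: "x \<in> {c..d}" "dist x x0 < \<delta>"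
        have sub: "closed_segment x0 x \<subseteq> {c..d}" using x0 x by (intro closed_segment_subset) auto
        have "continuous_on {c..d} (U w)"
          by (rule tau_eq_continuous_on[OF U[OF w]]) (auto simp: is_interval_cc)
        then have "continuous_on (closed_segment x0 x) (\<lambda>t. norm (U w t))"
          by (intro continuous_on_norm continuous_on_subset[OF _ sub])
        then obtain y where y: "y \<in> closed_segment x0 x" "\<And>t. t \<in> closed_segment x0 x \<Longrightarrow> norm (U w t) \<le> norm (U w y)"
          using continuous_attains_sup[of "closed_segment x0 x" "\<lambda>t. norm (U w t)"] by auto
        have yc: "y \<in> {c..d}" using y(1) sub by auto
        have "dist y x0 \<le> dist x x0"
          using y(1) by (auto simp: closed_segment_eq_real_ivl dist_real_def split: if_splits)
        then have "dist (G y) (G x0) < 1 / 4" using \<delta>(2)[OF yc] x(2) by linarith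
        then have g: "\<bar>G y - G x0\<bar> \<le> 1 / 4" by (simp add: dist_real_def)
        have "norm (U w y - U w x0) \<le> 2 * (norm (U w y) * \<bar>G y - G x0\<bar>)"
        proof (rule est[OF w yc x0])
          fix t assume "t \<in> closed_segment y x0"
          then have "t \<in> closed_segment x0 x"
            using closed_segment_subset[of y "closed_segment x0 x" x0] y(1) by auto
          then show "norm (U w t) \<le> norm (U w y)" by (rule y(2))
        qed
        also have "\<dots> \<le> 2 * (norm (U w y) * (1 / 4))"
          using g by (intro mult_left_mono) auto
        finally have "norm (U w y) \<le> 2 * norm (U w x0)"
          using norm_triangle_ineq2[of "U w y" "U w x0"] by simp
        then show "norm (U w x) \<le> 2 * norm (U w x0)"
          using y(2)[of x] by simp
      qed (rule \<delta>(1))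
    qed
    then obtain \<delta> where \<delta>: "\<And>x0. x0 \<in> {c..d} \<Longrightarrow> \<delta> x0 > 0"
      "\<And>x0 w x. x0 \<in> {c..d} \<Longrightarrow> w \<in> W \<Longrightarrow> x \<in> {c..d} \<Longrightarrow> dist x x0 < \<delta> x0 \<Longrightarrow> norm (U w x) \<le> 2 * norm (U w x0)"
      by metis
    obtain B where B: "\<And>y w. y \<in> {c..d} \<Longrightarrow> w \<in> W \<Longrightarrow> norm (U w y) \<le> B y"
      using bd by metis
    obtain C where C: "C \<subseteq> {c..d}" "finite C" "{c..d} \<subseteq> (\<Union>x0\<in>C. ball x0 (\<delta> x0))"
      by (rule compactE_image[of "{c..d}" "{c..d}" "\<lambda>x0. ball x0 (\<delta> x0)"]) (use \<delta>(1) in auto)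
    have "norm (U w y) \<le> (\<Sum>x0\<in>C. 2 * \<bar>B x0\<bar>)" if w: "w \<in> W" and y: "y \<in> {c..d}" for w y
    proof -
      obtain x0 where x0: "x0 \<in> C" "y \<in> ball x0 (\<delta> x0)" using C(3) y by blast
      have x0': "x0 \<in> {c..d}" using x0(1) C(1) by auto
      have "norm (U w y) \<le> 2 * norm (U w x0)"
        using \<delta>(2)[OF x0' w y] x0(2) by (auto simp: dist_commute)
      also have "\<dots> \<le> 2 * \<bar>B x0\<bar>" using B[OF x0' w] by linarith
      also have "\<dots> \<le> (\<Sum>x0\<in>C. 2 * \<bar>B x0\<bar>)"
        by (rule member_le_sum[OF x0(1)]) (use C(2) in auto)
      finally show ?thesis .
    qed
    then show ?thesis by blast
  qed auto
qed

section \<open>Dirac operators with a real entire fundamental system\<close>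

lemma ereal_less_trans_le: "a < ereal x \<Longrightarrow> x \<le> y \<Longrightarrow> a < ereal y"
  by (rule less_le_trans) auto

lemma ereal_le_trans_less: "x \<le> y \<Longrightarrow> ereal y < b \<Longrightarrow> ereal x < b"
  by (rule le_less_trans) auto

lemma square_integrable_Un:
  assumes "square_integrable S f" "square_integrable T f" "S \<in> sets lebesgue" "T \<in> sets lebesgue"
    "f \<in> borel_measurable (lebesgue_on (S \<union> T))"
  shows "square_integrable (S \<union> T) f"
proof (rule square_integrableI)
  show "(\<lambda>x. (norm (f x))\<^sup>2) absolutely_integrable_on (S \<union> T)"
    by (rule absolutely_integrable_Un[OF square_integrableD(2)[OF assms(1,3)] square_integrableD(2)[OF assms(2,4)]])
qed (use assms in auto)

lemma left_half_sets [simp]: "left_half a c \<in> sets lebesgue"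
proof (cases "a < ereal c")
  case True
  then show ?thesis using half_interval.E_sets[OF half_interval_left] by blast
next
  case False
  then have "left_half a c = {}" unfolding left_half_def by (auto dest: ereal_less_trans_le)
  then show ?thesis by simp
qed

lemma right_half_sets [simp]: "right_half c b \<in> sets lebesgue"
proof (cases "ereal c < b")
  case True
  then show ?thesis using half_interval.E_sets[OF half_interval_right] by blast
next
  case False
  then have "right_half c b = {}" unfolding right_half_def by (auto dest: ereal_le_trans_less)
  then show ?thesis by simp
qed

lemma einterval_sets [simp]: "einterval a b \<in> sets lebesgue"
  using borel_einterval[of a b] by (simp add: sets_completionI_sets)

lemma ac_deriv_left_end:
  assumes a: "a < ereal c" and p: "ac_deriv (left_half a c) p p'" "p' absolutely_integrable_on left_half a c"
  shows "(p \<longlongrightarrow> p c - integral (left_half a c) p') (to_left_end a)"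
proof -
  interpret half_interval "left_half a c" c "to_left_end a" by (rule half_interval_left[OF a])
  \<comment> \<open>A point strictly left of c decides the case distinction in
    \<open>orient\<close>.\<close>
  obtain r where "a < ereal r" "ereal r < ereal c" using ereal_dense2[OF a] by blast
  then have "r \<in> left_half a c" "r < c" by (auto simp: left_half_def)
  then have "\<not> (\<forall>x\<in>left_half a c. c \<le> x)" by (meson linorder_not_le)
  then have "orient = - 1" unfolding orient_def by simp
  then show ?thesis using ac_deriv_tendsto[OF p] by simp
qed

lemma ac_deriv_right_end:
  assumes b: "ereal c < b" and p: "ac_deriv (right_half c b) p p'" "p' absolutely_integrable_on right_half c b"
  shows "(p \<longlongrightarrow> p c + integral (right_half c b) p') (to_right_end b)"
proof -
  interpret half_interval "right_half c b" c "to_right_end b" by (rule half_interval_right[OF b])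
  have "orient = 1" unfolding orient_def by (simp add: right_half_def)
  then show ?thesis using ac_deriv_tendsto[OF p] by simp
qed

lemma ac_deriv_0_constant:
  assumes "ac_deriv S p p'" "is_interval S" "x \<in> S" "y \<in> S" "\<And>t. t \<in> S \<Longrightarrow> p' t = 0"
  shows "p x = p y"
proof -
  have "p x = p y" if xy: "x \<le> y" "x \<in> S" "y \<in> S" for x y
  proof -
    have sub: "{x..y} \<subseteq> S" using xy assms(2) by (meson atLeastAtMost_iff is_interval_1 subsetI)
    have "integral {x..y} p' = integral {x..y} (\<lambda>t. 0)"
      by (rule Henstock_Kurzweil_Integration.integral_cong) (use sub assms(5) in auto)
    then show ?thesis using ac_derivD(2)[OF assms(1) xy(1) sub] by simp
  qed
  then show ?thesis using assms(3,4) by (cases "x \<le> y") (auto, metis linorder_linear)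
qed

lemma solution_wronskian_constant:
  fixes Q :: "real \<Rightarrow> complex^2^2"
  assumes "tau_eq Q S u (\<lambda>x. z *s u x)" "tau_eq Q S v (\<lambda>x. z *s v x)" "S \<in> sets lebesgue" "is_interval S"
    "\<And>x. x \<in> S \<Longrightarrow> Q x $ 1 $ 2 = Q x $ 2 $ 1" "x \<in> S" "y \<in> S"
  shows "wronskian u v x = wronskian u v y"
  by (rule ac_deriv_0_constant[OF ac_deriv_wronskian[OF assms(1,2,3,5)] assms(4,6,7)])
    (simp_all add: dotT_eq algebra_simps)

text \<open>The potential enters only through local integrability, reality and symmetry, so that
  both the given operator and the commuted one are instances. The boundary functions may solve the
  equation for any parameter: it is 0 for the given operator and \<lambda> for the commuted
  one.\<close>

locale dirac_pair =
  fixes D :: dirac and \<Phi> \<Theta> :: "complex \<Rightarrow> real \<Rightarrow> complex^2"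
  assumes ends: "end_left D < end_right D"
    and pot_int: "\<And>c d i j. {c..d} \<subseteq> ival D \<Longrightarrow> (\<lambda>x. pot D x $ i $ j) absolutely_integrable_on {c..d}"
    and pot_real: "\<And>x i j. x \<in> ival D \<Longrightarrow> pot D x $ i $ j \<in> \<real>"
    and pot_sym: "\<And>x. x \<in> ival D \<Longrightarrow> pot D x $ 1 $ 2 = pot D x $ 2 $ 1"
    and \<Phi>: "real_entire_solution D \<Phi>" and \<Theta>: "real_entire_solution D \<Theta>"
    and wronskian_1: "\<And>z x. x \<in> ival D \<Longrightarrow> wronskian (\<Theta> z) (\<Phi> z) x = 1"
    and near: "\<And>z. in_domain_near_left D (\<Phi> z)"
    and bc_left: "limit_circle_left D \<Longrightarrow> \<exists>z. solution (pot D) (ival D) z (bc_left D) \<and> nontrivial D (bc_left D)"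
    and bc_right: "limit_circle_right D \<Longrightarrow> \<exists>z. solution (pot D) (ival D) z (bc_right D) \<and> nontrivial D (bc_right D)"
begin

abbreviation "S \<equiv> ival D"
abbreviation "Q \<equiv> pot D"
abbreviation "a \<equiv> end_left D"
abbreviation "b \<equiv> end_right D"

lemma S_sets [simp]: "S \<in> sets lebesgue" by (simp add: ival_def)

lemma S_iff: "x \<in> S \<longleftrightarrow> a < ereal x \<and> ereal x < b" by (simp add: ival_def einterval_iff)

lemma S_interval [simp]: "is_interval S"
  unfolding is_interval_1
proof (intro ballI allI impI)
  fix p q x assume "p \<in> S" "q \<in> S" "p \<le> x \<and> x \<le> q"
  then show "x \<in> S"
    using less_le_trans[of a "ereal p" "ereal x"] le_less_trans[of "ereal x" "ereal q" b] by (simp add: S_iff)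
qed

lemma Icc_subset: "c \<in> S \<Longrightarrow> d \<in> S \<Longrightarrow> {c..d} \<subseteq> S"
  using S_interval unfolding is_interval_1 by (meson atLeastAtMost_iff subsetI)

lemma left_half_subset: "c \<in> S \<Longrightarrow> left_half a c \<subseteq> S"
  by (auto simp: left_half_def S_iff intro: ereal_le_trans_less)

lemma right_half_subset: "c \<in> S \<Longrightarrow> right_half c b \<subseteq> S"
  by (auto simp: right_half_def S_iff intro: ereal_less_trans_le)

lemma Icc_subset_left: "c \<in> S \<Longrightarrow> x \<in> left_half a c \<Longrightarrow> {x..c} \<subseteq> left_half a c"
  by (auto simp: left_half_def intro: less_le_trans[of _ "ereal x" "ereal _"])

lemma left_half_interval: "c \<in> S \<Longrightarrow> half_interval (left_half a c) c (to_left_end a)"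
  by (rule half_interval_left) (simp add: S_iff)

lemma right_half_interval: "c \<in> S \<Longrightarrow> half_interval (right_half c b) c (to_right_end b)"
  by (rule half_interval_right) (simp add: S_iff)

lemma left_half_is_interval: "c \<in> S \<Longrightarrow> is_interval (left_half a c)"
  by (rule half_interval.interval[OF left_half_interval])

lemma c_in_left_half: "c \<in> S \<Longrightarrow> c \<in> left_half a c"
  by (simp add: left_half_def S_iff)

lemma S_nonempty: "\<exists>c. c \<in> S"
  using ereal_dense2[OF ends] by (auto simp: S_iff)

lemma sol_\<Phi>: "tau_eq Q S (\<Phi> z) (\<lambda>x. z *s \<Phi> z x)" and sol_\<Theta>: "tau_eq Q S (\<Theta> z) (\<lambda>x. z *s \<Theta> z x)"
  using \<Phi> \<Theta> by (simp_all add: real_entire_solution_def solution_def)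

lemma hol_\<Phi>: "x \<in> S \<Longrightarrow> (\<lambda>z. \<Phi> z x $ i) holomorphic_on A" and hol_\<Theta>: "x \<in> S \<Longrightarrow> (\<lambda>z. \<Theta> z x $ i) holomorphic_on A"
  using \<Phi> \<Theta> holomorphic_on_subset[OF _ subset_UNIV[of A]] by (simp_all add: real_entire_solution_def)

lemma continuous_solution: "tau_eq Q S u h \<Longrightarrow> continuous_on S u"
  by (rule tau_eq_continuous_on) auto

lemma tau_eq_left: "tau_eq Q S u h \<Longrightarrow> c \<in> S \<Longrightarrow> tau_eq Q (left_half a c) u h"
  by (rule tau_eq_subset[OF _ left_half_subset]) auto

lemma tau_eq_right: "tau_eq Q S u h \<Longrightarrow> c \<in> S \<Longrightarrow> tau_eq Q (right_half c b) u h"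
  by (rule tau_eq_subset[OF _ right_half_subset]) auto

lemma solution_combination:
  "tau_eq Q S (\<lambda>x. \<alpha> *s \<Phi> z x + \<beta> *s \<Theta> z x) (\<lambda>x. z *s (\<alpha> *s \<Phi> z x + \<beta> *s \<Theta> z x))"
  by (rule tau_eq_cong[OF tau_eq_add[OF tau_eq_scale[OF sol_\<Phi>[of z] S_sets, of \<alpha>]
          tau_eq_scale[OF sol_\<Theta>[of z] S_sets, of \<beta>] S_sets]])
    (auto simp: vec2_eq_iff algebra_simps)

lemma expand: "x \<in> S \<Longrightarrow> u x = wronskian (\<Theta> z) u x *s \<Phi> z x - wronskian (\<Phi> z) u x *s \<Theta> z x"
  using wronskian_expand[of "\<Theta> z" "\<Phi> z" x u] wronskian_1[of x z] wronskian_commute[of u "\<Phi> z" x]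
  by (simp add: vec2_eq_iff)

text \<open>Plays the role of uniqueness for the initial value problem: the coefficients of u in the
  pair are Wronskians of two solutions with the same z, hence constant on T, also when u is a
  solution on T only.\<close>

lemma solution_expand:
  assumes u: "tau_eq Q T u (\<lambda>x. z *s u x)" and T: "T \<subseteq> S" "T \<in> sets lebesgue" "is_interval T" "c \<in> T"
    and x: "x \<in> T"
  shows "u x = wronskian (\<Theta> z) u c *s \<Phi> z x - wronskian (\<Phi> z) u c *s \<Theta> z x"
proof -
  have "wronskian (\<Theta> z) u x = wronskian (\<Theta> z) u c" "wronskian (\<Phi> z) u x = wronskian (\<Phi> z) u c"
    by (intro solution_wronskian_constant[OF _ u T(2,3) _ x T(4)] tau_eq_subset[OF _ T(1) S_sets T(2)]
        sol_\<Phi> sol_\<Theta>; use pot_sym T(1) in auto)+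
  then show ?thesis using expand[of x u z] x T(1) by auto
qed

text \<open>If both W(p, \<Theta>) and W(p, \<Phi>) vanished at c, the expansion of p in the pair
  would give p(c) = 0. So one of the two solutions can serve as q in
  \<open>wronskian_tendsto_0\<close>.\<close>

lemma companion:
  assumes p: "solution Q S z p" "nontrivial D p"
  shows "\<exists>q w. tau_eq Q S q (\<lambda>x. z *s q x) \<and> w \<noteq> 0 \<and> (\<forall>x\<in>S. wronskian p q x = w)"
proof -
  have p': "tau_eq Q S p (\<lambda>x. z *s p x)" using p(1) by (simp add: solution_def)
  obtain c where c: "c \<in> S" "p c \<noteq> 0" using p(2) by (auto simp: nontrivial_def)
  have const: "wronskian p q x = wronskian p q c" if "tau_eq Q S q (\<lambda>x. z *s q x)" "x \<in> S" for q x
    by (rule solution_wronskian_constant[OF p' that(1) S_sets S_interval pot_sym that(2) c(1)])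
  have "wronskian p (\<Theta> z) c \<noteq> 0 \<or> wronskian p (\<Phi> z) c \<noteq> 0"
    using expand[OF c(1), of p z] c(2) wronskian_commute[of p "\<Theta> z" c] wronskian_commute[of p "\<Phi> z" c] by auto
  then show ?thesis
    using const[OF sol_\<Theta>] const[OF sol_\<Phi>] sol_\<Theta>[of z] sol_\<Phi>[of z] by metis
qed

text \<open>Half intervals with different cut points differ by a compact interval, on which a
  continuous function is square integrable. So the existentially chosen cut point of
  \<open>square_integrable_left\<close> can be replaced by any c.\<close>

lemma square_integrable_left_iff:
  assumes f: "continuous_on (left_half a c) f" and c: "c \<in> S"
    and "c' \<in> S" "square_integrable (einterval a (ereal c')) f"
  shows "square_integrable (left_half a c) f"
proof (cases "c \<le> c'")
  case True
  have "square_integrable (left_half a c') f"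
    using assms(3,4) left_half_insert[of a c'] by (simp add: S_iff square_integrable_insert)
  then show ?thesis
    by (rule square_integrable_subset) (use True in \<open>auto simp: left_half_def\<close>)
next
  case False
  have "square_integrable {c'..c} f"
    by (rule square_integrable_continuous_Icc, rule continuous_on_subset[OF f])
      (use assms(3) in \<open>auto simp: left_half_def S_iff intro: less_le_trans[of _ "ereal c'"]\<close>)
  moreover have "einterval a (ereal c') \<union> {c'..c} = left_half a c"
    using False assms(3) by (auto simp: left_half_def S_iff einterval_def intro: less_le_trans[of _ "ereal c'"])
  moreover have "f \<in> borel_measurable (lebesgue_on (left_half a c))"
    by (rule continuous_imp_measurable_on_sets_lebesgue[OF f]) simp
  ultimately show ?thesis
    using square_integrable_Un[OF assms(4), of "{c'..c}"] by simp
qed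

lemma square_integrable_right_iff:
  assumes f: "continuous_on (right_half c b) f" and c: "c \<in> S"
    and "c' \<in> S" "square_integrable (einterval (ereal c') b) f"
  shows "square_integrable (right_half c b) f"
proof (cases "c' \<le> c")
  case True
  have "square_integrable (right_half c' b) f"
    using assms(3,4) right_half_insert[of c' b] by (simp add: S_iff square_integrable_insert)
  then show ?thesis
    by (rule square_integrable_subset) (use True in \<open>auto simp: right_half_def\<close>)
next
  case False
  have "square_integrable {c..c'} f"
    by (rule square_integrable_continuous_Icc, rule continuous_on_subset[OF f])
      (use assms(3) in \<open>auto simp: right_half_def S_iff intro: le_less_trans[of _ "ereal c'"]\<close>)
  moreover have "{c..c'} \<union> einterval (ereal c') b = right_half c b"
    using False assms(3) by (auto simp: right_half_def S_iff einterval_def intro: le_less_trans[of _ "ereal c'"])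
  moreover have "f \<in> borel_measurable (lebesgue_on (right_half c b))"
    by (rule continuous_imp_measurable_on_sets_lebesgue[OF f]) simp
  ultimately show ?thesis
    using square_integrable_Un[OF _ assms(4), of "{c..c'}"] by simp
qed

lemma square_integrable_left_half:
  assumes "square_integrable_left D u" "tau_eq Q S u h" "c \<in> S"
  shows "square_integrable (left_half a c) u"
  using assms(1) square_integrable_left_iff[OF continuous_on_subset[OF continuous_solution[OF assms(2)] left_half_subset] assms(3)] assms(3)
  by (auto simp: square_integrable_left_def)

lemma square_integrable_right_half:
  assumes "square_integrable_right D u" "tau_eq Q S u h" "c \<in> S"
  shows "square_integrable (right_half c b) u"
  using assms(1) square_integrable_right_iff[OF continuous_on_subset[OF continuous_solution[OF assms(2)] right_half_subset] assms(3)] assms(3)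
  by (auto simp: square_integrable_right_def)

lemma square_integrable_\<Phi>: "c \<in> S \<Longrightarrow> square_integrable (left_half a c) (\<Phi> z)"
  using near[of z] by (intro square_integrable_left_half[OF _ sol_\<Phi>]) (auto simp: in_domain_near_left_def)

lemma boundary_\<Phi>: "boundary_left D (\<Phi> z)"
  using near[of z] by (simp add: in_domain_near_left_def)

text \<open>The limit exists by Lagrange's identity. If it were not 0, all solutions would be square
  integrable near a, so the boundary conditions would be in force. The boundary function then has a
  square integrable companion, and the Pluecker identity yields the limit 0 after all.\<close>

lemma wronskian_left_end:
  assumes c: "c \<in> S"
    and f: "tau_eq Q (left_half a c) f h" "square_integrable (left_half a c) f" "square_integrable (left_half a c) h"
      "boundary_left D f"
    and g: "tau_eq Q (left_half a c) g k" "square_integrable (left_half a c) g" "square_integrable (left_half a c) k"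
      "boundary_left D g"
  shows "(wronskian f g \<longlongrightarrow> 0) (to_left_end a)"
proof -
  interpret E: half_interval "left_half a c" c "to_left_end a" by (rule left_half_interval[OF c])
  have sym: "Q x $ 1 $ 2 = Q x $ 2 $ 1" if "x \<in> left_half a c" for x
    using pot_sym left_half_subset[OF c] that by auto
  obtain w where w: "(wronskian f g \<longlongrightarrow> w) (to_left_end a)"
    using E.wronskian_tendsto[where Q=Q, OF sym f(1-3) g(1-3)] by blast
  show ?thesis
  proof (cases "w = 0")
    case False
    have lc: "limit_circle_left D"
      unfolding limit_circle_left_def
    proof (intro allI impI)
      fix z u assume "solution Q S z u"
      then have u: "tau_eq Q S u (\<lambda>x. z *s u x)" by (simp add: solution_def)
      have "\<exists>e'\<in>left_half a c. square_integrable (left_half a e') u"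
      proof (rule E.solutions_square_integrable_near[where Q=Q, OF sym f(1-3) g(1-3) w False tau_eq_left[OF u c]])
        show "half_interval (left_half a e') e' (to_left_end a)" if "e' \<in> left_half a c" for e'
          using that by (intro half_interval_left) (simp add: left_half_def)
        show "left_half a e' \<subseteq> {x \<in> left_half a c. e' \<in> closed_segment c x}" if "e' \<in> left_half a c" for e'
          using that by (auto simp: left_half_def closed_segment_eq_real_ivl)
      qed
      then obtain e' where e': "e' \<in> left_half a c" "square_integrable (left_half a e') u" by blast
      have "square_integrable (einterval a (ereal e')) u"
        by (rule square_integrable_subset[OF e'(2)]) (auto simp: left_half_def einterval_def)
      then show "square_integrable_left D u"
        unfolding square_integrable_left_def using e'(1) left_half_subset[OF c] by blast
    qed
    then obtain z where p: "solution Q S z (bc_left D)" "nontrivial D (bc_left D)" using bc_left by blast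
    obtain q w' where q: "tau_eq Q S q (\<lambda>x. z *s q x)" "w' \<noteq> 0" "\<And>x. x \<in> S \<Longrightarrow> wronskian (bc_left D) q x = w'"
      using companion[OF p] by blast
    have "square_integrable (left_half a c) q"
      using lc q(1) by (intro square_integrable_left_half[OF _ q(1) c]) (auto simp: limit_circle_left_def solution_def)
    then show ?thesis
      by (intro E.wronskian_tendsto_0[where Q=Q and q=q and p="bc_left D" and w=w' and l="\<lambda>x. z *s q x", OF sym f(1-3) g(1-3)]
          tau_eq_left[OF q(1) c] square_integrable_scale q)
        (use lc f(4) g(4) left_half_subset[OF c] in \<open>auto simp: boundary_left_def\<close>)
  qed (use w in simp)
qed

lemma wronskian_right_end:
  assumes c: "c \<in> S"
    and f: "tau_eq Q (right_half c b) f h" "square_integrable (right_half c b) f" "square_integrable (right_half c b) h"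
      "boundary_right D f"
    and g: "tau_eq Q (right_half c b) g k" "square_integrable (right_half c b) g" "square_integrable (right_half c b) k"
      "boundary_right D g"
  shows "(wronskian f g \<longlongrightarrow> 0) (to_right_end b)"
proof -
  interpret E: half_interval "right_half c b" c "to_right_end b" by (rule right_half_interval[OF c])
  have sym: "Q x $ 1 $ 2 = Q x $ 2 $ 1" if "x \<in> right_half c b" for x
    using pot_sym right_half_subset[OF c] that by auto
  obtain w where w: "(wronskian f g \<longlongrightarrow> w) (to_right_end b)"
    using E.wronskian_tendsto[where Q=Q, OF sym f(1-3) g(1-3)] by blast
  show ?thesis
  proof (cases "w = 0")
    case False
    have lc: "limit_circle_right D"
      unfolding limit_circle_right_def
    proof (intro allI impI)
      fix z u assume "solution Q S z u"
      then have u: "tau_eq Q S u (\<lambda>x. z *s u x)" by (simp add: solution_def)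
      have "\<exists>e'\<in>right_half c b. square_integrable (right_half e' b) u"
      proof (rule E.solutions_square_integrable_near[where Q=Q and E'="\<lambda>e'. right_half e' b", OF sym f(1-3) g(1-3) w False tau_eq_right[OF u c]])
        show "half_interval (right_half e' b) e' (to_right_end b)" if "e' \<in> right_half c b" for e'
          using that by (intro half_interval_right) (simp add: right_half_def)
        show "right_half e' b \<subseteq> {x \<in> right_half c b. e' \<in> closed_segment c x}" if "e' \<in> right_half c b" for e'
          using that by (auto simp: right_half_def closed_segment_eq_real_ivl)
      qed
      then obtain e' where e': "e' \<in> right_half c b" "square_integrable (right_half e' b) u" by blast
      have "square_integrable (einterval (ereal e') b) u"
        by (rule square_integrable_subset[OF e'(2)]) (auto simp: right_half_def einterval_def)
      then show "square_integrable_right D u"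
        unfolding square_integrable_right_def using e'(1) right_half_subset[OF c] by blast
    qed
    then obtain z where p: "solution Q S z (bc_right D)" "nontrivial D (bc_right D)" using bc_right by blast
    obtain q w' where q: "tau_eq Q S q (\<lambda>x. z *s q x)" "w' \<noteq> 0" "\<And>x. x \<in> S \<Longrightarrow> wronskian (bc_right D) q x = w'"
      using companion[OF p] by blast
    have "square_integrable (right_half c b) q"
      using lc q(1) by (intro square_integrable_right_half[OF _ q(1) c]) (auto simp: limit_circle_right_def solution_def)
    then show ?thesis
      by (intro E.wronskian_tendsto_0[where Q=Q and q=q and p="bc_right D" and w=w' and l="\<lambda>x. z *s q x", OF sym f(1-3) g(1-3)]
          tau_eq_right[OF q(1) c] square_integrable_scale q)
        (use lc f(4) g(4) right_half_subset[OF c] in \<open>auto simp: boundary_right_def\<close>)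
  qed (use w in simp)
qed

end

text \<open>The Schwarz reflection of f from the upper half plane is entire and equals f above the
  axis, hence everywhere.\<close>

lemma entire_cnj:
  assumes f: "f holomorphic_on UNIV" and r: "\<And>w. w \<in> \<real> \<Longrightarrow> f w \<in> \<real>"
  shows "f (cnj z) = cnj (f z)"
proof -
  let ?g = "\<lambda>z. if 0 \<le> Im z then f z else cnj (f (cnj z))"
  have g: "?g holomorphic_on UNIV"
    by (rule Schwarz_reflection)
      (use f r in \<open>auto intro: holomorphic_on_subset holomorphic_on_imp_continuous_on\<close>)
  have eq: "?g w = f w" for w
  proof (rule analytic_continuation_open[of "{z. 0 < Im z}" UNIV ?g f])
    show "{z. 0 < Im z} \<noteq> {}" using zero_less_one by (auto intro: exI[of _ \<i>])
  qed (use f g in \<open>auto simp: open_halfspace_Im_gt\<close>)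
  consider "Im z > 0" | "Im z < 0" | "Im z = 0" by linarith
  then show ?thesis
  proof cases
    case 1 then show ?thesis using eq[of "cnj z"] by simp
  next
    case 2 then show ?thesis using arg_cong[OF eq[of z], of cnj] by simp
  next
    case 3
    then have "z \<in> \<real>" by (simp add: complex_is_Real_iff)
    then show ?thesis using r[of z] Reals_cnj_iff by metis
  qed
qed

lemma entire_Lipschitz:
  assumes f: "f holomorphic_on UNIV"
  shows "\<exists>L. \<forall>x y. norm x \<le> R \<longrightarrow> norm y \<le> R \<longrightarrow> norm (f x - f y) \<le> L * norm (x - y)"
proof -
  have "continuous_on (cball 0 R) (deriv f)"
    by (intro holomorphic_on_imp_continuous_on holomorphic_on_subset[OF holomorphic_deriv[OF f]]) auto
  from compact_imp_bounded[OF compact_continuous_image[OF this compact_cball]]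
  obtain L where L: "\<And>x. x \<in> cball 0 R \<Longrightarrow> norm (deriv f x) \<le> L" unfolding bounded_iff by blast
  have "norm (f x - f y) \<le> L * norm (x - y)" if "norm x \<le> R" "norm y \<le> R" for x y
    by (rule field_differentiable_bound[of "cball 0 R" f "deriv f"])
      (use that L holomorphic_derivI[OF f open_UNIV] in auto)
  then show ?thesis by blast
qed

section \<open>The entire solution \<Phi> near the left end: norms as Wronskians\<close>

context dirac_pair
begin

text \<open>The boundary term at the left end drops out by Weyl's alternative.\<close>

lemma wronskian_\<Phi>_left:
  assumes c: "c \<in> S"
    and f: "tau_eq Q (left_half a c) f h" "square_integrable (left_half a c) f" "square_integrable (left_half a c) h"
      "boundary_left D f"
  shows "wronskian (\<Phi> z) f c = integral (left_half a c) (\<lambda>x. z * dotT (\<Phi> z x) (f x) - dotT (\<Phi> z x) (h x))"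
proof -
  have a: "a < ereal c" using c by (simp add: S_iff)
  note si = square_integrable_\<Phi>[OF c, of z]
  have "(wronskian (\<Phi> z) f \<longlongrightarrow> 0) (to_left_end a)"
    by (rule wronskian_left_end[OF c tau_eq_left[OF sol_\<Phi> c] si square_integrable_scale[OF si] boundary_\<Phi> f]) simp
  moreover have "(wronskian (\<Phi> z) f \<longlongrightarrow> wronskian (\<Phi> z) f c -
      integral (left_half a c) (\<lambda>x. dotT (z *s \<Phi> z x) (f x) - dotT (\<Phi> z x) (h x))) (to_left_end a)"
  proof (rule ac_deriv_left_end[OF a ac_deriv_wronskian[OF tau_eq_left[OF sol_\<Phi> c] f(1)]])
    show "Q x $ 1 $ 2 = Q x $ 2 $ 1" if "x \<in> left_half a c" for x
      using that left_half_subset[OF c] pot_sym by auto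
    show "(\<lambda>x. dotT (z *s \<Phi> z x) (f x) - dotT (\<Phi> z x) (h x)) absolutely_integrable_on left_half a c"
      by (intro set_integral_diff absolutely_integrable_dotT square_integrable_scale si f) simp_all
  qed simp
  ultimately have "0 = wronskian (\<Phi> z) f c -
      integral (left_half a c) (\<lambda>x. dotT (z *s \<Phi> z x) (f x) - dotT (\<Phi> z x) (h x))"
    by (rule tendsto_unique[OF to_left_end_neq_bot[OF a]])
  moreover have "dotT (z *s \<Phi> z x) (f x) = z * dotT (\<Phi> z x) (f x)" for x
    by (simp add: dotT_eq algebra_simps)
  ultimately show ?thesis by simp
qed

lemma dotT_\<Phi>_integrable: "c \<in> S \<Longrightarrow> (\<lambda>x. dotT (\<Phi> z x) (\<Phi> w x)) absolutely_integrable_on left_half a c"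
  by (intro absolutely_integrable_dotT square_integrable_\<Phi>) simp_all

text \<open>In the bilinear product the two spectral terms combine to the factor z - w. The identity
  expresses integrals up to the singular end through entire functions at the single point c; their
  analytic dependence on the parameter comes from here.\<close>

lemma wronskian_\<Phi>_\<Phi>:
  assumes c: "c \<in> S"
  shows "wronskian (\<Phi> z) (\<Phi> w) c = (z - w) * integral (left_half a c) (\<lambda>x. dotT (\<Phi> z x) (\<Phi> w x))"
proof -
  have "wronskian (\<Phi> z) (\<Phi> w) c =
      integral (left_half a c) (\<lambda>x. z * dotT (\<Phi> z x) (\<Phi> w x) - dotT (\<Phi> z x) (w *s \<Phi> w x))"
    by (intro wronskian_\<Phi>_left[OF c tau_eq_left[OF sol_\<Phi> c]] square_integrable_\<Phi> square_integrable_scale boundary_\<Phi> c) simp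
  also have "(\<lambda>x. z * dotT (\<Phi> z x) (\<Phi> w x) - dotT (\<Phi> z x) (w *s \<Phi> w x)) = (\<lambda>x. (z - w) * dotT (\<Phi> z x) (\<Phi> w x))"
    by (simp add: fun_eq_iff dotT_eq algebra_simps)
  finally show ?thesis by simp
qed

lemma real_on_reals: "x \<in> S \<Longrightarrow> w \<in> \<real> \<Longrightarrow> \<Phi> w x $ i \<in> \<real>" "x \<in> S \<Longrightarrow> w \<in> \<real> \<Longrightarrow> \<Theta> w x $ i \<in> \<real>"
  using \<Phi> \<Theta> by (auto simp: real_entire_solution_def real_valued_def)

lemma \<Phi>_cnj: "x \<in> S \<Longrightarrow> \<Phi> (cnj z) x $ i = cnj (\<Phi> z x $ i)"
  by (rule entire_cnj[OF hol_\<Phi>]) (auto intro: real_on_reals)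

lemma \<Phi>_bounded:
  assumes "d \<in> S" "c \<in> S" "compact W"
  shows "\<exists>B. \<forall>w\<in>W. \<forall>x\<in>{d..c}. norm (\<Phi> w x) \<le> B"
    and "\<exists>B. \<forall>w\<in>W. \<forall>x\<in>{d..c}. norm (\<Theta> w x) \<le> B"
proof -
  have sub: "{d..c} \<subseteq> S" by (rule Icc_subset[OF assms(1,2)])
  obtain R where R: "\<And>w. w \<in> W \<Longrightarrow> norm w \<le> R"
    using compact_imp_bounded[OF assms(3)] unfolding bounded_iff by blast
  have bd: "\<exists>B. \<forall>w\<in>W. norm (U w y) \<le> B"
    if "\<And>i. (\<lambda>w. U w y $ i) holomorphic_on UNIV" for U :: "complex \<Rightarrow> real \<Rightarrow> complex^2" and y
  proof -
    have "continuous_on W (\<lambda>w. \<chi> i. U w y $ i)"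
      by (intro continuous_on_vec_lambda holomorphic_on_imp_continuous_on holomorphic_on_subset[OF that]) simp
    then have "continuous_on W (\<lambda>w. U w y)" by simp
    from compact_imp_bounded[OF compact_continuous_image[OF this assms(3)]]
    show ?thesis unfolding bounded_iff by auto
  qed
  show "\<exists>B. \<forall>w\<in>W. \<forall>x\<in>{d..c}. norm (\<Phi> w x) \<le> B"
    by (rule solution_family_bounded[where Q=Q and z="\<lambda>w. w" and R=R])
      (use sub in \<open>auto intro: pot_int R bd[OF hol_\<Phi>] tau_eq_subset[OF sol_\<Phi> sub]\<close>)
  show "\<exists>B. \<forall>w\<in>W. \<forall>x\<in>{d..c}. norm (\<Theta> w x) \<le> B"
    by (rule solution_family_bounded[where Q=Q and z="\<lambda>w. w" and R=R])
      (use sub in \<open>auto intro: pot_int R bd[OF hol_\<Theta>] tau_eq_subset[OF sol_\<Theta> sub]\<close>)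
qed

lemma norm_sq_eq_dotT_cnj: "x \<in> S \<Longrightarrow> complex_of_real ((norm (\<Phi> z x))\<^sup>2) = dotT (\<Phi> (cnj z) x) (\<Phi> z x)"
  by (simp add: norm_vec2 dotT_eq \<Phi>_cnj complex_norm_square mult.commute del: of_real_power of_real_add)
    (simp add: complex_norm_square[symmetric] mult.commute)

lemma integral_of_real_complex:
  fixes k :: "real \<Rightarrow> real"
  assumes "k integrable_on T"
  shows "integral T (\<lambda>x. complex_of_real (k x)) = complex_of_real (integral T k)"
  using integral_linear[OF assms bounded_linear_of_real] by (simp add: o_def)

text \<open>Since \<Phi> is real on the real axis, \<Phi>(cnj z) is the conjugate of \<Phi>(z), and
  the bilinear integral in \<open>wronskian_\<Phi>_\<Phi>\<close> becomes a squared norm.\<close>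

lemma integral_norm_\<Phi>:
  assumes c: "c \<in> S"
  shows "wronskian (\<Phi> (cnj z)) (\<Phi> z) c = (cnj z - z) * complex_of_real (integral (left_half a c) (\<lambda>x. (norm (\<Phi> z x))\<^sup>2))"
proof -
  have "integral (left_half a c) (\<lambda>x. dotT (\<Phi> (cnj z) x) (\<Phi> z x)) =
      integral (left_half a c) (\<lambda>x. complex_of_real ((norm (\<Phi> z x))\<^sup>2))"
    by (rule Henstock_Kurzweil_Integration.integral_cong)
      (use norm_sq_eq_dotT_cnj left_half_subset[OF c] in auto)
  also have "\<dots> = complex_of_real (integral (left_half a c) (\<lambda>x. (norm (\<Phi> z x))\<^sup>2))"
    by (rule integral_of_real_complex[OF square_integrableD(3)[OF square_integrable_\<Phi>[OF c]]]) simp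
  finally show ?thesis using wronskian_\<Phi>_\<Phi>[OF c, of "cnj z" z] by simp
qed

lemma \<Phi>_nonzero: "x \<in> S \<Longrightarrow> \<Phi> z x \<noteq> 0"
  using wronskian_1[of x z] by (auto simp: wronskian_def)

lemma integral_norm_\<Phi>_pos:
  assumes c: "c \<in> S"
  shows "0 < integral (left_half a c) (\<lambda>x. (norm (\<Phi> z x))\<^sup>2)"
proof -
  obtain d where d: "a < ereal d" "ereal d < ereal c" using ereal_dense2[of a "ereal c"] c by (auto simp: S_iff)
  then have dS: "d \<in> S" "d < c" using c by (auto simp: S_iff intro: ereal_le_trans_less[of d c])
  have sub: "{d..c} \<subseteq> S" by (rule Icc_subset[OF dS(1) c])
  have sub': "{d..c} \<subseteq> left_half a c" using d by (auto simp: left_half_def intro: ereal_less_trans_le)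
  have cont: "continuous_on {d..c} (\<lambda>x. (norm (\<Phi> z x))\<^sup>2)"
    by (intro continuous_intros continuous_on_subset[OF continuous_solution[OF sol_\<Phi>] sub])
  have i: "(\<lambda>x. (norm (\<Phi> z x))\<^sup>2) integrable_on {d..c}" by (rule integrable_continuous_real[OF cont])
  have "0 \<le> integral {d..c} (\<lambda>x. (norm (\<Phi> z x))\<^sup>2)" by (rule integral_nonneg[OF i]) simp
  moreover have "integral {d..c} (\<lambda>x. (norm (\<Phi> z x))\<^sup>2) \<noteq> 0"
    using integral_eq_0_iff[OF cont] dS sub \<Phi>_nonzero by force
  moreover have "integral {d..c} (\<lambda>x. (norm (\<Phi> z x))\<^sup>2) \<le> integral (left_half a c) (\<lambda>x. (norm (\<Phi> z x))\<^sup>2)"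
    by (rule integral_subset_le[OF sub' i square_integrableD(3)[OF square_integrable_\<Phi>[OF c]]]) auto
  ultimately show ?thesis by linarith
qed

text \<open>A nonreal zero would be a nonreal eigenvalue of the Dirichlet restriction: the Wronskian
  of \<Phi>(cnj z) and \<Phi>(z) would vanish at c, although it is cnj z - z times a positive
  number.\<close>

lemma \<Phi>1_nonzero:
  assumes c: "c \<in> S" and z: "z \<notin> \<real>"
  shows "\<Phi> z c $ 1 \<noteq> 0"
proof
  assume 0: "\<Phi> z c $ 1 = 0"
  then have "\<Phi> (cnj z) c $ 1 = 0" by (simp add: \<Phi>_cnj[OF c])
  with 0 have "wronskian (\<Phi> (cnj z)) (\<Phi> z) c = 0" by (simp add: wronskian_def)
  then have "cnj z = z" using integral_norm_\<Phi>[OF c, of z] integral_norm_\<Phi>_pos[OF c, of z] by simp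
  then show False using z by (metis Reals_cnj_iff)
qed

text \<open>
  Off the real axis the norm of \<open>\<Phi>\<close> is a difference quotient of an entire function, hence bounded
  near real points.
\<close>

lemma integral_norm_\<Phi>_bounded:
  assumes c: "c \<in> S"
  shows "\<exists>B. \<forall>w. norm w \<le> R \<and> w \<notin> \<real> \<longrightarrow> integral (left_half a c) (\<lambda>x. (norm (\<Phi> w x))\<^sup>2) \<le> B"
proof -
  obtain L1 where L1: "\<And>x y. norm x \<le> R \<Longrightarrow> norm y \<le> R \<Longrightarrow> norm (\<Phi> x c $ 1 - \<Phi> y c $ 1) \<le> L1 * norm (x - y)"
    using entire_Lipschitz[OF hol_\<Phi>[OF c], of R 1] by blast
  obtain L2 where L2: "\<And>x y. norm x \<le> R \<Longrightarrow> norm y \<le> R \<Longrightarrow> norm (\<Phi> x c $ 2 - \<Phi> y c $ 2) \<le> L2 * norm (x - y)"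
    using entire_Lipschitz[OF hol_\<Phi>[OF c], of R 2] by blast
  obtain B where B: "\<And>w. norm w \<le> R \<Longrightarrow> norm (\<Phi> w c) \<le> B"
    using \<Phi>_bounded(1)[OF c c compact_cball[of 0 R]] by (metis atLeastAtMost_singleton mem_cball_0 singletonI)
  have "integral (left_half a c) (\<lambda>x. (norm (\<Phi> w x))\<^sup>2) \<le> (L1 + L2) * B" if w: "norm w \<le> R" "w \<notin> \<real>" for w
  proof -
    let ?I = "integral (left_half a c) (\<lambda>x. (norm (\<Phi> w x))\<^sup>2)"
    have ne: "norm (cnj w - w) > 0" using w(2) by (auto simp: Reals_cnj_iff)
    have I: "?I > 0" by (rule integral_norm_\<Phi>_pos[OF c])
    have n: "norm (cnj w) \<le> R" using w by simp
    have "norm (cnj w - w) * ?I = norm (wronskian (\<Phi> (cnj w)) (\<Phi> w) c)"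
      using I unfolding integral_norm_\<Phi>[OF c] norm_mult norm_of_real by simp
    \<comment> \<open>Subtracting \<Phi>(w), which has Wronskian 0 with itself, exposes an increment
      of the entire map w -> \<Phi>(w, c). Its Lipschitz bound supplies the factor |cnj w - w| that
      cancels.\<close>
    also have "wronskian (\<Phi> (cnj w)) (\<Phi> w) c = wronskian (\<lambda>x. \<Phi> (cnj w) x - \<Phi> w x) (\<Phi> w) c"
      by (simp add: wronskian_def algebra_simps)
    also have "norm \<dots> \<le> norm (\<Phi> (cnj w) c - \<Phi> w c) * norm (\<Phi> w c)"
      by (rule norm_wronskian_le)
    also have "\<dots> \<le> ((L1 + L2) * norm (cnj w - w)) * B"
    proof (rule mult_mono)
      have "norm (\<Phi> (cnj w) c - \<Phi> w c) \<le> L1 * norm (cnj w - w) + L2 * norm (cnj w - w)"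
        using norm_vec2_le[of "\<Phi> (cnj w) c - \<Phi> w c"] L1[OF n w(1)] L2[OF n w(1)] by simp
      then show le: "norm (\<Phi> (cnj w) c - \<Phi> w c) \<le> (L1 + L2) * norm (cnj w - w)"
        by (simp add: algebra_simps)
      show "0 \<le> (L1 + L2) * norm (cnj w - w)" using order_trans[OF norm_ge_zero le] .
    qed (use B[OF w(1)] in auto)
    finally have "norm (cnj w - w) * ?I \<le> norm (cnj w - w) * ((L1 + L2) * B)" by (simp add: mult_ac)
    then show ?thesis using ne by simp
  qed
  then show ?thesis by blast
qed

lemma integral_left_split:
  fixes k :: "real \<Rightarrow> 'a::euclidean_space"
  assumes c: "c \<in> S" and d: "d \<in> left_half a c" and k: "k absolutely_integrable_on left_half a c"
  shows "integral (left_half a c) k = integral (left_half a d) k + integral {d..c} k"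
proof -
  have dc: "d \<le> c" "a < ereal d" using d by (auto simp: left_half_def)
  have U: "left_half a d \<union> {d..c} = left_half a c"
    using dc by (auto simp: left_half_def intro: ereal_less_trans_le)
  have "k integrable_on left_half a d" "k integrable_on {d..c}"
    using set_integrable_subset[OF k, of "left_half a d"] set_integrable_subset[OF k, of "{d..c}"] U
    by (auto simp: absolutely_integrable_on_def)
  moreover have "left_half a d \<inter> {d..c} = {d}" using dc by (auto simp: left_half_def)
  ultimately show ?thesis using integral_Un[of k "left_half a d" "{d..c}"] U by simp
qed

lemma integral_left_tendsto_0:
  fixes k :: "real \<Rightarrow> 'a::euclidean_space"
  assumes c: "c \<in> S" and k: "k absolutely_integrable_on left_half a c"
  shows "((\<lambda>d. integral (left_half a d) k) \<longlongrightarrow> 0) (to_left_end a)"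
proof -
  interpret half_interval "left_half a c" c "to_left_end a" by (rule left_half_interval[OF c])
  have "((\<lambda>d. integral (left_half a c) k - integral (closed_segment c d) k) \<longlongrightarrow>
      integral (left_half a c) k - integral (left_half a c) k) (to_left_end a)"
    by (intro tendsto_intros integral_segment_tendsto k)
  moreover have "\<forall>\<^sub>F d in to_left_end a. integral (left_half a c) k - integral (closed_segment c d) k
      = integral (left_half a d) k"
    using eventually_in
  proof (rule eventually_mono)
    fix d assume d: "d \<in> left_half a c"
    then have "closed_segment c d = {d..c}" by (auto simp: closed_segment_eq_real_ivl left_half_def)
    then show "integral (left_half a c) k - integral (closed_segment c d) k = integral (left_half a d) k"
      using integral_left_split[OF c d k] by simp
  qed
  ultimately show ?thesis by (simp add: Lim_transform_eventually)
qed

text \<open>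
  The norm bound off the real axis turns pointwise convergence into weak convergence along
  \<open>l + \<i> / n\<close>, which identifies the value at the removable singularity.
\<close>

lemma deriv_wronskian_\<Phi>:
  assumes c: "c \<in> S" and l: "l \<in> \<real>"
  shows "((\<lambda>z. wronskian (\<Phi> l) (\<Phi> z) c) has_field_derivative
      - integral (left_half a c) (\<lambda>x. dotT (\<Phi> l x) (\<Phi> l x))) (at l)"
proof -
  let ?A = "\<lambda>z. wronskian (\<Phi> l) (\<Phi> z) c"
  let ?J = "\<lambda>z. integral (left_half a c) (\<lambda>x. dotT (\<Phi> l x) (\<Phi> z x))"
  define e where "e n = inverse (real (Suc n))" for n
  have e: "e n > 0" "e n \<le> 1" for n by (auto simp: e_def inverse_le_1_iff)
  have elim: "e \<longlonglongrightarrow> 0" unfolding e_def[abs_def] by (rule LIMSEQ_inverse_real_of_nat)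
  define zs where "zs n = l + \<i> * complex_of_real (e n)" for n
  have "?A holomorphic_on UNIV"
    unfolding wronskian_def by (intro holomorphic_intros hol_\<Phi> c)
  from holomorphic_derivI[OF this open_UNIV]
  have der: "(?A has_field_derivative deriv ?A l) (at l)" by simp
  have zl: "zs n \<noteq> l" for n using e(1)[of n] by (simp add: zs_def)
  have znr: "zs n \<notin> \<real>" for n using l e(1)[of n] by (auto simp: zs_def complex_is_Real_iff)
  have zlim: "zs \<longlonglongrightarrow> l"
  proof -
    have "zs \<longlonglongrightarrow> l + \<i> * complex_of_real 0"
      unfolding zs_def by (intro tendsto_intros tendsto_of_real elim)
    then show ?thesis by simp
  qed
  have zb: "norm (zs n) \<le> norm l + 1" for n
  proof -
    have "norm (zs n) \<le> norm l + e n"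
      unfolding zs_def using e(1)[of n] by (intro order_trans[OF norm_triangle_ineq]) (simp add: norm_mult)
    then show ?thesis using e(2)[of n] by simp
  qed
  have A0: "?A l = 0" by simp
  have q: "(\<lambda>n. - ?J (zs n)) \<longlonglongrightarrow> deriv ?A l"
  proof -
    have "((\<lambda>z. (?A z - ?A l) / (z - l)) \<longlongrightarrow> deriv ?A l) (at l)"
      using der by (simp add: has_field_derivative_iff)
    moreover have "filterlim zs (at l) sequentially"
      using zlim zl by (intro filterlim_atI) auto
    ultimately have "(\<lambda>n. (?A (zs n) - ?A l) / (zs n - l)) \<longlonglongrightarrow> deriv ?A l"
      by (rule filterlim_compose)
    moreover have "(?A (zs n) - ?A l) / (zs n - l) = - ?J (zs n)" for n
      using zl[of n] wronskian_\<Phi>_\<Phi>[OF c, of l "zs n"] by (simp add: field_simps)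
    ultimately show ?thesis by simp
  qed
  obtain B where B: "\<And>w. norm w \<le> norm l + 1 \<Longrightarrow> w \<notin> \<real> \<Longrightarrow> integral (left_half a c) (\<lambda>x. (norm (\<Phi> w x))\<^sup>2) \<le> B"
    using integral_norm_\<Phi>_bounded[OF c] by meson
  let ?N = "\<lambda>d w. integral (left_half a d) (\<lambda>x. (norm (\<Phi> w x))\<^sup>2)"
  have tail: "norm (integral (left_half a d) (\<lambda>x. dotT (\<Phi> l x) (\<Phi> w x))) \<le> sqrt (?N d l) * sqrt (?N c w)"
    if d: "d \<in> left_half a c" for d w
  proof -
    have dS: "d \<in> S" using left_half_subset[OF c] d by auto
    have "?N d w \<le> ?N c w"
      using d by (intro integral_subset_le square_integrableD(3) square_integrable_\<Phi> dS c)
        (auto simp: left_half_def)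
    then have "sqrt (?N d l) * sqrt (?N d w) \<le> sqrt (?N d l) * sqrt (?N c w)"
      using integral_norm_\<Phi>_pos[OF dS, of l] by (intro mult_left_mono real_sqrt_le_mono) auto
    then show ?thesis
      using integral_dotT_Cauchy_Schwarz[OF square_integrable_\<Phi>[OF dS, of l] square_integrable_\<Phi>[OF dS, of w]] by simp
  qed
  have lim: "(\<lambda>n. ?J (zs n)) \<longlonglongrightarrow> ?J l"
  proof (rule LIMSEQ_I)
    fix \<epsilon> :: real assume \<epsilon>: "\<epsilon> > 0"
    \<comment> \<open>Covers both tails beyond d at once: that of \<Phi>(zs n), whose norm is at
      most sqrt B, and that of \<Phi>(l) itself.\<close>
    define K where "K = sqrt B + sqrt (?N c l)"
    have "((\<lambda>d. sqrt (?N d l) * K) \<longlongrightarrow> sqrt 0 * K) (to_left_end a)"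
      by (intro tendsto_intros integral_left_tendsto_0[OF c] square_integrableD(2) square_integrable_\<Phi> c) simp
    then have "\<forall>\<^sub>F d in to_left_end a. sqrt (?N d l) * K < \<epsilon> / 2"
      by (rule order_tendstoD) (use \<epsilon> in simp)
    then have "\<exists>d\<in>left_half a c. \<forall>x\<in>left_half a c. d \<in> closed_segment c x \<longrightarrow> sqrt (?N x l) * K < \<epsilon> / 2"
      by (rule half_interval.eventually_near[OF left_half_interval[OF c]])
    then obtain d where d: "d \<in> left_half a c" "sqrt (?N d l) * K < \<epsilon> / 2" by auto
    have dS: "d \<in> S" using left_half_subset[OF c] d by auto
    have sub: "{d..c} \<subseteq> left_half a c" by (rule Icc_subset_left[OF c d(1)])
    have subS: "{d..c} \<subseteq> S" by (rule Icc_subset[OF dS c])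
    let ?I = "\<lambda>z. integral {d..c} (\<lambda>x. dotT (\<Phi> l x) (\<Phi> z x))"
    have ii: "(\<lambda>x. dotT (\<Phi> l x) (\<Phi> z x)) integrable_on {d..c}" for z
      using set_integrable_subset[OF dotT_\<Phi>_integrable[OF c, of l z] _ sub] by (simp add: absolutely_integrable_on_def)
    obtain B' where B': "\<And>w x. norm w \<le> norm l + 1 \<Longrightarrow> x \<in> {d..c} \<Longrightarrow> norm (\<Phi> w x) \<le> B'"
      using \<Phi>_bounded(1)[OF dS c compact_cball[of 0 "norm l + 1"]] by (metis mem_cball_0)
    have "(\<lambda>n. ?I (zs n)) \<longlonglongrightarrow> ?I l"
    proof (rule dominated_convergence(2)[where h="\<lambda>x. B' * B'"])
      fix n x assume x: "x \<in> {d..c}"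
      have "norm (\<Phi> l x) * norm (\<Phi> (zs n) x) \<le> B' * B'"
        by (intro mult_mono B' x zb) (use order_trans[OF norm_ge_zero B'[of l x]] x in auto)
      then show "norm (dotT (\<Phi> l x) (\<Phi> (zs n) x)) \<le> B' * B'"
        using norm_dotT_le order_trans by blast
    next
      fix x assume x: "x \<in> {d..c}"
      have "(\<lambda>n. \<Phi> (zs n) x $ i) \<longlonglongrightarrow> \<Phi> l x $ i" for i
      proof -
        have "isCont (\<lambda>z. \<Phi> z x $ i) l"
          using holomorphic_on_imp_continuous_on[OF hol_\<Phi>[of x i UNIV]] x subS
          by (auto simp: continuous_on_eq_continuous_at)
        from isCont_tendsto_compose[OF this zlim] show ?thesis .
      qed
      then show "(\<lambda>n. dotT (\<Phi> l x) (\<Phi> (zs n) x)) \<longlonglongrightarrow> dotT (\<Phi> l x) (\<Phi> l x)"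
        unfolding dotT_eq by (intro tendsto_add tendsto_mult tendsto_const)
    qed (auto intro: ii)
    then obtain N where N: "\<And>n. n \<ge> N \<Longrightarrow> norm (?I (zs n) - ?I l) < \<epsilon> / 2"
      using LIMSEQ_D[of "\<lambda>n. ?I (zs n)" "?I l" "\<epsilon> / 2"] \<epsilon> by (metis half_gt_zero)
    show "\<exists>N. \<forall>n\<ge>N. norm (?J (zs n) - ?J l) < \<epsilon>"
    proof (intro exI[of _ N] allI impI)
      fix n assume n: "n \<ge> N"
      let ?t = "\<lambda>w. integral (left_half a d) (\<lambda>x. dotT (\<Phi> l x) (\<Phi> w x))"
      have s: "?J w = ?t w + ?I w" for w by (rule integral_left_split[OF c d(1) dotT_\<Phi>_integrable[OF c]])
      have eq: "?J (zs n) - ?J l = (?I (zs n) - ?I l) + (?t (zs n) - ?t l)" unfolding s by simp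
      have "norm (?J (zs n) - ?J l) \<le> norm (?I (zs n) - ?I l) + (norm (?t (zs n)) + norm (?t l))"
        unfolding eq using norm_triangle_ineq[of "?I (zs n) - ?I l" "?t (zs n) - ?t l"] norm_triangle_ineq4[of "?t (zs n)" "?t l"]
        by linarith
      moreover have "norm (?t (zs n)) \<le> sqrt (?N d l) * sqrt B"
        using integral_norm_\<Phi>_pos[OF dS, of l] B[OF zb znr]
        by (intro order_trans[OF tail[OF d(1)]] mult_left_mono real_sqrt_le_mono) auto
      moreover have "norm (?t l) \<le> sqrt (?N d l) * sqrt (?N c l)" by (rule tail[OF d(1)])
      moreover have "sqrt (?N d l) * K = sqrt (?N d l) * sqrt B + sqrt (?N d l) * sqrt (?N c l)"
        by (simp add: K_def algebra_simps)
      ultimately show "norm (?J (zs n) - ?J l) < \<epsilon>" using N[OF n] d(2) by linarith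
    qed
  qed
  have "deriv ?A l = - ?J l"
    by (rule LIMSEQ_unique[OF q tendsto_minus[OF lim]])
  with der show ?thesis by simp
qed

end

section \<open>Parameter integrals and complex conjugation\<close>

text \<open>Differentiation under the integral sign. Cauchy's estimate converts the bound Bd on k
  into the bound Bd / \<rho> on its w-derivative near w0, hence on the difference quotients, and
  dominated convergence applies along every sequence tending to w0.\<close>

lemma holomorphic_integral:
  fixes k :: "complex \<Rightarrow> real \<Rightarrow> complex"
  assumes U: "open U" and int: "\<And>w. w \<in> U \<Longrightarrow> k w integrable_on T"
    and hol: "\<And>y. y \<in> T \<Longrightarrow> (\<lambda>w. k w y) holomorphic_on U"
    and Bd: "Bd integrable_on T" "\<And>w y. w \<in> U \<Longrightarrow> y \<in> T \<Longrightarrow> norm (k w y) \<le> Bd y"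
  shows "(\<lambda>w. integral T (k w)) holomorphic_on U"
proof -
  have "(\<lambda>w. integral T (k w)) field_differentiable at w0" if w0: "w0 \<in> U" for w0
  proof -
    obtain e where e: "e > 0" "cball w0 e \<subseteq> U" using U w0 open_contains_cball by blast
    \<comment> \<open>Half of e, so that closed discs of radius \<rho> centred in the \<rho>-ball
      about w0 stay inside U and Cauchy's estimate is available at every such centre.\<close>
    define \<rho> where "\<rho> = e / 2"
    have \<rho>: "\<rho> > 0" using e(1) by (simp add: \<rho>_def)
    have bU: "ball w0 \<rho> \<subseteq> U" using e by (auto simp: \<rho>_def)
    have cU: "cball v \<rho> \<subseteq> U" if "v \<in> ball w0 \<rho>" for v
    proof
      fix u assume "u \<in> cball v \<rho>"
      then have "dist w0 u \<le> e" using that dist_triangle[of w0 u v] by (simp add: \<rho>_def)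
      then show "u \<in> U" using e(2) by auto
    qed
    let ?d = "\<lambda>y. deriv (\<lambda>w. k w y)"
    have der: "((\<lambda>w. k w y) has_field_derivative ?d y v) (at v)" if "y \<in> T" "v \<in> U" for y v
      by (rule holomorphic_derivI[OF hol[OF that(1)] U that(2)])
    have dB: "norm (?d y v) \<le> Bd y / \<rho>" if "y \<in> T" "v \<in> ball w0 \<rho>" for y v
    proof -
      have "norm ((deriv ^^ 1) (\<lambda>w. k w y) v) \<le> fact 1 * Bd y / \<rho> ^ 1"
      proof (rule Cauchy_inequality)
        show "(\<lambda>w. k w y) holomorphic_on ball v \<rho>"
          by (rule holomorphic_on_subset[OF hol[OF that(1)]]) (use cU[OF that(2)] in auto)
        show "continuous_on (cball v \<rho>) (\<lambda>w. k w y)"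
          by (intro holomorphic_on_imp_continuous_on holomorphic_on_subset[OF hol[OF that(1)]] cU that)
        show "norm (k x y) \<le> Bd y" if "norm (v - x) = \<rho>" for x
          using cU[OF \<open>v \<in> ball w0 \<rho>\<close>] that \<open>y \<in> T\<close> by (intro Bd(2)) (auto simp: dist_norm)
      qed (rule \<rho>)
      then show ?thesis by simp
    qed
    have Lip: "norm (k v y - k w0 y) \<le> Bd y / \<rho> * norm (v - w0)" if "y \<in> T" "v \<in> ball w0 \<rho>" for y v
    proof (rule field_differentiable_bound[of "ball w0 \<rho>" _ "?d y"])
      show "((\<lambda>w. k w y) has_field_derivative ?d y z) (at z within ball w0 \<rho>)" if "z \<in> ball w0 \<rho>" for z
        by (rule has_field_derivative_at_within, rule der[OF \<open>y \<in> T\<close>]) (use that bU in auto)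
      show "norm (?d y z) \<le> Bd y / \<rho>" if "z \<in> ball w0 \<rho>" for z
        by (rule dB[OF \<open>y \<in> T\<close> that])
      show "v \<in> ball w0 \<rho>" by (rule that(2))
      show "w0 \<in> ball w0 \<rho>" using \<rho> by simp
    qed simp
    have "((\<lambda>v. (integral T (k v) - integral T (k w0)) / (v - w0)) \<longlongrightarrow> integral T (\<lambda>y. ?d y w0)) (at w0 within ball w0 \<rho>)"
      unfolding tendsto_at_iff_sequentially
    proof (intro allI impI)
      fix X :: "nat \<Rightarrow> complex" assume X: "\<forall>i. X i \<in> ball w0 \<rho> - {w0}" "X \<longlonglongrightarrow> w0"
      have XU: "X n \<in> U" for n using X(1) bU by auto
      let ?q = "\<lambda>n y. (k (X n) y - k w0 y) / (X n - w0)"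
      have qi: "?q n integrable_on T" for n
        using int[OF XU[of n]] int[OF w0] by (intro integrable_on_divide integrable_diff)
      have "(\<lambda>n. integral T (?q n)) \<longlonglongrightarrow> integral T (\<lambda>y. ?d y w0)"
      proof (rule dominated_convergence(2)[where h="\<lambda>y. Bd y / \<rho>"])
        show "?q n integrable_on T" for n by (rule qi)
        show "(\<lambda>y. Bd y / \<rho>) integrable_on T" using Bd(1) by (rule integrable_on_divide)
        show "norm (?q n y) \<le> Bd y / \<rho>" if "y \<in> T" for n y
        proof -
          have ne: "norm (X n - w0) > 0" using X(1) by auto
          have "norm (k (X n) y - k w0 y) \<le> Bd y / \<rho> * norm (X n - w0)"
            using Lip[OF that] X(1) by auto
          then show ?thesis using ne by (simp add: norm_divide divide_le_eq)
        qed
        show "(\<lambda>n. ?q n y) \<longlonglongrightarrow> ?d y w0" if "y \<in> T" for y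
        proof -
          have "((\<lambda>v. (k v y - k w0 y) / (v - w0)) \<longlongrightarrow> ?d y w0) (at w0)"
            using der[OF that w0] by (simp add: has_field_derivative_iff)
          moreover have "filterlim X (at w0) sequentially"
            using X by (intro filterlim_atI) auto
          ultimately show ?thesis by (rule filterlim_compose)
        qed
      qed
      moreover have "integral T (\<lambda>y. k (X n) y - k w0 y) = integral T (k (X n)) - integral T (k w0)" for n
        by (rule integral_diff[OF int[OF XU] int[OF w0]])
      ultimately show "((\<lambda>v. (integral T (k v) - integral T (k w0)) / (v - w0)) \<circ> X) \<longlonglongrightarrow> integral T (\<lambda>y. ?d y w0)"
        by (simp add: o_def)
    qed
    then have "((\<lambda>w. integral T (k w)) has_field_derivative integral T (\<lambda>y. ?d y w0)) (at w0 within ball w0 \<rho>)"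
      by (simp add: has_field_derivative_iff)
    moreover have "at w0 within ball w0 \<rho> = at w0" using \<rho> by (intro at_within_open) auto
    ultimately show ?thesis unfolding field_differentiable_def by auto
  qed
  then show ?thesis
    unfolding holomorphic_on_def by (blast intro: field_differentiable_at_within)
qed

text \<open>Minkowski's inequality.\<close>

lemma integral_norm_add_sqrt:
  assumes "square_integrable T f" "square_integrable T g" "T \<in> sets lebesgue"
  shows "sqrt (integral T (\<lambda>x. (norm (f x + g x))\<^sup>2))
    \<le> sqrt (integral T (\<lambda>x. (norm (f x))\<^sup>2)) + sqrt (integral T (\<lambda>x. (norm (g x))\<^sup>2))"
proof -
  note F = square_integrableD[OF assms(1,3)] and G = square_integrableD[OF assms(2,3)]
  let ?F = "integral T (\<lambda>x. (norm (f x))\<^sup>2)" and ?G = "integral T (\<lambda>x. (norm (g x))\<^sup>2)"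
  have i: "(\<lambda>x. norm (f x) * norm (g x)) integrable_on T"
    using absolutely_integrable_norm_mult[OF assms] by (simp add: absolutely_integrable_on_def)
  have pos: "0 \<le> ?F" "0 \<le> ?G" using F(3) G(3) by (auto intro: integral_nonneg)
  have "integral T (\<lambda>x. (norm (f x + g x))\<^sup>2)
      \<le> integral T (\<lambda>x. (norm (f x))\<^sup>2 + 2 * (norm (f x) * norm (g x)) + (norm (g x))\<^sup>2)"
  proof (rule integral_le[OF square_integrableD(3)[OF square_integrable_add[OF assms] assms(3)]])
    show "(\<lambda>x. (norm (f x))\<^sup>2 + 2 * (norm (f x) * norm (g x)) + (norm (g x))\<^sup>2) integrable_on T"
      by (intro integrable_add integrable_on_mult_right F(3) G(3) i)
    fix x
    have "(norm (f x + g x))\<^sup>2 \<le> (norm (f x) + norm (g x))\<^sup>2"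
      by (intro power_mono norm_triangle_ineq) simp
    then show "(norm (f x + g x))\<^sup>2 \<le> (norm (f x))\<^sup>2 + 2 * (norm (f x) * norm (g x)) + (norm (g x))\<^sup>2"
      by (simp add: power2_sum algebra_simps)
  qed
  also have "\<dots> = ?F + 2 * integral T (\<lambda>x. norm (f x) * norm (g x)) + ?G"
    by (simp add: integral_add integrable_add integrable_on_mult_right F(3) G(3) i)
  also have "\<dots> \<le> ?F + 2 * (sqrt ?F * sqrt ?G) + ?G"
    using integral_Cauchy_Schwarz[OF assms] by simp
  also have "\<dots> = (sqrt ?F + sqrt ?G)\<^sup>2"
    using pos by (simp add: power2_sum)
  finally show ?thesis
    using pos by (intro real_le_lsqrt) auto
qed

definition vcnj :: "complex^2 \<Rightarrow> complex^2" where
  "vcnj v = (\<chi> i. cnj (v $ i))"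

lemma vcnj_nth [simp]: "vcnj v $ i = cnj (v $ i)" by (simp add: vcnj_def)

lemma norm_vcnj [simp]: "norm (vcnj v) = norm v" by (simp add: norm_vec_def)

lemma dotT_vcnj: "dotT (vcnj v) v = complex_of_real ((norm v)\<^sup>2)"
  unfolding dotT_eq norm_vec2 of_real_add vcnj_nth
  by (simp only: complex_norm_square mult.commute)

lemma continuous_on_vcnj [continuous_intros]: "continuous_on T f \<Longrightarrow> continuous_on T (\<lambda>x. vcnj (f x))"
  unfolding vcnj_def by (intro continuous_intros)

lemma ac_deriv_cnj:
  assumes "ac_deriv T f f'"
  shows "ac_deriv T (\<lambda>x. cnj (f x)) (\<lambda>x. cnj (f' x))"
  unfolding ac_deriv_def
proof (intro allI impI)
  fix c d :: real assume *: "c \<le> d \<and> {c..d} \<subseteq> T"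
  note F = ac_derivD[OF assms, of c d]
  have "f' integrable_on {c..d}" using F(1) * by (simp add: absolutely_integrable_on_def)
  from integral_linear[OF this bounded_linear_cnj]
  have "integral {c..d} (\<lambda>x. cnj (f' x)) = cnj (integral {c..d} f')" by (simp add: o_def)
  moreover have "(\<lambda>x. cnj (f' x)) absolutely_integrable_on {c..d}"
    using absolutely_integrable_linear[OF F(1) bounded_linear_cnj] * by (simp add: o_def)
  ultimately show "(\<lambda>x. cnj (f' x)) absolutely_integrable_on {c..d} \<and>
      cnj (f d) = cnj (f c) + integral {c..d} (\<lambda>x. cnj (f' x))"
    using F(2) * by simp
qed

lemma tau_eq_vcnj:
  fixes Q :: "real \<Rightarrow> complex^2^2"
  assumes f: "tau_eq Q T f h" and T: "T \<in> sets lebesgue" and Q: "\<And>x i j. x \<in> T \<Longrightarrow> Q x $ i $ j \<in> \<real>"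
  shows "tau_eq Q T (\<lambda>x. vcnj (f x)) (\<lambda>x. vcnj (h x))"
proof -
  have r: "cnj (Q x $ i $ j) = Q x $ i $ j" if "x \<in> T" for x i j
    using Q[OF that] by (simp add: Reals_cnj_iff)
  show ?thesis
    unfolding tau_eq_iff[OF T]
    by (intro conjI; rule ac_deriv_cong[OF ac_deriv_cnj[OF tau_eq_deriv1[OF T f]]]
        ac_deriv_cong[OF ac_deriv_cnj[OF tau_eq_deriv2[OF T f]]]) (simp_all add: r)
qed

section \<open>Green's function and discreteness of the spectrum\<close>

context dirac_pair
begin

text \<open>The solution obeying the Dirichlet condition at c, normalised to W(\<Phi>,
  \<open>chi\<close>) = 1. Where \<Phi>_1(z, c) = 0 the quotient is 0 by convention and
  \<open>chi\<close> is -\<Theta>, so the differential equation and the normalisation persist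
  there.\<close>

definition chi :: "real \<Rightarrow> complex \<Rightarrow> real \<Rightarrow> complex^2" where
  "chi c z x = (\<Theta> z c $ 1 / \<Phi> z c $ 1) *s \<Phi> z x - \<Theta> z x"

text \<open>Variation of constants for the Dirichlet restriction: \<Phi> carries the condition at a
  and \<open>chi\<close> the one at c. The products are bilinear, without conjugation, so the kernel
  is analytic in z off the zeros of \<Phi>_1(z, c).\<close>

definition green :: "real \<Rightarrow> complex \<Rightarrow> (real \<Rightarrow> complex^2) \<Rightarrow> real \<Rightarrow> complex^2" where
  "green c z g x = - integral {x..c} (\<lambda>y. dotT (chi c z y) (g y)) *s \<Phi> z x
     - integral (left_half a x) (\<lambda>y. dotT (\<Phi> z y) (g y)) *s chi c z x"

lemma sol_chi: "tau_eq Q S (chi c z) (\<lambda>x. z *s chi c z x)"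
  by (rule tau_eq_cong[OF solution_combination[of "\<Theta> z c $ 1 / \<Phi> z c $ 1" z "- 1"]])
    (auto simp: chi_def vec2_eq_iff algebra_simps)

lemma chi_c: "\<Phi> z c $ 1 \<noteq> 0 \<Longrightarrow> chi c z c $ 1 = 0"
  by (simp add: chi_def)

lemma wronskian_\<Phi>_chi: "x \<in> S \<Longrightarrow> wronskian (\<Phi> z) (chi c z) x = 1"
  using wronskian_1[of x z] by (simp add: chi_def wronskian_def algebra_simps)

lemma green_c: "\<Phi> z c $ 1 \<noteq> 0 \<Longrightarrow> green c z g c $ 1 = 0"
  by (simp add: green_def chi_c)

lemma square_integrable_Icc:
  "c \<in> S \<Longrightarrow> x \<in> left_half a c \<Longrightarrow> square_integrable (left_half a c) g \<Longrightarrow> square_integrable {x..c} g"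
  by (rule square_integrable_subset[OF _ Icc_subset_left]) auto

lemma square_integrable_left_sub:
  "x \<in> left_half a c \<Longrightarrow> square_integrable (left_half a c) g \<Longrightarrow> square_integrable (left_half a x) g"
  by (rule square_integrable_subset) (auto simp: left_half_def)

lemma in_left_half_S: "c \<in> S \<Longrightarrow> x \<in> left_half a c \<Longrightarrow> x \<in> S"
  using left_half_subset by auto

lemma square_integrable_solution_Icc:
  "tau_eq Q S u h \<Longrightarrow> {x..c} \<subseteq> S \<Longrightarrow> square_integrable {x..c} u"
  by (intro square_integrable_continuous_Icc continuous_on_subset[OF continuous_solution])

text \<open>In the expansion of f by \<Phi> and \<open>chi\<close> the coefficients are Wronskians,
  and each is integrated from the end where it vanishes: W(\<Phi>, f) from a, where both obey the
  boundary condition, and W(\<open>chi\<close>, f) from c, where both first components are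
  0.\<close>

lemma eq_green:
  assumes c: "c \<in> S" and nz: "\<Phi> z c $ 1 \<noteq> 0"
    and f: "tau_eq Q (left_half a c) f h" "square_integrable (left_half a c) f" "square_integrable (left_half a c) h"
      "boundary_left D f" "f c $ 1 = 0" and x: "x \<in> left_half a c"
  shows "f x = green c z (\<lambda>y. h y - z *s f y) x"
proof -
  have xS: "x \<in> S" by (rule in_left_half_S[OF c x])
  have sub: "left_half a x \<subseteq> left_half a c" using x by (auto simp: left_half_def)
  have xc: "x \<le> c" using x by (simp add: left_half_def)
  have subI: "{x..c} \<subseteq> left_half a c" by (rule Icc_subset_left[OF c x])
  have subS: "{x..c} \<subseteq> S" by (rule Icc_subset[OF xS c])
  have w1: "wronskian (\<Phi> z) f x = - integral (left_half a x) (\<lambda>y. dotT (\<Phi> z y) (h y - z *s f y))"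
  proof -
    have "wronskian (\<Phi> z) f x = integral (left_half a x) (\<lambda>y. z * dotT (\<Phi> z y) (f y) - dotT (\<Phi> z y) (h y))"
      by (intro wronskian_\<Phi>_left[OF xS] tau_eq_subset[OF f(1) sub] square_integrable_left_sub[OF x] f) simp_all
    also have "\<dots> = integral (left_half a x) (\<lambda>y. - dotT (\<Phi> z y) (h y - z *s f y))"
      by (simp add: dotT_eq algebra_simps)
    finally show ?thesis by simp
  qed
  have w2: "wronskian (chi c z) f x = integral {x..c} (\<lambda>y. dotT (chi c z y) (h y - z *s f y))"
  proof -
    have "ac_deriv {x..c} (wronskian (chi c z) f) (\<lambda>y. dotT (z *s chi c z y) (f y) - dotT (chi c z y) (h y))"
      by (rule ac_deriv_wronskian[OF tau_eq_subset[OF sol_chi subS] tau_eq_subset[OF f(1) subI]])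
        (use subS pot_sym in auto)
    from ac_derivD(2)[OF this xc order_refl]
    have "wronskian (chi c z) f c = wronskian (chi c z) f x +
        integral {x..c} (\<lambda>y. dotT (z *s chi c z y) (f y) - dotT (chi c z y) (h y))" .
    moreover have "wronskian (chi c z) f c = 0" using chi_c[OF nz] f(5) by (simp add: wronskian_def)
    ultimately have "wronskian (chi c z) f x = - integral {x..c} (\<lambda>y. dotT (z *s chi c z y) (f y) - dotT (chi c z y) (h y))"
      by (simp add: eq_neg_iff_add_eq_0)
    also have "\<dots> = integral {x..c} (\<lambda>y. - (dotT (z *s chi c z y) (f y) - dotT (chi c z y) (h y)))"
      by (simp only: Henstock_Kurzweil_Integration.integral_neg)
    also have "\<dots> = integral {x..c} (\<lambda>y. dotT (chi c z y) (h y - z *s f y))"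
      by (simp add: dotT_eq algebra_simps)
    finally show ?thesis .
  qed
  have "f x = wronskian f (chi c z) x *s \<Phi> z x + wronskian (\<Phi> z) f x *s chi c z x"
    using wronskian_expand[of "\<Phi> z" "chi c z" x f] wronskian_\<Phi>_chi[OF xS, of z c] by simp
  then show ?thesis
    unfolding green_def w1 wronskian_commute[of f "chi c z" x] w2 by (simp add: vec2_eq_iff)
qed

lemma ac_deriv_lower_integral:
  assumes c: "c \<in> S" and k: "\<And>x. x \<in> left_half a c \<Longrightarrow> k absolutely_integrable_on {x..c}"
  shows "ac_deriv (left_half a c) (\<lambda>x. integral {x..c} k) (\<lambda>x. - k x)"
  unfolding ac_deriv_def
proof (intro allI impI)
  fix x y assume xy: "x \<le> y \<and> {x..y} \<subseteq> left_half a c"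
  then have x: "x \<in> left_half a c" and y: "y \<le> c" by (auto simp: left_half_def)
  have "k absolutely_integrable_on {x..y}"
    by (rule set_integrable_subset[OF k[OF x]]) (use y in auto)
  then have "(\<lambda>x. - k x) absolutely_integrable_on {x..y}"
    using set_integrable_mult_right[of "- 1" lebesgue "{x..y}" k] by simp
  moreover have "integral {x..y} k + integral {y..c} k = integral {x..c} k"
    using k[OF x] xy y by (intro Henstock_Kurzweil_Integration.integral_combine) (auto simp: absolutely_integrable_on_def)
  ultimately show "(\<lambda>x. - k x) absolutely_integrable_on {x..y} \<and>
      integral {y..c} k = integral {x..c} k + integral {x..y} (\<lambda>x. - k x)"
    by (auto simp: algebra_simps)
qed

lemma ac_deriv_upper_integral:
  assumes c: "c \<in> S" and k: "k absolutely_integrable_on left_half a c"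
  shows "ac_deriv (left_half a c) (\<lambda>x. integral (left_half a x) k) k"
  unfolding ac_deriv_def
proof (intro allI impI)
  fix x y assume xy: "x \<le> y \<and> {x..y} \<subseteq> left_half a c"
  then have x: "x \<in> left_half a y" and y: "y \<in> left_half a c" by (auto simp: left_half_def)
  have ky: "k absolutely_integrable_on left_half a y"
    by (rule set_integrable_subset[OF k]) (use y in \<open>auto simp: left_half_def\<close>)
  have "k absolutely_integrable_on {x..y}"
    by (rule set_integrable_subset[OF k]) (use xy in auto)
  then show "k absolutely_integrable_on {x..y} \<and>
      integral (left_half a y) k = integral (left_half a x) k + integral {x..y} k"
    using integral_left_split[OF in_left_half_S[OF c y] x ky] by simp
qed

lemma tau_eq_green:
  assumes c: "c \<in> S" and g: "square_integrable (left_half a c) g"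
  shows "tau_eq Q (left_half a c) (green c z g) (\<lambda>x. z *s green c z g x + g x)"
proof -
  let ?A = "\<lambda>x. integral {x..c} (\<lambda>y. dotT (chi c z y) (g y))"
  let ?B = "\<lambda>x. integral (left_half a x) (\<lambda>y. dotT (\<Phi> z y) (g y))"
  have A: "ac_deriv (left_half a c) ?A (\<lambda>x. - dotT (chi c z x) (g x))"
    by (rule ac_deriv_lower_integral[OF c], intro absolutely_integrable_dotT square_integrable_solution_Icc[OF sol_chi]
        square_integrable_Icc[OF c _ g] Icc_subset in_left_half_S[OF c] c) simp_all
  have B: "ac_deriv (left_half a c) ?B (\<lambda>x. dotT (\<Phi> z x) (g x))"
    by (intro ac_deriv_upper_integral[OF c] absolutely_integrable_dotT square_integrable_\<Phi> c g) simp
  show ?thesis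
  proof (rule tau_eq_cong[OF tau_eq_add[OF tau_eq_scale_ac[OF tau_eq_left[OF sol_\<Phi>[of z] c] ac_deriv_scale[OF A, of "-1"]]
          tau_eq_scale_ac[OF tau_eq_left[OF sol_chi[of c z] c] ac_deriv_scale[OF B, of "-1"]]]])
    fix x assume "x \<in> left_half a c"
    then have W: "\<Phi> z x $ 1 * chi c z x $ 2 - \<Phi> z x $ 2 * chi c z x $ 1 = 1"
      using wronskian_\<Phi>_chi[OF in_left_half_S[OF c], of x z c] by (simp add: wronskian_def)
    \<comment> \<open>Differentiating the two integrals leaves terms in g without integrals;
      W(\<Phi>, \<open>chi\<close>) = 1 makes them add up to g, checked here in each
      component.\<close>
    have e1: "dotT (chi c z x) (g x) * (- \<Phi> z x $ 2) - dotT (\<Phi> z x) (g x) * (- chi c z x $ 2) = g x $ 1"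
      using arg_cong[OF W, of "\<lambda>t. t * g x $ 1"] by (simp add: dotT_eq algebra_simps)
    have e2: "dotT (chi c z x) (g x) * \<Phi> z x $ 1 - dotT (\<Phi> z x) (g x) * chi c z x $ 1 = g x $ 2"
      using arg_cong[OF W, of "\<lambda>t. t * g x $ 2"] by (simp add: dotT_eq algebra_simps)
    show "(- 1 * ?A x) *s (z *s \<Phi> z x) + (- 1 * - dotT (chi c z x) (g x)) *s vector [- \<Phi> z x $ 2, \<Phi> z x $ 1] +
        ((- 1 * ?B x) *s (z *s chi c z x) + (- 1 * dotT (\<Phi> z x) (g x)) *s vector [- chi c z x $ 2, chi c z x $ 1])
        = z *s green c z g x + g x"
      unfolding vec2_eq_iff green_def vector_add_component vector_smult_component vector_minus_component
        vector_2 e1[symmetric] e2[symmetric] by (simp add: algebra_simps)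
    show "(- 1 * ?A x) *s \<Phi> z x + (- 1 * ?B x) *s chi c z x = green c z g x"
      by (simp add: green_def vec2_eq_iff)
  qed simp_all
qed

text \<open>In the limit circle case \<open>chi\<close> is square integrable near a as well. So the
  coefficient of \<Phi> stays finite and multiplies a Wronskian that tends to 0, while the
  coefficient of \<open>chi\<close> tends to 0 and multiplies a convergent Wronskian.\<close>

lemma boundary_green:
  assumes c: "c \<in> S" and g: "square_integrable (left_half a c) g"
  shows "boundary_left D (green c z g)"
  unfolding boundary_left_def
proof
  assume lc: "limit_circle_left D"
  interpret E: half_interval "left_half a c" c "to_left_end a" by (rule left_half_interval[OF c])
  let ?A = "\<lambda>x. integral {x..c} (\<lambda>y. dotT (chi c z y) (g y))"
  let ?B = "\<lambda>x. integral (left_half a x) (\<lambda>y. dotT (\<Phi> z y) (g y))"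
  let ?bc = "dirac.bc_left D"
  obtain z0 where p: "tau_eq Q S ?bc (\<lambda>x. z0 *s ?bc x)"
    using bc_left[OF lc] by (auto simp: solution_def)
  have L2: "square_integrable (left_half a c) u" if "tau_eq Q S u (\<lambda>x. w *s u x)" for u w
    using lc that by (intro square_integrable_left_half[OF _ that c]) (auto simp: limit_circle_left_def solution_def)
  have sym: "Q x $ 1 $ 2 = Q x $ 2 $ 1" if "x \<in> left_half a c" for x
    using pot_sym left_half_subset[OF c] that by auto
  obtain w1 where w1: "(wronskian ?bc (chi c z) \<longlongrightarrow> w1) (to_left_end a)"
    using E.wronskian_tendsto[where Q=Q, OF sym tau_eq_left[OF p c] L2[OF p] square_integrable_scale[OF L2[OF p] E.E_sets]
        tau_eq_left[OF sol_chi c] L2[OF sol_chi] square_integrable_scale[OF L2[OF sol_chi] E.E_sets]] by blast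
  have w2: "(wronskian ?bc (\<Phi> z) \<longlongrightarrow> 0) (to_left_end a)"
    using boundary_\<Phi>[of z] lc by (simp add: boundary_left_def)
  have B: "(?B \<longlongrightarrow> 0) (to_left_end a)"
    by (intro integral_left_tendsto_0[OF c] absolutely_integrable_dotT square_integrable_\<Phi> c g) simp
  have "((\<lambda>x. integral (closed_segment c x) (\<lambda>y. dotT (chi c z y) (g y))) \<longlongrightarrow>
      integral (left_half a c) (\<lambda>y. dotT (chi c z y) (g y))) (to_left_end a)"
    by (intro E.integral_segment_tendsto absolutely_integrable_dotT L2[OF sol_chi] g) simp
  moreover have "\<forall>\<^sub>F x in to_left_end a. integral (closed_segment c x) (\<lambda>y. dotT (chi c z y) (g y)) = ?A x"
    using E.eventually_in by (rule eventually_mono) (auto simp: closed_segment_eq_real_ivl left_half_def)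
  ultimately have A: "(?A \<longlongrightarrow> integral (left_half a c) (\<lambda>y. dotT (chi c z y) (g y))) (to_left_end a)"
    by (rule Lim_transform_eventually)
  have "((\<lambda>x. - ?A x * wronskian ?bc (\<Phi> z) x - ?B x * wronskian ?bc (chi c z) x) \<longlongrightarrow>
      - integral (left_half a c) (\<lambda>y. dotT (chi c z y) (g y)) * 0 - 0 * w1) (to_left_end a)"
    by (intro tendsto_intros A B w1 w2)
  moreover have "- ?A x * wronskian ?bc (\<Phi> z) x - ?B x * wronskian ?bc (chi c z) x = wronskian ?bc (green c z g) x" for x
    by (simp add: wronskian_def green_def algebra_simps)
  ultimately show "(wronskian ?bc (green c z g) \<longlongrightarrow> 0) (to_left_end a)" by simp
qed

text \<open>The resolvent estimate of a symmetric operator, from Lagrange's identity for f and its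
  conjugate on \<open>{d..c}\<close>. The term at c vanishes by the Dirichlet condition. Left of d
  the data g is 0 and f is a multiple \<kappa> of \<Phi>, so the term at d is cnj w - w times
  |\<kappa>|^2 P; it adds to the squared norm of f with the same sign and may be dropped.\<close>

lemma green_bound_nonreal:
  assumes c: "c \<in> S" and w: "w \<notin> \<real>" and d: "d \<in> left_half a c"
    and g: "square_integrable (left_half a c) g" "\<And>x. x \<le> d \<Longrightarrow> g x = 0"
  shows "\<bar>Im w\<bar> * sqrt (integral {d..c} (\<lambda>x. (norm (green c w g x))\<^sup>2)) \<le> sqrt (integral {d..c} (\<lambda>x. (norm (g x))\<^sup>2))"
proof -
  let ?f = "green c w g"
  define \<kappa> where "\<kappa> = - integral {d..c} (\<lambda>y. dotT (chi c w y) (g y))"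
  define P where "P = integral (left_half a d) (\<lambda>x. (norm (\<Phi> w x))\<^sup>2)"
  define N where "N = integral {d..c} (\<lambda>x. (norm (?f x))\<^sup>2)"
  define G where "G = integral {d..c} (\<lambda>x. (norm (g x))\<^sup>2)"
  have dS: "d \<in> S" by (rule in_left_half_S[OF c d])
  have dc: "d \<le> c" using d by (simp add: left_half_def)
  have sub: "{d..c} \<subseteq> left_half a c" by (rule Icc_subset_left[OF c d])
  have subS: "{d..c} \<subseteq> S" by (rule Icc_subset[OF dS c])
  have f: "tau_eq Q {d..c} ?f (\<lambda>x. w *s ?f x + g x)"
    by (rule tau_eq_subset[OF tau_eq_green[OF c g(1)] sub]) simp_all
  have fb: "tau_eq Q {d..c} (\<lambda>x. vcnj (?f x)) (\<lambda>x. vcnj (w *s ?f x + g x))"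
    by (rule tau_eq_vcnj[OF f]) (use subS pot_real in auto)
  have fi: "square_integrable {d..c} ?f"
    by (intro square_integrable_continuous_Icc tau_eq_continuous_on[OF f]) (auto simp: is_interval_cc)
  have gi: "square_integrable {d..c} g" by (rule square_integrable_Icc[OF c d g(1)])
  have Ppos: "P > 0" unfolding P_def by (rule integral_norm_\<Phi>_pos[OF dS])
  have "ac_deriv {d..c} (wronskian (\<lambda>x. vcnj (?f x)) ?f)
      (\<lambda>x. dotT (vcnj (w *s ?f x + g x)) (?f x) - dotT (vcnj (?f x)) (w *s ?f x + g x))"
    by (rule ac_deriv_wronskian[OF fb f]) (use subS pot_sym in auto)
  from ac_derivD(2)[OF this dc order_refl]
  have eq: "wronskian (\<lambda>x. vcnj (?f x)) ?f c = wronskian (\<lambda>x. vcnj (?f x)) ?f d +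
      integral {d..c} (\<lambda>x. dotT (vcnj (w *s ?f x + g x)) (?f x) - dotT (vcnj (?f x)) (w *s ?f x + g x))" .
  have Wc: "wronskian (\<lambda>x. vcnj (?f x)) ?f c = 0"
    using green_c[OF \<Phi>1_nonzero[OF c w]] by (simp add: wronskian_def)
  have fd: "?f d = \<kappa> *s \<Phi> w d"
  proof -
    have "integral (left_half a d) (\<lambda>y. dotT (\<Phi> w y) (g y)) = integral (left_half a d) (\<lambda>y. 0)"
      by (rule Henstock_Kurzweil_Integration.integral_cong) (simp add: g(2) left_half_def dotT_eq)
    then show ?thesis by (simp add: green_def \<kappa>_def)
  qed
  have Wd: "wronskian (\<lambda>x. vcnj (?f x)) ?f d = complex_of_real ((norm \<kappa>)\<^sup>2) * ((cnj w - w) * complex_of_real P)"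
  proof -
    have "wronskian (\<lambda>x. vcnj (?f x)) ?f d = (\<kappa> * cnj \<kappa>) * wronskian (\<Phi> (cnj w)) (\<Phi> w) d"
      by (simp add: wronskian_def fd \<Phi>_cnj[OF dS] algebra_simps)
    then show ?thesis unfolding integral_norm_\<Phi>[OF dS] P_def complex_norm_square by simp
  qed
  let ?X = "\<lambda>x. dotT (vcnj (g x)) (?f x) - dotT (vcnj (?f x)) (g x)"
  have vi: "square_integrable {d..c} (\<lambda>x. vcnj (?f x))"
    by (intro square_integrable_continuous_Icc tau_eq_continuous_on[OF fb]) (auto simp: is_interval_cc)
  have "(\<lambda>x. cnj (dotT (vcnj (?f x)) (g x))) absolutely_integrable_on {d..c}"
    using absolutely_integrable_linear[OF absolutely_integrable_dotT[OF vi gi] bounded_linear_cnj] by (simp add: o_def)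
  moreover have "cnj (dotT (vcnj (?f x)) (g x)) = dotT (vcnj (g x)) (?f x)" for x
    by (simp add: dotT_eq)
  ultimately have g1: "(\<lambda>x. dotT (vcnj (g x)) (?f x)) absolutely_integrable_on {d..c}" by simp
  have Xi: "?X integrable_on {d..c}"
    using set_integral_diff(1)[OF g1 absolutely_integrable_dotT[OF vi gi]] by (simp add: absolutely_integrable_on_def)
  have "integral {d..c} (\<lambda>x. dotT (vcnj (w *s ?f x + g x)) (?f x) - dotT (vcnj (?f x)) (w *s ?f x + g x))
      = integral {d..c} (\<lambda>x. (cnj w - w) * complex_of_real ((norm (?f x))\<^sup>2) + ?X x)"
    unfolding dotT_vcnj[symmetric] by (simp add: dotT_eq algebra_simps)
  also have "\<dots> = (cnj w - w) * complex_of_real N + integral {d..c} ?X"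
  proof -
    have i: "(\<lambda>x. complex_of_real ((norm (?f x))\<^sup>2)) integrable_on {d..c}"
      using integrable_linear[OF square_integrableD(3)[OF fi] bounded_linear_of_real] by (simp add: o_def)
    have "integral {d..c} (\<lambda>x. complex_of_real ((norm (?f x))\<^sup>2)) = complex_of_real N"
      unfolding N_def by (rule integral_of_real_complex[OF square_integrableD(3)[OF fi]]) simp
    then show ?thesis
      by (simp only: integral_add[OF integrable_on_mult_right[OF i] Xi] integral_mult_right)
  qed
  finally have "(w - cnj w) * (complex_of_real ((norm \<kappa>)\<^sup>2) * complex_of_real P + complex_of_real N) = integral {d..c} ?X"
    using eq unfolding Wc Wd by (simp add: algebra_simps)
  then have "norm (integral {d..c} ?X) = norm (w - cnj w) * norm (complex_of_real ((norm \<kappa>)\<^sup>2 * P + N))"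
    unfolding norm_mult[symmetric] by simp
  also have "norm (w - cnj w) = 2 * \<bar>Im w\<bar>"
    by (simp add: complex_diff_cnj norm_mult)
  finally have X: "norm (integral {d..c} ?X) = 2 * \<bar>Im w\<bar> * \<bar>(norm \<kappa>)\<^sup>2 * P + N\<bar>"
    by (simp only: norm_of_real)
  have N0: "N \<ge> 0" and G0: "G \<ge> 0"
    unfolding N_def G_def by (auto intro!: integral_nonneg square_integrableD(3) fi gi)
  have "norm (integral {d..c} ?X) \<le> integral {d..c} (\<lambda>x. 2 * (norm (?f x) * norm (g x)))"
  proof (rule integral_norm_bound_integral[OF Xi])
    show "(\<lambda>x. 2 * (norm (?f x) * norm (g x))) integrable_on {d..c}"
      using absolutely_integrable_norm_mult[OF fi gi]
      by (intro integrable_on_mult_right) (simp add: absolutely_integrable_on_def)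
    fix x
    have "norm (?X x) \<le> norm (vcnj (g x)) * norm (?f x) + norm (vcnj (?f x)) * norm (g x)"
      by (intro order_trans[OF norm_triangle_ineq4] add_mono norm_dotT_le)
    then show "norm (?X x) \<le> 2 * (norm (?f x) * norm (g x))" by (simp add: algebra_simps)
  qed
  also have "\<dots> \<le> 2 * (sqrt N * sqrt G)"
    using integral_Cauchy_Schwarz[OF fi gi] by (simp add: N_def G_def)
  finally have "2 * \<bar>Im w\<bar> * N \<le> 2 * (sqrt N * sqrt G)"
    unfolding X using Ppos N0 mult_left_mono[of N "\<bar>(norm \<kappa>)\<^sup>2 * P + N\<bar>" "2 * \<bar>Im w\<bar>"] by simp
  moreover have "sqrt N * (\<bar>Im w\<bar> * sqrt N) = \<bar>Im w\<bar> * N"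
    using N0 by (metis abs_of_nonneg mult.commute mult.left_commute real_sqrt_abs2 real_sqrt_mult)
  ultimately have "sqrt N * (\<bar>Im w\<bar> * sqrt N) \<le> sqrt N * sqrt G" by linarith
  then show ?thesis
    using N0 G0 unfolding N_def[symmetric] G_def[symmetric] by (cases "N = 0") auto
qed

lemma hol_dotT:
  assumes "\<And>i. (\<lambda>w. u w $ i) holomorphic_on A"
  shows "(\<lambda>w. dotT v (u w)) holomorphic_on A" "(\<lambda>w. dotT (u w) v) holomorphic_on A"
  unfolding dotT_eq by (intro holomorphic_intros assms)+

lemma hol_chi:
  assumes "c \<in> S" "x \<in> S" "\<And>w. w \<in> A \<Longrightarrow> \<Phi> w c $ 1 \<noteq> 0"
  shows "(\<lambda>w. chi c w x $ i) holomorphic_on A"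
  unfolding chi_def vector_minus_component vector_smult_component
  by (intro holomorphic_intros hol_\<Phi> hol_\<Theta> assms)

lemma chi_bounded:
  assumes d: "d \<in> S" and c: "c \<in> S" and W: "compact W" "\<And>w. w \<in> W \<Longrightarrow> \<Phi> w c $ 1 \<noteq> 0"
  shows "\<exists>B. \<forall>w\<in>W. \<forall>x\<in>{d..c}. norm (chi c w x) \<le> B"
proof -
  have sub: "{d..c} \<subseteq> S" by (rule Icc_subset[OF d c])
  obtain R where R: "\<And>w. w \<in> W \<Longrightarrow> norm w \<le> R"
    using compact_imp_bounded[OF W(1)] unfolding bounded_iff by blast
  have bd: "\<exists>B. \<forall>w\<in>W. norm (chi c w y) \<le> B" if "y \<in> S" for y
  proof -
    have "continuous_on W (\<lambda>w. \<chi> i. chi c w y $ i)"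
      by (intro continuous_on_vec_lambda holomorphic_on_imp_continuous_on hol_chi c that W)
    then have "continuous_on W (\<lambda>w. chi c w y)" by simp
    from compact_imp_bounded[OF compact_continuous_image[OF this W(1)]]
    show ?thesis unfolding bounded_iff by auto
  qed
  show ?thesis
    by (rule solution_family_bounded[where Q=Q and z="\<lambda>w. w" and R=R])
      (use sub in \<open>auto intro: pot_int R bd tau_eq_subset[OF sol_chi sub]\<close>)
qed

text \<open>
  On the circle of radius \<open>r\<close> about a real point, \<open>\<bar>(w - z\<^sub>0)\<^sup>2 - r\<^sup>2\<bar> = 2 r \<bar>Im w\<bar>\<close> compensates the
  blow-up of the bound off the real axis; the maximum principle then yields a bound at
  the centre.
\<close>

lemma green_bound_real:
  assumes c: "c \<in> S" and z0: "z0 \<in> \<real>" and r: "r > 0" "\<And>w. w \<in> cball z0 (2 * r) \<Longrightarrow> \<Phi> w c $ 1 \<noteq> 0"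
    and d: "d \<in> left_half a c"
    and g: "square_integrable (left_half a c) g" "\<And>x. x \<le> d \<Longrightarrow> g x = 0"
  shows "r * sqrt (integral {d..c} (\<lambda>x. (norm (green c z0 g x))\<^sup>2)) \<le> 2 * sqrt (integral {d..c} (\<lambda>x. (norm (g x))\<^sup>2))"
proof -
  let ?U = "ball z0 (2 * r)"
  have dS: "d \<in> S" by (rule in_left_half_S[OF c d])
  have sub: "{d..c} \<subseteq> left_half a c" by (rule Icc_subset_left[OF c d])
  have subS: "{d..c} \<subseteq> S" by (rule Icc_subset[OF dS c])
  have gi: "square_integrable {d..c} g" by (rule square_integrable_Icc[OF c d g(1)])
  define h where "h x = vcnj (green c z0 g x)" for x
  have tg: "tau_eq Q {d..c} (green c w g) (\<lambda>x. w *s green c w g x + g x)" for w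
    by (rule tau_eq_subset[OF tau_eq_green[OF c g(1)] sub]) simp_all
  have cg: "continuous_on {d..c} (green c w g)" for w
    by (rule tau_eq_continuous_on[OF tg]) (auto simp: is_interval_cc)
  have ch: "continuous_on {d..c} h" unfolding h_def by (intro continuous_intros cg)
  have si: "square_integrable {d..c} (green c w g)" "square_integrable {d..c} h" for w
    by (intro square_integrable_continuous_Icc cg ch)+
  \<comment> \<open>Pairing with the fixed conjugate h of the value at z0 makes a scalar function
    that is holomorphic in w and equals N^2 at w = z0.\<close>
  define F where "F w = integral {d..c} (\<lambda>x. dotT (h x) (green c w g x))" for w
  define G where "G = sqrt (integral {d..c} (\<lambda>x. (norm (g x))\<^sup>2))"
  define N where "N = sqrt (integral {d..c} (\<lambda>x. (norm (green c z0 g x))\<^sup>2))"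
  have N0: "N \<ge> 0" unfolding N_def by (auto intro!: integral_nonneg square_integrableD(3) si)
  have G0: "G \<ge> 0" unfolding G_def by (auto intro!: integral_nonneg square_integrableD(3) gi)
  have Fz0: "F z0 = complex_of_real (N\<^sup>2)"
  proof -
    have "F z0 = integral {d..c} (\<lambda>x. complex_of_real ((norm (green c z0 g x))\<^sup>2))"
      unfolding F_def h_def dotT_vcnj ..
    also have "\<dots> = complex_of_real (integral {d..c} (\<lambda>x. (norm (green c z0 g x))\<^sup>2))"
      by (rule integral_of_real_complex[OF square_integrableD(3)[OF si(1)]]) simp
    also have "integral {d..c} (\<lambda>x. (norm (green c z0 g x))\<^sup>2) = N\<^sup>2"
      unfolding N_def by (subst real_sqrt_pow2) (auto intro!: integral_nonneg square_integrableD(3) si)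
    finally show ?thesis .
  qed
  have Fb: "\<bar>Im w\<bar> * norm (F w) \<le> N * G" if w: "w \<notin> \<real>" for w
  proof -
    have "norm (F w) \<le> sqrt (integral {d..c} (\<lambda>x. (norm (h x))\<^sup>2)) * sqrt (integral {d..c} (\<lambda>x. (norm (green c w g x))\<^sup>2))"
      unfolding F_def by (rule integral_dotT_Cauchy_Schwarz) (use si in auto)
    from mult_left_mono[OF this abs_ge_zero[of "Im w"]]
    have "\<bar>Im w\<bar> * norm (F w) \<le> N * (\<bar>Im w\<bar> * sqrt (integral {d..c} (\<lambda>x. (norm (green c w g x))\<^sup>2)))"
      by (simp add: h_def N_def mult_ac)
    also have "\<dots> \<le> N * G"
      unfolding G_def by (intro mult_left_mono N0 green_bound_nonreal[OF c w d g])
    finally show ?thesis .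
  qed
  have holF: "F holomorphic_on ?U"
  proof -
    obtain B1 where B1: "\<And>w x. w \<in> ?U \<Longrightarrow> x \<in> {d..c} \<Longrightarrow> norm (\<Phi> w x) \<le> B1"
      using \<Phi>_bounded(1)[OF dS c compact_cball[of z0 "2 * r"]] ball_subset_cball[of z0 "2 * r"] by blast
    obtain B2 where B2: "\<And>w x. w \<in> ?U \<Longrightarrow> x \<in> {d..c} \<Longrightarrow> norm (chi c w x) \<le> B2"
      using chi_bounded[OF dS c compact_cball[of z0 "2 * r"] r(2)] ball_subset_cball[of z0 "2 * r"] by blast
    have nz: "\<Phi> w c $ 1 \<noteq> 0" if "w \<in> ?U" for w using r(2) that by auto
    have ng: "(\<lambda>x. norm (g x)) absolutely_integrable_on {d..c}"
    proof -
      have "square_integrable {d..c} (\<lambda>x. axis 1 1 :: complex^2)"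
        by (intro square_integrable_continuous_Icc continuous_intros)
      from absolutely_integrable_norm_mult[OF gi this] show ?thesis by (simp add: norm_axis_1)
    qed
    define Y where "Y = integral {d..c} (\<lambda>x. norm (g x))"
    have part: "(\<lambda>w. integral T (\<lambda>y. dotT (u w y) (g y))) holomorphic_on ?U \<and>
        (\<forall>w\<in>?U. norm (integral T (\<lambda>y. dotT (u w y) (g y))) \<le> \<bar>B\<bar> * Y)"
      if T: "T = {p..q}" "T \<subseteq> {d..c}" and sol: "\<And>w. tau_eq Q S (u w) (\<lambda>x. w *s u w x)"
        and hol: "\<And>y i. y \<in> S \<Longrightarrow> (\<lambda>w. u w y $ i) holomorphic_on ?U"
        and B: "\<And>w x. w \<in> ?U \<Longrightarrow> x \<in> {d..c} \<Longrightarrow> norm (u w x) \<le> B" for T p q u B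
    proof -
      have i: "(\<lambda>y. dotT (u w y) (g y)) integrable_on T" for w
      proof -
        have "square_integrable T (u w)"
          unfolding T(1) by (rule square_integrable_solution_Icc[OF sol]) (use T subS in auto)
        moreover have "square_integrable T g"
          by (rule square_integrable_subset[OF gi T(2)]) (auto simp: T(1))
        ultimately show ?thesis
          using absolutely_integrable_dotT[of T "u w" g] by (auto simp: T(1) absolutely_integrable_on_def)
      qed
      have bi: "(\<lambda>y. \<bar>B\<bar> * norm (g y)) integrable_on T"
        using set_integrable_subset[OF ng _ T(2)] by (intro integrable_on_mult_right) (auto simp: T(1) absolutely_integrable_on_def)
      have bd: "norm (dotT (u w y) (g y)) \<le> \<bar>B\<bar> * norm (g y)" if "w \<in> ?U" "y \<in> T" for w y
      proof -
        have "norm (dotT (u w y) (g y)) \<le> norm (u w y) * norm (g y)" by (rule norm_dotT_le)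
        also have "\<dots> \<le> \<bar>B\<bar> * norm (g y)"
          using B[OF that(1), of y] that(2) T(2) by (intro mult_right_mono) auto
        finally show ?thesis .
      qed
      have "(\<lambda>w. integral T (\<lambda>y. dotT (u w y) (g y))) holomorphic_on ?U"
        by (rule holomorphic_integral[OF open_ball i _ bi bd])
          (use T(2) subS hol in \<open>auto intro!: hol_dotT\<close>)
      moreover have "norm (integral T (\<lambda>y. dotT (u w y) (g y))) \<le> \<bar>B\<bar> * Y" if w: "w \<in> ?U" for w
      proof -
        have "norm (integral T (\<lambda>y. dotT (u w y) (g y))) \<le> integral T (\<lambda>y. \<bar>B\<bar> * norm (g y))"
          by (rule integral_norm_bound_integral[OF i bi bd[OF w]])
        also have "\<dots> = \<bar>B\<bar> * integral T (\<lambda>y. norm (g y))" by simp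
        also have "\<dots> \<le> \<bar>B\<bar> * Y"
          unfolding Y_def using ng set_integrable_subset[OF ng _ T(2)]
          by (intro mult_left_mono integral_subset_le T(2)) (auto simp: T(1) absolutely_integrable_on_def)
        finally show ?thesis .
      qed
      ultimately show ?thesis by blast
    qed
    \<comment> \<open>Since g vanishes left of d, both integrals run over compact intervals, where
      \<Phi> and \<open>chi\<close> are bounded uniformly in w.\<close>
    have gr: "green c w g x = - integral {x..c} (\<lambda>y. dotT (chi c w y) (g y)) *s \<Phi> w x
        - integral {d..x} (\<lambda>y. dotT (\<Phi> w y) (g y)) *s chi c w x" if x: "x \<in> {d..c}" for w x
    proof -
      have xl: "x \<in> left_half a c" using x sub by auto
      have dx: "d \<in> left_half a x" using d x by (auto simp: left_half_def)
      have "integral (left_half a x) (\<lambda>y. dotT (\<Phi> w y) (g y)) =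
          integral (left_half a d) (\<lambda>y. dotT (\<Phi> w y) (g y)) + integral {d..x} (\<lambda>y. dotT (\<Phi> w y) (g y))"
        by (intro integral_left_split[OF in_left_half_S[OF c xl] dx] absolutely_integrable_dotT square_integrable_\<Phi>
            square_integrable_left_sub[OF xl] g(1) in_left_half_S[OF c xl]) simp
      moreover have "integral (left_half a d) (\<lambda>y. dotT (\<Phi> w y) (g y)) = integral (left_half a d) (\<lambda>y. 0)"
        by (rule Henstock_Kurzweil_Integration.integral_cong) (simp add: g(2) left_half_def dotT_eq)
      ultimately show ?thesis unfolding green_def by simp
    qed
    have hc: "(\<lambda>w. chi c w y $ i) holomorphic_on ?U" if "y \<in> S" for y i
      by (rule hol_chi[OF c that nz])
    have p1: "(\<lambda>w. integral {x..c} (\<lambda>y. dotT (chi c w y) (g y))) holomorphic_on ?U \<and>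
        (\<forall>w\<in>?U. norm (integral {x..c} (\<lambda>y. dotT (chi c w y) (g y))) \<le> \<bar>B2\<bar> * Y)" if x: "x \<in> {d..c}" for x
      by (rule part[OF refl]) (use x B2 sol_chi hc in auto)
    have p2: "(\<lambda>w. integral {d..x} (\<lambda>y. dotT (\<Phi> w y) (g y))) holomorphic_on ?U \<and>
        (\<forall>w\<in>?U. norm (integral {d..x} (\<lambda>y. dotT (\<Phi> w y) (g y))) \<le> \<bar>B1\<bar> * Y)" if x: "x \<in> {d..c}" for x
      by (rule part[OF refl]) (use x B1 sol_\<Phi> hol_\<Phi> in auto)
    obtain B3 where B3: "\<And>x. x \<in> {d..c} \<Longrightarrow> norm (h x) \<le> B3"
      using compact_imp_bounded[OF compact_continuous_image[OF ch compact_Icc]] unfolding bounded_iff by blast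
    define M where "M = \<bar>B2\<bar> * Y * \<bar>B1\<bar> + \<bar>B1\<bar> * Y * \<bar>B2\<bar>"
    show ?thesis
      unfolding F_def
    proof (rule holomorphic_integral[OF open_ball])
      show "(\<lambda>x. dotT (h x) (green c w g x)) integrable_on {d..c}" for w
        using absolutely_integrable_dotT[OF si(2) si(1)[of w]] by (simp add: absolutely_integrable_on_def)
      show "(\<lambda>w. dotT (h x) (green c w g x)) holomorphic_on ?U" if x: "x \<in> {d..c}" for x
      proof (rule hol_dotT(1))
        fix i
        have "(\<lambda>w. (- integral {x..c} (\<lambda>y. dotT (chi c w y) (g y)) *s \<Phi> w x
            - integral {d..x} (\<lambda>y. dotT (\<Phi> w y) (g y)) *s chi c w x) $ i) holomorphic_on ?U"
          unfolding vector_minus_component vector_smult_component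
          using p1[OF x] p2[OF x] x subS by (intro holomorphic_intros hol_\<Phi> hol_chi[OF c _ nz]) auto
        then show "(\<lambda>w. green c w g x $ i) holomorphic_on ?U" using gr[OF x] by simp
      qed
      show "(\<lambda>x. \<bar>B3\<bar> * M) integrable_on {d..c}" by (rule integrable_const_ivl)
      show "norm (dotT (h x) (green c w g x)) \<le> \<bar>B3\<bar> * M" if w: "w \<in> ?U" and x: "x \<in> {d..c}" for w x
      proof -
        have Y0: "0 \<le> Y" unfolding Y_def using ng by (auto intro!: integral_nonneg simp: absolutely_integrable_on_def)
        have "norm (green c w g x) \<le> norm (integral {x..c} (\<lambda>y. dotT (chi c w y) (g y))) * norm (\<Phi> w x)
            + norm (integral {d..x} (\<lambda>y. dotT (\<Phi> w y) (g y))) * norm (chi c w x)"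
          unfolding gr[OF x] by (rule order_trans[OF norm_triangle_ineq4]) (simp add: norm_vector_scalar_mult)
        also have "\<dots> \<le> M"
          unfolding M_def using p1[OF x] p2[OF x] w B1[OF w x] B2[OF w x] Y0
          by (intro add_mono mult_mono) (auto intro: order_trans)
        finally have "norm (h x) * norm (green c w g x) \<le> \<bar>B3\<bar> * M"
          using B3[OF x] by (intro mult_mono) auto
        then show ?thesis using norm_dotT_le order_trans by blast
      qed
    qed
  qed
  have "norm (((z0 - z0)\<^sup>2 - (complex_of_real r)\<^sup>2) * F z0) \<le> 2 * r * (N * G)"
  proof (rule maximum_modulus_frontier[of "\<lambda>w. ((w - z0)\<^sup>2 - (complex_of_real r)\<^sup>2) * F w" "cball z0 r"])
    have hh: "(\<lambda>w. ((w - z0)\<^sup>2 - (complex_of_real r)\<^sup>2) * F w) holomorphic_on ?U"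
      by (intro holomorphic_intros holF)
    show "(\<lambda>w. ((w - z0)\<^sup>2 - (complex_of_real r)\<^sup>2) * F w) holomorphic_on interior (cball z0 r)"
      by (rule holomorphic_on_subset[OF hh]) (use r(1) in auto)
    show "continuous_on (closure (cball z0 r)) (\<lambda>w. ((w - z0)\<^sup>2 - (complex_of_real r)\<^sup>2) * F w)"
      by (rule holomorphic_on_imp_continuous_on, rule holomorphic_on_subset[OF hh]) (use r(1) in auto)
    fix w assume "w \<in> frontier (cball z0 r)"
    then have wr: "norm (w - z0) = r" using r(1) by (simp add: frontier_cball sphere_def dist_norm norm_minus_commute)
    have im: "Im (w - z0) = Im w" using z0 by (simp add: complex_is_Real_iff)
    \<comment> \<open>On the circle r^2 is w - z0 times its conjugate, so w - z0 factors out and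
      twice the imaginary part is left.\<close>
    have "(w - z0)\<^sup>2 - (complex_of_real r)\<^sup>2 = (w - z0) * ((w - z0) - cnj (w - z0))"
      using complex_norm_square[of "w - z0"] wr by (simp add: power2_eq_square algebra_simps)
    also have "(w - z0) - cnj (w - z0) = 2 * \<i> * Im w" unfolding complex_diff_cnj im by simp
    finally have n: "norm ((w - z0)\<^sup>2 - (complex_of_real r)\<^sup>2) = 2 * r * \<bar>Im w\<bar>"
      by (simp add: norm_mult wr)
    show "norm (((w - z0)\<^sup>2 - (complex_of_real r)\<^sup>2) * F w) \<le> 2 * r * (N * G)"
    proof (cases "w \<in> \<real>")
      case True
      then show ?thesis unfolding norm_mult n using r(1) N0 G0 by (simp add: complex_is_Real_iff)
    next
      case False
      then show ?thesis unfolding norm_mult n using Fb[OF False] r(1) by simp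
    qed
  qed (use r(1) in auto)
  \<comment> \<open>At the centre the weight is -r^2, so the bound reads r^2 N^2 <= 2 r N G.\<close>
  then have "r * (r * N\<^sup>2) \<le> r * (2 * (N * G))"
    unfolding Fz0 using r(1) by (simp add: norm_mult norm_power power2_eq_square mult_ac)
  then have "r * (N * (r * N)) \<le> r * (N * (2 * G))" by (simp only: power2_eq_square mult_ac)
  then have "N * (r * N) \<le> N * (2 * G)" using r(1) by (rule mult_left_le_imp_le)
  then have "r * N \<le> 2 * G" using N0 G0 by (cases "N = 0") (auto simp: mult_le_cancel_left)
  then show ?thesis by (simp add: N_def G_def)
qed

text \<open>The constant depends on z and c but not on d; this uniformity is what allows the cut-off
  to be removed in \<open>green_bound\<close>.\<close>

lemma green_bound_cutoff:
  assumes c: "c \<in> S" and nz: "\<Phi> z c $ 1 \<noteq> 0"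
  shows "\<exists>C\<ge>0. \<forall>d\<in>left_half a c. \<forall>g. square_integrable (left_half a c) g \<and> (\<forall>x\<le>d. g x = 0) \<longrightarrow>
    sqrt (integral {d..c} (\<lambda>x. (norm (green c z g x))\<^sup>2)) \<le> C * sqrt (integral {d..c} (\<lambda>x. (norm (g x))\<^sup>2))"
proof (cases "z \<in> \<real>")
  case True
  have "continuous_on UNIV (\<lambda>w. \<Phi> w c $ 1)"
    by (intro holomorphic_on_imp_continuous_on hol_\<Phi> c)
  then have "isCont (\<lambda>w. \<Phi> w c $ 1) z" by (simp add: continuous_on_eq_continuous_at)
  then obtain e where e: "e > 0" "\<And>w. dist z w < e \<Longrightarrow> \<Phi> w c $ 1 \<noteq> 0"
    using continuous_at_avoid[of z "\<lambda>w. \<Phi> w c $ 1" 0] nz by auto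
  \<comment> \<open>Makes the closed disc of radius 2 r fit into the open disc of radius e.\<close>
  define r where "r = e / 4"
  have r: "r > 0" using e(1) by (simp add: r_def)
  have nz': "\<Phi> w c $ 1 \<noteq> 0" if "w \<in> cball z (2 * r)" for w
    using e that by (auto simp: r_def)
  show ?thesis
    by (rule exI[of _ "2 / r"]) (use green_bound_real[OF c True r nz'] r in \<open>auto simp: field_simps\<close>)
next
  case False
  then have "\<bar>Im z\<bar> > 0" by (simp add: complex_is_Real_iff)
  then show ?thesis
    by (intro exI[of _ "1 / \<bar>Im z\<bar>"]) (use green_bound_nonreal[OF c False] in \<open>auto simp: field_simps\<close>)
qed

text \<open>Removes the cut-off. Setting g to 0 left of t changes the Green image on
  \<open>{d..c}\<close> by a multiple of \<open>chi\<close> whose coefficient is the integral of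
  \<Phi>^T g over (a, t), and this tends to 0 as t approaches a. The limit gives the bound on every
  \<open>{d..c}\<close>, and exhaustion gives square integrability.\<close>

lemma green_bound:
  assumes c: "c \<in> S" and nz: "\<Phi> z c $ 1 \<noteq> 0"
  shows "\<exists>C\<ge>0. \<forall>g. square_integrable (left_half a c) g \<longrightarrow>
    square_integrable (left_half a c) (green c z g) \<and>
    sqrt (integral (left_half a c) (\<lambda>x. (norm (green c z g x))\<^sup>2)) \<le> C * sqrt (integral (left_half a c) (\<lambda>x. (norm (g x))\<^sup>2))"
proof -
  obtain C where C: "C \<ge> 0" "\<And>d g. d \<in> left_half a c \<Longrightarrow> square_integrable (left_half a c) g \<Longrightarrow> (\<And>x. x \<le> d \<Longrightarrow> g x = 0) \<Longrightarrow>
      sqrt (integral {d..c} (\<lambda>x. (norm (green c z g x))\<^sup>2)) \<le> C * sqrt (integral {d..c} (\<lambda>x. (norm (g x))\<^sup>2))"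
    using green_bound_cutoff[OF c nz] by metis
  interpret E: half_interval "left_half a c" c "to_left_end a" by (rule left_half_interval[OF c])
  have main: "square_integrable (left_half a c) (green c z g) \<and>
    sqrt (integral (left_half a c) (\<lambda>x. (norm (green c z g x))\<^sup>2)) \<le> C * sqrt (integral (left_half a c) (\<lambda>x. (norm (g x))\<^sup>2))"
    if g: "square_integrable (left_half a c) g" for g
  proof -
    let ?f = "green c z g"
    let ?G = "integral (left_half a c) (\<lambda>x. (norm (g x))\<^sup>2)"
    have cf: "continuous_on (left_half a c) ?f"
      by (rule tau_eq_continuous_on[OF tau_eq_green[OF c g] E.interval]) simp
    have G0: "?G \<ge> 0" by (auto intro!: integral_nonneg square_integrableD(3)[OF g])
    have fin: "sqrt (integral {d..c} (\<lambda>x. (norm (?f x))\<^sup>2)) \<le> C * sqrt ?G" if d: "d \<in> left_half a c" for d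
    proof -
      have subd: "{d..c} \<subseteq> left_half a c" by (rule Icc_subset_left[OF c d])
      have subS: "{d..c} \<subseteq> S" by (rule Icc_subset[OF in_left_half_S[OF c d] c])
      define \<epsilon> where "\<epsilon> t = integral (left_half a t) (\<lambda>y. dotT (\<Phi> z y) (g y))" for t
      define K where "K = sqrt (integral {d..c} (\<lambda>x. (norm (chi c z x))\<^sup>2))"
      have dint: "(\<lambda>y. dotT (\<Phi> z y) (g y)) absolutely_integrable_on left_half a c"
        by (intro absolutely_integrable_dotT square_integrable_\<Phi> c g) simp
      have le: "sqrt (integral {d..c} (\<lambda>x. (norm (?f x))\<^sup>2)) \<le> C * sqrt ?G + norm (\<epsilon> t) * K"
        if t: "t \<in> left_half a c" "d \<in> closed_segment c t" for t
      proof -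
        have td: "t \<le> d" using t by (auto simp: closed_segment_eq_real_ivl left_half_def split: if_splits)
        define gt where "gt x = (if x \<le> t then 0 else g x)" for x
        have subt: "{t..c} \<subseteq> left_half a c" by (rule Icc_subset_left[OF c t(1)])
        have gtm: "gt \<in> borel_measurable (lebesgue_on (left_half a c))"
          unfolding gt_def
        proof (rule measurable_If)
          have "{x \<in> space (lebesgue_on (left_half a c)). x \<le> t} = left_half a t \<inter> left_half a c"
            by (auto simp: left_half_def)
          then show "{x \<in> space (lebesgue_on (left_half a c)). x \<le> t} \<in> sets (lebesgue_on (left_half a c))"
            by (simp add: sets_restrict_space_iff sets.Int)
        qed (use square_integrableD(1)[OF g] in auto)
        have gt: "square_integrable (left_half a c) gt"
          by (rule square_integrable_bound[OF gtm g, of 1]) (auto simp: gt_def)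
        have eq: "?f x = green c z gt x + (- \<epsilon> t) *s chi c z x" if x: "x \<in> {d..c}" for x
        proof -
          have xl: "x \<in> left_half a c" using x subd by auto
          have tx: "t \<in> left_half a x" using t(1) td x by (auto simp: left_half_def)
          have s: "integral (left_half a x) (\<lambda>y. dotT (\<Phi> z y) (u y)) =
              integral (left_half a t) (\<lambda>y. dotT (\<Phi> z y) (u y)) + integral {t..x} (\<lambda>y. dotT (\<Phi> z y) (u y))"
            if u: "square_integrable (left_half a c) u" for u
            by (intro integral_left_split[OF in_left_half_S[OF c xl] tx] absolutely_integrable_dotT square_integrable_\<Phi>
              square_integrable_left_sub[OF xl] u in_left_half_S[OF c xl]) simp
          have "integral (left_half a t) (\<lambda>y. dotT (\<Phi> z y) (gt y)) = integral (left_half a t) (\<lambda>y. 0)"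
            by (rule Henstock_Kurzweil_Integration.integral_cong) (simp add: gt_def left_half_def dotT_eq)
          moreover have "integral {t..x} (\<lambda>y. dotT (\<Phi> z y) (gt y)) = integral {t..x} (\<lambda>y. dotT (\<Phi> z y) (g y))"
            by (rule integral_spike[of "{t}"]) (auto simp: gt_def)
          ultimately have B: "integral (left_half a x) (\<lambda>y. dotT (\<Phi> z y) (g y)) = \<epsilon> t + integral (left_half a x) (\<lambda>y. dotT (\<Phi> z y) (gt y))"
            using s[OF g] s[OF gt] by (simp add: \<epsilon>_def)
          have A: "integral {x..c} (\<lambda>y. dotT (chi c z y) (gt y)) = integral {x..c} (\<lambda>y. dotT (chi c z y) (g y))"
            by (rule integral_spike[of "{t}"]) (use td x in \<open>auto simp: gt_def\<close>)
          show ?thesis unfolding green_def A B by (simp add: vec2_eq_iff algebra_simps)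
        qed
        have cgt: "continuous_on (left_half a c) (green c z gt)"
          by (rule tau_eq_continuous_on[OF tau_eq_green[OF c gt] E.interval]) simp
        have s1: "square_integrable {d..c} (green c z gt)" "square_integrable {t..c} (green c z gt)"
          by (intro square_integrable_continuous_Icc continuous_on_subset[OF cgt] subd subt)+
        have s2: "square_integrable {d..c} (chi c z)"
          by (rule square_integrable_solution_Icc[OF sol_chi subS])
        have "integral {d..c} (\<lambda>x. (norm (?f x))\<^sup>2) = integral {d..c} (\<lambda>x. (norm (green c z gt x + (- \<epsilon> t) *s chi c z x))\<^sup>2)"
          by (rule Henstock_Kurzweil_Integration.integral_cong) (simp only: eq)
        then have "sqrt (integral {d..c} (\<lambda>x. (norm (?f x))\<^sup>2)) \<le> sqrt (integral {d..c} (\<lambda>x. (norm (green c z gt x))\<^sup>2)) +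
            sqrt (integral {d..c} (\<lambda>x. (norm ((- \<epsilon> t) *s chi c z x))\<^sup>2))"
          using integral_norm_add_sqrt[OF s1(1) square_integrable_scale[OF s2, of "- \<epsilon> t"]] by simp
        also have "sqrt (integral {d..c} (\<lambda>x. (norm ((- \<epsilon> t) *s chi c z x))\<^sup>2)) = norm (\<epsilon> t) * K"
          by (simp add: norm_vector_scalar_mult power_mult_distrib real_sqrt_mult K_def)
        also have "integral {d..c} (\<lambda>x. (norm (green c z gt x))\<^sup>2) \<le> integral {t..c} (\<lambda>x. (norm (green c z gt x))\<^sup>2)"
          using td by (intro integral_subset_le square_integrableD(3) s1) auto
        also have "sqrt (integral {t..c} (\<lambda>x. (norm (green c z gt x))\<^sup>2)) \<le> C * sqrt (integral {t..c} (\<lambda>x. (norm (gt x))\<^sup>2))"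
          by (rule C(2)[OF t(1) gt]) (simp add: gt_def)
        also have "integral {t..c} (\<lambda>x. (norm (gt x))\<^sup>2) = integral {t..c} (\<lambda>x. (norm (g x))\<^sup>2)"
          by (rule integral_spike[of "{t}"]) (auto simp: gt_def)
        also have "integral {t..c} (\<lambda>x. (norm (g x))\<^sup>2) \<le> ?G"
          by (intro integral_subset_le subt square_integrableD(3) g square_integrable_Icc[OF c t(1)]) auto
        finally show ?thesis using C(1) by (simp add: mult_left_mono)
      qed
      have "((\<lambda>t. C * sqrt ?G + norm (\<epsilon> t) * K) \<longlongrightarrow> C * sqrt ?G + norm (0::complex) * K) (to_left_end a)"
        unfolding \<epsilon>_def by (intro tendsto_intros integral_left_tendsto_0[OF c dint])
      then have "((\<lambda>t. C * sqrt ?G + norm (\<epsilon> t) * K) \<longlongrightarrow> C * sqrt ?G) (to_left_end a)" by simp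
      moreover have "\<forall>\<^sub>F t in to_left_end a. sqrt (integral {d..c} (\<lambda>x. (norm (?f x))\<^sup>2)) \<le> C * sqrt ?G + norm (\<epsilon> t) * K"
        using E.eventually_beyond[OF d] by (rule eventually_mono) (use le in auto)
      ultimately show ?thesis
        by (rule tendsto_lowerbound[OF _ _ E.nontriv])
    qed
    have "integral (closed_segment c x) (\<lambda>y. (norm (?f y))\<^sup>2) \<le> (C * sqrt ?G)\<^sup>2" if x: "x \<in> left_half a c" for x
    proof -
      have "closed_segment c x = {x..c}" using x by (auto simp: left_half_def closed_segment_eq_real_ivl)
      moreover have "integral {x..c} (\<lambda>y. (norm (?f y))\<^sup>2) \<le> (C * sqrt ?G)\<^sup>2"
        using fin[OF x] sqrt_le_D by blast
      ultimately show ?thesis by simp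
    qed
    from E.square_integrable_exhaust[OF cf this]
    show ?thesis using C(1) G0 by (auto intro!: real_le_lsqrt)
  qed
  show ?thesis using C(1) main by blast
qed

section \<open>The spectrum of the Dirichlet restriction\<close>

lemma left_half_eq: "{x. a < ereal x \<and> x \<le> c} = left_half a c"
  by (simp add: left_half_def)

lemma einterval_left: "c \<in> S \<Longrightarrow> left_half a c = insert c (einterval a (ereal c))"
  by (rule left_half_insert) (simp add: S_iff)

lemma square_integrable_einterval_left:
  assumes "c \<in> S"
  shows "square_integrable (einterval a (ereal c)) f \<longleftrightarrow> square_integrable (left_half a c) f"
  using square_integrable_insert[of "einterval a (ereal c)" f c] einterval_left[OF assms]
    square_integrable_subset[of "left_half a c" f "einterval a (ereal c)"] by auto

lemma L2norm_left:
  assumes c: "c \<in> S" and f: "square_integrable (left_half a c) f"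
  shows "L2norm (einterval a (ereal c)) f = sqrt (integral (left_half a c) (\<lambda>x. (norm (f x))\<^sup>2))"
proof -
  have "square_integrable (einterval a (ereal c)) f" using f square_integrable_einterval_left[OF c] by simp
  then show ?thesis by (simp add: L2norm_eq einterval_left[OF c] integral_insert)
qed

lemma dirichlet_op_iff:
  assumes c: "c \<in> S"
  shows "(f, h) \<in> dirichlet_op D c \<longleftrightarrow> square_integrable (left_half a c) f \<and> tau_eq Q (left_half a c) f h \<and>
    square_integrable (left_half a c) h \<and> boundary_left D f \<and> f c $ 1 = 0"
  by (simp add: dirichlet_op_def left_half_eq square_integrable_einterval_left[OF c])

text \<open>Green's operator is a left inverse of the restriction minus z, which yields the norm
  bound, and a right inverse, which yields surjectivity.\<close>

lemma resolvent_set_dirichlet: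
  assumes c: "c \<in> S" and nz: "\<Phi> z c $ 1 \<noteq> 0"
  shows "z \<in> resolvent_set (einterval a (ereal c)) (dirichlet_op D c)"
proof -
  obtain C where C: "\<And>g. square_integrable (left_half a c) g \<Longrightarrow> square_integrable (left_half a c) (green c z g)"
    "\<And>g. square_integrable (left_half a c) g \<Longrightarrow>
      sqrt (integral (left_half a c) (\<lambda>x. (norm (green c z g x))\<^sup>2)) \<le> C * sqrt (integral (left_half a c) (\<lambda>x. (norm (g x))\<^sup>2))"
    using green_bound[OF c nz] by blast
  have bd: "L2norm (einterval a (ereal c)) f \<le> C * L2norm (einterval a (ereal c)) (\<lambda>x. h x - z *s f x)"
    if "(f, h) \<in> dirichlet_op D c" for f h
  proof -
    have f: "tau_eq Q (left_half a c) f h" "square_integrable (left_half a c) f" "square_integrable (left_half a c) h"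
      "boundary_left D f" "f c $ 1 = 0"
      using that by (simp_all add: dirichlet_op_iff[OF c])
    let ?g = "\<lambda>x. h x - z *s f x"
    have g: "square_integrable (left_half a c) ?g"
    proof -
      have "square_integrable (left_half a c) (\<lambda>x. h x + (- z) *s f x)"
        by (intro square_integrable_add square_integrable_scale f) simp_all
      then show ?thesis by (simp add: vector_sneg_minus1[symmetric] vector_smult_lneg)
    qed
    have "integral (left_half a c) (\<lambda>x. (norm (f x))\<^sup>2) = integral (left_half a c) (\<lambda>x. (norm (green c z ?g x))\<^sup>2)"
      by (rule Henstock_Kurzweil_Integration.integral_cong) (simp only: eq_green[OF c nz f])
    then show ?thesis
      using C(2)[OF g] by (simp add: L2norm_left[OF c] f(2) g)
  qed
  have sur: "\<exists>(f, h)\<in>dirichlet_op D c. AE x in lebesgue_on (einterval a (ereal c)). h x - z *s f x = g x"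
    if "square_integrable (einterval a (ereal c)) g" for g
  proof -
    have g: "square_integrable (left_half a c) g" using that by (simp add: square_integrable_einterval_left[OF c])
    have "(green c z g, \<lambda>x. z *s green c z g x + g x) \<in> dirichlet_op D c"
      unfolding dirichlet_op_iff[OF c]
      using C(1)[OF g] tau_eq_green[OF c g] boundary_green[OF c g] green_c[OF nz]
        square_integrable_add[OF square_integrable_scale[OF C(1)[OF g]] g] by auto
    then show ?thesis by (intro bexI[of _ "(green c z g, \<lambda>x. z *s green c z g x + g x)"]) auto
  qed
  show ?thesis
    unfolding resolvent_set_def using bd sur by (auto intro!: exI[of _ C])
qed

text \<open>The spectrum lies in the zero set of the entire function z -> \<Phi>_1(z, c), which is
  not identically 0 because it does not vanish at i; hence no accumulation. At a zero, \<Phi>(z)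
  satisfies both conditions and is an eigenfunction, and by \<open>solution_expand\<close> every
  other one is a multiple of it.\<close>

theorem dirichlet_discrete:
  assumes c: "c \<in> S"
  shows "dirichlet_discrete D c"
proof -
  let ?I = "einterval a (ereal c)"
  let ?Z = "{z. \<Phi> z c $ 1 = 0}"
  have sub: "spectrum ?I (dirichlet_op D c) \<subseteq> ?Z"
    using resolvent_set_dirichlet[OF c] by (auto simp: spectrum_def)
  have nolim: "\<not> z islimpt spectrum ?I (dirichlet_op D c)" for z
  proof
    assume "z islimpt spectrum ?I (dirichlet_op D c)"
    then have "z islimpt ?Z" using islimpt_subset sub by blast
    then have "\<Phi> \<i> c $ 1 = 0"
      by (rule analytic_continuation[OF hol_\<Phi>[OF c] open_UNIV connected_UNIV, of ?Z z, rotated 2]) auto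
    then show False using \<Phi>1_nonzero[OF c, of \<i>] by (auto simp: complex_is_Real_iff)
  qed
  have "eigenvalue ?I (dirichlet_op D c) z \<and> finite_multiplicity ?I (dirichlet_op D c) z"
    if "z \<in> spectrum ?I (dirichlet_op D c)" for z
  proof
    have z: "\<Phi> z c $ 1 = 0" using that sub by auto
    have ev: "\<Phi> z \<in> eigenspace (dirichlet_op D c) z"
      unfolding eigenspace_def mem_Collect_eq dirichlet_op_iff[OF c]
      using square_integrable_\<Phi>[OF c, of z] tau_eq_left[OF sol_\<Phi> c, of z] boundary_\<Phi>[of z] z
      by (auto intro: square_integrable_scale)
    have nae: "\<not> (AE x in lebesgue_on ?I. \<Phi> z x = 0)"
    proof
      assume "AE x in lebesgue_on ?I. \<Phi> z x = 0"
      then obtain N where N: "negligible N" "\<And>x. x \<in> ?I - N \<Longrightarrow> \<Phi> z x = 0"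
        by (rule AE_lebesgue_on_negligible[OF _ einterval_sets]) (rule that)
      have "?I \<subseteq> N"
      proof
        fix x assume x: "x \<in> ?I"
        then have "x \<in> S" using left_half_subset[OF c] einterval_left[OF c] by auto
        then show "x \<in> N" using N(2)[of x] \<Phi>_nonzero[of x z] x by auto
      qed
      then have nI: "negligible ?I" by (rule negligible_subset[OF N(1)])
      obtain p where p: "a < ereal p" "ereal p < ereal c" using c ereal_dense2[of a "ereal c"] by (auto simp: S_iff)
      have "{p<..<c} \<subseteq> ?I" using ereal_less_trans_le[OF p(1)] by (auto simp: einterval_def)
      then have "negligible {p<..<c}" by (rule negligible_subset[OF nI])
      then show False using open_not_negligible[of "{p<..<c}"] p(2) by simp
    qed
    show "eigenvalue ?I (dirichlet_op D c) z"
      unfolding eigenvalue_def using ev nae by blast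
    have mult: "\<exists>k. \<forall>x\<in>left_half a c. f x = k *s \<Phi> z x" if "f \<in> eigenspace (dirichlet_op D c) z" for f
    proof -
      have f: "tau_eq Q (left_half a c) f (\<lambda>x. z *s f x)" "f c $ 1 = 0"
        using that by (auto simp: eigenspace_def dirichlet_op_iff[OF c])
      have "wronskian (\<Phi> z) f c = 0" using z f(2) by (simp add: wronskian_def)
      then have "f x = wronskian (\<Theta> z) f c *s \<Phi> z x" if "x \<in> left_half a c" for x
        using solution_expand[OF f(1) left_half_subset[OF c] left_half_sets left_half_is_interval[OF c] c_in_left_half[OF c] that]
        by simp
      then show ?thesis by blast
    qed
    show "finite_multiplicity ?I (dirichlet_op D c) z"
      unfolding finite_multiplicity_def
    proof (intro exI[of _ "{\<Phi> z}"] conjI ballI)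
      fix f assume "f \<in> eigenspace (dirichlet_op D c) z"
      then obtain k where k: "\<And>x. x \<in> left_half a c \<Longrightarrow> f x = k *s \<Phi> z x"
        using mult by blast
      show "\<exists>k. AE x in lebesgue_on ?I. f x = (\<Sum>g\<in>{\<Phi> z}. k g *s g x)"
        by (rule exI[of _ "\<lambda>_. k"], rule AE_I2) (simp add: k einterval_left[OF c])
    qed (use ev in auto)
  qed
  then show ?thesis
    unfolding purely_discrete_spectrum_def using nolim by blast
qed

end

section \<open>Weyl solutions at the right end and the singular Weyl function\<close>

lemma square_integrable_cong:
  assumes "square_integrable T u" "T \<in> sets lebesgue" "\<And>x. x \<in> T \<Longrightarrow> u x = v x"
  shows "square_integrable T v"
proof (rule square_integrable_bound[OF _ assms(1,2), of _ 1])
  show "v \<in> borel_measurable (lebesgue_on T)"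
    using square_integrableD(1)[OF assms(1,2)] measurable_cong[of "lebesgue_on T" u v borel] assms(3) by simp
qed (use assms(3) in auto)

lemma square_integrable_extend:
  assumes "square_integrable T f" "T \<subseteq> S" "T \<in> sets lebesgue" "S \<in> sets lebesgue"
  shows "square_integrable S (\<lambda>x. if x \<in> T then f x else 0)"
proof (rule square_integrableI)
  have "(\<lambda>x. if x \<in> T then f x else 0) \<in> borel_measurable lebesgue"
    by (rule borel_measurable_if_I[OF square_integrableD(1)[OF assms(1,3)] assms(3)])
  then show "(\<lambda>x. if x \<in> T then f x else 0) \<in> borel_measurable (lebesgue_on S)"
    by (rule measurable_restrict_space1)
  have "(\<lambda>x. if x \<in> T then (norm (f x))\<^sup>2 else 0) absolutely_integrable_on UNIV"
    by (subst absolutely_integrable_restrict_UNIV) (rule square_integrableD(2)[OF assms(1,3)])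
  then have "(\<lambda>x. if x \<in> T then (norm (f x))\<^sup>2 else 0) absolutely_integrable_on S"
    by (rule set_integrable_subset) (use assms(4) in auto)
  moreover have "(\<lambda>x. if x \<in> T then (norm (f x))\<^sup>2 else 0) = (\<lambda>x. (norm (if x \<in> T then f x else 0))\<^sup>2)"
    by (simp add: fun_eq_iff)
  ultimately show "(\<lambda>x. (norm (if x \<in> T then f x else 0))\<^sup>2) absolutely_integrable_on S" by simp
qed fact

context dirac_pair
begin

lemma square_integrable_rightI: "c \<in> S \<Longrightarrow> square_integrable (right_half c b) u \<Longrightarrow> square_integrable_right D u"
  unfolding square_integrable_right_def
  by (rule bexI[of _ c], rule square_integrable_subset[of "right_half c b"]) (auto simp: right_half_def einterval_def)

lemma square_integrable_S:
  assumes "tau_eq Q S u h" "c \<in> S" "square_integrable (left_half a c) u" "square_integrable (right_half c b) u"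
  shows "square_integrable S u"
proof -
  have "left_half a c \<union> right_half c b = S"
    using assms(2) left_half_subset[OF assms(2)] right_half_subset[OF assms(2)]
    by (auto simp: left_half_def right_half_def S_iff)
  moreover have "u \<in> borel_measurable (lebesgue_on S)"
    by (rule continuous_imp_measurable_on_sets_lebesgue[OF continuous_solution[OF assms(1)]]) simp
  ultimately show ?thesis using square_integrable_Un[OF assms(3,4)] by simp
qed

lemma eventually_right_half: "c \<in> S \<Longrightarrow> \<forall>\<^sub>F x in to_right_end b. x \<in> right_half c b"
  by (rule half_interval.eventually_in[OF right_half_interval])

text \<open>Values outside the interval are arbitrary, so an identity valid on the interval does not
  give equal functions and has to be transported explicitly.\<close>

lemma weyl_solution_right_cong:
  assumes u: "weyl_solution_right D z u" and eq: "\<And>x. x \<in> S \<Longrightarrow> u x = v x"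
  shows "weyl_solution_right D z v"
proof -
  obtain c where c: "c \<in> S" using S_nonempty by blast
  have u': "tau_eq Q S u (\<lambda>x. z *s u x)" "nontrivial D u" "square_integrable_right D u" "boundary_right D u"
    using u by (auto simp: weyl_solution_right_def solution_def in_domain_near_right_def)
  have "tau_eq Q S v (\<lambda>x. z *s v x)"
    by (rule tau_eq_cong[OF u'(1)]) (auto simp: eq)
  moreover have "nontrivial D v" using u'(2) eq by (auto simp: nontrivial_def)
  moreover have "square_integrable_right D v"
    by (rule square_integrable_rightI[OF c], rule square_integrable_cong[OF square_integrable_right_half[OF u'(3,1) c]])
      (use right_half_subset[OF c] eq in auto)
  moreover have "boundary_right D v"
    unfolding boundary_right_def
  proof
    assume "limit_circle_right D"
    then have "(wronskian (dirac.bc_right D) u \<longlongrightarrow> 0) (to_right_end b)"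
      using u'(4) by (simp add: boundary_right_def)
    moreover have "\<forall>\<^sub>F x in to_right_end b. wronskian (dirac.bc_right D) u x = wronskian (dirac.bc_right D) v x"
      using eventually_right_half[OF c]
      by (rule eventually_mono) (use right_half_subset[OF c] eq in \<open>auto simp: wronskian_def\<close>)
    ultimately show "(wronskian (dirac.bc_right D) v \<longlongrightarrow> 0) (to_right_end b)"
      by (rule Lim_transform_eventually)
  qed
  ultimately show ?thesis by (simp add: weyl_solution_right_def solution_def in_domain_near_right_def)
qed

lemma boundary_right_scale: "boundary_right D u \<Longrightarrow> boundary_right D (\<lambda>x. k *s u x)"
proof -
  have "wronskian p (\<lambda>x. k *s u x) = (\<lambda>x. k * wronskian p u x)" for p
    by (simp add: fun_eq_iff wronskian_def algebra_simps)
  then show "boundary_right D u \<Longrightarrow> boundary_right D (\<lambda>x. k *s u x)"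
    unfolding boundary_right_def using tendsto_mult_right_zero by fastforce
qed

lemma square_integrable_right_scale: "square_integrable_right D u \<Longrightarrow> square_integrable_right D (\<lambda>x. k *s u x)"
  unfolding square_integrable_right_def using square_integrable_scale einterval_sets by blast

lemma weyl_solution_right_scale:
  assumes u: "weyl_solution_right D z u" and k: "k \<noteq> 0"
  shows "weyl_solution_right D z (\<lambda>x. k *s u x)"
proof -
  have "tau_eq Q S u (\<lambda>x. z *s u x)" using u by (simp add: weyl_solution_right_def solution_def)
  from tau_eq_scale[OF this S_sets, of k]
  have "tau_eq Q S (\<lambda>x. k *s u x) (\<lambda>x. z *s (k *s u x))"
    by (rule tau_eq_cong) (auto simp: vec2_eq_iff)
  moreover have "k *s v = 0 \<longleftrightarrow> v = 0" for v :: "complex^2" using k by (simp add: vec2_eq_iff)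
  ultimately show ?thesis
    using u boundary_right_scale square_integrable_right_scale
    by (simp add: weyl_solution_right_def solution_def in_domain_near_right_def nontrivial_def)
qed

text \<open>The Wronskian is constant in x, and by \<open>wronskian_right_end\<close> its limit at b
  is 0.\<close>

lemma weyl_solution_right_unique:
  assumes u: "weyl_solution_right D z u" and v: "weyl_solution_right D z v" and x: "x \<in> S"
  shows "wronskian u v x = 0"
proof -
  have u': "tau_eq Q S u (\<lambda>x. z *s u x)" "square_integrable (right_half x b) u" "boundary_right D u"
    using u square_integrable_right_half[OF _ _ x] by (auto simp: weyl_solution_right_def solution_def in_domain_near_right_def)
  have v': "tau_eq Q S v (\<lambda>x. z *s v x)" "square_integrable (right_half x b) v" "boundary_right D v"
    using v square_integrable_right_half[OF _ _ x] by (auto simp: weyl_solution_right_def solution_def in_domain_near_right_def)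
  have "(wronskian u v \<longlongrightarrow> 0) (to_right_end b)"
    by (rule wronskian_right_end[OF x tau_eq_right[OF u'(1) x] u'(2) _ u'(3) tau_eq_right[OF v'(1) x] v'(2) _ v'(3)])
      (intro square_integrable_scale u'(2) v'(2) right_half_sets)+
  moreover have "\<forall>\<^sub>F t in to_right_end b. wronskian u v t = wronskian u v x"
    using eventually_right_half[OF x]
  proof (rule eventually_mono)
    fix t assume "t \<in> right_half x b"
    then have "t \<in> S" using right_half_subset[OF x] by auto
    then show "wronskian u v t = wronskian u v x"
      by (intro solution_wronskian_constant[OF u'(1) v'(1) S_sets S_interval pot_sym _ x])
  qed
  ultimately have "((\<lambda>t. wronskian u v x) \<longlongrightarrow> 0) (to_right_end b)"
    by (rule Lim_transform_eventually)
  then show ?thesis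
    using half_interval.nontriv[OF right_half_interval[OF x]] by (simp add: tendsto_const_iff)
qed

lemma const_wronskian_eq:
  assumes "\<And>x. x \<in> S \<Longrightarrow> wronskian f g x = w"
  shows "const_wronskian D f g = w"
  unfolding const_wronskian_def using assms S_nonempty by (intro the_equality) auto

lemma wronskian_solutions_eq:
  assumes "tau_eq Q S u (\<lambda>x. z *s u x)" "tau_eq Q S v (\<lambda>x. z *s v x)" "c \<in> S"
  shows "const_wronskian D u v = wronskian u v c"
  by (rule const_wronskian_eq, rule solution_wronskian_constant[OF assms(1,2) S_sets S_interval pot_sym _ assms(3)])

text \<open>The definition picks some Weyl solution u. Any such u is parallel to \<Theta> + m
  \<Phi>, and the vanishing of their Wronskian can be solved for m, whatever the choice. Only a Weyl
  solution at z is asked for, so the lemma applies to the commuted operator without knowledge of its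
  spectrum.\<close>

lemma singular_weyl_function_eqI:
  assumes \<psi>: "weyl_solution_right D z (\<lambda>x. \<Theta> z x + m *s \<Phi> z x)"
  shows "singular_weyl_function D \<Phi> \<Theta> z = m"
proof -
  define u where "u = (SOME u. weyl_solution_right D z u)"
  have u: "weyl_solution_right D z u" unfolding u_def by (rule someI[of _ "\<lambda>x. \<Theta> z x + m *s \<Phi> z x"]) (rule \<psi>)
  then have su: "tau_eq Q S u (\<lambda>x. z *s u x)" and "nontrivial D u"
    by (auto simp: weyl_solution_right_def solution_def)
  then obtain c where c: "c \<in> S" "u c \<noteq> 0" by (auto simp: nontrivial_def)
  have 0: "wronskian (\<Theta> z) u c + m * wronskian (\<Phi> z) u c = 0"
    using weyl_solution_right_unique[OF \<psi> u c(1)] by (simp add: wronskian_def algebra_simps)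
  \<comment> \<open>If W(\<Phi>, u) were 0, the previous line would give W(\<Theta>, u) = 0 as well,
    and the expansion would make u(c) = 0.\<close>
  then have nz: "wronskian (\<Phi> z) u c \<noteq> 0"
    using expand[OF c(1), of u z] c(2) by auto
  have "singular_weyl_function D \<Phi> \<Theta> z = - (wronskian (\<Theta> z) u c / wronskian (\<Phi> z) u c)"
    unfolding singular_weyl_function_def Let_def u_def[symmetric]
      wronskian_solutions_eq[OF sol_\<Theta> su c(1)] wronskian_solutions_eq[OF sol_\<Phi> su c(1)] ..
  also have "\<dots> = m" using 0 nz by (simp add: field_simps add_eq_0_iff2)
  finally show ?thesis .
qed

text \<open>Otherwise \<Phi>(z) would be an eigenfunction, and the resolvent bound would force its
  norm to be 0.\<close>

lemma \<Phi>_not_weyl_right: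
  assumes z: "z \<notin> spectrum S (dirac_op D)"
  shows "\<not> weyl_solution_right D z (\<Phi> z)"
proof
  assume w: "weyl_solution_right D z (\<Phi> z)"
  obtain C where C: "\<And>f h. (f, h) \<in> dirac_op D \<Longrightarrow> L2norm S f \<le> C * L2norm S (\<lambda>x. h x - z *s f x)"
    using z unfolding spectrum_def resolvent_set_def by auto blast
  obtain c where c: "c \<in> S" using S_nonempty by blast
  have r: "square_integrable (right_half c b) (\<Phi> z)"
    using w square_integrable_right_half[OF _ sol_\<Phi> c] by (auto simp: weyl_solution_right_def in_domain_near_right_def)
  have si: "square_integrable S (\<Phi> z)"
    by (rule square_integrable_S[OF sol_\<Phi> c square_integrable_\<Phi>[OF c] r])
  have "(\<Phi> z, \<lambda>x. z *s \<Phi> z x) \<in> dirac_op D"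
    using si sol_\<Phi>[of z] square_integrable_scale[OF si S_sets, of z] boundary_\<Phi>[of z] w
    by (auto simp: dirac_op_def weyl_solution_right_def in_domain_near_right_def)
  from C[OF this] have "L2norm S (\<Phi> z) \<le> 0" by (simp add: L2norm_def)
  then have "integral S (\<lambda>x. (norm (\<Phi> z x))\<^sup>2) \<le> 0" by (simp add: L2norm_eq[OF si S_sets])
  moreover have "integral (left_half a c) (\<lambda>x. (norm (\<Phi> z x))\<^sup>2) \<le> integral S (\<lambda>x. (norm (\<Phi> z x))\<^sup>2)"
    by (intro integral_subset_le left_half_subset[OF c] square_integrableD(3) square_integrable_\<Phi> c si) auto
  ultimately show False using integral_norm_\<Phi>_pos[OF c, of z] by simp
qed

lemma tau_eq_AE:
  assumes "tau_eq Q S f h" "AE x in lebesgue_on S. h x = k x"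
  shows "tau_eq Q S f k"
proof -
  obtain f' where f': "AC_loc_deriv S f f'" "AE x in lebesgue_on S. (1 / \<i>) *s (sigma2 *v f' x) + Q x *v f x = h x"
    using assms(1) by (auto simp: tau_eq_def)
  have "AE x in lebesgue_on S. (1 / \<i>) *s (sigma2 *v f' x) + Q x *v f x = k x"
    using f'(2) assms(2) by eventually_elim simp
  then show ?thesis using f'(1) by (auto simp: tau_eq_def)
qed

lemma boundary_right_cong:
  assumes c: "c \<in> S" and "boundary_right D u" "\<And>x. x \<in> right_half c b \<Longrightarrow> u x = v x"
  shows "boundary_right D v"
  unfolding boundary_right_def
proof
  assume "limit_circle_right D"
  then have "(wronskian (dirac.bc_right D) u \<longlongrightarrow> 0) (to_right_end b)"
    using assms(2) by (simp add: boundary_right_def)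
  moreover have "\<forall>\<^sub>F x in to_right_end b. wronskian (dirac.bc_right D) u x = wronskian (dirac.bc_right D) v x"
    using eventually_right_half[OF c]
    by (rule eventually_mono) (use assms(3) in \<open>auto simp: wronskian_def\<close>)
  ultimately show "(wronskian (dirac.bc_right D) v \<longlongrightarrow> 0) (to_right_end b)"
    by (rule Lim_transform_eventually)
qed

text \<open>
  Solving \<open>(\<tau> - z) f = g\<close> with \<open>g\<close> compactly supported and not orthogonal to \<open>\<Phi>\<close> produces a
  Weyl solution: beyond the support of \<open>g\<close>, \<open>f\<close> is a solution and not a multiple of \<open>\<Phi>\<close>.
\<close>

lemma weyl_solution_right_exists:
  assumes z: "z \<notin> spectrum S (dirac_op D)"
  shows "\<exists>u. weyl_solution_right D z u"
proof -
  obtain p where p: "p \<in> S" using S_nonempty by blast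
  obtain c where c: "p < c" "ereal c < b" using p ereal_dense2[of "ereal p" b] by (auto simp: S_iff)
  have cS: "c \<in> S" using c p by (auto simp: S_iff intro: ereal_less_trans_le[of a p c])
  \<comment> \<open>The support \<open>{p..q}\<close> of g has to end before c, so that f solves the
    homogeneous equation on all of \<open>right_half c b\<close>.\<close>
  define q where "q = (p + c) / 2"
  have q: "p < q" "q < c" using c by (auto simp: q_def)
  have sub: "{p..q} \<subseteq> left_half a c" using p q by (auto simp: left_half_def S_iff intro: ereal_less_trans_le)
  have subS: "{p..q} \<subseteq> S" using sub left_half_subset[OF cS] by blast
  \<comment> \<open>The conjugate makes the bilinear pairing with \<Phi> equal to the integral of
    |\<Phi>|^2 over \<open>{p..q}\<close>, which is positive.\<close>
  define g where "g x = (if x \<in> {p..q} then vcnj (\<Phi> z x) else 0)" for x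
  have cont: "continuous_on {p..q} (\<Phi> z)" by (rule continuous_on_subset[OF continuous_solution[OF sol_\<Phi>] subS])
  have g: "square_integrable S g"
    unfolding g_def by (intro square_integrable_extend square_integrable_continuous_Icc continuous_intros cont subS) simp_all
  have "\<exists>(f, h)\<in>dirac_op D. AE x in lebesgue_on S. h x - z *s f x = g x"
    using z g unfolding spectrum_def resolvent_set_def by blast
  then obtain f h where fh: "(f, h) \<in> dirac_op D" and ae: "AE x in lebesgue_on S. h x - z *s f x = g x"
    by blast
  let ?h = "\<lambda>x. z *s f x + g x"
  have f: "square_integrable S f" "tau_eq Q S f h" "boundary_left D f" "boundary_right D f"
    using fh by (auto simp: dirac_op_def)
  \<comment> \<open>The resolvent equation holds almost everywhere only, but \<open>tau_eq\<close>
    sees h up to null sets, so h may be replaced by the exact expression.\<close>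
  have "AE x in lebesgue_on S. h x = ?h x"
    using ae by eventually_elim (simp add: algebra_simps)
  from tau_eq_AE[OF f(2) this] have t: "tau_eq Q S f ?h" .
  have hs: "square_integrable S ?h" by (intro square_integrable_add square_integrable_scale f g) simp_all
  have L: "square_integrable (left_half a c) u" if "square_integrable S u" for u
    by (rule square_integrable_subset[OF that left_half_subset[OF cS]]) simp_all
  have W: "wronskian (\<Phi> z) f c \<noteq> 0"
  proof -
    have cont2: "continuous_on {p..q} (\<lambda>x. (norm (\<Phi> z x))\<^sup>2)" by (intro continuous_intros cont)
    have i: "(\<lambda>x. (norm (\<Phi> z x))\<^sup>2) integrable_on {p..q}" by (rule integrable_continuous_real[OF cont2])
    have "wronskian (\<Phi> z) f c = integral (left_half a c) (\<lambda>x. z * dotT (\<Phi> z x) (f x) - dotT (\<Phi> z x) (?h x))"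
      by (rule wronskian_\<Phi>_left[OF cS tau_eq_left[OF t cS] L[OF f(1)] L[OF hs] f(3)])
    also have "(\<lambda>x. z * dotT (\<Phi> z x) (f x) - dotT (\<Phi> z x) (?h x)) = (\<lambda>x. - (if x \<in> {p..q} then complex_of_real ((norm (\<Phi> z x))\<^sup>2) else 0))"
      unfolding dotT_vcnj[symmetric] by (simp add: fun_eq_iff dotT_eq g_def algebra_simps)
    also have "integral (left_half a c) \<dots> = - integral (left_half a c) (\<lambda>x. if x \<in> {p..q} then complex_of_real ((norm (\<Phi> z x))\<^sup>2) else 0)"
      by (rule Henstock_Kurzweil_Integration.integral_neg)
    also have "\<dots> = - complex_of_real (integral {p..q} (\<lambda>x. (norm (\<Phi> z x))\<^sup>2))"
      unfolding Henstock_Kurzweil_Integration.integral_restrict_Int Int_absorb2[OF sub] integral_of_real_complex[OF i] ..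
    finally have eq: "wronskian (\<Phi> z) f c = - complex_of_real (integral {p..q} (\<lambda>x. (norm (\<Phi> z x))\<^sup>2))" .
    have "integral {p..q} (\<lambda>x. (norm (\<Phi> z x))\<^sup>2) \<noteq> 0"
      using integral_eq_0_iff[OF cont2 q(1)] \<Phi>_nonzero[OF p, of z] q(1) by force
    then show ?thesis by (simp add: eq)
  qed
  have tr: "tau_eq Q (right_half c b) f (\<lambda>x. z *s f x)"
    by (rule tau_eq_cong[OF tau_eq_right[OF t cS]]) (use q in \<open>auto simp: g_def right_half_def\<close>)
  define u where "u x = wronskian (\<Theta> z) f c *s \<Phi> z x + (- wronskian (\<Phi> z) f c) *s \<Theta> z x" for x
  have fu: "f x = u x" if "x \<in> right_half c b" for x
    using solution_expand[OF tr right_half_subset[OF cS] right_half_sets half_interval.interval[OF right_half_interval[OF cS]]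
        half_interval.e_in[OF right_half_interval[OF cS]] that] by (simp add: u_def vec2_eq_iff)
  have su: "tau_eq Q S u (\<lambda>x. z *s u x)" unfolding u_def by (rule solution_combination)
  have "wronskian (\<Phi> z) u c = wronskian (\<Phi> z) f c * wronskian (\<Theta> z) (\<Phi> z) c"
    by (simp add: u_def wronskian_def[of "\<Phi> z" u] wronskian_def[of "\<Theta> z" "\<Phi> z"] algebra_simps)
  then have "wronskian (\<Phi> z) u c = wronskian (\<Phi> z) f c"
    using wronskian_1[OF cS, of z] by simp
  then have "u c \<noteq> 0" using W by (auto simp: wronskian_def)
  then have nt: "nontrivial D u" using cS by (auto simp: nontrivial_def)
  have "square_integrable (right_half c b) f"
    by (rule square_integrable_subset[OF f(1) right_half_subset[OF cS]]) simp_all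
  then have "square_integrable (right_half c b) u" by (rule square_integrable_cong) (simp_all add: fu)
  then have "square_integrable_right D u" by (rule square_integrable_rightI[OF cS])
  moreover have "boundary_right D u" by (rule boundary_right_cong[OF cS f(4) fu])
  ultimately have "weyl_solution_right D z u"
    using su nt by (simp add: weyl_solution_right_def solution_def in_domain_near_right_def)
  then show ?thesis by blast
qed

text \<open>The coefficient B = W(\<Phi>, u) of a Weyl solution u is not 0, since otherwise
  \<Phi>(z) itself would be one. Dividing by -B normalises u to \<Theta> - (A / B) \<Phi>, and
  \<open>singular_weyl_function_eqI\<close> reads off the coefficient.\<close>

lemma weyl_solution_right_singular:
  assumes z: "z \<notin> spectrum S (dirac_op D)"
  shows "weyl_solution_right D z (\<lambda>x. \<Theta> z x + singular_weyl_function D \<Phi> \<Theta> z *s \<Phi> z x)"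
proof -
  obtain u where u: "weyl_solution_right D z u" using weyl_solution_right_exists[OF z] by blast
  then have su: "tau_eq Q S u (\<lambda>x. z *s u x)" and nt: "nontrivial D u" by (auto simp: weyl_solution_right_def solution_def)
  then obtain c where c: "c \<in> S" "u c \<noteq> 0" by (auto simp: nontrivial_def)
  define A where "A = wronskian (\<Theta> z) u c"
  define B where "B = wronskian (\<Phi> z) u c"
  have eq: "u x = A *s \<Phi> z x - B *s \<Theta> z x" if "x \<in> S" for x
    unfolding A_def B_def by (rule solution_expand[OF su order_refl S_sets S_interval c(1) that])
  have eqi: "u x $ i = A * \<Phi> z x $ i - B * \<Theta> z x $ i" if "x \<in> S" for x i
    using eq[OF that] by simp
  have B: "B \<noteq> 0"
  proof
    assume B: "B = 0"
    then have A: "A \<noteq> 0" using eq[OF c(1)] c(2) by auto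
    have "(1 / A) *s u x = \<Phi> z x" if "x \<in> S" for x
      unfolding vec2_eq_iff vector_smult_component eqi[OF that] using A B by simp
    then have "weyl_solution_right D z (\<Phi> z)"
      by (intro weyl_solution_right_cong[OF weyl_solution_right_scale[OF u, of "1 / A"]]) (use A in auto)
    then show False using \<Phi>_not_weyl_right[OF z] by blast
  qed
  have w: "weyl_solution_right D z (\<lambda>x. \<Theta> z x + (- A / B) *s \<Phi> z x)"
  proof (rule weyl_solution_right_cong[OF weyl_solution_right_scale[OF u, of "- 1 / B"]])
    show "- 1 / B \<noteq> 0" using B by simp
    show "(- 1 / B) *s u x = \<Theta> z x + (- A / B) *s \<Phi> z x" if "x \<in> S" for x
      unfolding vec2_eq_iff vector_smult_component vector_add_component eqi[OF that]
      using B by (simp add: field_simps)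
  qed
  from singular_weyl_function_eqI[OF w] w show ?thesis by simp
qed

end

section \<open>Double commutation\<close>

lemma tau_eq_add_potential:
  assumes f: "tau_eq Q S f h" and S: "S \<in> sets lebesgue"
  shows "tau_eq (\<lambda>x. Q x + P x) S f (\<lambda>x. h x + P x *v f x)"
  unfolding tau_eq_iff[OF S]
  by (intro conjI; rule ac_deriv_cong[OF tau_eq_deriv1[OF S f]] ac_deriv_cong[OF tau_eq_deriv2[OF S f]])
    (simp_all add: matrix_vector_mult_2 algebra_simps)

lemma entire_eq_at:
  assumes f: "f holomorphic_on UNIV" and eq: "\<And>z. z \<noteq> l \<Longrightarrow> f z = (k :: complex)"
  shows "f l = k"
proof -
  have "isCont f l" using holomorphic_on_imp_continuous_on[OF f] by (simp add: continuous_on_eq_continuous_at)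
  then have "(f \<longlongrightarrow> f l) (at l)" by (simp add: isCont_def)
  moreover have "(f \<longlongrightarrow> k) (at l)"
    by (rule tendsto_eventually) (use eq in \<open>auto simp: eventually_at_filter\<close>)
  ultimately show ?thesis by (rule tendsto_unique[OF at_neq_bot])
qed

lemma entire_real_at:
  assumes f: "f holomorphic_on UNIV" and r: "\<And>z. z \<in> \<real> \<Longrightarrow> z \<noteq> l \<Longrightarrow> f z \<in> \<real>" and l: "l \<in> \<real>"
  shows "f l \<in> \<real>"
proof -
  define X where "X n = l + complex_of_real (inverse (real (Suc n)))" for n
  have c: "isCont f l" using holomorphic_on_imp_continuous_on[OF f] by (simp add: continuous_on_eq_continuous_at)
  have "X \<longlonglongrightarrow> l + complex_of_real 0"
    unfolding X_def by (intro tendsto_add tendsto_const tendsto_of_real LIMSEQ_inverse_real_of_nat)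
  then have lim: "(\<lambda>n. f (X n)) \<longlonglongrightarrow> f l"
    using isCont_tendsto_compose[OF c, of X sequentially] by simp
  have "f (X n) \<in> \<real>" for n
  proof (rule r)
    show "X n \<in> \<real>" unfolding X_def using l by (intro Reals_add Reals_of_real)
    have "complex_of_real (inverse (real (Suc n))) \<noteq> 0" unfolding of_real_eq_0_iff by simp
    then show "X n \<noteq> l" unfolding X_def by simp
  qed
  then show ?thesis by (rule closed_sequentially[OF closed_complex_Reals _ lim])
qed

lemma integral_Reals:
  assumes "\<And>x. x \<in> T \<Longrightarrow> k x \<in> \<real>" "k integrable_on T"
  shows "integral T k \<in> (\<real> :: complex set)"
proof -
  have "(\<lambda>x. Re (k x)) integrable_on T"
    using integrable_linear[OF assms(2) bounded_linear_Re] by (simp add: o_def)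
  from integral_linear[OF this bounded_linear_of_real]
  have "integral T (\<lambda>x. complex_of_real (Re (k x))) = complex_of_real (integral T (\<lambda>x. Re (k x)))" by (simp add: o_def)
  moreover have "integral T (\<lambda>x. complex_of_real (Re (k x))) = integral T k"
    by (rule Henstock_Kurzweil_Integration.integral_cong) (use assms(1) in \<open>simp add: complex_is_Real_iff complex_eq_iff\<close>)
  ultimately show ?thesis by (metis Reals_of_real)
qed

text \<open>For \<gamma> < 0 the lower bound on \<gamma> is restated for 1/\<gamma>, the form in
  which it keeps \<open>c_gamma\<close> negative. The assumption \<open>eigenfunction\<close> is
  what being an eigenvalue yields for u at the right end. The value \<gamma> = 0, where nothing
  changes, is left to the final theorem.\<close>

locale commutation = dirac_pair D \<Phi> \<Theta> for D \<Phi> \<Theta> +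
  fixes lam \<gamma> :: real
  assumes gamma_nonzero: "\<gamma> \<noteq> 0"
    and gamma_cases: "\<gamma> > 0 \<or> (square_integrable (ival D) (\<Phi> (of_real lam)) \<and>
        1 / \<gamma> \<le> - integral (ival D) (\<lambda>x. (norm (\<Phi> (of_real lam) x))\<^sup>2) \<and> \<gamma> < 0)"
    and eigenfunction: "square_integrable (ival D) (\<Phi> (of_real lam)) \<Longrightarrow> boundary_right D (\<Phi> (of_real lam))"
begin

abbreviation "l \<equiv> complex_of_real lam"
abbreviation "u \<equiv> \<Phi> l"
abbreviation "D' \<equiv> double_commutation D \<gamma> u"
abbreviation "P \<equiv> pot D'"

definition cr :: "real \<Rightarrow> real" where
  "cr x = 1 / \<gamma> + integral (left_half a x) (\<lambda>y. (norm (u y))\<^sup>2)"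

definition II :: "complex \<Rightarrow> real \<Rightarrow> complex" where
  "II z x = integral (left_half a x) (\<lambda>y. dotT (u y) (\<Phi> z y))"

lemma l_Reals: "l \<in> \<real>" by simp

lemma u_cnj: "x \<in> S \<Longrightarrow> cnj (u x $ i) = u x $ i"
  using real_on_reals(1)[of x l i] by (simp add: Reals_cnj_iff)

lemma dotT_uu: "x \<in> S \<Longrightarrow> dotT (u x) (u x) = complex_of_real ((norm (u x))\<^sup>2)"
  using norm_sq_eq_dotT_cnj[of x l] by simp

lemma integral_dotT_uu:
  assumes x: "x \<in> S"
  shows "integral (left_half a x) (\<lambda>y. dotT (u y) (u y)) = complex_of_real (integral (left_half a x) (\<lambda>y. (norm (u y))\<^sup>2))"
proof -
  have "integral (left_half a x) (\<lambda>y. dotT (u y) (u y)) = integral (left_half a x) (\<lambda>y. complex_of_real ((norm (u y))\<^sup>2))"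
    by (rule Henstock_Kurzweil_Integration.integral_cong) (rule dotT_uu, rule in_left_half_S[OF x])
  also have "\<dots> = complex_of_real (integral (left_half a x) (\<lambda>y. (norm (u y))\<^sup>2))"
    by (rule integral_of_real_complex[OF square_integrableD(3)[OF square_integrable_\<Phi>[OF x]]]) simp
  finally show ?thesis .
qed

lemma LINT_left:
  assumes x: "x \<in> S"
  shows "(LINT y|lebesgue_on (einterval a (ereal x)). dotT (u y) (\<Phi> z y)) = II z x"
proof -
  have "(\<lambda>y. dotT (u y) (\<Phi> z y)) absolutely_integrable_on einterval a (ereal x)"
    by (rule set_integrable_subset[OF dotT_\<Phi>_integrable[OF x]]) (use einterval_left[OF x] in auto)
  from LINT_eq_integral[OF this einterval_sets] show ?thesis
    by (simp add: II_def einterval_left[OF x] integral_insert)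
qed

lemma c_gamma_eq: "x \<in> S \<Longrightarrow> c_gamma D \<gamma> u x = complex_of_real (cr x)"
  unfolding c_gamma_def using LINT_left[of x l] integral_dotT_uu[of x] by (simp add: II_def cr_def)

lemma II_l: "x \<in> S \<Longrightarrow> II l x = complex_of_real (cr x) - 1 / complex_of_real \<gamma>"
  using integral_dotT_uu[of x] by (simp add: II_def cr_def)

lemma integral_split_S:
  fixes k :: "real \<Rightarrow> 'a::euclidean_space"
  assumes x: "x \<in> S" and k: "k absolutely_integrable_on S"
  shows "integral S k = integral (left_half a x) k + integral (right_half x b) k"
proof -
  have U: "left_half a x \<union> right_half x b = S"
    using x left_half_subset[OF x] right_half_subset[OF x] by (auto simp: left_half_def right_half_def S_iff)
  have "left_half a x \<inter> right_half x b = {x}" using x by (auto simp: left_half_def right_half_def S_iff)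
  moreover have "k integrable_on left_half a x" "k integrable_on right_half x b"
    using set_integrable_subset[OF k left_half_sets left_half_subset[OF x]]
      set_integrable_subset[OF k right_half_sets right_half_subset[OF x]] by (auto simp: absolutely_integrable_on_def)
  ultimately show ?thesis using integral_Un[of k "left_half a x" "right_half x b"] U by simp
qed

lemma right_norm_pos:
  assumes x: "x \<in> S" and si: "square_integrable S u"
  shows "0 < integral (right_half x b) (\<lambda>y. (norm (u y))\<^sup>2)"
proof -
  obtain d where d: "ereal x < ereal d" "ereal d < b" using ereal_dense2[of "ereal x" b] x by (auto simp: S_iff)
  then have dS: "d \<in> S" "x < d" using x by (auto simp: S_iff intro: ereal_less_trans_le[of a x d])
  have sub: "{x..d} \<subseteq> S" by (rule Icc_subset[OF x dS(1)])
  have sub': "{x..d} \<subseteq> right_half x b" using d by (auto simp: right_half_def intro: ereal_le_trans_less)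
  have cont: "continuous_on {x..d} (\<lambda>x. (norm (u x))\<^sup>2)"
    by (intro continuous_intros continuous_on_subset[OF continuous_solution[OF sol_\<Phi>] sub])
  have i: "(\<lambda>x. (norm (u x))\<^sup>2) integrable_on {x..d}" by (rule integrable_continuous_real[OF cont])
  have "square_integrable (right_half x b) u"
    by (rule square_integrable_subset[OF si right_half_subset[OF x]]) simp_all
  then have "integral {x..d} (\<lambda>x. (norm (u x))\<^sup>2) \<le> integral (right_half x b) (\<lambda>x. (norm (u x))\<^sup>2)"
    by (intro integral_subset_le[OF sub' i] square_integrableD(3)) auto
  moreover have "0 \<le> integral {x..d} (\<lambda>x. (norm (u x))\<^sup>2)" by (rule integral_nonneg[OF i]) simp
  moreover have "integral {x..d} (\<lambda>x. (norm (u x))\<^sup>2) \<noteq> 0"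
    using integral_eq_0_iff[OF cont dS(2)] \<Phi>_nonzero[OF x, of l] dS(2) by force
  ultimately show ?thesis by linarith
qed

lemma cr_pos: "\<gamma> > 0 \<Longrightarrow> x \<in> S \<Longrightarrow> 1 / \<gamma> < cr x"
  using integral_norm_\<Phi>_pos[of x l] by (simp add: cr_def)

text \<open>Since 1/\<gamma> is at most minus the squared norm of u over the whole interval, adding
  the part over (a, x) leaves at most minus the part over (x, b). The tail bound is kept because
  \<open>cr\<close> tends to 0 at b in the borderline case \<gamma> = -||u||^(-2), where no uniform
  bound holds.\<close>

lemma cr_neg:
  assumes "\<gamma> < 0" "x \<in> S"
  shows "cr x \<le> - integral (right_half x b) (\<lambda>y. (norm (u y))\<^sup>2)" "cr x < 0"
proof -
  have si: "square_integrable S u" and le: "1 / \<gamma> \<le> - integral S (\<lambda>x. (norm (u x))\<^sup>2)"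
    using gamma_cases assms(1) by auto
  have "integral S (\<lambda>x. (norm (u x))\<^sup>2) = integral (left_half a x) (\<lambda>x. (norm (u x))\<^sup>2) + integral (right_half x b) (\<lambda>x. (norm (u x))\<^sup>2)"
    by (rule integral_split_S[OF assms(2) square_integrableD(2)[OF si S_sets]])
  then show 1: "cr x \<le> - integral (right_half x b) (\<lambda>y. (norm (u y))\<^sup>2)"
    using le by (simp add: cr_def)
  then show "cr x < 0" using right_norm_pos[OF assms(2) si] by linarith
qed

lemma cr_nonzero: "x \<in> S \<Longrightarrow> cr x \<noteq> 0"
  using cr_pos[of x] cr_neg(2)[of x] gamma_nonzero zero_less_divide_1_iff[of \<gamma>]
  by (cases "\<gamma> > 0") (force, fastforce)

lemma ac_deriv_S:
  assumes "\<And>y. y \<in> S \<Longrightarrow> ac_deriv (left_half a y) f f'"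
  shows "ac_deriv S f f'"
  unfolding ac_deriv_def
proof (intro allI impI)
  fix c d :: real assume *: "c \<le> d \<and> {c..d} \<subseteq> S"
  then have "c \<in> S" "d \<in> S" by auto
  then have "{c..d} \<subseteq> left_half a d" by (auto simp: left_half_def S_iff intro: ereal_less_trans_le)
  then show "f' absolutely_integrable_on {c..d} \<and> f d = f c + integral {c..d} f'"
    using ac_derivD[OF assms[OF \<open>d \<in> S\<close>], of c d] * by simp
qed

lemma ac_deriv_II: "ac_deriv S (II z) (\<lambda>x. dotT (u x) (\<Phi> z x))"
  unfolding II_def[abs_def] by (rule ac_deriv_S, rule ac_deriv_upper_integral) (auto intro: dotT_\<Phi>_integrable)

lemma cr_diff: "p \<in> S \<Longrightarrow> q \<in> S \<Longrightarrow> p \<le> q \<Longrightarrow> cr q = cr p + integral {p..q} (\<lambda>x. (norm (u x))\<^sup>2)"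
  using integral_left_split[of q p "\<lambda>x. (norm (u x))\<^sup>2"] square_integrableD(2)[OF square_integrable_\<Phi>[of q l]]
  by (simp add: cr_def left_half_def S_iff)

lemma continuous_norm_u: "continuous_on S (\<lambda>x. (norm (u x))\<^sup>2)"
  by (intro continuous_intros continuous_solution[OF sol_\<Phi>])

lemma ac_deriv_cr: "ac_deriv S (\<lambda>x. complex_of_real (cr x)) (\<lambda>x. dotT (u x) (u x))"
proof -
  have "ac_deriv S (\<lambda>x. II l x + 1 / complex_of_real \<gamma>) (\<lambda>x. dotT (u x) (u x) + 0)"
    by (rule ac_deriv_add[OF ac_deriv_II ac_deriv_const])
  then show ?thesis by (rule ac_deriv_cong) (auto simp: II_l)
qed

text \<open>The integrand is -|u_\<gamma>|^2, so square integrability of u_\<gamma> near b will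
  bound the reciprocal of \<open>cr\<close> there.\<close>

lemma inverse_cr_diff:
  assumes pq: "p \<in> S" "q \<in> S" "p \<le> q"
  shows "((\<lambda>x. - ((norm (u x))\<^sup>2 / (cr x)\<^sup>2)) has_integral (1 / cr q - 1 / cr p)) {p..q}"
proof (rule fundamental_theorem_of_calculus[OF pq(3)])
  have sub: "{p..q} \<subseteq> S" by (rule Icc_subset[OF pq(1,2)])
  fix x assume x: "x \<in> {p..q}"
  have "((\<lambda>t. integral {p..t} (\<lambda>x. (norm (u x))\<^sup>2)) has_vector_derivative (norm (u x))\<^sup>2) (at x within {p..q})"
    by (rule integral_has_vector_derivative[OF continuous_on_subset[OF continuous_norm_u sub] x])
  then have "((\<lambda>t. cr p + integral {p..t} (\<lambda>x. (norm (u x))\<^sup>2)) has_vector_derivative (norm (u x))\<^sup>2) (at x within {p..q})"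
    by (auto intro!: derivative_eq_intros)
  then have d: "(cr has_vector_derivative (norm (u x))\<^sup>2) (at x within {p..q})"
    by (rule has_vector_derivative_transform[OF x, rotated]) (use sub pq(1) in \<open>auto intro: cr_diff\<close>)
  have "((\<lambda>t. 1 / cr t) has_field_derivative - ((norm (u x))\<^sup>2 / (cr x)\<^sup>2)) (at x within {p..q})"
    using d cr_nonzero[of x] x sub unfolding has_real_derivative_iff_has_vector_derivative[symmetric]
    by (auto intro!: derivative_eq_intros simp: power2_eq_square)
  then show "((\<lambda>t. 1 / cr t) has_vector_derivative - ((norm (u x))\<^sup>2 / (cr x)\<^sup>2)) (at x within {p..q})"
    by (simp add: has_real_derivative_iff_has_vector_derivative)
qed

lemma continuous_cr: "continuous_on S cr"
proof -
  have "continuous_on S (\<lambda>x. Re (complex_of_real (cr x)))"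
    by (intro continuous_intros ac_deriv_continuous[OF ac_deriv_cr S_interval])
  then show ?thesis by simp
qed

lemma ac_deriv_inverse_cr:
  "ac_deriv S (\<lambda>x. 1 / complex_of_real (cr x)) (\<lambda>x. - (dotT (u x) (u x) / (complex_of_real (cr x))\<^sup>2))"
  unfolding ac_deriv_def
proof (intro allI impI)
  fix c d :: real assume *: "c \<le> d \<and> {c..d} \<subseteq> S"
  let ?k = "\<lambda>x. - ((norm (u x))\<^sup>2 / (cr x)\<^sup>2)"
  let ?f = "\<lambda>x. - (dotT (u x) (u x) / (complex_of_real (cr x))\<^sup>2)"
  have eq: "?f x = complex_of_real (?k x)" if "x \<in> {c..d}" for x
    using dotT_uu[of x] that * by auto
  have cont: "continuous_on {c..d} ?k"
    by (intro continuous_intros continuous_on_subset[OF continuous_norm_u] continuous_on_subset[OF continuous_cr])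
      (use * cr_nonzero in auto)
  have "(\<lambda>x. complex_of_real (?k x)) absolutely_integrable_on {c..d}"
    by (intro absolutely_integrable_continuous_real continuous_on_of_real cont)
  then have ai: "?f absolutely_integrable_on {c..d}"
    by (rule absolutely_integrable_spike[OF _ negligible_empty]) (use eq in auto)
  have "integral {c..d} ?f = integral {c..d} (\<lambda>x. complex_of_real (?k x))"
    by (rule Henstock_Kurzweil_Integration.integral_cong) (rule eq)
  also have "\<dots> = complex_of_real (integral {c..d} ?k)"
    by (rule integral_of_real_complex[OF integrable_continuous_real[OF cont]])
  also have "integral {c..d} ?k = 1 / cr d - 1 / cr c"
    by (rule integral_unique[OF inverse_cr_diff]) (use * in auto)
  finally show "?f absolutely_integrable_on {c..d} \<and> 1 / complex_of_real (cr d) = 1 / complex_of_real (cr c) + integral {c..d} ?f"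
    using ai by simp
qed

lemma ival_D': "ival D' = S" and ends_D': "end_left D' = a" "end_right D' = b"
  by (simp_all add: double_commutation_def ival_def)

lemma P_eq: "P x = pot D x + Q_gamma D \<gamma> u x"
  using gamma_nonzero by (simp add: double_commutation_def)

lemma bc_D': "dirac.bc_left D' = u_gamma D \<gamma> u" "dirac.bc_right D' = u_gamma D \<gamma> u"
  using gamma_nonzero by (simp_all add: double_commutation_def)

lemma u_gamma_eq: "x \<in> S \<Longrightarrow> u_gamma D \<gamma> u x = (1 / complex_of_real (cr x)) *s u x"
  using gamma_nonzero by (simp add: u_gamma_def c_gamma_eq)

lemma Q_gamma_nth:
  assumes "x \<in> S"
  shows "Q_gamma D \<gamma> u x $ 1 $ 1 = - (2 * (u x $ 1 * u x $ 2) / complex_of_real (cr x))"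
    "Q_gamma D \<gamma> u x $ 1 $ 2 = ((u x $ 1)\<^sup>2 - (u x $ 2)\<^sup>2) / complex_of_real (cr x)"
    "Q_gamma D \<gamma> u x $ 2 $ 1 = ((u x $ 1)\<^sup>2 - (u x $ 2)\<^sup>2) / complex_of_real (cr x)"
    "Q_gamma D \<gamma> u x $ 2 $ 2 = 2 * (u x $ 1 * u x $ 2) / complex_of_real (cr x)"
  using gamma_nonzero c_gamma_eq[OF assms]
  by (simp_all add: Q_gamma_def sigma1_def sigma3_def matrix_matrix_mult_def mat_def sum_2)

text \<open>The transformation intertwines \<open>\<tau>\<close> and \<open>\<tau>\<^sub>\<gamma>\<close> up to the boundary term \<open>W(u, f) - l J\<close>.\<close>

lemma tau_eq_transform:
  assumes f: "tau_eq Q S f h" and J: "ac_deriv S J (\<lambda>x. dotT (u x) (f x))"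
  shows "tau_eq P S (\<lambda>x. f x - (J x / complex_of_real (cr x)) *s u x)
    (\<lambda>x. h x + ((wronskian u f x - l * J x) / complex_of_real (cr x)) *s u x)"
proof -
  let ?c = "\<lambda>x. complex_of_real (cr x)"
  let ?R = "\<lambda>x. (- 1) * (J x * (1 / ?c x))"
  let ?R' = "\<lambda>x. (- 1) * (dotT (u x) (f x) * (1 / ?c x) + J x * - (dotT (u x) (u x) / (?c x)\<^sup>2))"
  have R: "ac_deriv S ?R ?R'"
    by (rule ac_deriv_scale[OF ac_deriv_mult[OF J ac_deriv_inverse_cr]])
  have 1: "tau_eq Q S (\<lambda>x. f x + ?R x *s u x) (\<lambda>x. h x + (?R x *s (l *s u x) + ?R' x *s vector [- u x $ 2, u x $ 1]))"
    by (rule tau_eq_add[OF f tau_eq_scale_ac[OF sol_\<Phi> R S_sets] S_sets])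
  have 2: "tau_eq P S (\<lambda>x. f x + ?R x *s u x) (\<lambda>x. h x + (?R x *s (l *s u x) + ?R' x *s vector [- u x $ 2, u x $ 1])
      + Q_gamma D \<gamma> u x *v (f x + ?R x *s u x))"
    unfolding P_eq[abs_def] by (rule tau_eq_add_potential[OF 1 S_sets])
  show ?thesis
  proof (rule tau_eq_cong[OF 2 S_sets])
    fix x assume x: "x \<in> S"
    show "f x + ?R x *s u x = f x - (J x / ?c x) *s u x" by (simp add: vec2_eq_iff)
    have c: "?c x \<noteq> 0" using cr_nonzero[OF x] by simp
    \<comment> \<open>Here the form of \<open>Q_gamma\<close> is used. It maps u to (u^T u / c)
      (-u2, u1), which cancels the terms with J, and f to (u^T f / c) (-u2, u1) + (W(u, f) / c) u,
      whose first part cancels the remaining term of R'.\<close>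
    show "h x + (?R x *s (l *s u x) + ?R' x *s vector [- u x $ 2, u x $ 1]) + Q_gamma D \<gamma> u x *v (f x + ?R x *s u x)
        = h x + ((wronskian u f x - l * J x) / ?c x) *s u x"
      unfolding vec2_eq_iff vector_add_component vector_smult_component matrix_vector_mult_2 Q_gamma_nth[OF x] vector_2
        wronskian_def dotT_eq
      using c by (simp add: field_simps power2_eq_square)
  qed
qed

text \<open>J is determined by its derivative only up to a constant. The hypothesis on W fixes the
  constant and turns the remainder W(u, f) - l J into -z J, as the eigenvalue equation
  requires.\<close>

lemma solution_transform:
  assumes f: "tau_eq Q S f (\<lambda>x. z *s f x)" and J: "ac_deriv S J (\<lambda>x. dotT (u x) (f x))"
    and W: "\<And>x. x \<in> S \<Longrightarrow> wronskian u f x = (l - z) * J x"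
  shows "tau_eq P S (\<lambda>x. f x - (J x / complex_of_real (cr x)) *s u x)
    (\<lambda>x. z *s (f x - (J x / complex_of_real (cr x)) *s u x))"
proof (rule tau_eq_cong[OF tau_eq_transform[OF f J] S_sets])
  fix x assume x: "x \<in> S"
  have c: "complex_of_real (cr x) \<noteq> 0" using cr_nonzero[OF x] by simp
  show "z *s f x + ((wronskian u f x - l * J x) / complex_of_real (cr x)) *s u x = z *s (f x - (J x / complex_of_real (cr x)) *s u x)"
    unfolding W[OF x] vec2_eq_iff using c by (simp add: field_simps)
qed simp

text \<open>\<open>\<bar>f\<^sub>\<gamma>\<bar>\<^sup>2 = \<bar>f\<bar>\<^sup>2 - (\<bar>J\<bar>\<^sup>2 / c\<^sub>\<gamma>)'\<close>, where \<open>f\<^sub>\<gamma>\<close> is the transform of \<open>f\<close>.\<close>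

lemma integral_norm_transform:
  assumes f: "continuous_on S f" and J: "ac_deriv S J (\<lambda>x. dotT (u x) (f x))"
    and pq: "p \<in> S" "q \<in> S" "p \<le> q"
  shows "integral {p..q} (\<lambda>x. (norm (f x - (J x / complex_of_real (cr x)) *s u x))\<^sup>2)
    = integral {p..q} (\<lambda>x. (norm (f x))\<^sup>2) - ((norm (J q))\<^sup>2 / cr q - (norm (J p))\<^sup>2 / cr p)"
proof -
  let ?c = "\<lambda>x. complex_of_real (cr x)"
  let ?g = "\<lambda>x. f x - (J x / ?c x) *s u x"
  let ?k = "\<lambda>x. (dotT (u x) (f x) * cnj (J x) + J x * cnj (dotT (u x) (f x))) * (1 / ?c x)
      + J x * cnj (J x) * - (dotT (u x) (u x) / (?c x)\<^sup>2)"
  have sub: "{p..q} \<subseteq> S" by (rule Icc_subset[OF pq(1,2)])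
  have "ac_deriv S (\<lambda>x. J x * cnj (J x) * (1 / ?c x)) ?k"
    by (intro ac_deriv_mult ac_deriv_cnj J ac_deriv_inverse_cr)
  from ac_derivD[OF this pq(3) sub]
  have ki: "?k absolutely_integrable_on {p..q}"
    and k: "J q * cnj (J q) * (1 / ?c q) = J p * cnj (J p) * (1 / ?c p) + integral {p..q} ?k" by auto
  have cJ: "continuous_on S J" by (rule ac_deriv_continuous[OF J S_interval])
  have cf: "continuous_on {p..q} f" by (rule continuous_on_subset[OF f sub])
  have i: "(\<lambda>x. (norm (f x))\<^sup>2) integrable_on {p..q}"
    by (intro integrable_continuous_real continuous_intros cf)
  have eq: "complex_of_real ((norm (?g x))\<^sup>2) = complex_of_real ((norm (f x))\<^sup>2) - ?k x" if "x \<in> {p..q}" for x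
  proof -
    have x: "x \<in> S" using that sub by auto
    have c: "?c x \<noteq> 0" using cr_nonzero[OF x] by simp
    show ?thesis
      unfolding dotT_vcnj[symmetric] dotT_eq vcnj_nth
      using c by (simp add: u_cnj[OF x] field_simps power2_eq_square)
  qed
  have ri: "(\<lambda>x. complex_of_real ((norm (f x))\<^sup>2)) integrable_on {p..q}"
    using integrable_linear[OF i bounded_linear_of_real] by (simp add: o_def)
  have eq2: "(norm (?g x))\<^sup>2 = (norm (f x))\<^sup>2 - Re (?k x)" if "x \<in> {p..q}" for x
    using arg_cong[OF eq[OF that], of Re] by (simp only: Re_complex_of_real minus_complex.simps)
  have rk: "(\<lambda>x. Re (?k x)) integrable_on {p..q}"
    using integrable_linear[OF _ bounded_linear_Re, of ?k "{p..q}"] ki by (auto simp: o_def absolutely_integrable_on_def)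
  have rke: "integral {p..q} (\<lambda>x. Re (?k x)) = Re (integral {p..q} ?k)"
    using integral_linear[OF _ bounded_linear_Re, of ?k "{p..q}"] ki by (auto simp: o_def absolutely_integrable_on_def)
  have ie: "integral {p..q} ?k = complex_of_real ((norm (J q))\<^sup>2 / cr q - (norm (J p))\<^sup>2 / cr p)"
    using k by (simp add: complex_norm_square[symmetric])
  have "integral {p..q} (\<lambda>x. (norm (?g x))\<^sup>2) = integral {p..q} (\<lambda>x. (norm (f x))\<^sup>2 - Re (?k x))"
    by (rule Henstock_Kurzweil_Integration.integral_cong) (rule eq2)
  also have "\<dots> = integral {p..q} (\<lambda>x. (norm (f x))\<^sup>2) - Re (integral {p..q} ?k)"
    by (simp only: integral_diff[OF i rk] rke)
  finally show ?thesis unfolding ie by simp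
qed

end

text \<open>Reaches the exceptional parameter l, where the quotient formula for \<Theta>_\<gamma>
  does not apply. The integral form of the system is passed to the limit along zs by dominated
  convergence; entire dependence bounds U at each fixed x, and
  \<open>solution_family_bounded\<close> makes the bound uniform in x.\<close>

lemma solution_limit:
  fixes P :: "real \<Rightarrow> complex^2^2"
  assumes Pi: "\<And>c d i j. {c..d} \<subseteq> S \<Longrightarrow> (\<lambda>x. P x $ i $ j) absolutely_integrable_on {c..d}"
    and S: "S \<in> sets lebesgue" and hol: "\<And>x i. x \<in> S \<Longrightarrow> (\<lambda>z. U z x $ i) holomorphic_on UNIV"
    and sol: "\<And>z. z \<noteq> l \<Longrightarrow> tau_eq P S (U z) (\<lambda>x. z *s U z x)"
  shows "tau_eq P S (U l) (\<lambda>x. l *s U l x)"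
proof -
  define zs where "zs n = l + complex_of_real (inverse (real (Suc n)))" for n
  have e0: "complex_of_real (inverse (real (Suc n))) \<noteq> 0" for n unfolding of_real_eq_0_iff by simp
  have zl: "zs n \<noteq> l" for n unfolding zs_def using e0[of n] by simp
  have "zs \<longlonglongrightarrow> l + complex_of_real 0"
    unfolding zs_def by (intro tendsto_add tendsto_const tendsto_of_real LIMSEQ_inverse_real_of_nat)
  then have zlim: "zs \<longlonglongrightarrow> l" by simp
  have zb: "norm (zs n) \<le> norm l + 1" for n
  proof -
    have "norm (zs n) \<le> norm l + norm (complex_of_real (inverse (real (Suc n))))"
      unfolding zs_def by (rule norm_triangle_ineq)
    also have "norm (complex_of_real (inverse (real (Suc n)))) \<le> 1"
      unfolding norm_of_real by (simp add: inverse_le_1_iff)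
    finally show ?thesis by simp
  qed
  have Ulim: "(\<lambda>n. U (zs n) x $ i) \<longlonglongrightarrow> U l x $ i" if "x \<in> S" for x i
  proof -
    have c: "isCont (\<lambda>z. U z x $ i) l"
      using holomorphic_on_imp_continuous_on[OF hol[OF that]] by (simp add: continuous_on_eq_continuous_at)
    show ?thesis by (rule isCont_tendsto_compose[OF c zlim])
  qed
  have bdd: "\<exists>B. \<forall>n. \<forall>y\<in>{c..d}. norm (U (zs n) y) \<le> B" if sub: "{c..d} \<subseteq> S" for c d
  proof -
    have sb: "{c..d} \<in> sets lebesgue" by simp
    have "\<exists>B. \<forall>w\<in>range zs. \<forall>y\<in>{c..d}. norm (U w y) \<le> B"
    proof (rule solution_family_bounded[where Q=P and z="\<lambda>w. w" and R="norm l + 1"])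
      show "tau_eq P {c..d} (U w) (\<lambda>x. w *s U w x)" if "w \<in> range zs" for w
        by (rule tau_eq_subset[OF sol sub S sb]) (use that zl in auto)
      show "\<exists>B. \<forall>w\<in>range zs. norm (U w y) \<le> B" if y: "y \<in> {c..d}" for y
      proof -
        have "continuous_on (cball 0 (norm l + 1)) (\<lambda>w. \<chi> i. U w y $ i)"
          using sub y by (intro continuous_on_vec_lambda holomorphic_on_imp_continuous_on holomorphic_on_subset[OF hol]) auto
        then have "continuous_on (cball 0 (norm l + 1)) (\<lambda>w. U w y)" by simp
        from compact_imp_bounded[OF compact_continuous_image[OF this compact_cball]]
        obtain B where B: "\<And>w. w \<in> cball 0 (norm l + 1) \<Longrightarrow> norm (U w y) \<le> B" unfolding bounded_iff by blast
        show ?thesis by (rule exI[of _ B]) (use B zb in \<open>auto simp: mem_cball_0\<close>)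
      qed
    qed (use Pi sub zb in auto)
    then show ?thesis by auto
  qed
  \<comment> \<open>j is the component of U and j1 the row of the potential in its equation. The
    derivative part swaps the rows, so j = 1 goes with j1 = 2 and vice versa.\<close>
  have ac: "ac_deriv S (\<lambda>x. U l x $ j) (F l)"
    if Fn: "\<And>n. ac_deriv S (\<lambda>x. U (zs n) x $ j) (F (zs n))"
      and Flim: "\<And>x. x \<in> S \<Longrightarrow> (\<lambda>n. F (zs n) x) \<longlonglongrightarrow> F l x"
      and Fb: "\<And>n x. norm (F (zs n) x) \<le> (norm l + 1 + norm (P x $ j1 $ 1) + norm (P x $ j1 $ 2)) * norm (U (zs n) x)" for F j j1
    unfolding ac_deriv_def
  proof (intro allI impI)
    fix c d :: real assume cd: "c \<le> d \<and> {c..d} \<subseteq> S"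
    then have sub: "{c..d} \<subseteq> S" and "c \<in> S" "d \<in> S" by auto
    obtain B where B: "\<And>n y. y \<in> {c..d} \<Longrightarrow> norm (U (zs n) y) \<le> B" using bdd[OF sub] by blast
    let ?h = "\<lambda>x. (norm l + 1 + norm (P x $ j1 $ 1) + norm (P x $ j1 $ 2)) * B"
    have hi: "?h integrable_on {c..d}"
      using Pi[OF sub] by (intro integrable_on_mult_left integrable_add) (auto simp: absolutely_integrable_on_def)
    have ai: "F (zs n) absolutely_integrable_on {c..d}"
      and eq: "U (zs n) d $ j = U (zs n) c $ j + integral {c..d} (F (zs n))" for n
      using ac_derivD[OF Fn, of c d] cd by auto
    have le: "norm (F (zs n) x) \<le> ?h x" if "x \<in> {c..d}" for n x
      by (rule order_trans[OF Fb]) (intro mult_left_mono B that, auto intro!: add_nonneg_nonneg)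
    have lim: "(\<lambda>n. F (zs n) x) \<longlonglongrightarrow> F l x" if "x \<in> {c..d}" for x using Flim that sub by auto
    have "norm (F l x) \<le> ?h x" if "x \<in> {c..d}" for x
      by (rule LIMSEQ_le_const2[OF tendsto_norm[OF lim[OF that]]]) (use le[OF that] in blast)
    then have "F l absolutely_integrable_on {c..d}"
      by (rule dominated_convergence_absolutely_integrable[OF ai hi _ lim])
    moreover have "(\<lambda>n. integral {c..d} (F (zs n))) \<longlonglongrightarrow> integral {c..d} (F l)"
      by (rule dominated_convergence(2)[OF _ hi le lim]) (use ai in \<open>auto simp: absolutely_integrable_on_def\<close>)
    then have "(\<lambda>n. U (zs n) c $ j + integral {c..d} (F (zs n))) \<longlonglongrightarrow> U l c $ j + integral {c..d} (F l)"
      by (intro tendsto_add Ulim \<open>c \<in> S\<close>)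
    then have "(\<lambda>n. U (zs n) d $ j) \<longlonglongrightarrow> U l c $ j + integral {c..d} (F l)" unfolding eq[symmetric] .
    then have "U l d $ j = U l c $ j + integral {c..d} (F l)"
      by (rule LIMSEQ_unique[OF Ulim[OF \<open>d \<in> S\<close>]])
    ultimately show "F l absolutely_integrable_on {c..d} \<and> U l d $ j = U l c $ j + integral {c..d} (F l)" by blast
  qed
  have b: "norm (v1 * U (zs n) x $ 1) \<le> norm v1 * norm (U (zs n) x)" "norm (v1 * U (zs n) x $ 2) \<le> norm v1 * norm (U (zs n) x)" for v1 n x
    unfolding norm_mult by (intro mult_left_mono Finite_Cartesian_Product.norm_nth_le norm_ge_zero)+
  have zb': "norm (zs n) * norm (U (zs n) x) \<le> (norm l + 1) * norm (U (zs n) x)" for n x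
    by (intro mult_right_mono zb) simp
  let ?F1 = "\<lambda>z x. (z *s U z x) $ 2 - P x $ 2 $ 1 * U z x $ 1 - P x $ 2 $ 2 * U z x $ 2"
  let ?F2 = "\<lambda>z x. P x $ 1 $ 1 * U z x $ 1 + P x $ 1 $ 2 * U z x $ 2 - (z *s U z x) $ 1"
  have "ac_deriv S (\<lambda>x. U l x $ 1) (?F1 l)"
  proof (rule ac[of 1 ?F1 2])
    show "ac_deriv S (\<lambda>x. U (zs n) x $ 1) (?F1 (zs n))" for n by (rule tau_eq_deriv1[OF S sol[OF zl]])
    show "(\<lambda>n. ?F1 (zs n) x) \<longlonglongrightarrow> ?F1 l x" if "x \<in> S" for x
      unfolding vector_smult_component by (intro tendsto_diff tendsto_mult tendsto_const Ulim[OF that] zlim)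
    show "norm (?F1 (zs n) x) \<le> (norm l + 1 + norm (P x $ 2 $ 1) + norm (P x $ 2 $ 2)) * norm (U (zs n) x)" for n x
    proof -
      have "norm (?F1 (zs n) x) \<le> norm (zs n * U (zs n) x $ 2) + norm (P x $ 2 $ 1 * U (zs n) x $ 1) + norm (P x $ 2 $ 2 * U (zs n) x $ 2)"
        unfolding vector_smult_component by (intro order_trans[OF norm_triangle_ineq4] add_right_mono norm_triangle_ineq4)
      also have "\<dots> \<le> (norm l + 1 + norm (P x $ 2 $ 1) + norm (P x $ 2 $ 2)) * norm (U (zs n) x)"
        unfolding distrib_right[of _ _ "norm (U (zs n) x)"] using b(2)[of "zs n" n x] zb'[of n x] b(1)[of "P x $ 2 $ 1" n x] b(2)[of "P x $ 2 $ 2" n x]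
        by (simp add: algebra_simps)
      finally show ?thesis .
    qed
  qed
  moreover have "ac_deriv S (\<lambda>x. U l x $ 2) (?F2 l)"
  proof (rule ac[of 2 ?F2 1])
    show "ac_deriv S (\<lambda>x. U (zs n) x $ 2) (?F2 (zs n))" for n by (rule tau_eq_deriv2[OF S sol[OF zl]])
    show "(\<lambda>n. ?F2 (zs n) x) \<longlonglongrightarrow> ?F2 l x" if "x \<in> S" for x
      unfolding vector_smult_component by (intro tendsto_diff tendsto_add tendsto_mult tendsto_const Ulim[OF that] zlim)
    show "norm (?F2 (zs n) x) \<le> (norm l + 1 + norm (P x $ 1 $ 1) + norm (P x $ 1 $ 2)) * norm (U (zs n) x)" for n x
    proof -
      have "norm (?F2 (zs n) x) \<le> norm (P x $ 1 $ 1 * U (zs n) x $ 1) + norm (P x $ 1 $ 2 * U (zs n) x $ 2) + norm (zs n * U (zs n) x $ 1)"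
        unfolding vector_smult_component by (intro order_trans[OF norm_triangle_ineq4] add_right_mono norm_triangle_ineq)
      also have "\<dots> \<le> (norm l + 1 + norm (P x $ 1 $ 1) + norm (P x $ 1 $ 2)) * norm (U (zs n) x)"
        unfolding distrib_right[of _ _ "norm (U (zs n) x)"] using b(1)[of "zs n" n x] zb'[of n x] b(1)[of "P x $ 1 $ 1" n x] b(2)[of "P x $ 1 $ 2" n x]
        by (simp add: algebra_simps)
      finally show ?thesis .
    qed
  qed
  ultimately show ?thesis unfolding tau_eq_iff[OF S] by blast
qed

section \<open>The transformed entire pair\<close>

context commutation
begin

abbreviation "uG \<equiv> u_gamma D \<gamma> u"

definition PhiG :: "complex \<Rightarrow> real \<Rightarrow> complex^2" where
  "PhiG z x = \<Phi> z x - (II z x / complex_of_real (cr x)) *s u x"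

text \<open>The quotient has a removable singularity at l, and the first branch is the value that
  removes it: the derivative of the numerator, see \<open>ThetaG_nth\<close>. \<open>PhiG\<close>
  avoids the distinction by using the integral \<open>II\<close>.\<close>

definition ThetaG :: "complex \<Rightarrow> real \<Rightarrow> complex^2" where
  "ThetaG z x = (if z = l then \<Theta> l x + wronskian u (z_deriv \<Theta> l) x *s uG x + of_real \<gamma> *s z_deriv PhiG l x
     else \<Theta> z x + (1 / (z - l)) *s (wronskian u (\<Theta> z) x *s uG x + of_real \<gamma> *s PhiG z x))"

lemma P_nth: "P x $ i $ j = Q x $ i $ j + Q_gamma D \<gamma> u x $ i $ j"
  by (simp add: P_eq)

lemma P_sym: "x \<in> S \<Longrightarrow> P x $ 1 $ 2 = P x $ 2 $ 1"
  by (simp add: P_nth Q_gamma_nth pot_sym)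

lemma Q_gamma_Reals: "x \<in> S \<Longrightarrow> Q_gamma D \<gamma> u x $ i $ j \<in> \<real>"
proof -
  assume x: "x \<in> S"
  have r: "u x $ k \<in> \<real>" for k by (rule real_on_reals(1)[OF x l_Reals])
  have n: "(2::complex) \<in> \<real>" by simp
  show ?thesis
    using exhaust_2[of i] exhaust_2[of j]
    by (elim disjE; simp only: Q_gamma_nth[OF x]; intro Reals_minus Reals_diff Reals_divide Reals_mult Reals_power Reals_of_real r n)
qed

lemma P_real: "x \<in> S \<Longrightarrow> P x $ i $ j \<in> \<real>"
  unfolding P_nth by (intro Reals_add pot_real Q_gamma_Reals)

lemma P_int:
  assumes sub: "{c..d} \<subseteq> S"
  shows "(\<lambda>x. P x $ i $ j) absolutely_integrable_on {c..d}"
proof -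
  have cu: "continuous_on {c..d} (\<lambda>x. u x $ k)" for k
    using continuous_on_subset[OF continuous_solution[OF sol_\<Phi>] sub] by (rule continuous_on_component)
  have cc: "continuous_on {c..d} (\<lambda>x. complex_of_real (cr x))"
    by (intro continuous_intros continuous_on_subset[OF continuous_cr] sub)
  have cnz: "\<forall>x\<in>{c..d}. complex_of_real (cr x) \<noteq> 0" using cr_nonzero sub by auto
  have m: "(\<lambda>x. - (2 * (u x $ 1 * u x $ 2) / complex_of_real (cr x))) absolutely_integrable_on {c..d}"
    "(\<lambda>x. 2 * (u x $ 1 * u x $ 2) / complex_of_real (cr x)) absolutely_integrable_on {c..d}"
    "(\<lambda>x. ((u x $ 1)\<^sup>2 - (u x $ 2)\<^sup>2) / complex_of_real (cr x)) absolutely_integrable_on {c..d}"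
    by (intro absolutely_integrable_continuous_real continuous_intros cu cc cnz)+
  have xS: "x \<in> S" if "x \<in> {c..d} - {}" for x using sub that by auto
  have "(\<lambda>x. Q_gamma D \<gamma> u x $ 1 $ 1) absolutely_integrable_on {c..d}"
    by (rule absolutely_integrable_spike[OF m(1) negligible_empty]) (rule Q_gamma_nth[OF xS])
  moreover have "(\<lambda>x. Q_gamma D \<gamma> u x $ 1 $ 2) absolutely_integrable_on {c..d}"
    by (rule absolutely_integrable_spike[OF m(3) negligible_empty]) (rule Q_gamma_nth[OF xS])
  moreover have "(\<lambda>x. Q_gamma D \<gamma> u x $ 2 $ 1) absolutely_integrable_on {c..d}"
    by (rule absolutely_integrable_spike[OF m(3) negligible_empty]) (rule Q_gamma_nth[OF xS])
  moreover have "(\<lambda>x. Q_gamma D \<gamma> u x $ 2 $ 2) absolutely_integrable_on {c..d}"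
    by (rule absolutely_integrable_spike[OF m(2) negligible_empty]) (rule Q_gamma_nth[OF xS])
  ultimately have "(\<lambda>x. Q_gamma D \<gamma> u x $ i $ j) absolutely_integrable_on {c..d}"
    using exhaust_2[of i] exhaust_2[of j] by auto
  then show ?thesis unfolding P_nth by (intro set_integral_add pot_int sub)
qed

lemma sol_PhiG: "tau_eq P S (PhiG z) (\<lambda>x. z *s PhiG z x)"
  unfolding PhiG_def by (rule solution_transform[OF sol_\<Phi> ac_deriv_II]) (simp add: wronskian_\<Phi>_\<Phi> II_def)

text \<open>Off l, \<open>II\<close> is minus the difference quotient of the entire function W(u,
  \<Phi>(z)), so its singularity at l is removable. That the integral at z = l is the removing value
  is the content of \<open>deriv_wronskian_\<Phi>\<close>.\<close>

lemma hol_II: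
  assumes x: "x \<in> S"
  shows "(\<lambda>z. II z x) holomorphic_on UNIV"
proof -
  let ?A = "\<lambda>z. wronskian u (\<Phi> z) x"
  have A: "?A holomorphic_on UNIV" unfolding wronskian_def by (intro holomorphic_intros hol_\<Phi> x)
  have "(\<lambda>z. - (if z = l then deriv ?A l else (?A z - ?A l) / (z - l))) holomorphic_on UNIV"
    by (intro holomorphic_on_minus pole_lemma[OF A]) simp
  moreover have "- (if z = l then deriv ?A l else (?A z - ?A l) / (z - l)) = II z x" for z
    using DERIV_imp_deriv[OF deriv_wronskian_\<Phi>[OF x l_Reals]] wronskian_\<Phi>_\<Phi>[OF x, of l z]
    by (simp add: II_def) (simp add: field_simps)
  ultimately show ?thesis by simp
qed

lemma hol_PhiG:
  assumes x: "x \<in> S"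
  shows "(\<lambda>z. PhiG z x $ i) holomorphic_on UNIV"
  unfolding PhiG_def vector_minus_component vector_smult_component
  by (intro holomorphic_intros hol_\<Phi> hol_II x) (use cr_nonzero[OF x] in auto)

text \<open>At z = l the integral \<open>II\<close> equals c - 1/\<gamma> with c =
  \<open>cr x\<close>, so u - (1 - 1/(\<gamma> c)) u = u / (\<gamma> c) remains.\<close>

lemma PhiG_l:
  assumes x: "x \<in> S"
  shows "PhiG l x = (1 / of_real \<gamma>) *s uG x"
proof -
  have c: "complex_of_real (cr x) \<noteq> 0" using cr_nonzero[OF x] by simp
  show ?thesis
    using c gamma_nonzero by (simp add: PhiG_def II_l[OF x] u_gamma_eq[OF x] vec2_eq_iff field_simps)
qed

text \<open>Puts each component into the shape of \<open>pole_lemma\<close>, which then gives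
  holomorphy of \<open>ThetaG\<close> across l.\<close>

lemma ThetaG_nth:
  fixes i :: 2
  assumes x: "x \<in> S"
  defines "N \<equiv> \<lambda>z. wronskian u (\<Theta> z) x * uG x $ i + of_real \<gamma> * PhiG z x $ i"
  shows "ThetaG z x $ i = \<Theta> z x $ i + (if z = l then deriv N l else (N z - N l) / (z - l))"
    "N holomorphic_on UNIV"
proof -
  \<comment> \<open>The pole cancels: W(u, \<Theta>(l)) = -1 contributes -u_\<gamma>, and \<gamma>
    \<Phi>_\<gamma>(l) is u_\<gamma>.\<close>
  have N0: "N l = 0"
    using wronskian_1[OF x, of l] wronskian_commute[of u "\<Theta> l" x] gamma_nonzero
    by (simp add: N_def PhiG_l[OF x])
  have dT: "((\<lambda>z. \<Theta> z x $ j) has_field_derivative z_deriv \<Theta> l x $ j) (at l)" for j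
    using holomorphic_derivI[OF hol_\<Theta>[OF x, of j UNIV] open_UNIV] by (simp add: z_deriv_def)
  have dP: "((\<lambda>z. PhiG z x $ j) has_field_derivative z_deriv PhiG l x $ j) (at l)" for j
    using holomorphic_derivI[OF hol_PhiG[OF x, of j] open_UNIV] by (simp add: z_deriv_def)
  have "(N has_field_derivative (wronskian u (z_deriv \<Theta> l) x * uG x $ i + of_real \<gamma> * z_deriv PhiG l x $ i)) (at l)"
    unfolding N_def wronskian_def
    by (rule derivative_eq_intros dT dP refl)+ (simp add: algebra_simps)
  then have d: "deriv N l = wronskian u (z_deriv \<Theta> l) x * uG x $ i + of_real \<gamma> * z_deriv PhiG l x $ i"
    by (rule DERIV_imp_deriv)
  show "ThetaG z x $ i = \<Theta> z x $ i + (if z = l then deriv N l else (N z - N l) / (z - l))"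
    unfolding d N0 by (simp add: ThetaG_def N_def add_divide_distrib)
  show "N holomorphic_on UNIV"
    unfolding N_def wronskian_def by (intro holomorphic_intros hol_\<Theta> hol_PhiG x)
qed

lemma hol_ThetaG:
  assumes x: "x \<in> S"
  shows "(\<lambda>z. ThetaG z x $ i) holomorphic_on UNIV"
  unfolding ThetaG_nth(1)[OF x]
  by (intro holomorphic_on_add hol_\<Theta>[OF x] pole_lemma[OF ThetaG_nth(2)[OF x]]) simp

text \<open>For z \<noteq> l Lagrange's identity provides an antiderivative J of u^T v with the
  normalisation of \<open>solution_transform\<close>, whether or not u^T v is integrable near a.
  This is the J used for \<Theta> and for Weyl solutions.\<close>

lemma ac_deriv_wronskian_u:
  assumes v: "tau_eq Q S v (\<lambda>x. z *s v x)" and z: "z \<noteq> l"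
  shows "ac_deriv S (\<lambda>x. - (wronskian u v x / (z - l))) (\<lambda>x. dotT (u x) (v x))"
    "wronskian u v x = (l - z) * - (wronskian u v x / (z - l))"
proof -
  have "ac_deriv S (\<lambda>x. (- 1 / (z - l)) * wronskian u v x) (\<lambda>x. (- 1 / (z - l)) * (dotT (l *s u x) (v x) - dotT (u x) (z *s v x)))"
    by (rule ac_deriv_scale[OF ac_deriv_wronskian[OF sol_\<Phi> v S_sets pot_sym]])
  then show "ac_deriv S (\<lambda>x. - (wronskian u v x / (z - l))) (\<lambda>x. dotT (u x) (v x))"
    by (rule ac_deriv_cong) (use z in \<open>auto simp: dotT_eq field_simps\<close>)
  show "wronskian u v x = (l - z) * - (wronskian u v x / (z - l))" using z by (simp add: field_simps)
qed

lemma transform_eq: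
  assumes "x \<in> S"
  shows "v x - (- (wronskian u v x / (z - l)) / complex_of_real (cr x)) *s u x = v x + (1 / (z - l) * wronskian u v x) *s uG x"
  by (simp add: u_gamma_eq[OF assms] vec2_eq_iff)

lemma sol_transform:
  assumes v: "tau_eq Q S v (\<lambda>x. z *s v x)" and z: "z \<noteq> l"
  shows "tau_eq P S (\<lambda>x. v x + (1 / (z - l) * wronskian u v x) *s uG x) (\<lambda>x. z *s (v x + (1 / (z - l) * wronskian u v x) *s uG x))"
  by (rule tau_eq_cong[OF solution_transform[OF v ac_deriv_wronskian_u(1)[OF v z] ac_deriv_wronskian_u(2)[OF v z]] S_sets])
    (simp_all only: transform_eq)

lemma PhiG_eq:
  assumes x: "x \<in> S" and z: "z \<noteq> l"
  shows "PhiG z x = \<Phi> z x + (1 / (z - l) * wronskian u (\<Phi> z) x) *s uG x"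
proof -
  have "1 / (z - l) * wronskian u (\<Phi> z) x = - II z x"
    using z unfolding wronskian_\<Phi>_\<Phi>[OF x] II_def[symmetric] by (simp add: field_simps)
  then show ?thesis
    unfolding PhiG_def u_gamma_eq[OF x] by (simp add: vec2_eq_iff)
qed

lemma sol_ThetaG: "tau_eq P S (ThetaG z) (\<lambda>x. z *s ThetaG z x)"
proof -
  have ne: "tau_eq P S (ThetaG z) (\<lambda>x. z *s ThetaG z x)" if z: "z \<noteq> l" for z
    by (rule tau_eq_cong[OF tau_eq_add[OF sol_transform[OF sol_\<Theta> z] tau_eq_scale[OF sol_PhiG S_sets, of "of_real \<gamma> / (z - l)"] S_sets] S_sets])
      (use z in \<open>auto simp: ThetaG_def vec2_eq_iff field_simps\<close>)
  show ?thesis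
  proof (cases "z = l")
    case True
    then show ?thesis
      using solution_limit[where U=ThetaG and l=l, OF P_int S_sets hol_ThetaG ne] by simp
  qed (rule ne)
qed

lemma uG_real: "x \<in> S \<Longrightarrow> uG x $ i \<in> \<real>"
  unfolding u_gamma_eq vector_smult_component
  by (intro Reals_mult Reals_divide Reals_of_real Reals_1 real_on_reals(1) l_Reals)

lemma PhiG_real: "x \<in> S \<Longrightarrow> z \<in> \<real> \<Longrightarrow> PhiG z x $ i \<in> \<real>"
proof -
  assume x: "x \<in> S" and z: "z \<in> \<real>"
  have "II z x \<in> \<real>"
    unfolding II_def
  proof (rule integral_Reals)
    show "dotT (u y) (\<Phi> z y) \<in> \<real>" if "y \<in> left_half a x" for y
      unfolding dotT_eq by (intro Reals_add Reals_mult real_on_reals(1) in_left_half_S[OF x that] l_Reals z)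
    show "(\<lambda>y. dotT (u y) (\<Phi> z y)) integrable_on left_half a x"
      using dotT_\<Phi>_integrable[OF x] by (auto simp: absolutely_integrable_on_def)
  qed
  then show ?thesis
    unfolding PhiG_def vector_minus_component vector_smult_component
    by (intro Reals_diff Reals_mult Reals_divide Reals_of_real real_on_reals(1) x z l_Reals)
qed

lemma ThetaG_real:
  assumes x: "x \<in> S" and z: "z \<in> \<real>"
  shows "ThetaG z x $ i \<in> \<real>"
proof -
  have ne: "ThetaG z x $ i \<in> \<real>" if z: "z \<in> \<real>" "z \<noteq> l" for z
  proof -
    have "ThetaG z x $ i = \<Theta> z x $ i + 1 / (z - l) * (wronskian u (\<Theta> z) x * uG x $ i + of_real \<gamma> * PhiG z x $ i)"
      using z by (simp add: ThetaG_def add_divide_distrib)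
    also have "\<dots> \<in> \<real>"
      unfolding wronskian_def
      by (intro Reals_add Reals_mult Reals_diff Reals_divide Reals_of_real Reals_1 real_on_reals x z l_Reals uG_real PhiG_real)
    finally show ?thesis .
  qed
  show ?thesis
    by (cases "z = l") (use entire_real_at[OF hol_ThetaG[OF x] ne l_Reals] ne[OF z] in auto)
qed

lemma wronskian_uG: "x \<in> S \<Longrightarrow> wronskian uG v x = wronskian u v x / complex_of_real (cr x)"
  by (simp add: wronskian_def u_gamma_eq diff_divide_distrib)

text \<open>Up to a multiple of \<Phi>_\<gamma>, the solutions are \<Theta> + k1 u and \<Phi> + k2
  u, where k1 and k2 are proportional to W(u, \<Theta>) and W(u, \<Phi>) with the same factor, so
  the two cross terms cancel. The point z = l follows by continuity in z.\<close>

lemma wronskian_ThetaG_PhiG: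
  assumes x: "x \<in> S"
  shows "wronskian (ThetaG z) (PhiG z) x = 1"
proof -
  have ne: "wronskian (ThetaG z) (PhiG z) x = 1" if z: "z \<noteq> l" for z
  proof -
    define k1 where "k1 = 1 / (z - l) * wronskian u (\<Theta> z) x * (1 / complex_of_real (cr x))"
    define k2 where "k2 = 1 / (z - l) * wronskian u (\<Phi> z) x * (1 / complex_of_real (cr x))"
    define k3 where "k3 = of_real \<gamma> / (z - l)"
    have e1: "ThetaG z x = (\<Theta> z x + k1 *s u x) + k3 *s PhiG z x"
      using z by (simp add: ThetaG_def vec2_eq_iff k1_def k3_def u_gamma_eq[OF x] add_divide_distrib)
    have e2: "PhiG z x = \<Phi> z x + k2 *s u x"
      unfolding PhiG_eq[OF x z] k2_def u_gamma_eq[OF x] by (simp add: vec2_eq_iff)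
    have "wronskian (ThetaG z) (PhiG z) x = wronskian (\<lambda>x. \<Theta> z x + k1 *s u x) (\<lambda>x. \<Phi> z x + k2 *s u x) x"
      unfolding wronskian_def e1 by (simp add: e2 algebra_simps)
    also have "\<dots> = wronskian (\<Theta> z) (\<Phi> z) x + k2 * wronskian (\<Theta> z) u x + k1 * wronskian u (\<Phi> z) x"
      by (simp add: wronskian_def algebra_simps)
    also have "k2 * wronskian (\<Theta> z) u x = - (k1 * wronskian u (\<Phi> z) x)"
      unfolding k1_def k2_def wronskian_commute[of "\<Theta> z" u x] by simp
    also have "wronskian (\<Theta> z) (\<Phi> z) x + - (k1 * wronskian u (\<Phi> z) x) + k1 * wronskian u (\<Phi> z) x = 1"
      using wronskian_1[OF x, of z] by simp
    finally show ?thesis .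
  qed
  have "(\<lambda>z. wronskian (ThetaG z) (PhiG z) x) holomorphic_on UNIV"
    unfolding wronskian_def by (intro holomorphic_intros hol_ThetaG hol_PhiG x)
  from entire_eq_at[OF this ne] show ?thesis by (cases "z = l") (use ne in auto)
qed

text \<open>\<open>cr\<close> increases. For \<gamma> > 0 it stays above its initial value
  1/\<gamma>; for \<gamma> < 0 it is negative, so left of x0 its modulus is smallest at x0.\<close>

lemma cr_bounded_below:
  assumes x0: "x0 \<in> S"
  shows "\<exists>\<delta>>0. \<forall>x\<in>left_half a x0. \<delta> \<le> \<bar>cr x\<bar>"
proof (cases "\<gamma> > 0")
  case True
  then show ?thesis
    using cr_pos[OF True in_left_half_S[OF x0]]
    by (intro exI[of _ "1 / \<gamma>"]) (auto intro: order_trans[OF less_imp_le abs_ge_self])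
next
  case False
  then have n: "\<gamma> < 0" using gamma_nonzero by simp
  have "\<bar>cr x0\<bar> \<le> \<bar>cr x\<bar>" if x: "x \<in> left_half a x0" for x
  proof -
    have xS: "x \<in> S" by (rule in_left_half_S[OF x0 x])
    have "0 \<le> integral {x..x0} (\<lambda>x. (norm (u x))\<^sup>2)"
      by (intro integral_nonneg integrable_continuous_real continuous_on_subset[OF continuous_norm_u] Icc_subset xS x0) auto
    then have "cr x \<le> cr x0" using cr_diff[OF xS x0] x by (simp add: left_half_def)
    then show ?thesis using cr_neg(2)[OF n x0] by simp
  qed
  then show ?thesis using cr_neg(2)[OF n x0] by (intro exI[of _ "\<bar>cr x0\<bar>"]) auto
qed

text \<open>Near a the denominator \<open>cr\<close> is bounded away from 0 and \<open>II\<close> is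
  bounded by Cauchy-Schwarz, so \<Phi>_\<gamma> is dominated by |\<Phi>| + |u|. For the boundary
  condition, W(u_\<gamma>, \<Phi>_\<gamma>) is (l - z) times \<open>II\<close> divided by
  \<open>cr\<close>, and \<open>II\<close> tends to 0.\<close>

lemma near_PhiG: "in_domain_near_left D' (PhiG z)"
proof -
  obtain x0 where x0: "x0 \<in> S" using S_nonempty by blast
  obtain \<delta> where \<delta>: "\<delta> > 0" "\<And>x. x \<in> left_half a x0 \<Longrightarrow> \<delta> \<le> \<bar>cr x\<bar>" using cr_bounded_below[OF x0] by blast
  let ?n = "\<lambda>z x. integral (left_half a x) (\<lambda>y. (norm (\<Phi> z y))\<^sup>2)"
  define K where "K = sqrt (?n l x0) * sqrt (?n z x0)"
  have IIb: "norm (II z x) \<le> K" if x: "x \<in> left_half a x0" for x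
  proof -
    have xS: "x \<in> S" by (rule in_left_half_S[OF x0 x])
    have "norm (II z x) \<le> sqrt (?n l x) * sqrt (?n z x)"
      unfolding II_def by (rule integral_dotT_Cauchy_Schwarz) (auto intro: square_integrable_\<Phi> xS)
    also have "\<dots> \<le> K"
      unfolding K_def
    proof (rule mult_mono)
      have le: "?n w x \<le> ?n w x0" for w
        using x by (intro integral_subset_le square_integrableD(3) square_integrable_\<Phi> xS x0) (auto simp: left_half_def)
      show "sqrt (?n l x) \<le> sqrt (?n l x0)" "sqrt (?n z x) \<le> sqrt (?n z x0)" using le by auto
      show "0 \<le> sqrt (?n l x0)" "0 \<le> sqrt (?n z x)"
        using integral_norm_\<Phi>_pos[OF x0, of l] integral_norm_\<Phi>_pos[OF xS, of z] by auto
    qed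
    finally show ?thesis .
  qed
  have K0: "0 \<le> K" using order_trans[OF norm_ge_zero IIb[OF c_in_left_half[OF x0]]] .
  have "square_integrable (left_half a x0) (PhiG z)"
  proof (rule square_integrable_bound_add)
    have "continuous_on S (PhiG z)" by (rule tau_eq_continuous_on[OF sol_PhiG]) auto
    then show "PhiG z \<in> borel_measurable (lebesgue_on (left_half a x0))"
      by (intro continuous_imp_measurable_on_sets_lebesgue continuous_on_subset[OF _ left_half_subset[OF x0]]) auto
    show "square_integrable (left_half a x0) (\<Phi> z)" "square_integrable (left_half a x0) u"
      by (rule square_integrable_\<Phi>[OF x0])+
    fix x assume x: "x \<in> left_half a x0"
    have xS: "x \<in> S" by (rule in_left_half_S[OF x0 x])
    have "norm (PhiG z x) \<le> norm (\<Phi> z x) + norm (II z x) / \<bar>cr x\<bar> * norm (u x)"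
      unfolding PhiG_def by (rule order_trans[OF norm_triangle_ineq4]) (simp add: norm_vector_scalar_mult norm_divide)
    also have "norm (II z x) / \<bar>cr x\<bar> \<le> K / \<delta>"
      using IIb[OF x] \<delta>(2)[OF x] \<delta>(1) K0 by (intro frac_le) auto
    finally have "norm (PhiG z x) \<le> norm (\<Phi> z x) + K / \<delta> * norm (u x)" by (simp add: mult_right_mono)
    also have "\<dots> \<le> (1 + K / \<delta>) * (norm (\<Phi> z x) + norm (u x))"
      using K0 \<delta>(1) by (simp add: algebra_simps)
    finally show "norm (PhiG z x) \<le> (1 + K / \<delta>) * (norm (\<Phi> z x) + norm (u x))" .
  qed simp
  then have "square_integrable_left D' (PhiG z)"
    unfolding square_integrable_left_def ival_D' ends_D'
    using x0 square_integrable_einterval_left[OF x0, of "PhiG z"] by blast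
  moreover have "(wronskian uG (PhiG z) \<longlongrightarrow> 0) (to_left_end a)"
  proof (rule Lim_null_comparison)
    have "((\<lambda>x. II z x) \<longlongrightarrow> 0) (to_left_end a)"
      unfolding II_def by (rule integral_left_tendsto_0[OF x0 dotT_\<Phi>_integrable[OF x0]])
    then have "((\<lambda>x. norm (II z x) * (norm (l - z) / \<delta>)) \<longlongrightarrow> norm (0::complex) * (norm (l - z) / \<delta>)) (to_left_end a)"
      by (intro tendsto_intros)
    then show "((\<lambda>x. norm (II z x) * (norm (l - z) / \<delta>)) \<longlongrightarrow> 0) (to_left_end a)" by simp
    show "\<forall>\<^sub>F x in to_left_end a. norm (wronskian uG (PhiG z) x) \<le> norm (II z x) * (norm (l - z) / \<delta>)"
      using half_interval.eventually_in[OF left_half_interval[OF x0]]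
    proof (rule eventually_mono)
      fix x assume x: "x \<in> left_half a x0"
      have xS: "x \<in> S" by (rule in_left_half_S[OF x0 x])
      have "wronskian u (PhiG z) x = wronskian u (\<Phi> z) x" by (simp add: PhiG_def wronskian_def algebra_simps)
      then have "wronskian uG (PhiG z) x = (l - z) * II z x / complex_of_real (cr x)"
        using wronskian_uG[OF xS] wronskian_\<Phi>_\<Phi>[OF xS, of l z] by (simp add: II_def)
      then have "norm (wronskian uG (PhiG z) x) = norm (II z x) * (norm (l - z) / \<bar>cr x\<bar>)"
        by (simp add: norm_mult norm_divide)
      also have "\<dots> \<le> norm (II z x) * (norm (l - z) / \<delta>)"
        using \<delta>(2)[OF x] \<delta>(1) by (intro mult_left_mono divide_left_mono mult_pos_pos) auto
      finally show "norm (wronskian uG (PhiG z) x) \<le> norm (II z x) * (norm (l - z) / \<delta>)" .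
    qed
  qed
  ultimately show ?thesis
    by (simp add: in_domain_near_left_def boundary_left_def bc_D' ends_D')
qed

lemma sol_uG: "tau_eq P S uG (\<lambda>x. l *s uG x)"
  by (rule tau_eq_cong[OF tau_eq_scale[OF sol_PhiG[of l] S_sets, of "of_real \<gamma>"] S_sets])
    (use gamma_nonzero in \<open>auto simp: PhiG_l vec2_eq_iff\<close>)

lemma nontrivial_uG: "nontrivial D' uG"
proof -
  obtain x where x: "x \<in> S" using S_nonempty by blast
  have "uG x \<noteq> 0" using \<Phi>_nonzero[OF x, of l] cr_nonzero[OF x] by (simp add: u_gamma_eq[OF x] vec2_eq_iff)
  then show ?thesis using x by (auto simp: nontrivial_def ival_D')
qed

lemma real_entire_PhiG: "real_entire_solution D' PhiG" and real_entire_ThetaG: "real_entire_solution D' ThetaG"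
  using sol_PhiG sol_ThetaG hol_PhiG hol_ThetaG PhiG_real ThetaG_real
  by (simp_all add: real_entire_solution_def solution_def real_valued_def ival_D')

text \<open>Transfers the general theory to the commuted operator at one stroke: discreteness of its
  Dirichlet restrictions and identification of its Weyl function. Its boundary functions are
  u_\<gamma>, a nontrivial solution for the parameter l.\<close>

sublocale D': dirac_pair D' PhiG ThetaG
proof
  show "end_left D' < end_right D'" using ends by (simp add: ends_D')
  show "(\<lambda>x. P x $ i $ j) absolutely_integrable_on {c..d}" if "{c..d} \<subseteq> ival D'" for c d i j
    using P_int that by (simp add: ival_D')
  show "\<exists>z. solution P (ival D') z (dirac.bc_left D') \<and> nontrivial D' (dirac.bc_left D')"
    using sol_uG nontrivial_uG by (auto simp: bc_D' ival_D' solution_def)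
  show "\<exists>z. solution P (ival D') z (dirac.bc_right D') \<and> nontrivial D' (dirac.bc_right D')"
    using sol_uG nontrivial_uG by (auto simp: bc_D' ival_D' solution_def)
qed (use P_real P_sym real_entire_PhiG real_entire_ThetaG wronskian_ThetaG_PhiG near_PhiG in \<open>auto simp: ival_D'\<close>)

section \<open>The transform near the right end\<close>

lemma right_Icc: "p \<in> S \<Longrightarrow> q \<in> right_half p b \<Longrightarrow> closed_segment p q = {p..q} \<and> q \<in> S \<and> p \<le> q \<and> {p..q} \<subseteq> right_half p b"
  using right_half_subset[of p] by (auto simp: right_half_def closed_segment_eq_real_ivl intro: ereal_le_trans_less)

text \<open>Write c for \<open>cr\<close>. By \<open>integral_norm_transform\<close>, square
  integrability of g hinges on an upper bound for -|J|^2 / c near b. The boundary condition concerns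
  W(u_\<gamma>, g) = W(u, \<psi>) / c. If u is square integrable, W(u, \<psi>) tends to 0, and 1 / c
  is bounded in the limit circle case. Otherwise \<gamma> > 0, c tends to infinity, and W(u, \<psi>)
  grows at most like sqrt c.\<close>

lemma transform_near_right:
  assumes z: "z \<noteq> l" and \<psi>: "tau_eq Q S \<psi> (\<lambda>x. z *s \<psi> x)" "square_integrable_right D \<psi>" "boundary_right D \<psi>"
  defines "g \<equiv> \<lambda>x. \<psi> x + (1 / (z - l) * wronskian u \<psi> x) *s uG x"
  shows "in_domain_near_right D' g"
proof -
  obtain p where p: "p \<in> S" using S_nonempty by blast
  interpret E: half_interval "right_half p b" p "to_right_end b" by (rule right_half_interval[OF p])
  define J where "J x = - (wronskian u \<psi> x / (z - l))" for x
  have J: "ac_deriv S J (\<lambda>x. dotT (u x) (\<psi> x))" and WJ: "wronskian u \<psi> x = (l - z) * J x" for x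
    unfolding J_def using ac_deriv_wronskian_u[OF \<psi>(1) z] by auto
  have tg: "tau_eq P S g (\<lambda>x. z *s g x)" unfolding g_def by (rule sol_transform[OF \<psi>(1) z])
  have g_eq: "g x = \<psi> x - (J x / complex_of_real (cr x)) *s u x" if "x \<in> S" for x
    unfolding g_def J_def using transform_eq[OF that, where v=\<psi> and z=z] by simp
  have c\<psi>: "continuous_on S \<psi>" by (rule continuous_solution[OF \<psi>(1)])
  have si\<psi>: "square_integrable (right_half q b) \<psi>" if "q \<in> S" for q
    by (rule square_integrable_right_half[OF \<psi>(2,1) that])
  define T where "T = integral (right_half p b) (\<lambda>x. (norm (\<psi> x))\<^sup>2)"
  have T_le: "integral {p..q} (\<lambda>x. (norm (\<psi> x))\<^sup>2) \<le> T" if q: "q \<in> right_half p b" for q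
    unfolding T_def using right_Icc[OF p q]
    by (intro integral_subset_le square_integrableD(3)[OF si\<psi>[OF p]] integrable_continuous_real continuous_intros
        continuous_on_subset[OF c\<psi>] Icc_subset p) auto
  have T0: "0 \<le> T" unfolding T_def by (intro integral_nonneg square_integrableD(3)[OF si\<psi>[OF p]]) auto
  have norm_g: "integral {p..q} (\<lambda>x. (norm (g x))\<^sup>2)
      = integral {p..q} (\<lambda>x. (norm (\<psi> x))\<^sup>2) - ((norm (J q))\<^sup>2 / cr q - (norm (J p))\<^sup>2 / cr p)" if q: "q \<in> right_half p b" for q
  proof -
    have qS: "q \<in> S" "p \<le> q" using right_Icc[OF p q] by auto
    have "integral {p..q} (\<lambda>x. (norm (g x))\<^sup>2) = integral {p..q} (\<lambda>x. (norm (\<psi> x - (J x / complex_of_real (cr x)) *s u x))\<^sup>2)"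
      by (rule Henstock_Kurzweil_Integration.integral_cong) (use Icc_subset[OF p qS(1)] g_eq in auto)
    then show ?thesis using integral_norm_transform[OF c\<psi> J p qS] by simp
  qed
  have W0: "(wronskian u \<psi> \<longlongrightarrow> 0) (to_right_end b)" if si: "square_integrable S u"
  proof -
    have "square_integrable (right_half p b) u" by (rule square_integrable_subset[OF si right_half_subset[OF p]]) simp_all
    then show ?thesis
      by (intro wronskian_right_end[OF p tau_eq_right[OF sol_\<Phi> p] _ _ eigenfunction[OF si] tau_eq_right[OF \<psi>(1) p] si\<psi>[OF p] _ \<psi>(3)]
          square_integrable_scale si\<psi> p) simp_all
  qed
  \<comment> \<open>Because W(u, \<psi>) vanishes at b, J(q) is minus the integral of u^T \<psi>
    over (q, b). Cauchy-Schwarz bounds it by the tail norm of u, whose square is at most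
    \<open>- cr q\<close> by \<open>cr_neg\<close>, even where \<open>cr\<close> tends to 0.\<close>
  have Jc: "(norm (J q))\<^sup>2 \<le> - cr q * T" if n: "\<gamma> < 0" and q: "q \<in> right_half p b" for q
  proof -
    have si: "square_integrable S u" using gamma_cases n by auto
    have qS: "q \<in> S" "p \<le> q" using right_Icc[OF p q] by auto
    have siu: "square_integrable (right_half q b) u" by (rule square_integrable_subset[OF si right_half_subset[OF qS(1)]]) simp_all
    let ?s = "integral (right_half q b) (\<lambda>x. (norm (u x))\<^sup>2)" and ?t = "integral (right_half q b) (\<lambda>x. (norm (\<psi> x))\<^sup>2)"
    have qb: "ereal q < b" using qS by (simp add: S_iff)
    have "(J \<longlongrightarrow> J q + integral (right_half q b) (\<lambda>x. dotT (u x) (\<psi> x))) (to_right_end b)"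
      by (intro ac_deriv_right_end[OF qb] ac_deriv_subset[OF J right_half_subset[OF qS(1)]] absolutely_integrable_dotT siu si\<psi> qS) simp
    moreover have "(J \<longlongrightarrow> - (0 / (z - l))) (to_right_end b)"
      unfolding J_def[abs_def] by (intro tendsto_intros W0[OF si]) (use z in simp)
    ultimately have "J q + integral (right_half q b) (\<lambda>x. dotT (u x) (\<psi> x)) = - (0 / (z - l))"
      by (rule tendsto_unique[OF E.nontriv])
    then have "J q = - integral (right_half q b) (\<lambda>x. dotT (u x) (\<psi> x))" by (simp add: eq_neg_iff_add_eq_0)
    then have "norm (J q) \<le> sqrt ?s * sqrt ?t"
      using integral_dotT_Cauchy_Schwarz[OF siu si\<psi>[OF qS(1)]] by simp
    then have "(norm (J q))\<^sup>2 \<le> (sqrt ?s * sqrt ?t)\<^sup>2" by (rule power_mono) simp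
    also have "\<dots> = ?s * ?t"
      using integral_nonneg[OF square_integrableD(3)[OF siu right_half_sets]] integral_nonneg[OF square_integrableD(3)[OF si\<psi>[OF qS(1)] right_half_sets]]
      by (simp add: power_mult_distrib)
    also have "\<dots> \<le> - cr q * T"
    proof (rule mult_mono)
      show "?s \<le> - cr q" using cr_neg(1)[OF n qS(1)] by simp
      show "?t \<le> T" unfolding T_def using qS
        by (intro integral_subset_le square_integrableD(3) si\<psi> p) (auto simp: right_half_def)
      show "0 \<le> - cr q" using cr_neg(2)[OF n qS(1)] by simp
      show "0 \<le> ?t" by (intro integral_nonneg square_integrableD(3) si\<psi> qS) auto
    qed
    finally show ?thesis .
  qed
  have si_g: "square_integrable (right_half p b) g"
  proof (rule E.square_integrable_exhaust)
    have "continuous_on S g" by (rule tau_eq_continuous_on[OF tg]) auto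
    then show "continuous_on (right_half p b) g" by (rule continuous_on_subset[OF _ right_half_subset[OF p]])
    show "integral (closed_segment p q) (\<lambda>y. (norm (g y))\<^sup>2) \<le> T + \<bar>(norm (J p))\<^sup>2 / cr p\<bar> + T" if q: "q \<in> right_half p b" for q
    proof -
      have qS: "q \<in> S" "p \<le> q" and seg: "closed_segment p q = {p..q}" using right_Icc[OF p q] by auto
      have "- ((norm (J q))\<^sup>2 / cr q) \<le> T"
      proof (cases "\<gamma> > 0")
        case True
        then have "1 / \<gamma> < cr q" "0 < 1 / \<gamma>" using cr_pos[OF _ qS(1)] by auto
        then have "0 < cr q" by linarith
        then have "0 \<le> (norm (J q))\<^sup>2 / cr q" by simp
        then show ?thesis using T0 by linarith
      next
        case False
        then have n: "\<gamma> < 0" using gamma_nonzero by simp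
        show ?thesis using Jc[OF n q] cr_neg(2)[OF n qS(1)] by (simp add: field_simps)
      qed
      then show ?thesis unfolding seg norm_g[OF q] using T_le[OF q] by linarith
    qed
  qed
  have sr: "square_integrable_right D' g"
    using D'.square_integrable_rightI[of p g] si_g p by (simp add: ival_D' ends_D')
  have br: "(wronskian uG g \<longlongrightarrow> 0) (to_right_end b)" if lc: "limit_circle_right D'"
  proof -
    have Wg: "wronskian uG g x = wronskian u \<psi> x / complex_of_real (cr x)" if "x \<in> S" for x
    proof -
      have "wronskian u g x = wronskian u \<psi> x" by (simp add: g_eq[OF that] wronskian_def algebra_simps)
      then show ?thesis using wronskian_uG[OF that] by simp
    qed
    show ?thesis
    proof (cases "square_integrable S u")
      case True
      \<comment> \<open>Limit circle at b makes the solution u_\<gamma> square integrable there, and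
        |u_\<gamma>|^2 = -(1/c)' then keeps 1 / c bounded.\<close>
      have "square_integrable_right D' uG"
        using lc sol_uG by (auto simp: limit_circle_right_def solution_def ival_D')
      then have siG: "square_integrable (right_half p b) uG"
        using D'.square_integrable_right_half[of uG "\<lambda>x. l *s uG x" p] sol_uG p by (simp add: ival_D' ends_D')
      define K where "K = \<bar>1 / cr p\<bar> + integral (right_half p b) (\<lambda>x. (norm (uG x))\<^sup>2)"
      have K: "\<bar>1 / cr q\<bar> \<le> K" if q: "q \<in> right_half p b" for q
      proof -
        have qS: "q \<in> S" "p \<le> q" and sub: "{p..q} \<subseteq> right_half p b" using right_Icc[OF p q] by auto
        have eq: "(norm (uG x))\<^sup>2 = (norm (u x))\<^sup>2 / (cr x)\<^sup>2" if "x \<in> {p..q}" for x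
          using Icc_subset[OF p qS(1)] that by (simp add: u_gamma_eq norm_vector_scalar_mult norm_divide power_mult_distrib power_divide subset_eq)
        have hi: "((\<lambda>x. (norm (u x))\<^sup>2 / (cr x)\<^sup>2) has_integral (- (1 / cr q - 1 / cr p))) {p..q}"
          using has_integral_neg[OF inverse_cr_diff[OF p qS]] by simp
        have "((\<lambda>x. (norm (uG x))\<^sup>2) has_integral (- (1 / cr q - 1 / cr p))) {p..q}"
          by (rule has_integral_eq[OF _ hi]) (use eq in auto)
        then have i: "(\<lambda>x. (norm (uG x))\<^sup>2) integrable_on {p..q}" and e: "integral {p..q} (\<lambda>x. (norm (uG x))\<^sup>2) = 1 / cr p - 1 / cr q"
          by (auto simp: has_integral_integrable_integral)
        have "0 \<le> 1 / cr p - 1 / cr q" unfolding e[symmetric] by (intro integral_nonneg i) simp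
        moreover have "1 / cr p - 1 / cr q \<le> integral (right_half p b) (\<lambda>x. (norm (uG x))\<^sup>2)"
          unfolding e[symmetric] by (intro integral_subset_le sub i square_integrableD(3)[OF siG]) auto
        ultimately show ?thesis unfolding K_def by linarith
      qed
      have "((\<lambda>x. norm (wronskian u \<psi> x) * K) \<longlongrightarrow> norm (0::complex) * K) (to_right_end b)"
        by (intro tendsto_intros W0[OF True])
      then have "((\<lambda>x. norm (wronskian u \<psi> x) * K) \<longlongrightarrow> 0) (to_right_end b)" by simp
      then show ?thesis
      proof (rule Lim_null_comparison[rotated])
        show "\<forall>\<^sub>F x in to_right_end b. norm (wronskian uG g x) \<le> norm (wronskian u \<psi> x) * K"
          using E.eventually_in
        proof (rule eventually_mono)
          fix x assume x: "x \<in> right_half p b"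
          have "norm (wronskian uG g x) = norm (wronskian u \<psi> x) * \<bar>1 / cr x\<bar>"
            using Wg[of x] right_Icc[OF p x] by (simp add: norm_divide)
          also have "\<dots> \<le> norm (wronskian u \<psi> x) * K" by (intro mult_left_mono K x) simp
          finally show "norm (wronskian uG g x) \<le> norm (wronskian u \<psi> x) * K" .
        qed
      qed
    next
      case False
      then have g0: "\<gamma> > 0" using gamma_cases by auto
      \<comment> \<open>The norm identity \<open>norm_g\<close> read backwards: since its left side
        is nonnegative, |J|^2 / c is at most K.\<close>
      define K where "K = T + \<bar>(norm (J p))\<^sup>2 / cr p\<bar>"
      have cp: "0 < cr q" if "q \<in> right_half p b" for q
        using cr_pos[OF g0, of q] right_Icc[OF p that] g0 by (meson less_trans zero_less_divide_1_iff)
      have Jq: "(norm (J q))\<^sup>2 \<le> K * cr q" if q: "q \<in> right_half p b" for q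
      proof -
        have qS: "q \<in> S" "p \<le> q" using right_Icc[OF p q] by auto
        have cont: "continuous_on S g" by (rule tau_eq_continuous_on[OF tg]) auto
        have "0 \<le> integral {p..q} (\<lambda>x. (norm (g x))\<^sup>2)"
          by (intro integral_nonneg integrable_continuous_real continuous_intros continuous_on_subset[OF cont] Icc_subset p qS) auto
        then have "(norm (J q))\<^sup>2 / cr q \<le> K" unfolding norm_g[OF q] K_def using T_le[OF q] by linarith
        then show ?thesis using cp[OF q] by (simp add: field_simps)
      qed
      \<comment> \<open>\<open>cr\<close> is increasing, and an upper bound on it would bound the
        norm of u near b, against the case assumption.\<close>
      have top: "filterlim cr at_top (to_right_end b)"
        unfolding filterlim_at_top
      proof
        fix M :: real
        have "\<exists>q\<in>right_half p b. M < cr q"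
        proof (rule ccontr)
          assume "\<not> (\<exists>q\<in>right_half p b. M < cr q)"
          then have le: "cr q \<le> M" if "q \<in> right_half p b" for q using that by force
          have "square_integrable (right_half p b) u"
          proof (rule E.square_integrable_exhaust)
            show "continuous_on (right_half p b) u" by (rule continuous_on_subset[OF continuous_solution[OF sol_\<Phi>] right_half_subset[OF p]])
            show "integral (closed_segment p q) (\<lambda>y. (norm (u y))\<^sup>2) \<le> M - cr p" if q: "q \<in> right_half p b" for q
              using cr_diff[of p q] le[OF q] right_Icc[OF p q] p by simp
          qed
          then have "square_integrable S u" by (intro square_integrable_S[OF sol_\<Phi> p square_integrable_\<Phi>[OF p]])
          then show False using False by simp
        qed
        then obtain q0 where q0: "q0 \<in> right_half p b" "M < cr q0" by blast
        from E.eventually_beyond[OF q0(1)] show "\<forall>\<^sub>F x in to_right_end b. M \<le> cr x"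
        proof (rule eventually_mono, elim conjE)
          fix x assume x: "x \<in> right_half p b" "q0 \<in> closed_segment p x"
          then have q0x: "q0 \<le> x" using right_Icc[OF p x(1)] by auto
          have S: "q0 \<in> S" "x \<in> S" using right_Icc[OF p] q0(1) x(1) by auto
          have "0 \<le> integral {q0..x} (\<lambda>x. (norm (u x))\<^sup>2)"
            by (intro integral_nonneg integrable_continuous_real continuous_on_subset[OF continuous_norm_u] Icc_subset S) auto
          then show "M \<le> cr x" using cr_diff[OF S q0x] q0(2) by linarith
        qed
      qed
      have K0: "0 \<le> K" unfolding K_def using T0 by simp
      have "filterlim (\<lambda>x. sqrt (cr x)) at_top (to_right_end b)"
        by (rule filterlim_compose[OF sqrt_at_top top])
      then have "((\<lambda>x. (norm (l - z) * sqrt K) / sqrt (cr x)) \<longlongrightarrow> 0) (to_right_end b)"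
        by (rule real_tendsto_divide_at_top[OF tendsto_const])
      then show ?thesis
      proof (rule Lim_null_comparison[rotated])
        show "\<forall>\<^sub>F x in to_right_end b. norm (wronskian uG g x) \<le> (norm (l - z) * sqrt K) / sqrt (cr x)"
          using E.eventually_in
        proof (rule eventually_mono)
          fix x assume x: "x \<in> right_half p b"
          have xS: "x \<in> S" using right_Icc[OF p x] by auto
          have c: "cr x > 0" by (rule cp[OF x])
          have "norm (J x) \<le> sqrt (K * cr x)" using Jq[OF x] by (rule real_le_rsqrt)
          also have "\<dots> = sqrt K * sqrt (cr x)" by (rule real_sqrt_mult)
          finally have jb: "norm (J x) \<le> sqrt K * sqrt (cr x)" .
          have "norm (wronskian uG g x) = norm (l - z) * norm (J x) / cr x"
            unfolding Wg[OF xS] WJ using c by (simp add: norm_mult norm_divide)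
          also have "\<dots> \<le> norm (l - z) * (sqrt K * sqrt (cr x)) / cr x"
            using jb c by (intro divide_right_mono mult_left_mono) auto
          also have "\<dots> = (norm (l - z) * sqrt K) * (sqrt (cr x) / cr x)" by simp
          also have "sqrt (cr x) / cr x = 1 / sqrt (cr x)" using c by (simp add: sqrt_divide_self_eq inverse_eq_divide)
          finally show "norm (wronskian uG g x) \<le> (norm (l - z) * sqrt K) / sqrt (cr x)" by simp
        qed
      qed
    qed
  qed
  show ?thesis
    using sr br by (simp add: in_domain_near_right_def boundary_right_def bc_D' ends_D')
qed

text \<open>The transform is linear, so \<Theta> + m \<Phi> goes to the transform of \<Theta> plus m
  \<Phi>_\<gamma>. As \<Theta>_\<gamma> exceeds the transform of \<Theta> by \<gamma>
  \<Phi>_\<gamma> / (z - l), the coefficient m is lowered by \<gamma> / (z - l).\<close>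

theorem weyl_solution_right_transform:
  assumes z: "z \<noteq> l" and \<psi>: "weyl_solution_right D z (\<lambda>x. \<Theta> z x + m *s \<Phi> z x)"
  defines "\<psi> \<equiv> \<lambda>x. \<Theta> z x + m *s \<Phi> z x"
  shows "weyl_solution_right D' z (\<lambda>x. \<psi> x + (1 / (z - l) * wronskian u \<psi> x) *s uG x)"
    and "\<And>x. x \<in> S \<Longrightarrow> \<psi> x + (1 / (z - l) * wronskian u \<psi> x) *s uG x = ThetaG z x + (m - of_real \<gamma> / (z - l)) *s PhiG z x"
    and "singular_weyl_function D' PhiG ThetaG z = m - of_real \<gamma> / (z - l)"
proof -
  let ?g = "\<lambda>x. \<psi> x + (1 / (z - l) * wronskian u \<psi> x) *s uG x"
  have p: "tau_eq Q S \<psi> (\<lambda>x. z *s \<psi> x)" "square_integrable_right D \<psi>" "boundary_right D \<psi>"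
    using \<psi> by (auto simp: weyl_solution_right_def solution_def in_domain_near_right_def \<psi>_def)
  show eq: "?g x = ThetaG z x + (m - of_real \<gamma> / (z - l)) *s PhiG z x" if x: "x \<in> S" for x
  proof -
    define k where "k = 1 / (z - l)"
    have k: "of_real \<gamma> / (z - l) = of_real \<gamma> * k" by (simp add: k_def)
    show ?thesis
      using z unfolding k ThetaG_def k_def[symmetric] PhiG_eq[OF x z]
      by (simp add: \<psi>_def vec2_eq_iff wronskian_def algebra_simps)
  qed
  obtain x where x: "x \<in> S" using S_nonempty by blast
  \<comment> \<open>The Wronskian of \<Phi>_\<gamma> with this combination is -1, so it cannot
    vanish.\<close>
  have "?g x \<noteq> 0"
  proof
    assume 0: "?g x = 0"
    define K where "K = m - of_real \<gamma> / (z - l)"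
    have v: "ThetaG z x + K *s PhiG z x = 0" using eq[OF x] 0 unfolding K_def by simp
    have "wronskian (PhiG z) (\<lambda>x. ThetaG z x + K *s PhiG z x) x = 0"
      unfolding wronskian_def v by simp
    moreover have "wronskian (PhiG z) (\<lambda>x. ThetaG z x + K *s PhiG z x) x = - 1"
      using wronskian_ThetaG_PhiG[OF x, of z] by (simp add: wronskian_def algebra_simps)
    ultimately show False by simp
  qed
  then have "nontrivial D' ?g" using x by (auto simp: nontrivial_def ival_D')
  then show w: "weyl_solution_right D' z ?g"
    using transform_near_right[OF z p] sol_transform[OF p(1) z]
    by (simp add: weyl_solution_right_def solution_def ival_D')
  show "singular_weyl_function D' PhiG ThetaG z = m - of_real \<gamma> / (z - l)"
    by (rule D'.singular_weyl_function_eqI[OF D'.weyl_solution_right_cong[OF w]]) (use eq in \<open>simp add: ival_D'\<close>)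
qed

end

section \<open>The left Weyl solution and eigenfunctions\<close>

context dirac_pair
begin

lemma weyl_solution_left_\<Phi>: "weyl_solution_left D z (\<Phi> z)"
proof -
  obtain x where "x \<in> S" using S_nonempty by blast
  then show ?thesis
    using sol_\<Phi>[of z] near[of z] \<Phi>_nonzero[of x z]
    by (auto simp: weyl_solution_left_def solution_def nontrivial_def)
qed

text \<open>An eigenfunction f satisfies the condition at a, so W(\<Phi>(z), f) = 0 and f is a
  nonzero multiple of \<Phi>(z), which thereby inherits the condition at b.\<close>

lemma eigenvalue_boundary_right:
  assumes "eigenvalue S (dirac_op D) z"
  shows "boundary_right D (\<Phi> z)"
proof -
  obtain f where f: "(f, \<lambda>x. z *s f x) \<in> dirac_op D" and nz: "\<not> (AE x in lebesgue_on S. f x = 0)"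
    using assms by (auto simp: eigenvalue_def eigenspace_def)
  have F: "square_integrable S f" "tau_eq Q S f (\<lambda>x. z *s f x)" "boundary_left D f" "boundary_right D f"
    using f by (auto simp: dirac_op_def)
  obtain c where c: "c \<in> S" using S_nonempty by blast
  have si: "square_integrable (left_half a c) f"
    by (rule square_integrable_subset[OF F(1) left_half_subset[OF c]]) simp_all
  have "wronskian (\<Phi> z) f c = integral (left_half a c) (\<lambda>x. z * dotT (\<Phi> z x) (f x) - dotT (\<Phi> z x) (z *s f x))"
    by (rule wronskian_\<Phi>_left[OF c tau_eq_left[OF F(2) c] si square_integrable_scale[OF si] F(3)]) simp
  also have "\<dots> = 0" by (simp add: dotT_eq algebra_simps)
  finally have W: "wronskian (\<Phi> z) f c = 0" .
  define k where "k = wronskian (\<Theta> z) f c"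
  have fk: "f x = k *s \<Phi> z x" if "x \<in> S" for x
    using solution_expand[OF F(2) order_refl S_sets S_interval c that] W by (simp add: k_def)
  have "k \<noteq> 0"
  proof
    assume "k = 0"
    then have "AE x in lebesgue_on S. f x = 0" by (intro AE_I2) (simp add: fk)
    with nz show False by blast
  qed
  show ?thesis
  proof (rule boundary_right_cong[OF c boundary_right_scale[OF F(4), of "1 / k"]])
    fix x assume "x \<in> right_half c b"
    then have "x \<in> S" using right_half_subset[OF c] by auto
    then show "(1 / k) *s f x = \<Phi> z x" using fk \<open>k \<noteq> 0\<close> by (simp add: vec2_eq_iff)
  qed
qed

end

section \<open>The concrete potential and the final statement\<close>

lemma dirac_potential_nth:
  "dirac_potential m q_el q_am q_sc x $ 1 $ 1 = of_real (q_el x + (m + q_sc x))"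
  "dirac_potential m q_el q_am q_sc x $ 1 $ 2 = of_real (q_am x)"
  "dirac_potential m q_el q_am q_sc x $ 2 $ 1 = of_real (q_am x)"
  "dirac_potential m q_el q_am q_sc x $ 2 $ 2 = of_real (q_el x - (m + q_sc x))"
  by (simp_all add: dirac_potential_def sigma1_def sigma3_def mat_def scaleR_conv_of_real[where 'a=complex])

lemma dirac_potential_integrable:
  assumes "locally_integrable T q_el" "locally_integrable T q_am" "locally_integrable T q_sc" "{c..d} \<subseteq> T"
  shows "(\<lambda>x. dirac_potential m q_el q_am q_sc x $ i $ j) absolutely_integrable_on {c..d}"
proof -
  have q: "q_el absolutely_integrable_on {c..d}" "q_am absolutely_integrable_on {c..d}" "q_sc absolutely_integrable_on {c..d}"
    using assms by (auto simp: locally_integrable_def)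
  have m: "(\<lambda>x. m) absolutely_integrable_on {c..d}" by (intro absolutely_integrable_continuous_real continuous_intros)
  have r: "(\<lambda>x. complex_of_real (k x)) absolutely_integrable_on {c..d}" if "k absolutely_integrable_on {c..d}" for k :: "real \<Rightarrow> real"
    using absolutely_integrable_linear[OF that bounded_linear_of_real] by (simp add: o_def)
  have "(\<lambda>x. dirac_potential m q_el q_am q_sc x $ 1 $ 1) absolutely_integrable_on {c..d}"
    "(\<lambda>x. dirac_potential m q_el q_am q_sc x $ 1 $ 2) absolutely_integrable_on {c..d}"
    "(\<lambda>x. dirac_potential m q_el q_am q_sc x $ 2 $ 1) absolutely_integrable_on {c..d}"
    "(\<lambda>x. dirac_potential m q_el q_am q_sc x $ 2 $ 2) absolutely_integrable_on {c..d}"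
    unfolding dirac_potential_nth by (intro r set_integral_add set_integral_diff q m)+
  then show ?thesis using exhaust_2[of i] exhaust_2[of j] by auto
qed

theorem theorem3p4:
  fixes a b :: ereal and m :: real and q_el q_am q_sc :: "real \<Rightarrow> real"
    and u_minus u_plus :: "real \<Rightarrow> complex^2" and H H\<^sub>\<gamma> :: dirac
    and \<Phi> \<Theta> \<Psi> \<Psi>\<^sub>\<gamma> :: "complex \<Rightarrow> real \<Rightarrow> complex^2" and M M\<^sub>\<gamma> :: "complex \<Rightarrow> complex"
    and lam \<gamma> :: real and l :: complex and \<Phi>t :: "real \<Rightarrow> complex^2"
  assumes "a < b" and "m \<ge> 0"
    and "locally_integrable (einterval a b) q_el"
    and "locally_integrable (einterval a b) q_am"
    and "locally_integrable (einterval a b) q_sc"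
    and H: "H = \<lparr>end_left = a, end_right = b, pot = dirac_potential m q_el q_am q_sc,
                 bc_left = u_minus, bc_right = u_plus\<rparr>"
    and "limit_circle_left H \<Longrightarrow>
           solution (pot H) (ival H) 0 u_minus \<and> nontrivial H u_minus \<and> real_valued H u_minus"
    and "limit_circle_right H \<Longrightarrow>
           solution (pot H) (ival H) 0 u_plus \<and> nontrivial H u_plus \<and> real_valued H u_plus"
    and discrete: "\<exists>c \<in> ival H. dirichlet_discrete H c"
    and "real_entire_solution H \<Phi>" and "real_entire_solution H \<Theta>"
    and "\<And>z. nontrivial H (\<Phi> z) \<and> in_domain_near_left H (\<Phi> z)"
    and "\<And>z x. x \<in> ival H \<Longrightarrow> wronskian (\<Theta> z) (\<Phi> z) x = 1"
    and M: "M = singular_weyl_function H \<Phi> \<Theta>"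
    and \<Psi>: "\<Psi> = (\<lambda>z x. \<Theta> z x + M z *s \<Phi> z x)"
    and l: "l = complex_of_real lam"
    and "\<gamma> \<ge> (if square_integrable (ival H) (\<Phi> l) then - (1 / (L2norm (ival H) (\<Phi> l))\<^sup>2) else 0)"
    and "square_integrable (ival H) (\<Phi> l) \<Longrightarrow> eigenvalue (ival H) (dirac_op H) l"
    and H\<^sub>\<gamma>: "H\<^sub>\<gamma> = double_commutation H \<gamma> (\<Phi> l)"
    and \<Phi>t: "\<Phi>t = u_gamma H \<gamma> (\<Phi> l)"
    and \<Psi>\<^sub>\<gamma>: "\<Psi>\<^sub>\<gamma> = (\<lambda>z x. \<Psi> z x + (1 / (z - l) * wronskian (\<Phi> l) (\<Psi> z) x) *s \<Phi>t x)"
    and M\<^sub>\<gamma>: "M\<^sub>\<gamma> = (\<lambda>z. M z - of_real \<gamma> / (z - l))"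
  shows "\<exists>\<Phi>\<^sub>\<gamma> \<Theta>\<^sub>\<gamma>.
    real_entire_solution H\<^sub>\<gamma> \<Phi>\<^sub>\<gamma> \<and> real_entire_solution H\<^sub>\<gamma> \<Theta>\<^sub>\<gamma> \<and>
    (\<forall>z. \<forall>x \<in> ival H.
       \<Phi>\<^sub>\<gamma> z x = \<Phi> z x
         - (LINT y|lebesgue_on (einterval a (ereal x)). dotT (\<Phi> l y) (\<Phi> z y)) *s \<Phi>t x) \<and>
    (\<forall>z. z \<noteq> l \<longrightarrow> (\<forall>x \<in> ival H.
       \<Phi>\<^sub>\<gamma> z x = \<Phi> z x + (1 / (z - l) * wronskian (\<Phi> l) (\<Phi> z) x) *s \<Phi>t x)) \<and>
    (\<forall>z. z \<noteq> l \<longrightarrow> (\<forall>x \<in> ival H.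
       \<Theta>\<^sub>\<gamma> z x = \<Theta> z x
         + (1 / (z - l)) *s (wronskian (\<Phi> l) (\<Theta> z) x *s \<Phi>t x + of_real \<gamma> *s \<Phi>\<^sub>\<gamma> z x))) \<and>
    (\<forall>z. \<forall>x \<in> ival H. wronskian (\<Theta>\<^sub>\<gamma> z) (\<Phi>\<^sub>\<gamma> z) x = 1) \<and>
    (\<forall>x \<in> ival H. \<Phi>\<^sub>\<gamma> l x = (if \<gamma> = 0 then \<Phi> l x else (1 / of_real \<gamma>) *s \<Phi>t x)) \<and>
    (\<forall>x \<in> ival H.
       \<Theta>\<^sub>\<gamma> l x = \<Theta> l x + wronskian (\<Phi> l) (z_deriv \<Theta> l) x *s \<Phi>t x
         + of_real \<gamma> *s z_deriv \<Phi>\<^sub>\<gamma> l x) \<and>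
    (\<forall>c \<in> ival H. dirichlet_discrete H\<^sub>\<gamma> c) \<and>
    (\<forall>z. weyl_solution_left H\<^sub>\<gamma> z (\<Phi>\<^sub>\<gamma> z)) \<and>
    (\<forall>z. z \<notin> spectrum (ival H) (dirac_op H) \<and> z \<noteq> l \<longrightarrow>
       weyl_solution_right H\<^sub>\<gamma> z (\<Psi>\<^sub>\<gamma> z) \<and>
       (\<forall>x \<in> ival H. \<Psi>\<^sub>\<gamma> z x = \<Theta>\<^sub>\<gamma> z x + M\<^sub>\<gamma> z *s \<Phi>\<^sub>\<gamma> z x) \<and>
       M\<^sub>\<gamma> z = singular_weyl_function H\<^sub>\<gamma> \<Phi>\<^sub>\<gamma> \<Theta>\<^sub>\<gamma> z)"
proof -
  have Hs: "end_left H = a" "end_right H = b" "pot H = dirac_potential m q_el q_am q_sc"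
    "bc_left H = u_minus" "bc_right H = u_plus" and iv: "ival H = einterval a b"
    by (simp_all add: H ival_def)
  interpret dirac_pair H \<Phi> \<Theta>
  proof
    show "end_left H < end_right H" using assms(1) by (simp add: Hs)
    show "(\<lambda>x. pot H x $ i $ j) absolutely_integrable_on {c..d}" if "{c..d} \<subseteq> ival H" for c d i j
      unfolding Hs by (rule dirac_potential_integrable[OF assms(3-5)]) (use that iv in auto)
    show "pot H x $ i $ j \<in> \<real>" for x i j
      using exhaust_2[of i] exhaust_2[of j] by (auto simp only: Hs dirac_potential_nth Reals_of_real)
    show "pot H x $ 1 $ 2 = pot H x $ 2 $ 1" for x by (simp add: Hs dirac_potential_nth)
    show "\<exists>z. solution (pot H) (ival H) z (bc_left H) \<and> nontrivial H (bc_left H)" if "limit_circle_left H"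
      using assms(7)[OF that] by (auto simp: Hs(4))
    show "\<exists>z. solution (pot H) (ival H) z (bc_right H) \<and> nontrivial H (bc_right H)" if "limit_circle_right H"
      using assms(8)[OF that] by (auto simp: Hs(5))
  qed (use assms(10-13) in auto)
  have \<Psi>w: "weyl_solution_right H z (\<Psi> z)" if "z \<notin> spectrum (ival H) (dirac_op H)" for z
    using weyl_solution_right_singular[OF that] by (simp add: \<Psi> M)
  show ?thesis
  proof (cases "\<gamma> = 0")
    case True
    \<comment> \<open>For \<gamma> = 0 the definitions return H itself and the zero function for
      \<Phi>t, so \<Phi> and \<Theta> are the witnesses.\<close>
    have [simp]: "H\<^sub>\<gamma> = H" "\<Phi>t = (\<lambda>x. 0)"
      by (simp_all add: H\<^sub>\<gamma> \<Phi>t True double_commutation_def u_gamma_def fun_eq_iff)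
    have [simp]: "\<Psi>\<^sub>\<gamma> z = \<Psi> z" for z by (simp add: \<Psi>\<^sub>\<gamma>)
    show ?thesis
      using assms(10,11,13) dirichlet_discrete weyl_solution_left_\<Phi> \<Psi>w
      by (intro exI[of _ \<Phi>] exI[of _ \<Theta>]) (simp add: True M\<^sub>\<gamma> M \<Psi>)
  next
    case False
    interpret commutation H \<Phi> \<Theta> lam \<gamma>
    proof
      show "\<gamma> \<noteq> 0" by (rule False)
      show "boundary_right H (\<Phi> (of_real lam))" if "square_integrable (ival H) (\<Phi> (of_real lam))"
        using assms(18) that eigenvalue_boundary_right by (simp add: l)
      show "\<gamma> > 0 \<or> (square_integrable (ival H) (\<Phi> (of_real lam)) \<and>
        1 / \<gamma> \<le> - integral (ival H) (\<lambda>x. (norm (\<Phi> (of_real lam) x))\<^sup>2) \<and> \<gamma> < 0)"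
      proof (cases "\<gamma> > 0")
        case neg: False
        then have g: "\<gamma> < 0" using False by simp
        \<comment> \<open>A negative \<gamma> violates the bound 0 of the other branch, which forces
          square integrability.\<close>
        have si: "square_integrable (ival H) (\<Phi> (of_real lam))"
          using assms(17) g by (auto simp: l split: if_splits)
        let ?N = "integral (ival H) (\<lambda>x. (norm (\<Phi> (of_real lam) x))\<^sup>2)"
        have N0: "0 \<le> ?N" by (intro integral_nonneg square_integrableD(3)[OF si]) auto
        have "(L2norm (ival H) (\<Phi> l))\<^sup>2 = ?N"
          using N0 by (simp add: L2norm_eq[OF si S_sets] l)
        then have "- (1 / ?N) \<le> \<gamma>" using assms(17) si by (simp add: l)
        \<comment> \<open>Division by zero gives 0, so for \<open>?N = 0\<close> the preceding bound
          would read 0 <= \<gamma>.\<close>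
        moreover from this have "?N > 0" using g N0 by (cases "?N = 0") auto
        ultimately have "1 / \<gamma> \<le> - ?N" using g by (simp add: field_simps)
        then show ?thesis using si g by blast
      qed simp
    qed
    have [simp]: "\<Phi>t = uG" "H\<^sub>\<gamma> = D'" by (simp_all add: \<Phi>t H\<^sub>\<gamma> l)
    have f1: "PhiG z x = \<Phi> z x - (LINT y|lebesgue_on (einterval a (ereal x)). dotT (\<Phi> l y) (\<Phi> z y)) *s \<Phi>t x"
      if "x \<in> ival H" for z x
      using LINT_left[OF that, of z] by (simp add: Hs l PhiG_def u_gamma_eq[OF that] vec2_eq_iff)
    have disc: "dirichlet_discrete H\<^sub>\<gamma> c" if "c \<in> ival H" for c
      using D'.dirichlet_discrete[of c] that by (simp add: ival_D')
    have right: "weyl_solution_right H\<^sub>\<gamma> z (\<Psi>\<^sub>\<gamma> z) \<and> (\<forall>x\<in>ival H. \<Psi>\<^sub>\<gamma> z x = ThetaG z x + M\<^sub>\<gamma> z *s PhiG z x) \<and>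
        M\<^sub>\<gamma> z = singular_weyl_function H\<^sub>\<gamma> PhiG ThetaG z"
      if z: "z \<notin> spectrum (ival H) (dirac_op H)" "z \<noteq> l" for z
    proof -
      have w: "weyl_solution_right H z (\<lambda>x. \<Theta> z x + M z *s \<Phi> z x)" using \<Psi>w[OF z(1)] by (simp add: \<Psi>)
      have zl: "z \<noteq> complex_of_real lam" using z(2) by (simp add: l)
      show ?thesis
        using weyl_solution_right_transform[OF zl w] by (simp add: \<Psi>\<^sub>\<gamma> \<Psi> M\<^sub>\<gamma> l)
    qed
    have th: "ThetaG z x = \<Theta> z x + (1 / (z - l)) *s (wronskian (\<Phi> l) (\<Theta> z) x *s \<Phi>t x + of_real \<gamma> *s PhiG z x)"
      if "z \<noteq> l" for z x using that by (simp add: ThetaG_def l)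
    have thl: "ThetaG l x = \<Theta> l x + wronskian (\<Phi> l) (z_deriv \<Theta> l) x *s \<Phi>t x + of_real \<gamma> *s z_deriv PhiG l x" for x
      by (simp add: ThetaG_def l)
    have ph: "PhiG z x = \<Phi> z x + (1 / (z - l) * wronskian (\<Phi> l) (\<Phi> z) x) *s \<Phi>t x" if "x \<in> ival H" "z \<noteq> l" for z x
      using PhiG_eq[OF that(1)] that(2) by (simp add: l)
    have phl: "PhiG l x = (if \<gamma> = 0 then \<Phi> l x else (1 / of_real \<gamma>) *s \<Phi>t x)" if "x \<in> ival H" for x
      using PhiG_l[OF that] False by (simp add: l)
    have left: "weyl_solution_left H\<^sub>\<gamma> z (PhiG z)" for z using D'.weyl_solution_left_\<Phi> by simp
    have ent: "real_entire_solution H\<^sub>\<gamma> PhiG" "real_entire_solution H\<^sub>\<gamma> ThetaG"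
      using real_entire_PhiG real_entire_ThetaG by simp_all
    show ?thesis
      by (rule exI[of _ PhiG], rule exI[of _ ThetaG], intro conjI allI impI ballI)
        (use f1 disc right th thl ph phl left ent wronskian_ThetaG_PhiG in blast)+
  qed
qed


end
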